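(* Assume that $\mu_{X_n}$ converges almost surely weakly to a non-random compactly supported probability measure $\mu_X$, that the largest singular value of $X_n$ converges almost surely to $b:=\sup\operatorname{supp}\mu_X$, and that $\nu$ has mean zero, variance one and satisfies a log-Sobolev inequality. Let $\widetilde X_n=X_n+P_n$, with $P_n$ built according to either the i.i.d. model or the orthonormalized model. Let $i_0\in\{1,\dots,r\}$ be such that $\theta_{i_0}>\overline\theta$. For each $n$, let $\widetilde\sigma_{i_0}=\sigma_{i_0}(\widetilde X_n)$ and let $\widetilde u,\widetilde v$ be left and right unit singular vectors of $\widetilde X_n$ associated with $\widetilde\sigma_{i_0}$. Let $\rho=D_{\mu_X}^{-1}(1/\theta_{i_0}^2)$ (the limit of $\widetilde\sigma_{i_0}$). Then, as $n\to\infty$, almost surely: a) $$|\langle\widetilde u,\operatorname{Span}\{u_i:\theta_i=\theta_{i_0}\}\rangle|^2\to\frac{-2\varphi_{\mu_X}(\rho)}{\theta_{i_0}^2D_{\mu_X}'(\rho)}.$$ b) $$|\langle\widetilde v,\operatorname{Span}\{v_i:\theta_i=\theta_{i_0}\}\rangle|^2\to\frac{-2\varphi_{\widetilde\mu_X}(\rho)}{\theta_{i_0}^2D_{\mu_X}'(\rho)}.$$ c) $$|\langle\widetilde u,\operatorname{Span}\{u_i:\theta_i\ne\theta_{i_0}\}\rangle|^2\to0,\qquad|\langle\widetilde v,\operatorname{Span}\{v_i:\theta_i\ne\theta_{i_0}\}\rangle|^2\to0,$$ and $$\langle\varphi_{\mu_X}(\rho)P_n\widetilde v-\widetilde u,\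 \operatorname{Span}\{u_i:\theta_i=\theta_{i_0}\}\rangle\to0.$$
   Context: Let $\mathbb K=\mathbb R$ or $\mathbb C$. For each $n$, let $m=m_n\ge n$ be an integer, with $n/m_n\to c\in[0,1]$ as $n\to\infty$. $X_n$ is an $n\times m$ random matrix with entries in $\mathbb K$. The singular values of an $n\times m$ matrix $M$ are written $\sigma_1(M)\ge\cdots\ge\sigma_n(M)$, and $\mu_{X_n}=\frac1n\sum_{i=1}^n\delta_{\sigma_i(X_n)}$. Perturbation. Fix $r\ge1$ and deterministic $\theta_1\ge\cdots\ge\theta_r>0$, independent of $n$. Let $\nu$ be a probability measure on $\mathbb K$. For every $n$ let $G_u^{(n)}$ ($n\times r$) and $G_v^{(n)}$ ($m\times r$) be two independent matrices with i.i.d. entries of law $\nu$; the families $(G_u^{(n)},G_v^{(n)})_n$ and $(X_n)_n$ are independent. Column vectors $u_1,\dots,u_r\in\mathbb K^{n\times1}$, $v_1,\dots,v_r\in\mathbb K^{m\times1}$ are obtained in one of two ways. i.i.d. model: $u_i$, $v_i$ are the $i$-th columns of $\frac1{\sqrt n}G_u^{(n)}$, $\frac1{\sqrt m}G_v^{(n)}$. Orthonormalized model: the $u_i$'s (resp. $v_i$'s) result from Gram-Schmidt orthonormalization of the columns of $G_u^{(n)}$ (resp. $G_v^{(n)}$), which is well defined with probability tending to one. Set $P_n=\sum_{i=1}^r\theta_iu_iv_i^*$ and $\widetilde X_n=X_n+P_n$. Log-Sobolev inequality: there is a constant $C>0$ such that $\int f^2\log\frac{f^2}{\int f^2d\nu}\,d\nu\le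 2C\int|\nabla f|^2d\nu$ for all continuously differentiable $f\in L^2(\nu)$ (with $\mathbb C$ identified with $\mathbb R^2$). For a probability measure $\mu$, $\varphi_\mu(z)=\int\frac{z}{z^2-t^2}d\mu(t)$. Set $\widetilde\mu_X=c\mu_X+(1-c)\delta_0$ and, for $z>b$, $$D_{\mu_X}(z)=\Big[\int\frac{z}{z^2-t^2}d\mu_X(t)\Big]\times\Big[c\int\frac{z}{z^2-t^2}d\mu_X(t)+\frac{1-c}{z}\Big].$$ $D_{\mu_X}^{-1}$ is its functional inverse on $[b,+\infty)$, $D_{\mu_X}(b^+)=\lim_{z\downarrow b}D_{\mu_X}(z)$, and $\overline\theta=(D_{\mu_X}(b^+))^{-1/2}$ with the convention $(+\infty)^{-1/2}=0$. For a vector $x$ and a subspace $F$, $\langle x,F\rangle$ denotes the norm of the orthogonal projection of $x$ onto $F$. Left and right unit singular vectors $\widetilde u,\widetilde v$ associated with $\sigma$ form a matching pair: $\widetilde X_n\widetilde v=\sigma\widetilde u$, $\widetilde X_n^*\widetilde u=\sigma\widetilde v$. *)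

theory Defs
  imports
    "HOL-Probability.Probability"
    "Jordan_Normal_Form.Char_Poly"
    "Jordan_Normal_Form.Schur_Decomposition"
begin

unbundle no vec_syntax
hide_type (open) Finite_Cartesian_Product.vec

section \<open>The scalar field\<close>

text \<open>
  The scalar field is the field of real or of complex numbers. Both are instances of the following
  class, and lemma \<open>rc_field_cases\<close> shows that it has no others up to isomorphism.
\<close>

class rc_field = conjugatable_field + real_normed_field + euclidean_space +
  assumes mult_conjugate_scaleR: "x * conjugate x = (norm x)\<^sup>2 *\<^sub>R 1"

instance real :: rc_field
  by standard (simp add: power2_eq_square)

instance complex :: rc_field
  by standard (simp add: complex_norm_square[symmetric] scaleR_conv_of_real)

lemma mult_conjugate: "x * conjugate x = of_real ((norm (x :: 'a :: rc_field))\<^sup>2)"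
  by (simp add: mult_conjugate_scaleR of_real_def)

lemma rc_field_conjugate_of_real: "conjugate (of_real a :: 'a :: rc_field) = of_real a"
proof (cases "a = 0")
  case False
  have "(of_real a :: 'a) * conjugate (of_real a) = of_real a * of_real a"
    by (simp add: mult_conjugate power2_eq_square)
  with False show ?thesis by simp
qed simp

lemma rc_field_conjugate_fixed:
  fixes w :: "'a :: rc_field"
  assumes "conjugate w = w"
  shows "\<exists>a. w = of_real a"
proof -
  have one: "conjugate (1 :: 'a) = 1"
    using rc_field_conjugate_of_real[of 1] by simp
  have "(w + 1) * conjugate (w + 1) = w * conjugate w + w + w + 1"
    by (simp add: conjugate_dist_add one assms algebra_simps)
  then have "w + w = of_real ((norm (w + 1))\<^sup>2 - (norm w)\<^sup>2 - 1)"
    by (simp add: mult_conjugate algebra_simps)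
  then have "w = of_real (((norm (w + 1))\<^sup>2 - (norm w)\<^sup>2 - 1) / 2)"
    by (simp add: field_simps)
  then show ?thesis by blast
qed

lemma rc_field_cases:
  "(\<forall>x :: 'a :: rc_field. \<exists>a. x = of_real a) \<or>
   (\<exists>j :: 'a. j * j = -1 \<and> conjugate j = -j \<and> (\<forall>x. \<exists>a b. x = of_real a + of_real b * j))"
proof (cases "\<forall>x :: 'a. conjugate x = x")
  case True
  then show ?thesis using rc_field_conjugate_fixed by blast
next
  case False
  then obtain x0 :: 'a where x0: "conjugate x0 \<noteq> x0" by blast
  define y where "y = x0 - conjugate x0"
  have y0: "y \<noteq> 0" using x0 by (auto simp: y_def)
  have cy: "conjugate y = -y"
    using conjugate_dist_add[of x0 "- conjugate x0"] by (simp add: y_def conjugate_neg)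
  define j where "j = of_real (inverse (norm y)) * y"
  have cj: "conjugate j = -j"
    unfolding j_def by (simp only: conjugate_dist_mul rc_field_conjugate_of_real cy) simp
  have nj: "norm j = 1" using y0 by (simp add: j_def norm_mult norm_inverse)
  have jj: "j * j = -1"
    using mult_conjugate[of j] by (simp add: cj nj) (metis minus_minus)
  have "\<exists>a b. x = of_real a + of_real b * j" for x :: 'a
  proof -
    have "conjugate (x + conjugate x) = x + conjugate x"
      by (simp add: conjugate_dist_add)
    then obtain a where a: "x + conjugate x = of_real a"
      using rc_field_conjugate_fixed by blast
    define z where "z = x - conjugate x"
    have cz: "conjugate z = -z"
      using conjugate_dist_add[of x "- conjugate x"] by (simp add: z_def conjugate_neg)
    have "conjugate (z * j) = z * j"
      by (simp add: conjugate_dist_mul cz cj)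
    then obtain b where b: "z * j = of_real b"
      using rc_field_conjugate_fixed by blast
    have "z = - (z * j) * j" using jj by (simp add: mult.assoc)
    then have z: "z = of_real (- b) * j" by (simp add: b)
    have "x = ((x + conjugate x) + z) / 2" by (simp add: z_def)
    also have "\<dots> = of_real (a / 2) + of_real (- b / 2) * j"
      by (simp only: a z) (simp add: field_simps)
    finally show ?thesis by blast
  qed
  with jj cj show ?thesis by blast
qed

section \<open>Vectors and matrices\<close>

definition l2_norm :: "'a :: real_normed_vector vec \<Rightarrow> real" where
  "l2_norm x = L2_set (\<lambda>i. norm (vec_index x i)) {..<dim_vec x}"

definition vec_span :: "nat \<Rightarrow> 'a :: field vec set \<Rightarrow> 'a vec set" where
  "vec_span n S = LinearCombinations.module.span class_ring (module_vec TYPE('a) n) S"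

definition orth_proj :: "'a :: conjugatable_field vec \<Rightarrow> 'a vec set \<Rightarrow> 'a vec" where
  "orth_proj x F = (THE p. p \<in> F \<and> (\<forall>y\<in>F. (x - p) \<bullet>c y = 0))"

definition proj_norm :: "'a :: rc_field vec \<Rightarrow> 'a vec set \<Rightarrow> real" where
  "proj_norm x F = l2_norm (orth_proj x F)"

text \<open>
  For a matrix \<open>A\<close> with at most as many rows as columns: the square roots of the eigenvalues of
  \<open>A A\<^sup>*\<close>, with multiplicities, in decreasing order. These eigenvalues are nonnegative reals, but
  live in the scalar field; \<open>norm\<close> turns them into elements of type \<^typ>\<open>real\<close>.
  List positions start from 0, so \<open>\<sigma>\<^sub>i(A)\<close> is \<open>singular_values A ! (i - 1)\<close>.
\<close>

definition singular_values :: "'a :: rc_field mat \<Rightarrow> real list" where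
  "singular_values A =
     rev (sorted_list_of_multiset
       (image_mset (\<lambda>z. sqrt (norm z)) (proots (char_poly (A * mat_adjoint A)))))"

definition sv_measure :: "'a :: rc_field mat \<Rightarrow> real measure" where
  "sv_measure A =
     distr (uniform_count_measure {..<dim_row A}) borel (\<lambda>i. singular_values A ! i)"

definition singular_vector_pair ::
    "'a :: rc_field mat \<Rightarrow> real \<Rightarrow> 'a vec \<Rightarrow> 'a vec \<Rightarrow> bool" where
  "singular_vector_pair A s u v \<longleftrightarrow>
     u \<in> carrier_vec (dim_row A) \<and> v \<in> carrier_vec (dim_col A) \<and>
     l2_norm u = 1 \<and> l2_norm v = 1 \<and>
     A *\<^sub>v v = of_real s \<cdot>\<^sub>v u \<and> mat_adjoint A *\<^sub>v u = of_real s \<cdot>\<^sub>v v"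

section \<open>The perturbation\<close>

definition scaled_columns :: "'a :: rc_field mat \<Rightarrow> 'a vec list" where
  "scaled_columns G = map (\<lambda>g. of_real (1 / sqrt (real (dim_row G))) \<cdot>\<^sub>v g) (cols G)"

text \<open>
  \<^const>\<open>gram_schmidt\<close> only orthogonalizes. If the columns of \<open>G\<close> are linearly dependent,
  some of the vectors below are zero.
\<close>

definition orthonormalized_columns :: "'a :: rc_field mat \<Rightarrow> 'a vec list" where
  "orthonormalized_columns G =
     map (\<lambda>w. of_real (1 / l2_norm w) \<cdot>\<^sub>v w) (gram_schmidt (dim_row G) (cols G))"

definition perturbation ::
    "nat \<Rightarrow> nat \<Rightarrow> nat \<Rightarrow> (nat \<Rightarrow> real) \<Rightarrow> 'a :: rc_field vec list \<Rightarrow> 'a vec list \<Rightarrow> 'a mat" where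
  "perturbation n m r \<theta> us vs =
     Matrix.mat n m (\<lambda>(k, l). \<Sum>i<r.
       of_real (\<theta> i) * vec_index (us ! i) k * conjugate (vec_index (vs ! i) l))"

text \<open>
  \<open>g\<close> is the gradient of \<open>f\<close>. The left-hand integrand is bounded below for a probability
  measure \<open>\<nu>\<close>, so the left-hand side is finite or \<open>+\<infinity>\<close>; the integrability conclusion
  excludes the latter when the right-hand side is finite.
\<close>

definition log_sobolev :: "'a :: euclidean_space measure \<Rightarrow> bool" where
  "log_sobolev \<nu> \<longleftrightarrow>
     (\<exists>C>0. \<forall>(f :: 'a \<Rightarrow> real) (g :: 'a \<Rightarrow> 'a).
        (\<forall>x. GDERIV f x :> g x) \<and> continuous_on UNIV g \<and>
        integrable \<nu> (\<lambda>x. (f x)\<^sup>2) \<and> integrable \<nu> (\<lambda>x. (norm (g x))\<^sup>2) \<longrightarrow>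
        integrable \<nu> (\<lambda>x. (f x)\<^sup>2 * ln ((f x)\<^sup>2 / (\<integral>y. (f y)\<^sup>2 \<partial>\<nu>))) \<and>
        (\<integral>x. (f x)\<^sup>2 * ln ((f x)\<^sup>2 / (\<integral>y. (f y)\<^sup>2 \<partial>\<nu>)) \<partial>\<nu>)
          \<le> 2 * C * (\<integral>x. (norm (g x))\<^sup>2 \<partial>\<nu>))"

section \<open>The limiting objects\<close>

definition measure_support :: "real measure \<Rightarrow> real set" where
  "measure_support \<mu> = {x. \<forall>U. open U \<and> x \<in> U \<longrightarrow> emeasure \<mu> U > 0}"

definition sup_support :: "real measure \<Rightarrow> real" where
  "sup_support \<mu> = Sup (measure_support \<mu>)"

definition \<phi> :: "real measure \<Rightarrow> real \<Rightarrow> real" where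
  "\<phi> \<mu> z = (\<integral>t. z / (z\<^sup>2 - t\<^sup>2) \<partial>\<mu>)"

definition mix_dirac0 :: "real \<Rightarrow> real measure \<Rightarrow> real measure" where
  "mix_dirac0 c \<mu> = measure_of UNIV (sets borel)
     (\<lambda>A. ennreal c * emeasure \<mu> A + ennreal (1 - c) * indicator A 0)"

definition D_transform :: "real \<Rightarrow> real measure \<Rightarrow> real \<Rightarrow> real" where
  "D_transform c \<mu> z = \<phi> \<mu> z * (c * \<phi> \<mu> z + (1 - c) / z)"

text \<open>
  \<open>D_transform c \<mu>\<close> is injective on the open half-line, with range \<open>{0<..<D(b+)}\<close>;
  only arguments in this range are used.
\<close>

definition D_inverse :: "real \<Rightarrow> real measure \<Rightarrow> real \<Rightarrow> real" where
  "D_inverse c \<mu> = the_inv_into {sup_support \<mu><..} (D_transform c \<mu>)"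

definition D_edge :: "real \<Rightarrow> real measure \<Rightarrow> ereal" where
  "D_edge c \<mu> = Lim (at_right (sup_support \<mu>)) (\<lambda>z. ereal (D_transform c \<mu> z))"

definition theta_bar :: "real \<Rightarrow> real measure \<Rightarrow> real" where
  "theta_bar c \<mu> =
     (if D_edge c \<mu> = \<infinity> then 0 else real_of_ereal (D_edge c \<mu>) powr (- 1 / 2))"

end

theory Submission
  imports Defs
begin

text \<open>
  Let \<open>H\<close> be the Hermitian dilation of \<open>X\<^sub>n\<close>, the block matrix with off-diagonal blocks \<open>X\<^sub>n\<close> and its
  adjoint. For \<open>z > b\<close> the resolvent of \<open>H\<close> at \<open>z\<close> is eventually a convergent series in the powers
  of \<open>H\<close>, so everything reduces to the numbers \<open>\<langle>W\<^sub>s, H\<^sup>k W\<^sub>t\<rangle>\<close>, where \<open>W\<^sub>s\<close> runs over the \<open>2r\<close> vectors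
  \<open>(u\<^sub>i, 0)\<close> and \<open>(0, v\<^sub>i)\<close>. In the i.i.d. model they are quadratic forms in the entries of \<open>G\<^sub>u, G\<^sub>v\<close>;
  the log-Sobolev inequality gives an eighth moment of \<open>\<nu>\<close>, hence fourth moments of the centred forms
  that are summable in \<open>n\<close>, and almost surely the forms converge to the normalized traces: the
  moments of \<open>\<mu>\<^sub>X\<close> and of \<open>c \<mu>\<^sub>X + (1 - c) \<delta>\<^sub>0\<close> on the diagonal, zero off it. Gram--Schmidt moves the
  columns by \<open>o(1)\<close> in norm and does not change the limits.

  By variational arguments with the vectors of the resolvent, the singular value of index \<open>i\<^sub>0\<close> of the perturbed
  matrix tends to \<open>\<rho>\<close>. Its singular vectors form a vector \<open>x\<close> with
  \<open>(\<sigma> - H) x = \<Sum> \<theta>\<^sub>i (d\<^sub>i (u\<^sub>i, 0) + c\<^sub>i (0, v\<^sub>i))\<close>, where \<open>c\<^sub>i\<close> and \<open>d\<^sub>i\<close> are the overlaps with \<open>u\<^sub>i\<close> and \<open>v\<^sub>i\<close>.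
  Pairing with \<open>W\<^sub>s\<close> gives, up to \<open>o(1)\<close>, \<open>c\<^sub>i = \<theta>\<^sub>i \<phi>(\<rho>) d\<^sub>i\<close> and the analogous equation with the two
  sides exchanged, so that \<open>c\<^sub>i\<close> and \<open>d\<^sub>i\<close> vanish in the limit unless \<open>\<theta>\<^sub>i = \<theta>\<close> at \<open>i\<^sub>0\<close>; the norm of
  \<open>x\<close>, expressed by the derivative of the resolvent, fixes the sums of the \<open>|c\<^sub>i|\<^sup>2\<close> and the \<open>|d\<^sub>i|\<^sup>2\<close>.
\<close>

section \<open>Finite-dimensional vectors as functions\<close>

text \<open>Randomness enters only through countably many moment limits. The resolvent is needed at
  a singular value that moves with n, so almost sure limits at each fixed z would call for an extra
  uniformity argument. Powers of H are indexed by naturals, and dominated convergence of the series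
  then covers every sequence of points converging to some z > b. All later arguments concern one
  fixed realization. Fourth moments explain the eighth moment of \<nu>. The coefficient matrices
  have squared Hilbert-Schmidt norm O(1/n), so second moments of the centred forms are only O(1/n),
  which is not summable, while fourth moments are O(1/n^2); the fourth power of
  \<open>|y|^2 - 1\<close> costs eight powers of |y|. The Hilbert-Schmidt bound is itself random,
  hence a truncation of the coefficients at countably many levels. Equal values among the \<theta>'s
  rule out the tracking of individual directions: singular values are located by dimension counts,
  and only the total squared overlap over a group of equal \<theta>'s has a determined
  limit.\<close>

definition ip :: "'i set \<Rightarrow> ('i \<Rightarrow> complex) \<Rightarrow> ('i \<Rightarrow> complex) \<Rightarrow> complex" where
  "ip I x y = (\<Sum>i\<in>I. cnj (x i) * y i)"

definition nsq :: "'i set \<Rightarrow> ('i \<Rightarrow> complex) \<Rightarrow> real" where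
  "nsq I x = (\<Sum>i\<in>I. (norm (x i))\<^sup>2)"

text \<open>Vectors are functions and matrices are kernels, meaningful on the index sets only;
  outside them the values are arbitrary, so many identities are asserted just for indices of
  \<open>I\<close>. Dimensions that grow with n need no types of their own.\<close>

definition app :: "'j set \<Rightarrow> ('i \<Rightarrow> 'j \<Rightarrow> complex) \<Rightarrow> ('j \<Rightarrow> complex) \<Rightarrow> 'i \<Rightarrow> complex" where
  "app J A x = (\<lambda>i. \<Sum>j\<in>J. A i j * x j)"

definition adj :: "('i \<Rightarrow> 'j \<Rightarrow> complex) \<Rightarrow> 'j \<Rightarrow> 'i \<Rightarrow> complex" where
  "adj A = (\<lambda>j i. cnj (A i j))"

lemma adj_adj [simp]: "adj (adj A) = A"
  by (simp add: adj_def)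

lemma ip_cong: "(\<And>i. i \<in> I \<Longrightarrow> x i = x' i) \<Longrightarrow> (\<And>i. i \<in> I \<Longrightarrow> y i = y' i) \<Longrightarrow> ip I x y = ip I x' y'"
  by (simp add: ip_def)

lemma nsq_cong: "(\<And>i. i \<in> I \<Longrightarrow> x i = x' i) \<Longrightarrow> nsq I x = nsq I x'"
  by (simp add: nsq_def)

lemma app_cong: "(\<And>j. j \<in> J \<Longrightarrow> x j = y j) \<Longrightarrow> app J A x = app J A y"
  by (simp add: app_def)

lemma ip_add_right: "ip I x (\<lambda>i. y i + z i) = ip I x y + ip I x z"
  by (simp add: ip_def algebra_simps sum.distrib)

lemma ip_diff_right: "ip I x (\<lambda>i. y i - z i) = ip I x y - ip I x z"
  by (simp add: ip_def algebra_simps sum_subtractf)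

lemma ip_scale_right: "ip I x (\<lambda>i. c * y i) = c * ip I x y"
  by (simp add: ip_def sum_distrib_left algebra_simps)

lemma ip_sum_right: "ip I x (\<lambda>i. \<Sum>j\<in>J. y j i) = (\<Sum>j\<in>J. ip I x (y j))"
  by (simp add: ip_def sum_distrib_left sum.swap[of _ I J])

lemma cnj_ip: "cnj (ip I x y) = ip I y x"
  by (simp add: ip_def mult.commute)

lemma ip_add_left: "ip I (\<lambda>i. y i + z i) x = ip I y x + ip I z x"
  by (simp add: ip_def algebra_simps sum.distrib)

lemma ip_diff_left: "ip I (\<lambda>i. y i - z i) x = ip I y x - ip I z x"
  by (simp add: ip_def algebra_simps sum_subtractf)

lemma ip_scale_left: "ip I (\<lambda>i. c * y i) x = cnj c * ip I y x"
  by (simp add: ip_def sum_distrib_left algebra_simps)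

lemma ip_sum_left: "ip I (\<lambda>i. \<Sum>j\<in>J. y j i) x = (\<Sum>j\<in>J. ip I (y j) x)"
  by (simp add: ip_def sum_distrib_right sum.swap[of _ I J])

lemma ip_self: "ip I x x = of_real (nsq I x)"
  by (simp add: ip_def nsq_def complex_norm_square[symmetric] mult.commute[of "cnj _"])

lemma nsq_eq_Re: "nsq I x = Re (ip I x x)"
  by (simp add: ip_self)

lemma nsq_nonneg [simp]: "nsq I x \<ge> 0"
  by (simp add: nsq_def sum_nonneg)

lemma nsq_scale: "nsq I (\<lambda>i. c * x i) = (norm c)\<^sup>2 * nsq I x"
  by (simp add: nsq_def norm_mult power_mult_distrib sum_distrib_left)

lemma nsq_eq_0_iff: "finite I \<Longrightarrow> nsq I x = 0 \<longleftrightarrow> (\<forall>i\<in>I. x i = 0)"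
  by (auto simp: nsq_def sum_nonneg_eq_0_iff)

lemma sqrt_nsq: "sqrt (nsq I x) = L2_set (\<lambda>i. norm (x i)) I"
  by (simp add: nsq_def L2_set_def)

lemma sqrt_nsq_triangle: "sqrt (nsq I (\<lambda>i. x i + y i)) \<le> sqrt (nsq I x) + sqrt (nsq I y)"
proof -
  have "L2_set (\<lambda>i. norm (x i + y i)) I \<le> L2_set (\<lambda>i. norm (x i) + norm (y i)) I"
    by (intro L2_set_mono) (auto intro: norm_triangle_ineq)
  also have "\<dots> \<le> L2_set (\<lambda>i. norm (x i)) I + L2_set (\<lambda>i. norm (y i)) I"
    by (rule L2_set_triangle_ineq)
  finally show ?thesis by (simp add: sqrt_nsq)
qed

lemma norm_ip_le: "norm (ip I x y) \<le> sqrt (nsq I x) * sqrt (nsq I y)"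
proof -
  have "norm (ip I x y) \<le> (\<Sum>i\<in>I. \<bar>norm (x i)\<bar> * \<bar>norm (y i)\<bar>)"
    unfolding ip_def by (rule order_trans[OF norm_sum]) (simp add: norm_mult)
  also have "\<dots> \<le> L2_set (\<lambda>i. norm (x i)) I * L2_set (\<lambda>i. norm (y i)) I"
    by (rule L2_set_mult_ineq)
  finally show ?thesis by (simp add: sqrt_nsq)
qed

lemma norm_ip_sq_le: "(norm (ip I x y))\<^sup>2 \<le> nsq I x * nsq I y"
proof -
  have "(norm (ip I x y))\<^sup>2 \<le> (sqrt (nsq I x) * sqrt (nsq I y))\<^sup>2"
    by (intro power_mono norm_ip_le) simp
  then show ?thesis by (simp add: power_mult_distrib)
qed

lemma app_diff: "app J A (\<lambda>j. x j - y j) = (\<lambda>i. app J A x i - app J A y i)"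
  by (simp add: app_def algebra_simps sum_subtractf)

lemma app_scale: "app J A (\<lambda>j. c * x j) = (\<lambda>i. c * app J A x i)"
  by (simp add: app_def sum_distrib_left algebra_simps)

lemma app_sum: "app J A (\<lambda>j. \<Sum>k\<in>K. x k j) = (\<lambda>i. \<Sum>k\<in>K. app J A (x k) i)"
  by (simp add: app_def sum_distrib_left sum.swap[of _ J K])

lemma ip_app: "ip I x (app J A y) = ip J (app I (adj A) x) y"
  by (simp add: ip_def app_def adj_def sum_distrib_left sum_distrib_right mult_ac sum.swap[of _ I J])

lemma nsq_orthogonal_sum:
  assumes "finite K" and o: "\<And>j k. j \<in> K \<Longrightarrow> k \<in> K \<Longrightarrow> ip I (f j) (f k) = (if j = k then d k else 0)"
  shows "ip I (\<lambda>i. \<Sum>k\<in>K. a k * f k i) (\<lambda>i. \<Sum>k\<in>K. b k * f k i) = (\<Sum>k\<in>K. cnj (a k) * b k * d k)"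
proof -
  have "ip I (\<lambda>i. \<Sum>k\<in>K. a k * f k i) (\<lambda>i. \<Sum>k\<in>K. b k * f k i) =
      (\<Sum>j\<in>K. \<Sum>k\<in>K. cnj (a j) * (b k * (if j = k then d k else 0)))"
    by (simp add: ip_sum_left ip_sum_right ip_scale_left ip_scale_right o sum_distrib_left)
  also have "\<dots> = (\<Sum>j\<in>K. \<Sum>k\<in>K. if j = k then cnj (a j) * b j * d j else 0)"
    by (intro sum.cong refl) auto
  also have "\<dots> = (\<Sum>k\<in>K. cnj (a k) * b k * d k)"
    using assms(1) by (simp add: sum.delta')
  finally show ?thesis .
qed

text \<open>Gaussian elimination. All dimension counts rest on this: linear dependence of iterates,
  completeness of orthonormal families, and the min-max arguments for singular values.\<close>

lemma homogeneous_system: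
  fixes a :: "'r \<Rightarrow> 'c \<Rightarrow> 'f :: field"
  assumes "finite R" "finite C" "card R < card C"
  shows "\<exists>c. (\<exists>j\<in>C. c j \<noteq> 0) \<and> (\<forall>i\<in>R. (\<Sum>j\<in>C. a i j * c j) = 0)"
  using assms
proof (induction R arbitrary: C a rule: finite_induct)
  case empty
  then obtain j where "j \<in> C" by fastforce
  then show ?case by (intro exI[of _ "\<lambda>_. 1"]) auto
next
  case (insert i0 R)
  show ?case
  proof (cases "\<forall>j\<in>C. a i0 j = 0")
    case True
    have "card R < card C" using insert by simp
    from insert.IH[OF insert.prems(1) this, of a] obtain c where
      "(\<exists>j\<in>C. c j \<noteq> 0)" "(\<forall>i\<in>R. (\<Sum>j\<in>C. a i j * c j) = 0)" by blast
    with True show ?thesis by (intro exI[of _ c]) auto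
  next
    case False
    then obtain j0 where j0: "j0 \<in> C" "a i0 j0 \<noteq> 0" by blast
    define C' where "C' = C - {j0}"
    have C': "finite C'" "card R < card C'" "C = insert j0 C'" "j0 \<notin> C'"
      using insert j0 by (auto simp: C'_def card_Diff_singleton)
    \<comment> \<open>Each row minus the multiple of row \<open>i0\<close> that removes the unknown
      \<open>j0\<close>.\<close>
    from insert.IH[OF C'(1,2), of "\<lambda>i j. a i j - a i j0 * a i0 j / a i0 j0"] obtain c where
      c: "\<exists>j\<in>C'. c j \<noteq> 0"
      "\<And>i. i \<in> R \<Longrightarrow> (\<Sum>j\<in>C'. (a i j - a i j0 * a i0 j / a i0 j0) * c j) = 0" by blast
    define t where "t = - (\<Sum>j\<in>C'. a i0 j * c j) / a i0 j0"
    have s: "(\<Sum>j\<in>C. a i j * (c(j0 := t)) j) = a i j0 * t + (\<Sum>j\<in>C'. a i j * c j)" for i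
      using C' by (simp add: sum.insert) (intro sum.cong refl, auto)
    have "(\<Sum>j\<in>C. a i j * (c(j0 := t)) j) = 0" if "i \<in> insert i0 R" for i
    proof (cases "i = i0")
      case True then show ?thesis using j0 by (simp only: s) (simp add: t_def)
    next
      case False
      then have "i \<in> R" using that by simp
      from c(2)[OF this] have "(\<Sum>j\<in>C'. a i j * c j) - a i j0 / a i0 j0 * (\<Sum>j\<in>C'. a i0 j * c j) = 0"
        by (simp add: algebra_simps sum_subtractf sum_distrib_left)
      then show ?thesis by (simp only: s) (simp add: t_def)
    qed
    moreover have "\<exists>j\<in>C. (c(j0 := t)) j \<noteq> 0"
      using c(1) C' by auto
    ultimately show ?thesis by blast
  qed
qed

text \<open>Take p of least degree with p(H) x0 = 0 and a root l of p; dividing p by X - l and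
  applying the quotient to x0 gives an eigenvector, nonzero by minimality. It is recorded as a
  combination of the iterates of \<open>x0\<close> because it then lies in every
  \<open>H\<close>-invariant subspace that contains \<open>x0\<close>.\<close>

lemma eigenvector_in_invariant_subspace:
  assumes fin: "finite I"
    and x0: "\<exists>i\<in>I. x0 i \<noteq> 0"
  shows "\<exists>q l. (\<exists>i\<in>I. q i \<noteq> 0) \<and> (\<forall>i\<in>I. app I H q i = l * q i) \<and>
      (\<exists>N b. q = (\<lambda>i. \<Sum>t\<le>(N::nat). b t * (app I H ^^ t) x0 i))"
proof -
  define y where "y t = (app I H ^^ t) x0" for t
  \<comment> \<open>\<open>pact p\<close> is the polynomial p in H, applied to
    \<open>x0\<close>.\<close>
  define pact where "pact p = (\<lambda>i. \<Sum>t\<le>degree p. coeff p t * y t i)" for p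
  have pact_eq: "pact p = (\<lambda>i. \<Sum>t\<le>N. coeff p t * y t i)" if "degree p \<le> N" for p N
  proof
    fix i
    have "(\<Sum>t\<in>{..degree p}. coeff p t * y t i) = (\<Sum>t\<in>{..N}. coeff p t * y t i)"
      using that by (intro sum.mono_neutral_left) (auto simp: coeff_eq_0)
    then show "pact p i = (\<Sum>t\<le>N. coeff p t * y t i)" by (simp add: pact_def)
  qed
  \<comment> \<open>There are \<open>card I + 1\<close> iterates with only \<open>card I\<close>
    coordinates each, so they are linearly dependent.\<close>
  have "\<exists>p. p \<noteq> 0 \<and> (\<forall>i\<in>I. pact p i = 0)"
  proof -
    from homogeneous_system[of I "{..card I}" "\<lambda>i t. y t i"] fin obtain c where
      c: "\<exists>t\<le>card I. c t \<noteq> 0" "\<And>i. i \<in> I \<Longrightarrow> (\<Sum>t\<le>card I. y t i * c t) = 0"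
      by auto
    define p where "p = (\<Sum>t\<le>card I. monom (c t) t)"
    have cf: "coeff p t = (if t \<le> card I then c t else 0)" for t
      by (simp add: p_def coeff_sum)
    have "degree p \<le> card I" by (intro degree_le) (simp add: cf)
    then have "\<forall>i\<in>I. pact p i = 0" using c(2) by (simp add: pact_eq[of p "card I"] cf mult.commute)
    moreover have "p \<noteq> 0"
    proof
      assume "p = 0"
      then have "c t = 0" if "t \<le> card I" for t using cf[of t] that by simp
      with c(1) show False by blast
    qed
    ultimately show ?thesis by blast
  qed
  then obtain p0 where "p0 \<noteq> 0 \<and> (\<forall>i\<in>I. pact p0 i = 0)" by (elim exE)
  from ex_has_least_nat[of "\<lambda>p. p \<noteq> 0 \<and> (\<forall>i\<in>I. pact p i = 0)", OF this, of degree]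
  obtain p where p0: "p \<noteq> 0 \<and> (\<forall>i\<in>I. pact p i = 0)"
    and p1: "\<forall>q. (q \<noteq> 0 \<and> (\<forall>i\<in>I. pact q i = 0)) \<longrightarrow> degree p \<le> degree q"
    by (elim exE conjE) (rule that, rule conjI)
  note p = conjunct1[OF p0] conjunct2[OF p0]
  have pmin: "degree p \<le> degree q" if "q \<noteq> 0" "\<forall>i\<in>I. pact q i = 0" for q
    using mp[OF spec[OF p1] conjI[OF that]] .
  have "degree p \<noteq> 0"
  proof
    assume d: "degree p = 0"
    then obtain a where a: "p = [:a:]" by (metis degree_eq_zeroE)
    then have "\<forall>i\<in>I. a * x0 i = 0" using p(2) by (simp add: pact_def y_def)
    with x0 p(1) a show False by auto
  qed
  then have "\<not> constant (poly p)" by (simp add: constant_degree)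
  then obtain l where l: "poly p l = 0" using fundamental_theorem_of_algebra by blast
  then obtain q where q: "p = [:-l, 1:] * q" by (metis dvdE poly_eq_0_iff_dvd)
  have q0: "q \<noteq> 0" using p(1) q by auto
  have dq: "degree p = Suc (degree q)" using q0 by (subst q) (subst degree_mult_eq; simp)
  have nz: "\<exists>i\<in>I. pact q i \<noteq> 0"
  proof (rule ccontr)
    assume "\<not> ?thesis"
    then have "\<forall>i\<in>I. pact q i = 0" by blast
    from pmin[OF q0 this] dq show False by simp
  qed
  \<comment> \<open>Coefficients of the product of X - l and q; they turn \<open>pact p\<close> into
    H applied to \<open>pact q\<close>, minus l times \<open>pact q\<close>.\<close>
  have cfp: "coeff p t = (case t of 0 \<Rightarrow> 0 | Suc s \<Rightarrow> coeff q s) - l * coeff q t" for t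
    unfolding q by (cases t) (auto simp: coeff_pCons)
  have "app I H (pact q) i - l * pact q i = pact p i" for i
  proof -
    have "pact p i = (\<Sum>t\<le>Suc (degree q). (case t of 0 \<Rightarrow> 0 | Suc s \<Rightarrow> coeff q s) * y t i)
        - l * (\<Sum>t\<le>Suc (degree q). coeff q t * y t i)"
      by (simp add: pact_def dq cfp algebra_simps sum_subtractf sum_distrib_left)
    also have "(\<Sum>t\<le>Suc (degree q). coeff q t * y t i) = pact q i"
      by (subst pact_eq[of q "Suc (degree q)"]) auto
    also have "(\<Sum>t\<le>Suc (degree q). (case t of 0 \<Rightarrow> 0 | Suc s \<Rightarrow> coeff q s) * y t i)
        = (\<Sum>t\<le>degree q. coeff q t * y (Suc t) i)"
      by (subst sum.atMost_Suc_shift) simp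
    also have "\<dots> = app I H (pact q) i"
      by (simp add: pact_def app_sum app_scale y_def)
    finally show ?thesis by simp
  qed
  then have "\<forall>i\<in>I. app I H (pact q) i = l * pact q i" using p(2) by (simp add: eq_iff_diff_eq_0[of "app I H (pact q) _"])
  moreover have "pact q = (\<lambda>i. \<Sum>t\<le>degree q. coeff q t * (app I H ^^ t) x0 i)"
    by (simp add: pact_def y_def)
  ultimately show ?thesis using nz by (intro exI[of _ "pact q"] exI[of _ l] conjI) (assumption | blast)+
qed

text \<open>The kernel of A times its adjoint, whose eigenvalues are the squared singular
  values.\<close>

abbreviation gram_op :: "'i set \<Rightarrow> 'j set \<Rightarrow> ('i \<Rightarrow> 'j \<Rightarrow> complex) \<Rightarrow> 'i \<Rightarrow> 'i \<Rightarrow> complex" where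
  "gram_op I J A \<equiv> (\<lambda>i i'. \<Sum>j\<in>J. A i j * cnj (A i' j))"

lemma app_gram_op: "app I (gram_op I J A) x = app J A (app I (adj A) x)"
  by (simp add: app_def adj_def sum_distrib_left sum_distrib_right mult_ac sum.swap[of _ I J])

lemma ip_gram_op: "ip I x (app I (gram_op I J A) y) = ip J (app I (adj A) x) (app I (adj A) y)"
  by (simp add: app_gram_op ip_app)

text \<open>The orthogonal complement of the eigenvectors found so far is nonzero because
  \<open>k < card I\<close>, and invariant because the operator is self-adjoint; an eigenvector is
  found inside it. Its eigenvalue is real and nonnegative, being the Rayleigh quotient of A times
  its adjoint.\<close>

lemma orthonormal_eigenbasis_step:
  assumes fin: "finite I" and k: "k < card I"
    and e: "\<And>i j. i < k \<Longrightarrow> j < k \<Longrightarrow> ip I (e i) (e j) = (if i = j then 1 else 0)"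
    and eig: "\<And>j i. j < k \<Longrightarrow> i \<in> I \<Longrightarrow> app I (gram_op I J A) (e j) i = of_real (l j) * e j i"
  shows "\<exists>x (t::real). ip I x x = 1 \<and> (\<forall>j<k. ip I (e j) x = 0) \<and> t \<ge> 0 \<and>
     (\<forall>i\<in>I. app I (gram_op I J A) x i = of_real t * x i)"
proof -
  let ?H = "gram_op I J A"
  from homogeneous_system[of "{..<k}" I "\<lambda>j i. cnj (e j i)"] fin k obtain x0 where
    x0: "\<exists>i\<in>I. x0 i \<noteq> 0" "\<And>j. j < k \<Longrightarrow> ip I (e j) x0 = 0" by (auto simp: ip_def)
  have inv: "ip I (e j) (app I ?H y) = 0" if "j < k" "ip I (e j) y = 0" for j y
  proof -
    have "ip I (e j) (app I ?H y) = cnj (ip I y (app I ?H (e j)))"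
      by (simp add: ip_gram_op cnj_ip)
    also have "ip I y (app I ?H (e j)) = of_real (l j) * ip I y (e j)"
      by (subst ip_scale_right[symmetric]) (intro ip_cong refl eig that(1))
    finally show ?thesis using that(2) by (simp add: cnj_ip)
  qed
  have pow: "ip I (e j) ((app I ?H ^^ t) x0) = 0" if "j < k" for j t
    by (induction t) (simp_all add: x0(2) inv that)
  from eigenvector_in_invariant_subspace[OF fin x0(1), of ?H] obtain q t N b where
    q1: "\<exists>i\<in>I. q i \<noteq> 0" and q2: "\<forall>i\<in>I. app I ?H q i = t * q i"
    and qq: "q = (\<lambda>i. \<Sum>t\<le>(N::nat). b t * (app I ?H ^^ t) x0 i)"
    by (elim exE conjE) (rule that)
  note q = q1 bspec[OF q2]
  have qo: "ip I (e j) q = 0" if "j < k" for j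
    using that by (simp add: qq ip_sum_right ip_scale_right pow)
  have q0: "nsq I q > 0"
  proof -
    have "nsq I q \<noteq> 0" using q1 by (simp add: nsq_eq_0_iff[OF fin])
    then show ?thesis using nsq_nonneg[of I q] by linarith
  qed
  have "t * of_real (nsq I q) = ip I q (app I ?H q)"
    by (subst ip_self[symmetric], subst ip_scale_right[symmetric]) (intro ip_cong refl, simp add: q)
  also have "\<dots> = of_real (nsq J (app I (adj A) q))"
    by (simp add: ip_gram_op ip_self)
  finally have t: "t = of_real (nsq J (app I (adj A) q) / nsq I q)"
    using q0 by (simp add: field_simps)
  define s where "s = 1 / sqrt (nsq I q)"
  define x where "x = (\<lambda>i. of_real s * q i)"
  have "nsq I x = s\<^sup>2 * nsq I q" unfolding x_def by (subst nsq_scale) simp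
  also have "\<dots> = 1" using q0 by (simp add: s_def power_divide)
  finally have 1: "ip I x x = 1" by (simp add: ip_self)
  have 2: "\<forall>j<k. ip I (e j) x = 0" by (simp add: x_def ip_scale_right qo)
  define t' where "t' = nsq J (app I (adj A) q) / nsq I q"
  have 3: "t' \<ge> 0" by (simp add: t'_def)
  have 4: "\<forall>i\<in>I. app I ?H x i = of_real t' * x i"
  proof
    fix i assume "i \<in> I"
    then show "app I ?H x i = of_real t' * x i"
      unfolding x_def app_scale by (simp only: q t t'_def mult_ac)
  qed
  show ?thesis
    by (rule exI[of _ x], rule exI[of _ t'], rule conjI[OF 1 conjI[OF 2 conjI[OF 3 4]]])
qed

lemma orthonormal_eigenbasis:
  assumes fin: "finite I" and "k \<le> card I"
  shows "\<exists>e (l :: nat \<Rightarrow> real). (\<forall>i<k. \<forall>j<k. ip I (e i) (e j) = (if i = j then 1 else 0)) \<and>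
     (\<forall>j<k. l j \<ge> 0 \<and> (\<forall>i\<in>I. app I (gram_op I J A) (e j) i = of_real (l j) * e j i))"
  using assms(2)
proof (induction k)
  case (Suc k)
  from Suc.IH[OF Suc_leD[OF Suc.prems]] obtain e l where
    e0: "\<forall>i<k. \<forall>j<k. ip I (e i) (e j) = (if i = j then 1 else 0)"
    and l0: "\<forall>j<k. l j \<ge> 0 \<and> (\<forall>i\<in>I. app I (gram_op I J A) (e j) i = of_real (l j) * e j i)"
    by (elim exE conjE) (rule that)
  have e: "ip I (e i) (e j) = (if i = j then 1 else 0)" if "i < k" "j < k" for i j
    using e0 that by blast
  have l: "l j \<ge> 0" if "j < k" for j using l0 that by blast
  have eig: "app I (gram_op I J A) (e j) i = of_real (l j) * e j i" if "j < k" "i \<in> I" for j i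
    using l0 that by blast
  have kc: "k < card I" using Suc.prems by simp
  have "\<exists>x (t::real). ip I x x = 1 \<and> (\<forall>j<k. ip I (e j) x = 0) \<and> t \<ge> 0 \<and>
     (\<forall>i\<in>I. app I (gram_op I J A) x i = of_real t * x i)"
    by (rule orthonormal_eigenbasis_step[where e = e and l = l, OF fin kc]) (fact e, fact eig)
  then obtain x and t :: real where
    x1: "ip I x x = 1" and x2: "\<forall>j<k. ip I (e j) x = 0" and x3: "t \<ge> 0"
    and x4: "\<forall>i\<in>I. app I (gram_op I J A) x i = of_real t * x i"
    by (elim exE conjE) (rule that)
  note x = x1 mp[OF spec[OF x2]] x3 bspec[OF x4]
  have x': "ip I x (e j) = 0" if "j < k" for j using x(2)[OF that] cnj_ip[of I "e j" x] by simp
  define e' l' where "e' = e(k := x)" and "l' = l(k := t)"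
  have A: "ip I (e' i) (e' j) = (if i = j then 1 else 0)" if "i < Suc k" "j < Suc k" for i j
  proof (cases "i = k")
    case True
    then show ?thesis using that x(1) x'[of j] by (cases "j = k") (simp_all add: e'_def)
  next
    case False
    then show ?thesis using that x(2)[of i] e[of i j] by (cases "j = k") (simp_all add: e'_def)
  qed
  have B: "l' j \<ge> 0 \<and> (\<forall>i\<in>I. app I (gram_op I J A) (e' j) i = of_real (l' j) * e' j i)"
    if "j < Suc k" for j
  proof (cases "j = k")
    case True
    then show ?thesis using x(3) x4 by (simp add: e'_def l'_def)
  next
    case False
    then have "j < k" using that by simp
    from mp[OF spec[OF l0] this] False show ?thesis by (simp add: e'_def l'_def)
  qed
  have R1: "\<forall>i<Suc k. \<forall>j<Suc k. ip I (e' i) (e' j) = (if i = j then 1 else 0)"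
    by (intro allI impI A)
  have R2: "\<forall>j<Suc k. l' j \<ge> 0 \<and>
      (\<forall>i\<in>I. app I (gram_op I J A) (e' j) i = of_real (l' j) * e' j i)"
    by (intro allI impI B)
  show ?case
    by (rule exI[of _ e'], rule exI[of _ l'], rule conjI[OF R1 R2])
qed simp

section \<open>Passage to the complex field\<close>

definition rc_embedding :: "('a :: rc_field \<Rightarrow> complex) \<Rightarrow> bool" where
  "rc_embedding h \<longleftrightarrow> (\<forall>x y. h (x + y) = h x + h y) \<and> (\<forall>x y. h (x * y) = h x * h y) \<and>
     (\<forall>a. h (of_real a) = of_real a) \<and> (\<forall>x. h (conjugate x) = cnj (h x)) \<and> (\<forall>x. norm (h x) = norm x)"

lemma rc_embedding_normI:
  assumes "\<And>x y. h (x * y) = h x * h y" "\<And>a. h (of_real a) = of_real a"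
    "\<And>x. h (conjugate x) = cnj (h x)"
  shows "norm (h (x :: 'a :: rc_field)) = norm x"
proof -
  have "of_real ((norm x)\<^sup>2) = h (x * conjugate x)"
    by (simp only: mult_conjugate assms(2))
  also have "\<dots> = of_real ((norm (h x))\<^sup>2)"
    by (simp only: assms(1,3) complex_norm_square)
  finally have "(norm x)\<^sup>2 = (norm (h x))\<^sup>2" by (simp only: of_real_eq_iff)
  then show ?thesis by (metis norm_ge_zero power2_eq_imp_eq)
qed

text \<open>In the complex case every x is uniquely a + b j, so the coordinates are additive and
  multiplication follows from j j = -1. The norm is preserved because it is determined by
  \<open>x * conjugate x\<close>.\<close>

lemma rc_embedding_exists: "\<exists>h :: 'a :: rc_field \<Rightarrow> complex. rc_embedding h"
  using rc_field_cases[where 'a = 'a]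
proof
  assume "\<forall>x :: 'a. \<exists>a. x = of_real a"
  then obtain g where g: "\<And>x :: 'a. x = of_real (g x)" by metis
  define h where "h x = complex_of_real (g x)" for x :: 'a
  have gr: "g (of_real a) = a" for a using g[of "of_real a"] by simp
  have 1: "h (x + y) = h x + h y" for x y
  proof -
    have "x + y = of_real (g x + g y)" using g[of x] g[of y] by (metis of_real_add)
    then have "g (x + y) = g x + g y" by (simp only: gr)
    then show ?thesis by (simp add: h_def)
  qed
  have 2: "h (x * y) = h x * h y" for x y
  proof -
    have "x * y = of_real (g x * g y)" using g[of x] g[of y] by (metis of_real_mult)
    then have "g (x * y) = g x * g y" by (simp only: gr)
    then show ?thesis by (simp add: h_def)
  qed
  have 3: "h (of_real a) = of_real a" for a by (simp add: h_def gr)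
  have 4: "h (conjugate x) = cnj (h x)" for x
  proof -
    have "conjugate x = of_real (g x)" using g[of x] by (metis rc_field_conjugate_of_real)
    then show ?thesis by (simp add: h_def gr)
  qed
  show ?thesis
    using 1 2 3 4 rc_embedding_normI[OF 2 3 4] by (intro exI[of _ h]) (simp add: rc_embedding_def)
next
  assume "\<exists>j :: 'a. j * j = -1 \<and> conjugate j = -j \<and> (\<forall>x. \<exists>a b. x = of_real a + of_real b * j)"
  then obtain j :: 'a where j: "j * j = -1" "conjugate j = -j"
    and "\<forall>x. \<exists>a b. x = of_real a + of_real b * j" by blast
  then obtain g k where g: "\<And>x :: 'a. x = of_real (g x) + of_real (k x) * j" by metis
  \<comment> \<open>Squaring a - a' = (b' - b) j gives a vanishing sum of two real squares.\<close>
  have uniq: "a = a' \<and> b = b'" if "of_real a + of_real b * j = of_real a' + of_real b' * j" for a b a' b'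
  proof -
    have e: "of_real (a - a') = of_real (b' - b) * j" using that by (simp add: algebra_simps)
    have "of_real ((a - a') * (a - a')) = of_real ((b' - b) * (b' - b)) * (j * j)"
      using arg_cong[OF e, of "\<lambda>z. z * z"] by (simp add: algebra_simps)
    then have "of_real ((a - a') * (a - a')) = (of_real (- ((b' - b) * (b' - b))) :: 'a)"
      by (simp add: j)
    then have "(a - a') * (a - a') = - ((b' - b) * (b' - b))" by (simp only: of_real_eq_iff)
    then have "(a - a') * (a - a') + (b' - b) * (b' - b) = 0" by simp
    then show ?thesis by (simp add: sum_squares_eq_zero_iff)
  qed
  define h where "h x = Complex (g x) (k x)" for x
  have h: "h (of_real a + of_real b * j) = Complex a b" for a b
    using uniq[of a b "g (of_real a + of_real b * j)" "k (of_real a + of_real b * j)"] g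
    by (simp add: h_def)
  have 1: "h (x + y) = h x + h y" for x y
  proof -
    have "x + y = of_real (g x + g y) + of_real (k x + k y) * j"
      by (subst (1) g[of x], subst (1) g[of y]) (simp add: algebra_simps)
    then show ?thesis by (simp only: h) (simp add: h_def complex_eq_iff)
  qed
  have 2: "h (x * y) = h x * h y" for x y
  proof -
    have "x * y = (of_real (g x) + of_real (k x) * j) * (of_real (g y) + of_real (k y) * j)"
      by (simp only: g[symmetric])
    also have "\<dots> = of_real (g x * g y) + of_real (k x * k y) * (j * j)
        + of_real (g x * k y + k x * g y) * j"
      by (simp add: algebra_simps)
    also have "\<dots> = of_real (g x * g y - k x * k y) + of_real (g x * k y + k x * g y) * j"
      by (simp add: j)
    finally show ?thesis by (simp only: h) (simp add: h_def complex_eq_iff)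
  qed
  have 3: "h (of_real a) = of_real a" for a using h[of a 0] by (simp add: complex_eq_iff)
  have 4: "h (conjugate x) = cnj (h x)" for x
  proof -
    have "conjugate x = of_real (g x) + of_real (- k x) * j"
      by (subst (1) g[of x]) (simp add: conjugate_dist_add conjugate_dist_mul rc_field_conjugate_of_real j)
    then show ?thesis by (simp only: h) (simp add: h_def complex_eq_iff)
  qed
  show ?thesis
    using 1 2 3 4 rc_embedding_normI[OF 2 3 4] by (intro exI[of _ h]) (simp add: rc_embedding_def)
qed

text \<open>Any embedding would do; the range is the real line or the whole plane. Complex entries
  provide roots of polynomials, hence eigenvectors, while norms and inner products are
  preserved.\<close>

definition to_complex :: "'a :: rc_field \<Rightarrow> complex" where
  "to_complex = (SOME h. rc_embedding h)"

lemma rc_embedding_to_complex: "rc_embedding to_complex"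
  unfolding to_complex_def by (rule someI_ex[OF rc_embedding_exists])

lemma to_complex_simps [simp]:
  fixes x y :: "'a :: rc_field"
  shows "to_complex (x + y) = to_complex x + to_complex y"
  "to_complex (x * y) = to_complex x * to_complex y"
  "to_complex (of_real a :: 'a) = of_real a"
  "to_complex (conjugate x) = cnj (to_complex x)"
  "norm (to_complex x) = norm x"
  using rc_embedding_to_complex[where 'a = 'a] by (simp_all add: rc_embedding_def)

lemma to_complex_0 [simp]: "to_complex 0 = 0" and to_complex_1 [simp]: "to_complex 1 = 1"
  using to_complex_simps(3)[of 0] to_complex_simps(3)[of 1] by simp_all

lemma to_complex_minus [simp]: "to_complex (- x) = - to_complex x"
  using to_complex_simps(1)[of x "- x"] by (simp add: eq_neg_iff_add_eq_0 add.commute)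

lemma to_complex_diff [simp]: "to_complex (x - y) = to_complex x - to_complex y"
  using to_complex_simps(1)[of x "- y"] by simp

lemma to_complex_sum [simp]: "to_complex (\<Sum>i\<in>S. f i) = (\<Sum>i\<in>S. to_complex (f i))"
  by (induction S rule: infinite_finite_induct) auto

lemma to_complex_eq_iff [simp]: "to_complex x = to_complex y \<longleftrightarrow> x = y"
  using to_complex_simps(5)[of "x - y"] by (metis eq_iff_diff_eq_0 norm_eq_zero to_complex_diff)

lemma to_complex_divide [simp]: "to_complex (x / y) = to_complex x / to_complex y"
proof (cases "y = 0")
  case False
  then have "to_complex y \<noteq> 0" using to_complex_eq_iff[of y 0] by simp
  moreover have "to_complex (x / y) * to_complex y = to_complex x"
    using False by (simp flip: to_complex_simps(2))
  ultimately show ?thesis by (simp add: field_simps)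
qed simp

lemma continuous_on_to_complex: "continuous_on S to_complex"
proof (rule continuous_onI)
  fix x e assume "e > (0::real)"
  then show "\<exists>d>0. \<forall>x'\<in>S. dist x' x < d \<longrightarrow> dist (to_complex x') (to_complex x) \<le> e"
    by (intro exI[of _ e]) (auto simp: dist_norm simp flip: to_complex_diff)
qed

lemma measurable_to_complex [measurable]: "to_complex \<in> borel_measurable borel"
  by (intro borel_measurable_continuous_onI continuous_on_to_complex)

interpretation to_complex: inj_comm_ring_hom "to_complex :: 'a :: rc_field \<Rightarrow> complex"
  by unfold_locales (simp_all, metis to_complex_0 to_complex_eq_iff)

section \<open>Singular value decomposition\<close>

text \<open>Only left singular vectors are stored. The right ones are \<open>adj A\<close> applied
  to \<open>e k\<close>, divided by the singular value where it is positive.\<close>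

definition sv_basis ::
    "nat \<Rightarrow> nat \<Rightarrow> (nat \<Rightarrow> nat \<Rightarrow> complex) \<Rightarrow> (nat \<Rightarrow> real) \<Rightarrow> (nat \<Rightarrow> nat \<Rightarrow> complex) \<Rightarrow> bool" where
  "sv_basis n m A \<sigma> e \<longleftrightarrow>
     (\<forall>i<n. \<forall>j<n. ip {..<n} (e i) (e j) = (if i = j then 1 else 0)) \<and>
     (\<forall>k<n. \<sigma> k \<ge> 0 \<and>
       (\<forall>i<n. app {..<n} (gram_op {..<n} {..<m} A) (e k) i = of_real ((\<sigma> k)\<^sup>2) * e k i)) \<and>
     (\<forall>i j. i \<le> j \<longrightarrow> j < n \<longrightarrow> \<sigma> j \<le> \<sigma> i)"

definition entries :: "'a :: rc_field mat \<Rightarrow> nat \<Rightarrow> nat \<Rightarrow> complex" where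
  "entries A i j = to_complex (A $$ (i, j))"

lemma char_poly_orthonormal_eigenbasis:
  fixes G :: "complex mat"
  assumes G: "G \<in> carrier_mat n n"
    and o: "\<And>i j. i < n \<Longrightarrow> j < n \<Longrightarrow> ip {..<n} (e i) (e j) = (if i = j then 1 else 0)"
    and eig: "\<And>k i. k < n \<Longrightarrow> i < n \<Longrightarrow> app {..<n} (\<lambda>i j. G $$ (i, j)) (e k) i = d k * e k i"
  shows "char_poly G = (\<Prod>a\<leftarrow>map d [0..<n]. [:- a, 1:])"
proof -
  define U where "U = Matrix.mat n n (\<lambda>(i, k). e k i)"
  define V where "V = Matrix.mat n n (\<lambda>(k, i). cnj (e k i))"
  define D where "D = Matrix.mat n n (\<lambda>(i, k). if i = k then d k else 0)"
  have [simp]: "U \<in> carrier_mat n n" "V \<in> carrier_mat n n" "D \<in> carrier_mat n n"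
    by (simp_all add: U_def V_def D_def)
  have VU: "V * U = 1\<^sub>m n"
    by (rule eq_matI) (simp_all add: U_def V_def scalar_prod_def atLeast0LessThan o[unfolded ip_def])
  \<comment> \<open>A left inverse of a square matrix is a right inverse; this is the completeness
    of the orthonormal family.\<close>
  have UV: "U * V = 1\<^sub>m n"
    by (rule mat_mult_left_right_inverse[OF _ _ VU]) simp_all
  have GU: "G * U = U * D"
  proof (rule eq_matI)
    fix i k assume "i < dim_row (U * D)" "k < dim_col (U * D)"
    then have ik: "i < n" "k < n" by (simp_all add: U_def D_def)
    have "(G * U) $$ (i, k) = app {..<n} (\<lambda>i j. G $$ (i, j)) (e k) i"
      using ik G by (simp add: U_def scalar_prod_def app_def atLeast0LessThan)
    also have "\<dots> = (\<Sum>j<n. e j i * (if j = k then d k else 0))"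
      using ik by (simp add: eig if_distrib[of "\<lambda>x. _ * x"] sum.delta cong: if_cong)
    also have "\<dots> = (U * D) $$ (i, k)"
      using ik by (simp add: U_def D_def scalar_prod_def atLeast0LessThan)
    finally show "(G * U) $$ (i, k) = (U * D) $$ (i, k)" .
  qed (use G in \<open>simp_all add: U_def D_def\<close>)
  have "U * D * V = G * (U * V)" using G by (simp add: GU[symmetric] assoc_mult_mat[of _ n n _ n _ n])
  then have "G = U * D * V" using G by (simp add: UV)
  then have "similar_mat G D"
    using G UV VU by (intro similar_matI[of _ _ U V n]) auto
  then have "char_poly G = char_poly D" by (rule char_poly_similar)
  also have "\<dots> = (\<Prod>a\<leftarrow>diag_mat D. [:- a, 1:])"
    by (rule char_poly_upper_triangular[of _ n]) (auto simp: D_def upper_triangular_def)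
  also have "diag_mat D = map d [0..<n]" by (simp add: diag_mat_def D_def)
  finally show ?thesis .
qed

lemma proots_prod_linear: "proots (\<Prod>a\<leftarrow>xs. [:- a, 1:]) = mset (xs :: 'a :: idom list)"
proof (induction xs)
  case (Cons a xs)
  have "(\<Prod>a\<leftarrow>xs. [:- a, 1:]) \<noteq> 0" by (auto simp: prod_list_zero_iff)
  then have "proots ([:- a, 1:] * (\<Prod>a\<leftarrow>xs. [:- a, 1:])) = {#a#} + mset xs"
    by (subst proots_mult) (simp_all only: proots_linear_factor Cons.IH, simp_all)
  then show ?case by simp
qed simp

lemma entries_mat_adjoint:
  "A \<in> carrier_mat n m \<Longrightarrow> i < m \<Longrightarrow> j < n \<Longrightarrow> entries (mat_adjoint A) i j = adj (entries A) i j"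
  by (simp add: entries_def mat_adjoint_def mat_of_rows_def adj_def)

text \<open>Singular values are defined through the roots of a characteristic polynomial over the
  scalar field. The eigenvalues of the complexified Gram matrix are real, so its factorization into
  linear factors descends to that field and no root is lost even over the reals. A permutation then
  matches the eigenbasis with the decreasing list.\<close>

lemma sv_basis_exists:
  fixes A :: "'a :: rc_field mat"
  assumes A: "A \<in> carrier_mat n m"
  shows "\<exists>e. sv_basis n m (entries A) (\<lambda>k. singular_values A ! k) e"
proof -
  let ?B = "gram_op {..<n} {..<m} (entries A)"
  obtain e l where
    e0: "\<forall>i<n. \<forall>j<n. ip {..<n} (e i) (e j) = (if i = j then 1 else 0)"
    and l0: "\<forall>j<n. l j \<ge> (0::real) \<and> (\<forall>i\<in>{..<n}. app {..<n} ?B (e j) i = of_real (l j) * e j i)"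
    using orthonormal_eigenbasis[where I = "{..<n}" and k = n and J = "{..<m}" and A = "entries A"]
    by simp (elim exE conjE, rule that, simp_all)
  have adjd: "mat_adjoint A \<in> carrier_mat m n" using A by (intro carrier_matI) (simp_all add: mat_adjoint_def)
  define C where "C = A * mat_adjoint A"
  have C: "C \<in> carrier_mat n n" using A adjd by (simp add: C_def)
  define G where "G = map_mat to_complex C"
  have G: "G \<in> carrier_mat n n" using C by (simp add: G_def)
  have Gij: "G $$ (i, j) = ?B i j" if "i < n" "j < n" for i j
  proof -
    have "C $$ (i, j) = (\<Sum>k<m. A $$ (i, k) * mat_adjoint A $$ (k, j))"
      using that A adjd by (simp add: C_def scalar_prod_def atLeast0LessThan)
    moreover have "to_complex (mat_adjoint A $$ (k, j)) = cnj (entries A j k)" if "k < m" for k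
      using entries_mat_adjoint[OF A that \<open>j < n\<close>] by (simp add: entries_def adj_def)
    ultimately show ?thesis using that C by (simp add: G_def entries_def)
  qed
  interpret mp: map_poly_comm_ring_hom "to_complex :: 'a \<Rightarrow> complex" ..
  have mp: "map_poly to_complex (\<Prod>k\<leftarrow>xs. [:- (of_real (l k) :: 'a), 1:]) = (\<Prod>k\<leftarrow>xs. [:- of_real (l k), 1:])"
    for xs
    by (induction xs) (simp_all only: list.map prod_list.Nil prod_list.Cons mp.hom_mult mp.hom_one,
      simp add: map_poly_pCons)
  have "char_poly G = (\<Prod>a\<leftarrow>map (\<lambda>k. complex_of_real (l k)) [0..<n]. [:- a, 1:])"
  proof (rule char_poly_orthonormal_eigenbasis[OF G])
    show "ip {..<n} (e i) (e j) = (if i = j then 1 else 0)" if "i < n" "j < n" for i j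
      using e0 that by blast
    fix k i assume ki: "k < n" "i < n"
    have "app {..<n} (\<lambda>i j. G $$ (i, j)) (e k) i = app {..<n} ?B (e k) i"
      using ki by (simp add: app_def Gij)
    also have "\<dots> = of_real (l k) * e k i" using l0 ki by blast
    finally show "app {..<n} (\<lambda>i j. G $$ (i, j)) (e k) i = of_real (l k) * e k i" .
  qed
  also have "\<dots> = map_poly to_complex (\<Prod>k\<leftarrow>[0..<n]. [:- (of_real (l k) :: 'a), 1:])"
    by (simp add: mp comp_def)
  also have "char_poly G = map_poly to_complex (char_poly C)"
    unfolding G_def by (rule to_complex.char_poly_hom[OF C])
  finally have cp: "map_poly to_complex (char_poly C) =
      map_poly to_complex (\<Prod>k\<leftarrow>[0..<n]. [:- (of_real (l k) :: 'a), 1:])" .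
  \<comment> \<open>Coefficients are compared through the injective \<open>to_complex\<close>, so
    the factorization holds before complexification.\<close>
  have "char_poly C = (\<Prod>k\<leftarrow>[0..<n]. [:- of_real (l k), 1:])"
  proof (rule poly_eqI)
    fix i
    show "coeff (char_poly C) i = coeff (\<Prod>k\<leftarrow>[0..<n]. [:- of_real (l k), 1:]) i"
      using arg_cong[OF cp, of "\<lambda>p. coeff p i"] by (simp only: coeff_map_poly to_complex_0 to_complex_eq_iff)
  qed
  then have "char_poly C = (\<Prod>a\<leftarrow>map (\<lambda>k. of_real (l k)) [0..<n]. [:- a, 1:])"
    by (simp add: comp_def)
  then have pr: "proots (char_poly C) = mset (map (\<lambda>k. of_real (l k)) [0..<n])"
    by (simp only: proots_prod_linear)
  define s where "s = singular_values A"
  have ms: "mset s = mset (map (\<lambda>k. sqrt (l k)) [0..<n])"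
    using l0 by (simp add: s_def singular_values_def C_def[symmetric] pr image_mset.compositionality comp_def)
       (intro image_mset_cong, simp)
  have len: "length s = n" using mset_eq_length[OF ms] by simp
  \<comment> \<open>The list is ordered, the eigenbasis is not; p sends positions of the list to
    indices of the basis.\<close>
  from mset_eq_permutation[OF ms] obtain p where
    p: "p permutes {..<length (map (\<lambda>k. sqrt (l k)) [0..<n])}"
      "permute_list p (map (\<lambda>k. sqrt (l k)) [0..<n]) = s" .
  have pn: "p permutes {..<n}" using p(1) by simp
  have plt: "p k < n" if "k < n" for k using permutes_in_image[OF pn, of k] that by simp
  have sk: "s ! k = sqrt (l (p k))" if "k < n" for k
  proof -
    have "s ! k = map (\<lambda>k. sqrt (l k)) [0..<n] ! p k"
      unfolding p(2)[symmetric] by (rule permute_list_nth[OF p(1)]) (use that in simp)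
    then show ?thesis using plt[OF that] by simp
  qed
  have srt: "s ! j \<le> s ! i" if "i \<le> j" "j < n" for i j
  proof -
    define t where "t = rev s"
    have st: "sorted t" by (simp add: t_def s_def singular_values_def)
    have lt: "length t = n" by (simp add: t_def len)
    have "t ! (n - Suc j) \<le> t ! (n - Suc i)"
      using st that lt by (intro sorted_nth_mono) auto
    then show ?thesis using that len by (simp add: t_def rev_nth)
  qed
  have "sv_basis n m (entries A) (\<lambda>k. s ! k) (\<lambda>k. e (p k))"
    unfolding sv_basis_def
  proof (intro conjI allI impI)
    fix i j assume ij: "i < n" "j < n"
    have "p i = p j \<longleftrightarrow> i = j" using permutes_inj[OF pn] by (auto dest: injD)
    then show "ip {..<n} (e (p i)) (e (p j)) = (if i = j then 1 else 0)"
      using e0 plt[OF ij(1)] plt[OF ij(2)] by simp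
  next
    fix k assume k: "k < n"
    then show "0 \<le> s ! k" using l0 plt sk by simp
    fix i assume i: "i < n"
    have "(s ! k)\<^sup>2 = l (p k)" using sk[OF k] l0 plt[OF k] by simp
    then show "app {..<n} ?B (e (p k)) i = of_real ((s ! k)\<^sup>2) * e (p k) i"
      using l0 plt[OF k] i by simp
  next
    fix i j assume "i \<le> j" "j < n"
    then show "s ! j \<le> s ! i" by (rule srt)
  qed
  then show ?thesis unfolding s_def by blast
qed

section \<open>Extremal properties of singular values\<close>

lemma cnj_mult_self: "cnj z * z = of_real ((norm z)\<^sup>2)"
  using complex_norm_square[of z] by (simp add: mult.commute)

lemma sv_basisD:
  assumes "sv_basis n m A \<sigma> e"
  shows "i < n \<Longrightarrow> j < n \<Longrightarrow> ip {..<n} (e i) (e j) = (if i = j then 1 else 0)"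
    and "k < n \<Longrightarrow> \<sigma> k \<ge> 0"
    and "k < n \<Longrightarrow> i < n \<Longrightarrow> app {..<n} (gram_op {..<n} {..<m} A) (e k) i = of_real ((\<sigma> k)\<^sup>2) * e k i"
    and "i \<le> j \<Longrightarrow> j < n \<Longrightarrow> \<sigma> j \<le> \<sigma> i"
  using assms by (simp_all add: sv_basis_def)

lemma sv_basis_adj:
  assumes "sv_basis n m A \<sigma> e" "i < n" "j < n"
  shows "ip {..<m} (app {..<n} (adj A) (e i)) (app {..<n} (adj A) (e j)) =
    (if i = j then of_real ((\<sigma> i)\<^sup>2) else 0)"
proof -
  have "ip {..<m} (app {..<n} (adj A) (e i)) (app {..<n} (adj A) (e j)) =
      ip {..<n} (e i) (app {..<n} (gram_op {..<n} {..<m} A) (e j))"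
    by (simp only: ip_gram_op)
  also have "\<dots> = ip {..<n} (e i) (\<lambda>i. of_real ((\<sigma> j)\<^sup>2) * e j i)"
    using sv_basisD(3)[OF assms(1,3)] by (intro ip_cong refl) auto
  also have "\<dots> = (if i = j then of_real ((\<sigma> i)\<^sup>2) else 0)"
    using sv_basisD(1)[OF assms] by (simp add: ip_scale_right)
  finally show ?thesis .
qed

text \<open>The n + 1 vectors consisting of the \<open>e k\<close> and w satisfy a linear relation;
  orthonormality forces a nonzero coefficient of w and identifies the other coefficients.\<close>

lemma sv_basis_expand:
  assumes b: "sv_basis n m A \<sigma> e" and i: "i < n"
  shows "w i = (\<Sum>k<n. ip {..<n} (e k) w * e k i)"
proof -
  define f where "f k = (if k < n then e k else w)" for k
  from homogeneous_system[of "{..<n}" "{..n}" "\<lambda>i k. f k i"] obtain c where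
    c: "\<exists>k\<le>n. c k \<noteq> 0" "\<And>i. i < n \<Longrightarrow> (\<Sum>k\<le>n. f k i * c k) = 0" by auto
  have s: "(\<Sum>k<n. c k * e k i) + c n * w i = 0" if "i < n" for i
  proof -
    have "(\<Sum>k\<le>n. f k i * c k) = (\<Sum>k<n. f k i * c k) + f n i * c n"
      by (simp add: lessThan_Suc_atMost[symmetric])
    also have "(\<Sum>k<n. f k i * c k) = (\<Sum>k<n. c k * e k i)"
      by (intro sum.cong refl) (simp add: f_def)
    finally show ?thesis using c(2)[OF that] by (simp add: f_def mult.commute)
  qed
  have s': "c k + c n * ip {..<n} (e k) w = 0" if k: "k < n" for k
  proof -
    have "0 = ip {..<n} (e k) (\<lambda>i. (\<Sum>j<n. c j * e j i) + c n * w i)"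
      using s by (simp add: ip_def)
    also have "\<dots> = (\<Sum>j<n. c j * ip {..<n} (e k) (e j)) + c n * ip {..<n} (e k) w"
      by (simp add: ip_add_right ip_sum_right ip_scale_right)
    also have "(\<Sum>j<n. c j * ip {..<n} (e k) (e j)) = (\<Sum>j<n. if k = j then c k else 0)"
      using k by (intro sum.cong refl) (simp add: sv_basisD(1)[OF b])
    finally show ?thesis using k by simp
  qed
  have "c n \<noteq> 0"
  proof
    assume "c n = 0"
    then have "c k = 0" if "k \<le> n" for k using s'[of k] that by (cases "k = n") auto
    with c(1) show False by blast
  qed
  have "(\<Sum>k<n. c k * e k i) = (\<Sum>k<n. - (c n * (ip {..<n} (e k) w * e k i)))"
  proof (intro sum.cong refl)
    fix k assume "k \<in> {..<n}"
    then have "c k = - (c n * ip {..<n} (e k) w)" using s'[of k] by (simp add: eq_neg_iff_add_eq_0)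
    then show "c k * e k i = - (c n * (ip {..<n} (e k) w * e k i))" by simp
  qed
  also have "\<dots> = - (c n * (\<Sum>k<n. ip {..<n} (e k) w * e k i))"
    by (simp add: sum_negf sum_distrib_left)
  finally have S: "(\<Sum>k<n. c k * e k i) = - (c n * (\<Sum>k<n. ip {..<n} (e k) w * e k i))" .
  have "c n * w i = - (\<Sum>k<n. c k * e k i)"
    using s[OF i] by (simp add: eq_neg_iff_add_eq_0 add.commute)
  then have "c n * w i = c n * (\<Sum>k<n. ip {..<n} (e k) w * e k i)" by (simp only: S minus_minus)
  then show ?thesis using \<open>c n \<noteq> 0\<close> by simp
qed

lemma sv_basis_expand_app:
  assumes b: "sv_basis n m A \<sigma> e"
  shows "app {..<n} B w = (\<lambda>i. \<Sum>k<n. ip {..<n} (e k) w * app {..<n} B (e k) i)"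
proof -
  have "app {..<n} B w = app {..<n} B (\<lambda>i. \<Sum>k<n. ip {..<n} (e k) w * e k i)"
    by (intro app_cong sv_basis_expand[OF b]) simp
  then show ?thesis by (simp add: app_sum app_scale)
qed

lemma sv_basis_nsq:
  assumes b: "sv_basis n m A \<sigma> e"
  shows "nsq {..<n} w = (\<Sum>k<n. (norm (ip {..<n} (e k) w))\<^sup>2)"
proof -
  let ?w = "\<lambda>i. \<Sum>k<n. ip {..<n} (e k) w * e k i"
  have "of_real (nsq {..<n} w) = ip {..<n} ?w ?w"
    unfolding ip_self[symmetric] by (intro ip_cong sv_basis_expand[OF b]) simp_all
  also have "\<dots> = (\<Sum>k<n. cnj (ip {..<n} (e k) w) * ip {..<n} (e k) w * 1)"
    by (rule nsq_orthogonal_sum) (simp_all add: sv_basisD(1)[OF b])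
  also have "\<dots> = of_real (\<Sum>k<n. (norm (ip {..<n} (e k) w))\<^sup>2)"
    by (simp add: cnj_mult_self del: of_real_power)
  finally show ?thesis by (simp only: of_real_eq_iff)
qed

lemma sv_basis_nsq_adj:
  assumes b: "sv_basis n m A \<sigma> e"
  shows "nsq {..<m} (app {..<n} (adj A) w) = (\<Sum>k<n. (norm (ip {..<n} (e k) w))\<^sup>2 * (\<sigma> k)\<^sup>2)"
proof -
  have "of_real (nsq {..<m} (app {..<n} (adj A) w)) =
     (\<Sum>k<n. cnj (ip {..<n} (e k) w) * ip {..<n} (e k) w * of_real ((\<sigma> k)\<^sup>2))"
    unfolding ip_self[symmetric] sv_basis_expand_app[OF b, of "adj A" w]
    by (rule nsq_orthogonal_sum) (simp_all add: sv_basis_adj[OF b])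
  also have "\<dots> = of_real (\<Sum>k<n. (norm (ip {..<n} (e k) w))\<^sup>2 * (\<sigma> k)\<^sup>2)"
    by (simp add: cnj_mult_self del: of_real_power)
  finally show ?thesis by (simp only: of_real_eq_iff)
qed

text \<open>One half of the min-max principle: orthogonality to the first k vectors leaves only
  weights \<open>(\<sigma> i)^2\<close> with i at least k.\<close>

lemma sv_basis_nsq_adj_le:
  assumes b: "sv_basis n m A \<sigma> e" and k: "k < n" and "\<And>i. i < k \<Longrightarrow> ip {..<n} (e i) w = 0"
  shows "nsq {..<m} (app {..<n} (adj A) w) \<le> (\<sigma> k)\<^sup>2 * nsq {..<n} w"
proof -
  have "(norm (ip {..<n} (e i) w))\<^sup>2 * (\<sigma> i)\<^sup>2 \<le> (\<sigma> k)\<^sup>2 * (norm (ip {..<n} (e i) w))\<^sup>2" if "i < n" for i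
  proof (cases "i < k")
    case False
    then have "\<sigma> i \<le> \<sigma> k" "0 \<le> \<sigma> i" using sv_basisD(2,4)[OF b] that by auto
    then show ?thesis by (subst mult.commute) (intro mult_right_mono power_mono; simp)
  qed (simp add: assms)
  then show ?thesis
    unfolding sv_basis_nsq_adj[OF b] sv_basis_nsq[OF b] sum_distrib_left by (intro sum_mono) simp
qed

text \<open>An operator and its adjoint have the same norm: by Cauchy-Schwarz, |Av|^4 is at most
  |y|^2 |v|^2 with y the adjoint applied to Av, and one factor |Av|^2 cancels.\<close>

lemma sv_basis_nsq_app_le:
  assumes b: "sv_basis n m A \<sigma> e" and n: "0 < n"
  shows "nsq {..<n} (app {..<m} A v) \<le> (\<sigma> 0)\<^sup>2 * nsq {..<m} v"
proof -
  let ?y = "app {..<m} A v"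
  have "(nsq {..<n} ?y)\<^sup>2 = (norm (ip {..<n} ?y ?y))\<^sup>2" by (simp add: ip_self)
  also have "\<dots> = (norm (ip {..<m} (app {..<n} (adj A) ?y) v))\<^sup>2" by (subst (1) ip_app) simp
  also have "\<dots> \<le> nsq {..<m} (app {..<n} (adj A) ?y) * nsq {..<m} v" by (rule norm_ip_sq_le)
  also have "\<dots> \<le> ((\<sigma> 0)\<^sup>2 * nsq {..<n} ?y) * nsq {..<m} v"
    by (intro mult_right_mono sv_basis_nsq_adj_le[OF b n]) auto
  finally have "nsq {..<n} ?y * nsq {..<n} ?y \<le> nsq {..<n} ?y * ((\<sigma> 0)\<^sup>2 * nsq {..<m} v)"
    by (simp add: power2_eq_square mult_ac)
  then show ?thesis
    by (cases "nsq {..<n} ?y = 0") (simp_all add: mult_le_cancel_left less_le)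
qed

text \<open>Test vectors for upper bounds on a singular value: by a dimension count the span of the
  top k + 1 left vectors contains some w orthogonal to k prescribed vectors. Its partner v is its
  image under the partial isometry from left to right singular vectors, hence of equal norm.\<close>

lemma large_singular_value_witness:
  assumes b: "sv_basis n m A \<sigma> e" and k: "k < n" and z: "0 \<le> z" "z < \<sigma> k"
  shows "\<exists>w v. nsq {..<n} w > 0 \<and> nsq {..<m} v = nsq {..<n} w \<and> (\<forall>i<k. ip {..<n} (u i) w = 0) \<and>
    Re (ip {..<n} w (app {..<m} A v)) > z * nsq {..<n} w"
proof -
  from homogeneous_system[of "{..<k}" "{..k}" "\<lambda>i j. ip {..<n} (u i) (e j)"] obtain a where
    a: "\<exists>j\<le>k. a j \<noteq> 0" "\<And>i. i < k \<Longrightarrow> (\<Sum>j\<le>k. ip {..<n} (u i) (e j) * a j) = 0" by auto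
  define f where "f j = app {..<n} (adj A) (e j)" for j
  define w where "w = (\<lambda>i. \<Sum>j\<le>k. a j * e j i)"
  \<comment> \<open>Division by \<open>\<sigma> j\<close> normalizes the right vectors; these values
    exceed z, so they are nonzero.\<close>
  define v where "v = (\<lambda>i. \<Sum>j\<le>k. (a j / of_real (\<sigma> j)) * f j i)"
  have sk: "\<sigma> j > z" if "j \<le> k" for j using sv_basisD(4)[OF b that k] z by simp
  have ww: "nsq {..<n} w = (\<Sum>j\<le>k. (norm (a j))\<^sup>2)"
  proof -
    have "of_real (nsq {..<n} w) = (\<Sum>j\<le>k. cnj (a j) * a j * 1)"
      unfolding ip_self[symmetric] w_def
      by (rule nsq_orthogonal_sum) (use k in \<open>auto simp: sv_basisD(1)[OF b]\<close>)
    also have "\<dots> = of_real (\<Sum>j\<le>k. (norm (a j))\<^sup>2)" by (simp add: cnj_mult_self del: of_real_power)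
    finally show ?thesis by (simp only: of_real_eq_iff)
  qed
  have ff: "ip {..<m} (f i) (f j) = (if i = j then of_real ((\<sigma> i)\<^sup>2) else 0)" if "i \<le> k" "j \<le> k" for i j
    unfolding f_def using that k by (intro sv_basis_adj[OF b]) auto
  have vv: "nsq {..<m} v = (\<Sum>j\<le>k. (norm (a j))\<^sup>2)"
  proof -
    have "of_real (nsq {..<m} v) =
        (\<Sum>j\<le>k. cnj (a j / of_real (\<sigma> j)) * (a j / of_real (\<sigma> j)) * of_real ((\<sigma> j)\<^sup>2))"
      unfolding ip_self[symmetric] v_def by (rule nsq_orthogonal_sum) (auto simp: ff)
    also have "\<dots> = (\<Sum>j\<le>k. of_real ((norm (a j))\<^sup>2))"
    proof (intro sum.cong refl)
      fix j assume "j \<in> {..k}"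
      then have "\<sigma> j \<noteq> 0" using sk[of j] z by auto
      then show "cnj (a j / of_real (\<sigma> j)) * (a j / of_real (\<sigma> j)) * of_real ((\<sigma> j)\<^sup>2) =
          of_real ((norm (a j))\<^sup>2)"
        unfolding complex_norm_square by (simp add: power2_eq_square)
    qed
    finally show ?thesis by (simp only: of_real_sum[symmetric] of_real_eq_iff)
  qed
  have wv: "ip {..<n} w (app {..<m} A v) = of_real (\<Sum>j\<le>k. (norm (a j))\<^sup>2 * \<sigma> j)"
  proof -
    have "app {..<n} (adj A) w = (\<lambda>i. \<Sum>j\<le>k. a j * f j i)"
      by (simp add: w_def app_sum app_scale f_def)
    then have "ip {..<n} w (app {..<m} A v) = ip {..<m} (\<lambda>i. \<Sum>j\<le>k. a j * f j i) v"
      by (simp add: ip_app)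
    also have "\<dots> = (\<Sum>j\<le>k. cnj (a j) * (a j / of_real (\<sigma> j)) * of_real ((\<sigma> j)\<^sup>2))"
      unfolding v_def by (rule nsq_orthogonal_sum) (auto simp: ff)
    also have "\<dots> = (\<Sum>j\<le>k. of_real ((norm (a j))\<^sup>2 * \<sigma> j))"
    proof (intro sum.cong refl)
      fix j assume "j \<in> {..k}"
      then have "\<sigma> j \<noteq> 0" using sk[of j] z by auto
      then show "cnj (a j) * (a j / of_real (\<sigma> j)) * of_real ((\<sigma> j)\<^sup>2) =
          of_real ((norm (a j))\<^sup>2 * \<sigma> j)"
        unfolding of_real_mult complex_norm_square by (simp add: power2_eq_square)
    qed
    finally show ?thesis by simp
  qed
  obtain j0 where j0: "j0 \<le> k" "a j0 \<noteq> 0" using a(1) by blast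
  have pos: "nsq {..<n} w > 0"
    unfolding ww by (rule sum_pos2[of _ j0]) (use j0 in auto)
  have l: "z * (norm (a j))\<^sup>2 \<le> (norm (a j))\<^sup>2 * \<sigma> j" if "j \<le> k" for j
    using mult_left_mono[OF less_imp_le[OF sk[OF that]], of "(norm (a j))\<^sup>2"] by (simp add: mult.commute)
  have "z * (norm (a j0))\<^sup>2 < (norm (a j0))\<^sup>2 * \<sigma> j0"
    using mult_strict_left_mono[OF sk[OF j0(1)], of "(norm (a j0))\<^sup>2"] j0(2) by (simp add: mult.commute)
  then have "(\<Sum>j\<le>k. z * (norm (a j))\<^sup>2) < (\<Sum>j\<le>k. (norm (a j))\<^sup>2 * \<sigma> j)"
    using l j0(1) by (intro sum_strict_mono_ex1) auto
  then have "z * nsq {..<n} w < (\<Sum>j\<le>k. (norm (a j))\<^sup>2 * \<sigma> j)"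
    by (simp only: ww sum_distrib_left)
  moreover have "ip {..<n} (u i) w = 0" if "i < k" for i
    using a(2)[OF that] by (simp add: w_def ip_sum_right ip_scale_right mult.commute)
  ultimately show ?thesis
    using pos by (intro exI[of _ w] exI[of _ v]) (simp add: wv vv ww)
qed

text \<open>The opposite direction, for lower bounds: some combination of k + 1 trial pairs has its
  left part orthogonal to the top k left vectors, and Cauchy-Schwarz with the arithmetic-geometric
  mean inequality takes care of the right part. Nontriviality refers to the coefficients, since
  trial vectors may be dependent.\<close>

lemma small_singular_value_combination:
  assumes b: "sv_basis n m A \<sigma> e" and k: "k < n" and z: "\<sigma> k < z"
  shows "\<exists>c. (\<exists>j\<le>k. c j \<noteq> 0) \<and>
    2 * Re (ip {..<n} (\<lambda>i. \<Sum>j\<le>k. c j * p j i) (app {..<m} A (\<lambda>i. \<Sum>j\<le>k. c j * q j i)))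
      \<le> z * (nsq {..<n} (\<lambda>i. \<Sum>j\<le>k. c j * p j i) + nsq {..<m} (\<lambda>i. \<Sum>j\<le>k. c j * q j i))"
proof -
  from homogeneous_system[of "{..<k}" "{..k}" "\<lambda>i j. ip {..<n} (e i) (p j)"] obtain c where
    c: "\<exists>j\<le>k. c j \<noteq> 0" "\<And>i. i < k \<Longrightarrow> (\<Sum>j\<le>k. ip {..<n} (e i) (p j) * c j) = 0" by auto
  define P where "P = (\<lambda>i. \<Sum>j\<le>k. c j * p j i)"
  define Q where "Q = (\<lambda>i. \<Sum>j\<le>k. c j * q j i)"
  have "ip {..<n} (e i) P = 0" if "i < k" for i
    using c(2)[OF that] by (simp add: P_def ip_sum_right ip_scale_right mult.commute)
  then have le: "nsq {..<m} (app {..<n} (adj A) P) \<le> (\<sigma> k)\<^sup>2 * nsq {..<n} P"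
    by (rule sv_basis_nsq_adj_le[OF b k])
  have s0: "\<sigma> k \<ge> 0" using sv_basisD(2)[OF b k] .
  define x y where "x = sqrt (nsq {..<n} P)" and "y = sqrt (nsq {..<m} Q)"
  have "Re (ip {..<n} P (app {..<m} A Q)) \<le> norm (ip {..<m} (app {..<n} (adj A) P) Q)"
    by (simp only: ip_app complex_Re_le_cmod)
  also have "\<dots> \<le> sqrt (nsq {..<m} (app {..<n} (adj A) P)) * sqrt (nsq {..<m} Q)" by (rule norm_ip_le)
  also have "\<dots> \<le> sqrt ((\<sigma> k)\<^sup>2 * nsq {..<n} P) * sqrt (nsq {..<m} Q)"
    by (intro mult_right_mono real_sqrt_le_mono le) simp
  also have "\<dots> = \<sigma> k * (x * y)" using s0 by (simp add: x_def y_def real_sqrt_mult)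
  also have "\<dots> \<le> z * (x * y)" using z by (intro mult_right_mono) (simp_all add: x_def y_def)
  finally have "2 * Re (ip {..<n} P (app {..<m} A Q)) \<le> z * (2 * (x * y))" by simp
  also have "\<dots> \<le> z * (x\<^sup>2 + y\<^sup>2)"
    using z s0 sum_squares_bound[of x y] by (intro mult_left_mono) (simp_all add: mult.assoc)
  finally have "2 * Re (ip {..<n} P (app {..<m} A Q)) \<le> z * (nsq {..<n} P + nsq {..<m} Q)"
    by (simp add: x_def y_def)
  then show ?thesis unfolding P_def Q_def using c(1) by (intro exI[of _ c] conjI)
qed

section \<open>The Hermitian dilation\<close>

definition dil :: "(nat \<Rightarrow> nat \<Rightarrow> complex) \<Rightarrow> nat + nat \<Rightarrow> nat + nat \<Rightarrow> complex" where
  "dil A s t = (case s of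
      Inl i \<Rightarrow> (case t of Inl _ \<Rightarrow> 0 | Inr j \<Rightarrow> A i j)
    | Inr j \<Rightarrow> (case t of Inl i \<Rightarrow> cnj (A i j) | Inr _ \<Rightarrow> 0))"

abbreviation idx :: "nat \<Rightarrow> nat \<Rightarrow> (nat + nat) set" where
  "idx n m \<equiv> {..<n} <+> {..<m}"

lemma sum_idx: "(\<Sum>s\<in>idx n m. f s) = (\<Sum>i<n. f (Inl i)) + (\<Sum>j<m. f (Inr j))"
  by (simp add: sum.Plus)

lemma adj_dil [simp]: "adj (dil A) = dil A"
  by (auto simp: adj_def dil_def fun_eq_iff split: sum.splits)

lemma app_dil: "app (idx n m) (dil A) x =
    case_sum (app {..<m} A (x \<circ> Inr)) (app {..<n} (adj A) (x \<circ> Inl))"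
  by (auto simp: app_def dil_def adj_def sum_idx fun_eq_iff split: sum.splits)

lemma ip_idx: "ip (idx n m) x y = ip {..<n} (x \<circ> Inl) (y \<circ> Inl) + ip {..<m} (x \<circ> Inr) (y \<circ> Inr)"
  by (simp add: ip_def sum_idx)

lemma nsq_idx: "nsq (idx n m) x = nsq {..<n} (x \<circ> Inl) + nsq {..<m} (x \<circ> Inr)"
  by (simp add: nsq_def sum_idx)

lemma case_sum_comp [simp]: "case_sum f g \<circ> Inl = f" "case_sum f g \<circ> Inr = g"
  by (simp_all add: fun_eq_iff)

lemma Re_ip_dil: "Re (ip (idx n m) x (app (idx n m) (dil A) x)) =
    2 * Re (ip {..<n} (x \<circ> Inl) (app {..<m} A (x \<circ> Inr)))"
proof -
  have "ip {..<m} (x \<circ> Inr) (app {..<n} (adj A) (x \<circ> Inl)) = cnj (ip {..<n} (x \<circ> Inl) (app {..<m} A (x \<circ> Inr)))"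
    by (simp add: ip_app cnj_ip)
  then show ?thesis by (simp add: app_dil ip_idx)
qed

lemma nsq_app_dil_le:
  assumes b: "sv_basis n m A \<sigma> e" and n: "0 < n"
  shows "nsq (idx n m) (app (idx n m) (dil A) x) \<le> (\<sigma> 0)\<^sup>2 * nsq (idx n m) x"
  using sv_basis_nsq_app_le[OF b n, of "x \<circ> Inr"] sv_basis_nsq_adj_le[OF b n, of "x \<circ> Inl"]
  by (simp add: app_dil nsq_idx distrib_left)

section \<open>Resolvents\<close>

lemma ip_funpow:
  assumes "adj H = H"
  shows "ip I x ((app I H ^^ k) y) = ip I ((app I H ^^ k) x) y"
proof (induction k arbitrary: x)
  case (Suc k)
  have "ip I x ((app I H ^^ Suc k) y) = ip I (app I H x) ((app I H ^^ k) y)" by (simp add: ip_app assms)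
  also have "\<dots> = ip I ((app I H ^^ k) (app I H x)) y" by (rule Suc)
  finally show ?case by (simp add: funpow_swap1)
qed simp

lemma nsq_funpow_le:
  assumes "\<And>x. nsq I (app I H x) \<le> B\<^sup>2 * nsq I x"
  shows "nsq I ((app I H ^^ k) x) \<le> (B ^ k)\<^sup>2 * nsq I x"
proof (induction k)
  case (Suc k)
  have "nsq I ((app I H ^^ Suc k) x) \<le> B\<^sup>2 * nsq I ((app I H ^^ k) x)" using assms by simp
  also have "\<dots> \<le> B\<^sup>2 * ((B ^ k)\<^sup>2 * nsq I x)" by (intro mult_left_mono Suc) simp
  finally show ?case by (simp add: power_mult_distrib mult_ac)
qed simp

lemma norm_ip_funpow_le:
  assumes "\<And>x. nsq I (app I H x) \<le> B\<^sup>2 * nsq I x" "B \<ge> 0"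
  shows "norm (ip I y ((app I H ^^ k) x)) \<le> sqrt (nsq I y) * sqrt (nsq I x) * B ^ k"
proof -
  have "norm (ip I y ((app I H ^^ k) x)) \<le> sqrt (nsq I y) * sqrt (nsq I ((app I H ^^ k) x))"
    by (rule norm_ip_le)
  also have "\<dots> \<le> sqrt (nsq I y) * sqrt ((B ^ k)\<^sup>2 * nsq I x)"
    by (intro mult_left_mono real_sqrt_le_mono nsq_funpow_le assms) simp
  also have "\<dots> = sqrt (nsq I y) * sqrt (nsq I x) * B ^ k"
    using assms(2) by (simp add: real_sqrt_mult)
  finally show ?thesis .
qed

lemma funpow_app_cong:
  "(\<And>i. i \<in> I \<Longrightarrow> x i = y i) \<Longrightarrow> i \<in> I \<Longrightarrow> (app I H ^^ k) x i = (app I H ^^ k) y i"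
proof (induction k arbitrary: i)
  case (Suc k)
  have "app I H ((app I H ^^ k) x) = app I H ((app I H ^^ k) y)" by (intro app_cong Suc)
  then show ?case by simp
qed simp

lemma funpow_app_diff:
  fixes H :: "'i \<Rightarrow> 'i \<Rightarrow> complex"
  shows "(app I H ^^ k) (\<lambda>i. x i - y i) = (\<lambda>i. (app I H ^^ k) x i - (app I H ^^ k) y i)"
  by (induction k) (simp_all add: app_diff)

lemma funpow_app_scale:
  fixes H :: "'i \<Rightarrow> 'i \<Rightarrow> complex"
  shows "(app I H ^^ k) (\<lambda>i. c * x i) = (\<lambda>i. c * (app I H ^^ k) x i)"
  by (induction k) (simp_all add: app_scale)

lemma funpow_app_sum:
  fixes H :: "'i \<Rightarrow> 'i \<Rightarrow> complex"
  shows "(app I H ^^ k) (\<lambda>i. \<Sum>s\<in>S. x s i) = (\<lambda>i. \<Sum>s\<in>S. (app I H ^^ k) (x s) i)"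
  by (induction k) (simp_all add: app_sum)

lemma funpow_resolvent:
  assumes "\<And>i. i \<in> I \<Longrightarrow> z * x i = w i + app I H x i" "i \<in> I"
  shows "(app I H ^^ k) w i = z * (app I H ^^ k) x i - (app I H ^^ Suc k) x i"
proof -
  have "(app I H ^^ k) w i = (app I H ^^ k) (\<lambda>i. z * x i - app I H x i) i"
    by (rule funpow_app_cong[OF _ assms(2)]) (simp add: assms(1))
  then show ?thesis by (simp add: funpow_app_diff funpow_app_scale funpow_swap1)
qed

lemma power_ratio_tendsto_0:
  assumes "0 \<le> B" "B < (z :: real)"
  shows "(\<lambda>N. C * B ^ N / z ^ N) \<longlonglongrightarrow> 0" "(\<lambda>N. real N * (C * B ^ N / z ^ N)) \<longlonglongrightarrow> 0"
proof -
  have r: "0 \<le> B / z" "B / z < 1" using assms by simp_all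
  have "(\<lambda>N. (B / z) ^ N) \<longlonglongrightarrow> 0" using r by (intro LIMSEQ_power_zero) simp
  from tendsto_mult_right_zero[OF this, of C] show "(\<lambda>N. C * B ^ N / z ^ N) \<longlonglongrightarrow> 0"
    by (simp add: power_divide)
  have "(\<lambda>N. of_nat N * (B / z) ^ N) \<longlonglongrightarrow> 0" using r by (intro powser_times_n_limit_0) simp
  from tendsto_mult_right_zero[OF this, of C] show "(\<lambda>N. real N * (C * B ^ N / z ^ N)) \<longlonglongrightarrow> 0"
    by (simp add: power_divide mult_ac)
qed

text \<open>The Neumann series for a given solution: the k-th term is a difference of consecutive
  quotients \<open>b k / z ^ k\<close>, so the partial sums telescope and the remainder is of order
  \<open>(B / z) ^ N\<close>.\<close>

lemma resolvent_sums:
  assumes bnd: "\<And>x. nsq I (app I H x) \<le> B\<^sup>2 * nsq I x" "0 \<le> B" "B < z"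
    and x: "\<And>i. i \<in> I \<Longrightarrow> of_real z * x i = w i + app I H x i"
  shows "(\<lambda>k. ip I y ((app I H ^^ k) w) / of_real z ^ (k + 1)) sums ip I y x"
proof -
  have z: "z > 0" "complex_of_real z \<noteq> 0" using bnd by auto
  define b where "b k = ip I y ((app I H ^^ k) x)" for k
  have a: "ip I y ((app I H ^^ k) w) = of_real z * b k - b (Suc k)" for k
  proof -
    have "ip I y ((app I H ^^ k) w) = ip I y (\<lambda>i. of_real z * (app I H ^^ k) x i - (app I H ^^ Suc k) x i)"
      by (intro ip_cong refl funpow_resolvent) (simp_all add: x)
    then show ?thesis by (simp only: ip_diff_right ip_scale_right b_def)
  qed
  have part: "(\<Sum>k<N. ip I y ((app I H ^^ k) w) / of_real z ^ (k + 1)) = ip I y x - b N / of_real z ^ N" for N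
  proof (induction N)
    case (Suc N)
    then show ?case using z by (simp add: a) (simp add: diff_divide_distrib)
  qed (simp add: b_def)
  have "(\<lambda>N. b N / of_real z ^ N) \<longlonglongrightarrow> 0"
  proof (rule Lim_null_comparison[OF always_eventually power_ratio_tendsto_0(1)[OF bnd(2,3)]], rule allI)
    fix N
    show "norm (b N / of_real z ^ N) \<le> sqrt (nsq I y) * sqrt (nsq I x) * B ^ N / z ^ N"
      using norm_ip_funpow_le[OF bnd(1,2), of y N x] z
      by (simp add: b_def norm_divide norm_power divide_right_mono)
  qed
  from tendsto_diff[OF tendsto_const[of "ip I y x"] this] show ?thesis
    unfolding sums_def part by simp
qed

text \<open>As H is self-adjoint, the squared norm of x is the form of the squared resolvent at w,
  whose series is the Neumann series differentiated in z, up to sign.\<close>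

lemma resolvent_nsq_sums:
  assumes bnd: "\<And>x. nsq I (app I H x) \<le> B\<^sup>2 * nsq I x" "0 \<le> B" "B < z"
    and herm: "adj H = H"
    and x: "\<And>i. i \<in> I \<Longrightarrow> of_real z * x i = w i + app I H x i"
  shows "(\<lambda>k. of_nat (k + 1) * ip I w ((app I H ^^ k) w) / of_real z ^ (k + 2)) sums of_real (nsq I x)"
proof -
  have z: "z > 0" "complex_of_real z \<noteq> 0" using bnd by auto
  define d where "d k = ip I x ((app I H ^^ k) x)" for k
  have xw: "ip I w y = of_real z * ip I x y - ip I x (app I H y)" for y
  proof -
    have "ip I w y = ip I (\<lambda>i. of_real z * x i - app I H x i) y" by (intro ip_cong refl) (simp add: x)
    then show ?thesis by (simp add: ip_diff_left ip_scale_left ip_app herm)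
  qed
  have a: "ip I w ((app I H ^^ k) w) = of_real z ^ 2 * d k - 2 * of_real z * d (Suc k) + d (Suc (Suc k))" for k
  proof -
    have "ip I w ((app I H ^^ k) w) = ip I w (\<lambda>i. of_real z * (app I H ^^ k) x i - (app I H ^^ Suc k) x i)"
      by (intro ip_cong refl funpow_resolvent) (simp_all add: x)
    also have "\<dots> = of_real z * ip I w ((app I H ^^ k) x) - ip I w ((app I H ^^ Suc k) x)"
      by (simp only: ip_diff_right ip_scale_right)
    also have "\<dots> = of_real z ^ 2 * d k - 2 * of_real z * d (Suc k) + d (Suc (Suc k))"
      by (simp add: xw d_def algebra_simps power2_eq_square)
    finally show ?thesis .
  qed
  \<comment> \<open>The summands are second differences of \<open>d\<close> with weights linear in
    k; summation by parts leaves only the boundary terms \<open>d N\<close> and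
    \<open>d (Suc N)\<close>.\<close>
  have part: "(\<Sum>k<N. of_nat (k + 1) * ip I w ((app I H ^^ k) w) / of_real z ^ (k + 2)) =
      of_real (nsq I x) - (of_nat N + 1) * d N / of_real z ^ N + of_nat N * d (Suc N) / of_real z ^ Suc N" for N
  proof (induction N)
    case (Suc N)
    show ?case
      by (subst sum.lessThan_Suc, subst Suc.IH, subst a)
        (use z in \<open>simp add: field_simps power2_eq_square\<close>)
  qed (simp add: d_def ip_self)
  let ?C = "nsq I x"
  have dle: "norm (d N / of_real z ^ N) \<le> ?C * B ^ N / z ^ N" for N
    using norm_ip_funpow_le[OF bnd(1,2), of x N x] z
    by (simp add: d_def norm_divide norm_power divide_right_mono)
  have d0: "(\<lambda>N. d N / of_real z ^ N) \<longlonglongrightarrow> 0"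
    by (rule Lim_null_comparison[OF always_eventually power_ratio_tendsto_0(1)[OF bnd(2,3)]]) (use dle in blast)
  have d1: "(\<lambda>N. of_nat N * (d N / of_real z ^ N)) \<longlonglongrightarrow> 0"
  proof (rule Lim_null_comparison[OF always_eventually power_ratio_tendsto_0(2)[OF bnd(2,3)]], rule allI)
    fix N
    show "norm (of_nat N * (d N / of_real z ^ N)) \<le> real N * (?C * B ^ N / z ^ N)"
      unfolding norm_mult norm_of_nat by (intro mult_left_mono dle) simp
  qed
  have d2: "(\<lambda>N. of_nat N * (d (Suc N) / of_real z ^ Suc N)) \<longlonglongrightarrow> 0"
  proof -
    have "of_nat (Suc N) * X - X = of_nat N * X" for N and X :: complex
      by (simp add: distrib_right)
    then show ?thesis using tendsto_diff[OF LIMSEQ_Suc[OF d1] LIMSEQ_Suc[OF d0]]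
      by (simp only: diff_0_right)
  qed
  have "(\<lambda>N. of_real (nsq I x) - (of_nat N * (d N / of_real z ^ N) + d N / of_real z ^ N)
      + of_nat N * (d (Suc N) / of_real z ^ Suc N)) \<longlonglongrightarrow> of_real (nsq I x) - (0 + 0) + 0"
    by (intro tendsto_intros d0 d1 d2)
  then show ?thesis unfolding sums_def part by (simp add: algebra_simps add_divide_distrib)
qed

lemma norm_component_le: "finite I \<Longrightarrow> i \<in> I \<Longrightarrow> norm (x i) \<le> sqrt (nsq I x)"
  unfolding nsq_def by (rule real_le_rsqrt) (rule member_le_sum[of i I "\<lambda>i. (norm (x i))\<^sup>2"]; simp)

text \<open>The Neumann series converges in each coordinate.\<close>

lemma resolvent_exists:
  assumes fin: "finite I" and bnd: "\<And>x. nsq I (app I H x) \<le> B\<^sup>2 * nsq I x" "0 \<le> B" "B < z"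
  shows "\<exists>x. \<forall>i\<in>I. complex_of_real z * x i = w i + app I H x i"
proof -
  have z: "z > 0" "complex_of_real z \<noteq> 0" using bnd by auto
  define t where "t i k = (app I H ^^ k) w i / of_real z ^ (k + 1)" for i k
  have sm: "summable (t i)" if i: "i \<in> I" for i
  proof (rule summable_comparison_test')
    show "summable (\<lambda>k. sqrt (nsq I w) / z * (B / z) ^ k)"
      using bnd z by (intro summable_mult summable_geometric) simp
    fix k :: nat
    have "norm ((app I H ^^ k) w i) \<le> sqrt (nsq I ((app I H ^^ k) w))"
      by (rule norm_component_le[OF fin i])
    also have "\<dots> \<le> sqrt ((B ^ k)\<^sup>2 * nsq I w)" by (intro real_sqrt_le_mono nsq_funpow_le bnd)
    also have "\<dots> = B ^ k * sqrt (nsq I w)" using bnd by (simp add: real_sqrt_mult)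
    finally have "norm ((app I H ^^ k) w i) / z ^ (k + 1) \<le> B ^ k * sqrt (nsq I w) / z ^ (k + 1)"
      using z by (intro divide_right_mono) simp_all
    then show "norm (t i k) \<le> sqrt (nsq I w) / z * (B / z) ^ k"
      using z by (simp add: t_def norm_divide norm_mult norm_power power_divide mult_ac)
  qed
  define x where "x i = suminf (t i)" for i
  have step: "(\<Sum>j\<in>I. H i j * t j k) = of_real z * t i (Suc k)" for i k
  proof -
    have "(app I H ^^ Suc k) w i = (\<Sum>j\<in>I. H i j * (app I H ^^ k) w j)"
      by (simp add: app_def[of I H "(app I H ^^ k) w"])
    then show ?thesis using z
      by (simp only: t_def) (simp add: sum_divide_distrib[symmetric] del: funpow.simps)
  qed
  have "complex_of_real z * x i = w i + app I H x i" if i: "i \<in> I" for i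
  proof -
    have "app I H x i = (\<Sum>j\<in>I. \<Sum>k. H i j * t j k)"
      unfolding app_def x_def by (intro sum.cong refl suminf_mult[symmetric] sm)
    also have "\<dots> = (\<Sum>k. \<Sum>j\<in>I. H i j * t j k)"
      by (intro suminf_sum[symmetric] summable_mult sm)
    also have "\<dots> = (\<Sum>k. of_real z * t i (Suc k))" by (simp only: step)
    also have "\<dots> = of_real z * (\<Sum>k. t i (Suc k))"
      by (intro suminf_mult) (subst summable_Suc_iff, rule sm[OF i])
    also have "(\<Sum>k. t i (Suc k)) = x i - t i 0"
      unfolding x_def using suminf_minus_initial_segment[OF sm[OF i], of 1] by simp
    finally show ?thesis using z by (simp add: algebra_simps t_def)
  qed
  then show ?thesis by blast
qed

section \<open>Almost orthogonal families\<close>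

lemma norm_double_sum_le:
  assumes "finite S" "\<And>s t. s \<in> S \<Longrightarrow> t \<in> S \<Longrightarrow> norm (q s t) \<le> e"
  shows "norm (\<Sum>s\<in>S. \<Sum>t\<in>S. cnj (c s) * c t * q s t) \<le> e * real (card S) * (\<Sum>s\<in>S. (norm (c s))\<^sup>2)"
proof (cases "S = {}")
  case False
  then obtain s0 where "s0 \<in> S" by blast
  then have e: "e \<ge> 0" using assms(2)[of s0 s0] norm_ge_zero[of "q s0 s0"] by linarith
  have "norm (\<Sum>s\<in>S. \<Sum>t\<in>S. cnj (c s) * c t * q s t) \<le> (\<Sum>s\<in>S. \<Sum>t\<in>S. e * (norm (c s) * norm (c t)))"
  proof (intro order_trans[OF norm_sum] sum_mono)
    fix s t assume "s \<in> S" "t \<in> S"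
    then show "norm (cnj (c s) * c t * q s t) \<le> e * (norm (c s) * norm (c t))"
      using mult_right_mono[OF assms(2)[of s t], of "norm (c s) * norm (c t)"] by (simp add: norm_mult mult_ac)
  qed
  also have "\<dots> \<le> (\<Sum>s\<in>S. \<Sum>t\<in>S. e * ((norm (c s))\<^sup>2 + (norm (c t))\<^sup>2) / 2)"
  proof (intro sum_mono)
    fix s t
    show "e * (norm (c s) * norm (c t)) \<le> e * ((norm (c s))\<^sup>2 + (norm (c t))\<^sup>2) / 2"
      using mult_left_mono[OF sum_squares_bound[of "norm (c s)" "norm (c t)"] e] by simp
  qed
  also have "\<dots> = e / 2 * ((\<Sum>s\<in>S. \<Sum>t\<in>S. (norm (c s))\<^sup>2) + (\<Sum>s\<in>S. \<Sum>t\<in>S. (norm (c t))\<^sup>2))"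
    by (simp add: sum.distrib sum_divide_distrib[symmetric] sum_distrib_left[symmetric] distrib_left)
  also have "\<dots> = e * real (card S) * (\<Sum>s\<in>S. (norm (c s))\<^sup>2)"
    by (simp add: sum_distrib_left[symmetric])
  finally show ?thesis .
qed simp

lemma sum_diag:
  fixes a :: "'s \<Rightarrow> 's \<Rightarrow> complex"
  shows "finite S \<Longrightarrow> (\<Sum>s\<in>S. \<Sum>t\<in>S. a s t * (if s = t then d s else 0)) = (\<Sum>s\<in>S. a s s * d s)"
proof (rule sum.cong[OF refl])
  fix s assume "finite S" "s \<in> S"
  have "(\<Sum>t\<in>S. a s t * (if s = t then d s else 0)) = (\<Sum>t\<in>S. if s = t then a s s * d s else 0)"
    by (intro sum.cong refl) auto
  then show "(\<Sum>t\<in>S. a s t * (if s = t then d s else 0)) = a s s * d s"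
    using \<open>finite S\<close> \<open>s \<in> S\<close> by simp
qed

lemma sum_diag_cnj: "finite S \<Longrightarrow>
  (\<Sum>s\<in>S. \<Sum>t\<in>S. cnj (c s) * c t * (if s = t then of_real (d s) else 0)) = of_real (\<Sum>s\<in>S. (norm (c s))\<^sup>2 * d s)"
proof -
  assume "finite S"
  then have "(\<Sum>s\<in>S. \<Sum>t\<in>S. cnj (c s) * c t * (if s = t then of_real (d s) else 0)) = (\<Sum>s\<in>S. cnj (c s) * c s * of_real (d s))"
    by (rule sum_diag)
  then show ?thesis by (simp add: cnj_mult_self mult.assoc del: of_real_power)
qed

text \<open>Uniformity in the coefficients is the point: in the applications they come from a test
  vector chosen after n, and the threshold for n must not depend on it.\<close>

lemma almost_diagonal_form:
  fixes q :: "nat \<Rightarrow> 's \<Rightarrow> 's \<Rightarrow> complex"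
  assumes fin: "finite S" and e: "e > 0"
    and lim: "\<And>s t. s \<in> S \<Longrightarrow> t \<in> S \<Longrightarrow> (\<lambda>n. q n s t) \<longlonglongrightarrow> (if s = t then of_real (d s) else 0)"
  shows "\<forall>\<^sub>F n in sequentially. \<forall>c :: 's \<Rightarrow> complex.
    norm ((\<Sum>s\<in>S. \<Sum>t\<in>S. cnj (c s) * c t * q n s t) - of_real (\<Sum>s\<in>S. (norm (c s))\<^sup>2 * d s))
      \<le> e * (\<Sum>s\<in>S. (norm (c s))\<^sup>2)"
proof -
  \<comment> \<open>The added 1 keeps the denominator positive for empty S.\<close>
  define e' where "e' = e / (real (card S) + 1)"
  have e': "e' > 0" using e by (simp add: e'_def add_nonneg_pos)
  have "\<forall>\<^sub>F n in sequentially. norm (q n s t - (if s = t then of_real (d s) else 0)) < e'"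
    if "s \<in> S" "t \<in> S" for s t
    using tendstoD[OF lim[OF that] e'] by (simp add: dist_norm)
  then have "\<forall>\<^sub>F n in sequentially. \<forall>s\<in>S. \<forall>t\<in>S. norm (q n s t - (if s = t then of_real (d s) else 0)) < e'"
    using fin by (simp add: eventually_ball_finite)
  then show ?thesis
  proof eventually_elim
    case (elim n)
    show ?case
    proof
      fix c :: "'s \<Rightarrow> complex"
      let ?Q = "\<Sum>s\<in>S. (norm (c s))\<^sup>2"
      have "(\<Sum>s\<in>S. \<Sum>t\<in>S. cnj (c s) * c t * q n s t) - of_real (\<Sum>s\<in>S. (norm (c s))\<^sup>2 * d s) =
        (\<Sum>s\<in>S. \<Sum>t\<in>S. cnj (c s) * c t * (q n s t - (if s = t then of_real (d s) else 0)))"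
        unfolding sum_diag_cnj[OF fin, symmetric] by (simp only: right_diff_distrib sum_subtractf)
      also have "norm \<dots> \<le> e' * real (card S) * ?Q"
        by (rule norm_double_sum_le[OF fin]) (use elim in force)
      also have "\<dots> \<le> e * ?Q"
        using e by (intro mult_right_mono sum_nonneg) (auto simp: e'_def field_simps)
      finally show "norm ((\<Sum>s\<in>S. \<Sum>t\<in>S. cnj (c s) * c t * q n s t) -
          of_real (\<Sum>s\<in>S. (norm (c s))\<^sup>2 * d s)) \<le> e * ?Q" .
    qed
  qed
qed

section \<open>Resolvent limits\<close>

text \<open>Dominated convergence for the resolvent series: a threshold in n common to all k yields
  domination along the product filter.\<close>

lemma tannery_sequentially:
  fixes a :: "nat \<Rightarrow> nat \<Rightarrow> complex"
  assumes "\<And>k. (\<lambda>n. a k n) \<longlonglongrightarrow> of_real (b k)"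
    and "\<forall>\<^sub>F n in sequentially. \<forall>k. norm (a k n) \<le> M k" and "summable M"
  shows "summable b" "(\<lambda>n. \<Sum>k. a k n) \<longlonglongrightarrow> of_real (\<Sum>k. b k)"
proof -
  have "eventually (\<lambda>(k :: nat, n). \<forall>k. norm (a k n) \<le> M k) (sequentially \<times>\<^sub>F sequentially)"
    by (subst eventually_prod2) (use assms(2) in simp_all)
  then have ev: "eventually (\<lambda>(k, n). norm (a k n) \<le> M k) (sequentially \<times>\<^sub>F sequentially)"
  proof (rule eventually_mono)
    fix x :: "nat \<times> nat"
    assume "case x of (k, n) \<Rightarrow> \<forall>k. norm (a k n) \<le> M k"
    then show "case x of (k, n) \<Rightarrow> norm (a k n) \<le> M k" by (simp add: case_prod_beta)
  qed
  have t: "(\<forall>\<^sub>F n in sequentially. summable (\<lambda>k. norm (a k n))) \<and>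
      summable (\<lambda>k. norm (complex_of_real (b k))) \<and>
      (\<lambda>n. \<Sum>k. a k n) \<longlonglongrightarrow> (\<Sum>k. complex_of_real (b k))"
  proof (rule tannerys_theorem[where M = M])
    show "(\<lambda>n. a k n) \<longlonglongrightarrow> complex_of_real (b k)" for k by (rule assms(1))
    show "eventually (\<lambda>(k, n). norm (a k n) \<le> M k) (sequentially \<times>\<^sub>F sequentially)" by (rule ev)
    show "summable M" by (rule assms(3))
  qed simp
  from t have "summable (\<lambda>k. norm (complex_of_real (b k)))" by (elim conjE)
  then have "summable (\<lambda>k. norm (b k))" by (simp only: norm_of_real real_norm_def)
  then show s: "summable b" by (rule summable_norm_cancel)
  show "(\<lambda>n. \<Sum>k. a k n) \<longlonglongrightarrow> of_real (\<Sum>k. b k)"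
    unfolding suminf_of_real[OF s] using t by (elim conjE)
qed

text \<open>The deterministic data of one realization. The norm bound for each \<open>B > b\<close>
  holds for large n only; the moment limits are diagonal, so distinct spikes do not interact in the
  limit.\<close>

locale resolvent_limits =
  fixes I :: "nat \<Rightarrow> 'i set" and H :: "nat \<Rightarrow> 'i \<Rightarrow> 'i \<Rightarrow> complex"
    and W :: "nat \<Rightarrow> 's \<Rightarrow> 'i \<Rightarrow> complex" and S :: "'s set"
    and b :: real and L :: "'s \<Rightarrow> nat \<Rightarrow> real"
  assumes fin: "finite (I n)" "finite S"
    and herm: "adj (H n) = H n"
    and b_nonneg: "0 \<le> b"
    and bound: "B > b \<Longrightarrow> \<forall>\<^sub>F n in sequentially. \<forall>x. nsq (I n) (app (I n) (H n) x) \<le> B\<^sup>2 * nsq (I n) x"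
    and moments: "s \<in> S \<Longrightarrow> t \<in> S \<Longrightarrow>
      (\<lambda>n. ip (I n) (W n s) ((app (I n) (H n) ^^ k) (W n t))) \<longlonglongrightarrow> (if s = t then of_real (L s k) else 0)"
begin

abbreviation "T n \<equiv> app (I n) (H n)"

definition "mom n k s t = ip (I n) (W n s) ((T n ^^ k) (W n t))"

definition "R n z s t = (\<Sum>k. mom n k s t / complex_of_real z ^ (k + 1))"
definition "R2 n z s t = (\<Sum>k. of_nat (k + 1) * mom n k s t / complex_of_real z ^ (k + 2))"
text \<open>
  \<open>R\<close> and \<open>R2\<close> are the forms of \<open>(z - T)\<^sup>-\<^sup>1\<close> and \<open>(z - T)\<^sup>-\<^sup>2\<close> on the vectors \<open>W n s\<close>; their limits are
  \<open>F\<close> and \<open>G\<close>, the latter being minus the derivative of the former.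
\<close>

definition "F s z = (\<Sum>k. L s k / z ^ (k + 1))"
definition "G s z = (\<Sum>k. real (k + 1) * L s k / z ^ (k + 2))"

definition "comb n \<eta> = (\<lambda>i. \<Sum>t\<in>S. \<eta> t * W n t i)"

text \<open>A relation rather than an inverse, since the resolvent at z is only known to exist for
  large n; x stands for the resolvent applied to \<open>comb n \<eta>\<close>.\<close>

definition "solves n z \<eta> x \<longleftrightarrow> (\<forall>i\<in>I n. complex_of_real z * x i = comb n \<eta> i + T n x i)"

definition "bounded_by n B \<longleftrightarrow> (\<forall>x. nsq (I n) (T n x) \<le> B\<^sup>2 * nsq (I n) x)"

lemma eventually_bounded_by: "B > b \<Longrightarrow> \<forall>\<^sub>F n in sequentially. bounded_by n B"
  using bound by (simp add: bounded_by_def)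

lemma bounded_byD: "bounded_by n B \<Longrightarrow> nsq (I n) (T n x) \<le> B\<^sup>2 * nsq (I n) x"
  by (simp add: bounded_by_def)

lemma norm_mom_le:
  assumes "bounded_by n B" "0 \<le> B"
  shows "norm (mom n k s t) \<le> sqrt (nsq (I n) (W n s)) * sqrt (nsq (I n) (W n t)) * B ^ k"
  unfolding mom_def by (rule norm_ip_funpow_le[OF bounded_byD[OF assms(1)] assms(2)])

lemma nsq_W_tendsto: "s \<in> S \<Longrightarrow> (\<lambda>n. nsq (I n) (W n s)) \<longlonglongrightarrow> L s 0"
  using tendsto_Re[OF moments[of s s 0]] by (simp add: ip_self)

text \<open>The second series is a termwise derivative of the geometric series, expressed by
  \<open>diffs\<close> of a constant sequence.\<close>

lemma summable_weights:
  assumes "0 \<le> B" "B < z"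
  shows "summable (\<lambda>k. C * B ^ k / z ^ (k + 1))" "summable (\<lambda>k. real (k + 1) * (C * B ^ k) / z ^ (k + 2))"
proof -
  have r: "norm (B / z) < 1" using assms by simp
  have "summable (\<lambda>k. C / z * (B / z) ^ k)" by (intro summable_mult summable_geometric r)
  then show "summable (\<lambda>k. C * B ^ k / z ^ (k + 1))" by (simp add: power_divide)
  have 1: "summable (\<lambda>k. diffs (\<lambda>_. 1) k * (B / z) ^ k)"
  proof (rule termdiff_converges)
    show "norm (B / z) < 1" by (rule r)
    fix x :: real assume "norm x < 1"
    then show "summable (\<lambda>n. 1 * x ^ n)" by (simp add: summable_geometric)
  qed
  have "summable (\<lambda>k. C / z\<^sup>2 * (diffs (\<lambda>_. 1) k * (B / z) ^ k))" by (intro summable_mult 1)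
  then show "summable (\<lambda>k. real (k + 1) * (C * B ^ k) / z ^ (k + 2))"
    by (simp add: diffs_def power_divide power2_eq_square mult_ac add.commute)
qed

lemma eventually_mom_bound:
  assumes "s \<in> S" "t \<in> S" "B > b"
  shows "\<forall>\<^sub>F n in sequentially. \<forall>k. norm (mom n k s t) \<le> sqrt (L s 0 + 1) * sqrt (L t 0 + 1) * B ^ k"
proof -
  have "\<forall>\<^sub>F n in sequentially. nsq (I n) (W n s) < L s 0 + 1"
    by (rule order_tendstoD(2)[OF nsq_W_tendsto[OF assms(1)]]) simp
  moreover have "\<forall>\<^sub>F n in sequentially. nsq (I n) (W n t) < L t 0 + 1"
    by (rule order_tendstoD(2)[OF nsq_W_tendsto[OF assms(2)]]) simp
  ultimately show ?thesis using eventually_bounded_by[OF assms(3)]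
  proof eventually_elim
    case (elim n)
    have B: "0 \<le> B" using assms b_nonneg by simp
    show ?case
    proof
      fix k
      have "norm (mom n k s t) \<le> sqrt (nsq (I n) (W n s)) * sqrt (nsq (I n) (W n t)) * B ^ k"
        by (rule norm_mom_le[OF elim(3) B])
      also have "\<dots> \<le> sqrt (L s 0 + 1) * sqrt (L t 0 + 1) * B ^ k"
        using elim B order_trans[OF nsq_nonneg less_imp_le[OF elim(1)]]
        by (intro mult_right_mono mult_mono real_sqrt_le_mono zero_le_power) (auto simp: less_imp_le)
      finally show "norm (mom n k s t) \<le> sqrt (L s 0 + 1) * sqrt (L t 0 + 1) * B ^ k" .
    qed
  qed
qed

text \<open>The evaluation points move with n, because a singular value of the perturbed matrix
  takes their place later.\<close>

lemma R_tendsto: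
  assumes st: "s \<in> S" "t \<in> S" and z: "\<zeta> \<longlonglongrightarrow> z" "b < z"
  shows "(\<lambda>n. R n (\<zeta> n) s t) \<longlonglongrightarrow> (if s = t then of_real (F s z) else 0)"
    and "(\<lambda>n. R2 n (\<zeta> n) s t) \<longlonglongrightarrow> (if s = t then of_real (G s z) else 0)"
    and "s = t \<Longrightarrow> summable (\<lambda>k. L s k / z ^ (k + 1))"
    and "s = t \<Longrightarrow> summable (\<lambda>k. real (k + 1) * L s k / z ^ (k + 2))"
proof -
  \<comment> \<open>Two levels below z: B bounds the operator for large n, \<open>z0\<close> bounds
    the moving points from below, and the powers of \<open>B / z0\<close> dominate the
    series.\<close>
  obtain z0 where z0: "b < z0" "z0 < z" using dense[OF z(2)] by blast
  obtain B where B: "b < B" "B < z0" using dense[OF z0(1)] by blast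
  have pos: "0 \<le> B" "0 < z0" "0 < z" using B z0 b_nonneg by auto
  define C where "C = sqrt (L s 0 + 1) * sqrt (L t 0 + 1)"
  have ev: "\<forall>\<^sub>F n in sequentially. (\<forall>k. norm (mom n k s t) \<le> C * B ^ k) \<and> z0 < \<zeta> n"
    using eventually_mom_bound[OF st B(1)] order_tendstoD(1)[OF z(1) z0(2)]
    by eventually_elim (simp add: C_def)
  have bnd: "norm (a * mom n k s t / complex_of_real (\<zeta> n) ^ j) \<le> norm a * (C * B ^ k) / z0 ^ j"
    if "(\<forall>k. norm (mom n k s t) \<le> C * B ^ k) \<and> z0 < \<zeta> n" for n k j and a :: complex
  proof -
    have CB: "0 \<le> C * B ^ k" using that norm_ge_zero[of "mom n k s t"] by (meson order_trans)
    have "norm (a * mom n k s t / complex_of_real (\<zeta> n) ^ j) = norm a * norm (mom n k s t) / \<zeta> n ^ j"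
      using that pos by (simp add: norm_divide norm_mult norm_power)
    also have "\<dots> \<le> norm a * (C * B ^ k) / z0 ^ j"
      using that pos mult_nonneg_nonneg[OF norm_ge_zero[of a] CB]
      by (intro frac_le mult_left_mono power_mono) auto
    finally show ?thesis .
  qed
  define l where "l k = (if s = t then L s k else 0)" for k
  have moml: "(\<lambda>n. mom n k s t) \<longlonglongrightarrow> of_real (l k)" for k
    using moments[OF st, of k] by (cases "s = t") (simp_all add: mom_def l_def)
  have lim1: "(\<lambda>n. 1 * mom n k s t / complex_of_real (\<zeta> n) ^ (k + 1)) \<longlonglongrightarrow> of_real (l k / z ^ (k + 1))" for k
    unfolding of_real_divide of_real_power mult_1 using pos
    by (intro tendsto_intros moml z(1)) auto
  have lim2: "(\<lambda>n. of_nat (k + 1) * mom n k s t / complex_of_real (\<zeta> n) ^ (k + 2)) \<longlonglongrightarrow>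
      of_real (real (k + 1) * l k / z ^ (k + 2))" for k
    unfolding of_real_divide of_real_power of_real_mult of_real_of_nat_eq using pos
    by (intro tendsto_intros moml z(1)) auto
  have "\<forall>\<^sub>F n in sequentially. \<forall>k. norm (1 * mom n k s t / complex_of_real (\<zeta> n) ^ (k + 1))
      \<le> norm (1 :: complex) * (C * B ^ k) / z0 ^ (k + 1)"
    using ev by eventually_elim (intro allI bnd)
  note lim1' = tannery_sequentially[OF lim1 this, unfolded norm_one mult_1, OF summable_weights(1)[OF pos(1) B(2)]]
  have nk: "norm (complex_of_nat (k + 1)) = real (k + 1)" for k by (rule norm_of_nat)
  have "\<forall>\<^sub>F n in sequentially. \<forall>k. norm (of_nat (k + 1) * mom n k s t / complex_of_real (\<zeta> n) ^ (k + 2))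
      \<le> norm (complex_of_nat (k + 1)) * (C * B ^ k) / z0 ^ (k + 2)"
    using ev by eventually_elim (intro allI bnd)
  note lim2' = tannery_sequentially[OF lim2 this, unfolded nk, OF summable_weights(2)[OF pos(1) B(2)]]
  show "(\<lambda>n. R n (\<zeta> n) s t) \<longlonglongrightarrow> (if s = t then of_real (F s z) else 0)"
    using lim1'(2) by (cases "s = t") (simp_all add: F_def R_def l_def)
  show "(\<lambda>n. R2 n (\<zeta> n) s t) \<longlonglongrightarrow> (if s = t then of_real (G s z) else 0)"
    using lim2'(2) by (cases "s = t") (simp_all add: G_def R2_def l_def)
  show "s = t \<Longrightarrow> summable (\<lambda>k. L s k / z ^ (k + 1))" using lim1'(1) by (simp add: l_def)
  show "s = t \<Longrightarrow> summable (\<lambda>k. real (k + 1) * L s k / z ^ (k + 2))" using lim2'(1) by (simp add: l_def)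
qed

lemma funpow_comb: "(T n ^^ k) (comb n \<eta>) = (\<lambda>i. \<Sum>t\<in>S. \<eta> t * (T n ^^ k) (W n t) i)"
  by (simp add: comb_def funpow_app_sum funpow_app_scale)

lemma ip_solves:
  assumes "bounded_by n B" "0 \<le> B" "B < z" and x: "solves n z \<eta> x"
  shows "ip (I n) (W n s) x = (\<Sum>t\<in>S. \<eta> t * R n z s t)"
proof -
  have sm: "summable (\<lambda>k. mom n k s t / complex_of_real z ^ (k + 1))" for t
  proof (rule summable_comparison_test'[OF summable_weights(1)[OF assms(2,3)]])
    fix k
    show "norm (mom n k s t / complex_of_real z ^ (k + 1)) \<le>
        sqrt (nsq (I n) (W n s)) * sqrt (nsq (I n) (W n t)) * B ^ k / z ^ (k + 1)"
      using norm_mom_le[OF assms(1,2), of k s t] assms(2,3)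
      by (simp add: norm_divide norm_mult norm_power divide_right_mono)
  qed
  have A: "(\<lambda>k. ip (I n) (W n s) ((T n ^^ k) (comb n \<eta>)) / of_real z ^ (k + 1)) sums ip (I n) (W n s) x"
    using x by (intro resolvent_sums[OF bounded_byD[OF assms(1)] assms(2,3)]) (simp add: solves_def)
  have B: "(\<lambda>k. \<Sum>t\<in>S. \<eta> t * (mom n k s t / of_real z ^ (k + 1))) sums (\<Sum>t\<in>S. \<eta> t * R n z s t)"
    unfolding R_def by (intro sums_sum sums_mult summable_sums sm)
  have C: "(\<lambda>k. ip (I n) (W n s) ((T n ^^ k) (comb n \<eta>)) / of_real z ^ (k + 1)) =
      (\<lambda>k. \<Sum>t\<in>S. \<eta> t * (mom n k s t / of_real z ^ (k + 1)))"
    by (simp only: funpow_comb ip_sum_right ip_scale_right mom_def sum_divide_distrib times_divide_eq_right)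
  show ?thesis by (rule sums_unique2[OF A[unfolded C] B])
qed

lemma nsq_solves:
  assumes "bounded_by n B" "0 \<le> B" "B < z" and x: "solves n z \<eta> x"
  shows "of_real (nsq (I n) x) = (\<Sum>s\<in>S. \<Sum>t\<in>S. cnj (\<eta> s) * \<eta> t * R2 n z s t)"
proof -
  have sm: "summable (\<lambda>k. of_nat (k + 1) * mom n k s t / complex_of_real z ^ (k + 2))" for s t
  proof (rule summable_comparison_test'[OF summable_weights(2)[OF assms(2,3)]])
    fix k
    have "norm (complex_of_nat (k + 1)) = real (k + 1)" by (rule norm_of_nat)
    then have "norm (of_nat (k + 1) * mom n k s t / complex_of_real z ^ (k + 2)) =
        real (k + 1) * norm (mom n k s t) / z ^ (k + 2)"
      using assms(2,3) by (simp only: norm_divide norm_mult norm_power norm_of_real abs_of_nonneg less_imp_le order_less_le_trans order_le_less_trans[of 0 B z])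
    also have "\<dots> \<le> real (k + 1) * (sqrt (nsq (I n) (W n s)) * sqrt (nsq (I n) (W n t)) * B ^ k) / z ^ (k + 2)"
      using assms(2,3) by (intro divide_right_mono mult_left_mono norm_mom_le[OF assms(1,2)]) auto
    finally show "norm (of_nat (k + 1) * mom n k s t / complex_of_real z ^ (k + 2)) \<le>
        real (k + 1) * (sqrt (nsq (I n) (W n s)) * sqrt (nsq (I n) (W n t)) * B ^ k) / z ^ (k + 2)" .
  qed
  have A: "(\<lambda>k. of_nat (k + 1) * ip (I n) (comb n \<eta>) ((T n ^^ k) (comb n \<eta>)) / of_real z ^ (k + 2))
      sums of_real (nsq (I n) x)"
    using x by (intro resolvent_nsq_sums[OF bounded_byD[OF assms(1)] assms(2,3) herm]) (simp add: solves_def)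
  have B: "(\<lambda>k. \<Sum>s\<in>S. \<Sum>t\<in>S. cnj (\<eta> s) * \<eta> t * (of_nat (k + 1) * mom n k s t / of_real z ^ (k + 2)))
      sums (\<Sum>s\<in>S. \<Sum>t\<in>S. cnj (\<eta> s) * \<eta> t * R2 n z s t)"
    unfolding R2_def by (intro sums_sum sums_mult summable_sums sm)
  have C: "of_nat (k + 1) * ip (I n) (comb n \<eta>) ((T n ^^ k) (comb n \<eta>)) / of_real z ^ (k + 2) =
      (\<Sum>s\<in>S. \<Sum>t\<in>S. cnj (\<eta> s) * \<eta> t * (of_nat (k + 1) * mom n k s t / of_real z ^ (k + 2)))" for k
  proof -
    have "ip (I n) (comb n \<eta>) ((T n ^^ k) (comb n \<eta>)) = (\<Sum>s\<in>S. \<Sum>t\<in>S. cnj (\<eta> s) * \<eta> t * mom n k s t)"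
      unfolding funpow_comb by (simp only: comb_def ip_sum_left ip_sum_right ip_scale_left ip_scale_right
        mom_def sum_distrib_left mult.assoc)
    then have "of_nat (k + 1) * ip (I n) (comb n \<eta>) ((T n ^^ k) (comb n \<eta>)) / of_real z ^ (k + 2) =
      (\<Sum>s\<in>S. \<Sum>t\<in>S. of_nat (k + 1) * (cnj (\<eta> s) * \<eta> t * mom n k s t) / of_real z ^ (k + 2))"
      by (simp only: sum_distrib_left sum_divide_distrib)
    also have "\<dots> = (\<Sum>s\<in>S. \<Sum>t\<in>S. cnj (\<eta> s) * \<eta> t * (of_nat (k + 1) * mom n k s t / of_real z ^ (k + 2)))"
      by (intro sum.cong refl) (simp only: times_divide_eq_right mult.left_commute mult.assoc)
    finally show ?thesis .
  qed
  show ?thesis by (rule sums_unique2[OF A[unfolded C] B])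
qed

lemma solves_exists:
  assumes "bounded_by n B" "0 \<le> B" "B < z"
  shows "\<exists>x. solves n z \<eta> x"
  unfolding solves_def by (rule resolvent_exists[OF fin(1) bounded_byD[OF assms(1)] assms(2,3)])

lemma ip_solves_form:
  assumes "solves n z \<eta> y"
  shows "of_real z * ip (I n) x y - ip (I n) x (T n y) = (\<Sum>s\<in>S. \<eta> s * ip (I n) x (W n s))"
proof -
  have "of_real z * ip (I n) x y - ip (I n) x (T n y) = ip (I n) x (\<lambda>i. of_real z * y i - T n y i)"
    by (simp add: ip_diff_right ip_scale_right)
  also have "\<dots> = ip (I n) x (comb n \<eta>)"
    using assms by (intro ip_cong refl) (simp add: solves_def)
  finally show ?thesis by (simp add: comb_def ip_sum_right ip_scale_right)
qed

text \<open>The coefficients are bounded but need not converge, hence limits of differences. Each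
  difference is a finite sum of bounded factors times entries of \<open>R\<close> or
  \<open>R2\<close> minus their limits.\<close>

lemma solves_asymptotics:
  assumes z: "\<zeta> \<longlonglongrightarrow> z" "b < z"
    and eta: "\<And>n s. s \<in> S \<Longrightarrow> norm (\<eta> n s) \<le> C"
    and x: "\<forall>\<^sub>F n in sequentially. solves n (\<zeta> n) (\<eta> n) (x n)"
  shows "s \<in> S \<Longrightarrow> (\<lambda>n. ip (I n) (W n s) (x n) - of_real (F s z) * \<eta> n s) \<longlonglongrightarrow> 0"
    and "(\<lambda>n. nsq (I n) (x n) - (\<Sum>s\<in>S. G s z * (norm (\<eta> n s))\<^sup>2)) \<longlonglongrightarrow> 0"
proof -
  obtain B where B: "b < B" "B < z" using dense[OF z(2)] by blast
  have B0: "0 \<le> B" using B b_nonneg by simp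
  have ev: "\<forall>\<^sub>F n in sequentially. bounded_by n B \<and> B < \<zeta> n \<and> solves n (\<zeta> n) (\<eta> n) (x n)"
    using eventually_bounded_by[OF B(1)] order_tendstoD(1)[OF z(1) B(2)] x by eventually_elim simp
  have bz: "(\<lambda>n. e n * f n) \<longlonglongrightarrow> 0" if "\<And>n. norm (e n :: complex) \<le> K" "f \<longlonglongrightarrow> (0::complex)" for e f K
  proof (rule Lim_null_comparison[OF always_eventually])
    show "\<forall>n. norm (e n * f n) \<le> K * norm (f n)"
      using that(1) by (simp add: norm_mult mult_right_mono)
    show "(\<lambda>n. K * norm (f n)) \<longlonglongrightarrow> 0" by (rule tendsto_mult_right_zero[OF tendsto_norm_zero[OF that(2)]])
  qed
  show "(\<lambda>n. ip (I n) (W n s) (x n) - of_real (F s z) * \<eta> n s) \<longlonglongrightarrow> 0" if s: "s \<in> S"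
  proof -
    have A: "(\<lambda>n. \<Sum>t\<in>S. \<eta> n t * (R n (\<zeta> n) s t - (if s = t then of_real (F s z) else 0))) \<longlonglongrightarrow> 0"
    proof (rule tendsto_null_sum)
      fix t assume t: "t \<in> S"
      show "(\<lambda>n. \<eta> n t * (R n (\<zeta> n) s t - (if s = t then of_real (F s z) else 0))) \<longlonglongrightarrow> 0"
        by (rule bz[OF eta[OF t]]) (rule LIM_zero[OF R_tendsto(1)[OF s t z]])
    qed
    have "\<forall>\<^sub>F n in sequentially. (\<Sum>t\<in>S. \<eta> n t * (R n (\<zeta> n) s t - (if s = t then of_real (F s z) else 0))) =
          ip (I n) (W n s) (x n) - of_real (F s z) * \<eta> n s"
        using ev
      proof eventually_elim
        case (elim n)
        have "(\<Sum>t\<in>S. \<eta> n t * (if s = t then of_real (F s z) else 0)) = (\<Sum>t\<in>S. if s = t then of_real (F s z) * \<eta> n s else 0)"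
          by (intro sum.cong refl) auto
        also have "\<dots> = of_real (F s z) * \<eta> n s" using s fin by simp
        finally show ?case
          using ip_solves[of n B "\<zeta> n" "\<eta> n" "x n" s] elim B0
          by (simp add: right_diff_distrib sum_subtractf)
      qed
    from Lim_transform_eventually[OF A this] show ?thesis .
  qed
  have A: "(\<lambda>n. \<Sum>s\<in>S. \<Sum>t\<in>S. cnj (\<eta> n s) * \<eta> n t * (R2 n (\<zeta> n) s t - (if s = t then of_real (G s z) else 0))) \<longlonglongrightarrow> 0"
  proof (intro tendsto_null_sum)
    fix s t assume st: "s \<in> S" "t \<in> S"
    show "(\<lambda>n. cnj (\<eta> n s) * \<eta> n t * (R2 n (\<zeta> n) s t - (if s = t then of_real (G s z) else 0))) \<longlonglongrightarrow> 0"
    proof (rule bz[where K = "C * C"])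
      show "norm (cnj (\<eta> n s) * \<eta> n t) \<le> C * C" for n
        using eta[OF st(1), of n] eta[OF st(2), of n] order_trans[OF norm_ge_zero eta[OF st(1), of n]]
        by (simp add: norm_mult mult_mono)
    qed (rule LIM_zero[OF R_tendsto(2)[OF st z]])
  qed
  have "\<forall>\<^sub>F n in sequentially. (\<Sum>s\<in>S. \<Sum>t\<in>S. cnj (\<eta> n s) * \<eta> n t * (R2 n (\<zeta> n) s t - (if s = t then of_real (G s z) else 0))) =
        complex_of_real (nsq (I n) (x n) - (\<Sum>s\<in>S. G s z * (norm (\<eta> n s))\<^sup>2))"
      using ev
    proof eventually_elim
      case (elim n)
      have "of_real (nsq (I n) (x n)) = (\<Sum>s\<in>S. \<Sum>t\<in>S. cnj (\<eta> n s) * \<eta> n t * R2 n (\<zeta> n) s t)"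
        using nsq_solves[of n B "\<zeta> n" "\<eta> n" "x n"] elim B0 by simp
      then show ?case
        using sum_diag_cnj[OF fin(2), of "\<eta> n" "\<lambda>s. G s z"]
        by (simp only: right_diff_distrib sum_subtractf of_real_diff mult.commute[of "G _ _"])
    qed
  from tendsto_Re[OF Lim_transform_eventually[OF A this]]
  show "(\<lambda>n. nsq (I n) (x n) - (\<Sum>s\<in>S. G s z * (norm (\<eta> n s))\<^sup>2)) \<longlonglongrightarrow> 0"
    by (simp only: Re_complex_of_real zero_complex.sel)
qed

end

section \<open>Outliers of finite rank perturbations\<close>

locale spiked = resolvent_limits I H W "{..<r} <+> {..<r}" b L
  for I :: "nat \<Rightarrow> 'i set" and H and W :: "nat \<Rightarrow> nat + nat \<Rightarrow> 'i \<Rightarrow> complex" and r :: nat and b L +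
  fixes \<theta> :: "nat \<Rightarrow> real"
  assumes \<theta>_pos: "i < r \<Longrightarrow> \<theta> i > 0"
    and F_pos: "s \<in> idx r r \<Longrightarrow> b < z \<Longrightarrow> F s z > 0"
begin

text \<open>The sesquilinear form of the dilation of the rank r perturbation.\<close>

definition "pert n x y = (\<Sum>i<r. of_real (\<theta> i) *
    (ip (I n) x (W n (Inl i)) * ip (I n) (W n (Inr i)) y + ip (I n) x (W n (Inr i)) * ip (I n) (W n (Inl i)) y))"

text \<open>The form of \<open>z - T\<close>, positive semidefinite once z exceeds a norm bound of
  T.\<close>

definition "bform n z x y = of_real z * ip (I n) x y - ip (I n) x (T n y)"

lemma Re_bform: "Re (bform n z x x) = z * nsq (I n) x - Re (ip (I n) x (T n x))"
  by (simp add: bform_def ip_self)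

lemma bform_nonneg:
  assumes "bounded_by n B" "0 \<le> B" "B < z"
  shows "Re (bform n z x x) \<ge> 0"
proof -
  have "Re (ip (I n) x (T n x)) \<le> norm (ip (I n) x ((T n ^^ 1) x))" by (simp add: complex_Re_le_cmod)
  also have "\<dots> \<le> sqrt (nsq (I n) x) * sqrt (nsq (I n) x) * B ^ 1"
    by (rule norm_ip_funpow_le[OF bounded_byD[OF assms(1)] assms(2)])
  also have "\<dots> \<le> z * nsq (I n) x" using assms by (simp add: mult.commute[of _ B] mult_right_mono)
  finally show ?thesis by (simp add: Re_bform)
qed

lemma cnj_bform: "cnj (bform n z x y) = bform n z y x"
  by (simp add: bform_def cnj_ip ip_app herm)

lemma bform_diff_scale:
  "Re (bform n z (\<lambda>i. x i - of_real t * g i) (\<lambda>i. x i - of_real t * g i)) =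
    Re (bform n z x x) - 2 * t * Re (bform n z x g) + t\<^sup>2 * Re (bform n z g g)"
proof -
  have "Re (bform n z g x) = Re (bform n z x g)" by (subst cnj_bform[symmetric]) simp
  moreover have "bform n z (\<lambda>i. x i - of_real t * g i) (\<lambda>i. x i - of_real t * g i) =
    bform n z x x - of_real t * bform n z x g - of_real t * bform n z g x + of_real (t * t) * bform n z g g"
    by (simp add: bform_def app_diff app_scale ip_diff_left ip_diff_right ip_scale_left ip_scale_right algebra_simps)
  ultimately show ?thesis by (simp add: power2_eq_square)
qed

lemma bform_solves:
  assumes "solves n z \<eta> y"
  shows "bform n z x y = (\<Sum>s\<in>idx r r. \<eta> s * ip (I n) x (W n s))"
  unfolding bform_def by (rule ip_solves_form[OF assms])

lemma bform_solves_self: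
  assumes "bounded_by n B" "0 \<le> B" "B < z" "solves n z \<eta> g"
  shows "Re (bform n z g g) = Re (\<Sum>s\<in>idx r r. \<Sum>t\<in>idx r r. cnj (\<eta> s) * \<eta> t * R n z s t)"
proof -
  have "bform n z g g = (\<Sum>s\<in>idx r r. \<eta> s * cnj (ip (I n) (W n s) g))"
    by (simp add: bform_solves[OF assms(4)] cnj_ip)
  also have "\<dots> = cnj (\<Sum>s\<in>idx r r. \<Sum>t\<in>idx r r. cnj (\<eta> s) * \<eta> t * R n z s t)"
    by (simp add: ip_solves[OF assms] sum_distrib_left mult_ac)
  finally show ?thesis by (simp only: cnj.sel)
qed

text \<open>Positivity of \<open>z - T\<close> at x minus q times a resolvent vector g bounds
  \<open>bform\<close> at x from below by \<open>q * E\<close>, where \<open>E\<close> is the sum of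
  \<open>|c s|^2 / F s z\<close>. The perturbation restricted to J is at most \<open>q * E\<close>
  by a weighted arithmetic-geometric mean inequality, because each \<theta> times the root of the
  product of the two F's is at most q < 1.\<close>

lemma upper_edge:
  assumes z: "b < z" and J: "J \<subseteq> {..<r}"
    and sub: "\<And>i. i \<in> J \<Longrightarrow> (\<theta> i)\<^sup>2 * F (Inl i) z * F (Inr i) z < 1"
  shows "\<forall>\<^sub>F n in sequentially. \<forall>x. Re (ip (I n) x (T n x)) +
    2 * (\<Sum>i\<in>J. \<theta> i * norm (ip (I n) (W n (Inl i)) x) * norm (ip (I n) (W n (Inr i)) x)) \<le> z * nsq (I n) x"
proof -
  let ?S = "idx r r"
  have finJ: "finite J" using J finite_subset by blast
  define f where "f i = \<theta> i * sqrt (F (Inl i) z * F (Inr i) z)" for i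
  have JF: "F (Inl i) z > 0" "F (Inr i) z > 0" "\<theta> i > 0" if "i \<in> J" for i
    using that J by (auto intro!: F_pos z \<theta>_pos)
  have f1: "f i < 1" if "i \<in> J" for i
  proof -
    have "(f i)\<^sup>2 < 1\<^sup>2"
      using sub[OF that] JF[OF that] by (simp add: f_def power_mult_distrib mult.assoc)
    then show ?thesis by (rule power2_less_imp_less) simp
  qed
  \<comment> \<open>A common bound below 1; the inserted 1/2 makes the maximum meaningful and q
    positive also for empty J.\<close>
  define q where "q = Max (insert (1/2) (f ` J))"
  have q: "q > 0" "q < 1" and fq: "\<And>i. i \<in> J \<Longrightarrow> f i \<le> q"
  proof -
    have "1/2 \<le> q" unfolding q_def using finJ by (intro Max_ge) auto
    then show "q > 0" by linarith
    show "q < 1" unfolding q_def using finJ f1 by (subst Max_less_iff) auto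
    show "f i \<le> q" if "i \<in> J" for i unfolding q_def using finJ that by (intro Max_ge) auto
  qed
  define mF where "mF = Min (insert 1 ((\<lambda>s. F s z) ` ?S))"
  have mF: "mF > 0" "\<And>s. s \<in> ?S \<Longrightarrow> mF \<le> F s z"
    unfolding mF_def using fin(2) F_pos[OF _ z] by (auto simp: Min_gr_iff)
  \<comment> \<open>The tolerance on \<open>R\<close> that raises the form at resolvent vectors by
    at most the factor \<open>1 / q\<close>.\<close>
  define e where "e = (1 / q - 1) * mF"
  have e: "e > 0" using q mF by (simp add: e_def)
  obtain B where B: "b < B" "B < z" using dense[OF z] by blast
  have B0: "0 \<le> B" using B b_nonneg by simp
  have lim: "(\<lambda>n. R n z s t) \<longlonglongrightarrow> (if s = t then of_real (F s z) else 0)" if "s \<in> ?S" "t \<in> ?S" for s t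
    by (rule R_tendsto(1)[OF that tendsto_const z])
  have adf: "\<forall>\<^sub>F n in sequentially. \<forall>c.
      norm ((\<Sum>s\<in>?S. \<Sum>t\<in>?S. cnj (c s) * c t * R n z s t) - of_real (\<Sum>s\<in>?S. (norm (c s))\<^sup>2 * F s z))
        \<le> e * (\<Sum>s\<in>?S. (norm (c s))\<^sup>2)"
    by (rule almost_diagonal_form[OF fin(2) e]) (rule lim)
  show ?thesis
    using adf eventually_bounded_by[OF B(1)]
  proof eventually_elim
    case (elim n)
    show ?case
    proof
      fix x
      define c where "c s = ip (I n) (W n s) x" for s
      \<comment> \<open>With these weights the form of x with g and the limiting form of g with
        itself are both equal to E.\<close>
      define \<eta> where "\<eta> s = c s / of_real (F s z)" for s
      define E where "E = (\<Sum>s\<in>?S. (norm (c s))\<^sup>2 / F s z)"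
      obtain g where g: "solves n z \<eta> g" using solves_exists[OF elim(2) B0 B(2)] by blast
      have Enn: "E \<ge> 0" unfolding E_def using F_pos[OF _ z] by (intro sum_nonneg) (simp add: less_imp_le)
      have "bform n z x g = (\<Sum>s\<in>?S. of_real ((norm (c s))\<^sup>2 / F s z))"
        unfolding bform_solves[OF g]
      proof (intro sum.cong refl)
        fix s
        have "ip (I n) x (W n s) = cnj (c s)" by (simp add: c_def cnj_ip)
        then have "\<eta> s * ip (I n) x (W n s) = (cnj (c s) * c s) / of_real (F s z)" by (simp add: \<eta>_def)
        then show "\<eta> s * ip (I n) x (W n s) = of_real ((norm (c s))\<^sup>2 / F s z)"
          by (simp only: cnj_mult_self of_real_divide)
      qed
      then have xg: "Re (bform n z x g) = E" by (simp add: E_def)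
      have eE: "(\<Sum>s\<in>?S. (norm (\<eta> s))\<^sup>2 * F s z) = E"
        unfolding E_def
      proof (intro sum.cong refl)
        fix s assume "s \<in> ?S"
        then show "(norm (\<eta> s))\<^sup>2 * F s z = (norm (c s))\<^sup>2 / F s z"
          using F_pos[OF _ z, of s] by (simp add: \<eta>_def norm_divide power_divide power2_eq_square)
      qed
      have "Re (bform n z g g) \<le> (\<Sum>s\<in>?S. (norm (\<eta> s))\<^sup>2 * F s z) + e * (\<Sum>s\<in>?S. (norm (\<eta> s))\<^sup>2)"
      proof -
        have "Re (bform n z g g) - (\<Sum>s\<in>?S. (norm (\<eta> s))\<^sup>2 * F s z) =
          Re ((\<Sum>s\<in>?S. \<Sum>t\<in>?S. cnj (\<eta> s) * \<eta> t * R n z s t) - of_real (\<Sum>s\<in>?S. (norm (\<eta> s))\<^sup>2 * F s z))"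
          using bform_solves_self[OF elim(2) B0 B(2) g] by simp
        also have "\<dots> \<le> e * (\<Sum>s\<in>?S. (norm (\<eta> s))\<^sup>2)"
          by (rule order_trans[OF complex_Re_le_cmod spec[OF elim(1)]])
        finally show ?thesis by simp
      qed
      also have "e * (\<Sum>s\<in>?S. (norm (\<eta> s))\<^sup>2) \<le> (1 / q - 1) * (\<Sum>s\<in>?S. (norm (\<eta> s))\<^sup>2 * F s z)"
        unfolding e_def mult.assoc sum_distrib_left[of mF] using q mF(2)
        by (intro mult_left_mono sum_mono) (auto simp: mult.commute[of mF] mult_left_mono)
      finally have gg: "Re (bform n z g g) \<le> E / q" unfolding eE by (simp add: algebra_simps)
      \<comment> \<open>The multiple t = q minimizes \<open>- 2 * t * E + t^2 * E / q\<close>, which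
        bounds the change of the form.\<close>
      have "0 \<le> Re (bform n z (\<lambda>i. x i - of_real q * g i) (\<lambda>i. x i - of_real q * g i))"
        by (rule bform_nonneg[OF elim(2) B0 B(2)])
      also have "\<dots> = Re (bform n z x x) - 2 * q * E + q\<^sup>2 * Re (bform n z g g)"
        unfolding bform_diff_scale xg ..
      also have "q\<^sup>2 * Re (bform n z g g) \<le> q\<^sup>2 * (E / q)" by (intro mult_left_mono gg) simp
      also have "q\<^sup>2 * (E / q) = q * E" using q by (simp add: power2_eq_square)
      finally have main: "q * E \<le> Re (bform n z x x)" by (simp add: algebra_simps)
      have "2 * (\<Sum>i\<in>J. \<theta> i * norm (c (Inl i)) * norm (c (Inr i))) \<le>
          (\<Sum>i\<in>J. q * ((norm (c (Inl i)))\<^sup>2 / F (Inl i) z + (norm (c (Inr i)))\<^sup>2 / F (Inr i) z))"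
        unfolding sum_distrib_left
      proof (rule sum_mono)
        fix i assume i: "i \<in> J"
        define a where "a = sqrt (F (Inl i) z)"
        define d where "d = sqrt (F (Inr i) z)"
        have ad: "a > 0" "d > 0" "a\<^sup>2 = F (Inl i) z" "d\<^sup>2 = F (Inr i) z" using JF[OF i] by (simp_all add: a_def d_def)
        define X where "X = norm (c (Inl i)) / a"
        define Y where "Y = norm (c (Inr i)) / d"
        have XY: "norm (c (Inl i)) = a * X" "norm (c (Inr i)) = d * Y" "X \<ge> 0" "Y \<ge> 0"
          using ad by (simp_all add: X_def Y_def)
        have "f i = \<theta> i * a * d" by (simp add: f_def a_def d_def real_sqrt_mult)
        then have "2 * (\<theta> i * norm (c (Inl i)) * norm (c (Inr i))) = f i * (2 * X * Y)" by (simp add: XY)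
        also have "\<dots> \<le> q * (X\<^sup>2 + Y\<^sup>2)"
          using fq[OF i] q XY sum_squares_bound[of X Y] by (intro mult_mono) auto
        also have "\<dots> = q * ((norm (c (Inl i)))\<^sup>2 / F (Inl i) z + (norm (c (Inr i)))\<^sup>2 / F (Inr i) z)"
          by (simp add: X_def Y_def power_divide ad)
        finally show "2 * (\<theta> i * norm (c (Inl i)) * norm (c (Inr i))) \<le>
          q * ((norm (c (Inl i)))\<^sup>2 / F (Inl i) z + (norm (c (Inr i)))\<^sup>2 / F (Inr i) z)" .
      qed
      also have "\<dots> \<le> (\<Sum>i<r. q * ((norm (c (Inl i)))\<^sup>2 / F (Inl i) z + (norm (c (Inr i)))\<^sup>2 / F (Inr i) z))"
      proof (rule sum_mono2)
        fix i assume "i \<in> {..<r} - J"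
        then have "F (Inl i) z > 0" "F (Inr i) z > 0" by (auto intro!: F_pos z)
        then show "0 \<le> q * ((norm (c (Inl i)))\<^sup>2 / F (Inl i) z + (norm (c (Inr i)))\<^sup>2 / F (Inr i) z)"
          using q by simp
      qed (use J in auto)
      also have "\<dots> = q * E" by (simp add: E_def sum_idx sum.distrib sum_distrib_left[symmetric])
      finally show "Re (ip (I n) x (T n x)) +
        2 * (\<Sum>i\<in>J. \<theta> i * norm (ip (I n) (W n (Inl i)) x) * norm (ip (I n) (W n (Inr i)) x)) \<le> z * nsq (I n) x"
        using main by (simp add: Re_bform c_def)
    qed
  qed
qed

end

context spiked begin

lemma bform_pert_sum:
  "bform n z (\<lambda>i. \<Sum>j\<in>J. c j * x j i) (\<lambda>i. \<Sum>j\<in>J. c j * x j i) - pert n (\<lambda>i. \<Sum>j\<in>J. c j * x j i) (\<lambda>i. \<Sum>j\<in>J. c j * x j i) =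
    (\<Sum>j\<in>J. \<Sum>k\<in>J. cnj (c j) * c k * (bform n z (x j) (x k) - pert n (x j) (x k)))"
proof -
  let ?X = "\<lambda>i. \<Sum>j\<in>J. c j * x j i"
  have 1: "bform n z ?X ?X = (\<Sum>j\<in>J. \<Sum>k\<in>J. cnj (c j) * c k * bform n z (x j) (x k))"
  proof -
    have A: "ip (I n) ?X ?X = (\<Sum>j\<in>J. \<Sum>k\<in>J. cnj (c j) * (c k * ip (I n) (x j) (x k)))"
      by (simp only: ip_sum_left ip_sum_right ip_scale_left ip_scale_right sum_distrib_left)
    have B: "ip (I n) ?X (T n ?X) = (\<Sum>j\<in>J. \<Sum>k\<in>J. cnj (c j) * (c k * ip (I n) (x j) (T n (x k))))"
      by (simp only: app_sum app_scale ip_sum_left ip_sum_right ip_scale_left ip_scale_right sum_distrib_left)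
    show ?thesis
      unfolding bform_def A B sum_distrib_left sum_subtractf[symmetric]
      by (intro sum.cong refl) (simp add: algebra_simps)
  qed
  have w: "ip (I n) ?X u * ip (I n) v ?X = (\<Sum>j\<in>J. \<Sum>k\<in>J. cnj (c j) * c k * (ip (I n) (x j) u * ip (I n) v (x k)))" for u v
  proof -
    have "ip (I n) ?X u * ip (I n) v ?X = (\<Sum>j\<in>J. \<Sum>k\<in>J. (cnj (c j) * ip (I n) (x j) u) * (c k * ip (I n) v (x k)))"
      by (simp only: ip_sum_left ip_sum_right ip_scale_left ip_scale_right sum_product)
    then show ?thesis by (simp add: mult_ac)
  qed
  have "pert n ?X ?X = (\<Sum>i<r. \<Sum>j\<in>J. \<Sum>k\<in>J. cnj (c j) * c k * (of_real (\<theta> i) *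
    (ip (I n) (x j) (W n (Inl i)) * ip (I n) (W n (Inr i)) (x k) + ip (I n) (x j) (W n (Inr i)) * ip (I n) (W n (Inl i)) (x k))))"
    unfolding pert_def w sum.distrib[symmetric] sum_distrib_left
    by (intro sum.cong refl) (simp add: algebra_simps)
  also have "\<dots> = (\<Sum>j\<in>J. \<Sum>i<r. \<Sum>k\<in>J. cnj (c j) * c k * (of_real (\<theta> i) *
    (ip (I n) (x j) (W n (Inl i)) * ip (I n) (W n (Inr i)) (x k) + ip (I n) (x j) (W n (Inr i)) * ip (I n) (W n (Inl i)) (x k))))"
    by (rule sum.swap)
  also have "\<dots> = (\<Sum>j\<in>J. \<Sum>k\<in>J. cnj (c j) * c k * pert n (x j) (x k))"
    unfolding pert_def sum_distrib_left by (intro sum.cong refl) (rule sum.swap)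
  finally show ?thesis unfolding 1 by (simp only: right_diff_distrib sum_subtractf)
qed

text \<open>The trial vectors are resolvents applied to \<open>W n (Inl j)\<close> plus
  \<open>\<beta> j\<close> times \<open>W n (Inr j)\<close>. On them the form of
  \<open>z - T\<close> minus the perturbation tends to a diagonal matrix with negative entries
  \<open>d j\<close>, so it is negative definite for large n. Quantifying over coefficients makes
  this a statement about a space of dimension k + 1.\<close>

lemma lower_edge:
  assumes z: "b < z" and k: "k < r"
    and super: "\<And>i. i \<le> k \<Longrightarrow> (\<theta> i)\<^sup>2 * F (Inl i) z * F (Inr i) z > 1"
  shows "\<forall>\<^sub>F n in sequentially. \<exists>x. \<forall>c. (\<exists>j\<le>k. c j \<noteq> 0) \<longrightarrow>
    z * nsq (I n) (\<lambda>i. \<Sum>j\<le>k. c j * x j i) <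
      Re (ip (I n) (\<lambda>i. \<Sum>j\<le>k. c j * x j i) (T n (\<lambda>i. \<Sum>j\<le>k. c j * x j i))) +
      Re (pert n (\<lambda>i. \<Sum>j\<le>k. c j * x j i) (\<lambda>i. \<Sum>j\<le>k. c j * x j i))"
proof -
  let ?S = "idx r r"
  \<comment> \<open>This weight balances the contributions of the two blocks and so maximizes the
    gain from the perturbation relative to the form of \<open>z - T\<close>.\<close>
  define \<beta> where "\<beta> j = sqrt (F (Inl j) z / F (Inr j) z)" for j
  define \<eta> where "\<eta> j s = (if s = Inl j then 1 else if s = Inr j then \<beta> j else 0)" for j and s :: "nat + nat"
  have Fp: "F (Inl j) z > 0" "F (Inr j) z > 0" "\<theta> j > 0" if "j < r" for j
    using that by (auto intro!: F_pos z \<theta>_pos)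
  \<comment> \<open>A chosen solution of the resolvent equation; it is one only for those n at which
    a solution exists.\<close>
  define X where "X n j = (SOME x. solves n z (\<lambda>s. of_real (\<eta> j s)) x)" for n j
  define C where "C n s j = (\<Sum>t\<in>?S. of_real (\<eta> j t) * R n z s t)" for n s j
  have sumS: "(\<Sum>t\<in>?S. of_real (\<eta> j t) * h t) = h (Inl j) + of_real (\<beta> j) * h (Inr j)"
    if "j < r" for j and h :: "nat + nat \<Rightarrow> complex"
  proof -
    have 1: "(\<Sum>i<r. complex_of_real (\<eta> j (Inl i)) * h (Inl i)) = (\<Sum>i<r. if j = i then h (Inl j) else 0)"
      by (intro sum.cong refl) (auto simp: \<eta>_def)
    have 2: "(\<Sum>i<r. complex_of_real (\<eta> j (Inr i)) * h (Inr i)) = (\<Sum>i<r. if j = i then of_real (\<beta> j) * h (Inr j) else 0)"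
      by (intro sum.cong refl) (auto simp: \<eta>_def)
    show ?thesis unfolding sum_idx 1 2 using that by simp
  qed
  have Clim: "(\<lambda>n. C n s j) \<longlonglongrightarrow> of_real (F s z * \<eta> j s)" if "s \<in> ?S" "j < r" for s j
  proof -
    have "(\<lambda>n. C n s j) \<longlonglongrightarrow> (\<Sum>t\<in>?S. of_real (\<eta> j t) * (if s = t then of_real (F s z) else 0))"
      unfolding C_def by (intro tendsto_sum tendsto_mult_left R_tendsto(1)[OF that(1) _ tendsto_const z])
    also have "(\<Sum>t\<in>?S. of_real (\<eta> j t) * (if s = t then of_real (F s z) else 0)) =
        (\<Sum>t\<in>?S. if s = t then complex_of_real (F s z * \<eta> j s) else 0)"
      by (intro sum.cong refl) auto
    also have "\<dots> = complex_of_real (F s z * \<eta> j s)" using that(1) fin(2) by simp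
    finally show ?thesis .
  qed
  \<comment> \<open>The matrix of \<open>z - T\<close> minus the perturbation in the trial vectors,
    written through entries of \<open>R\<close>, so that its limit is available before the vectors
    are known to exist.\<close>
  define Q where "Q n j l = (\<Sum>s\<in>?S. of_real (\<eta> l s) * cnj (C n s j)) -
    (\<Sum>i<r. of_real (\<theta> i) * (cnj (C n (Inl i) j) * C n (Inr i) l + cnj (C n (Inr i) j) * C n (Inl i) l))" for n j l
  define d where "d j = 2 * F (Inl j) z * (1 - \<theta> j * sqrt (F (Inl j) z * F (Inr j) z))" for j
  have d: "d j < 0" if "j \<le> k" for j
  proof -
    have j: "j < r" using that k by simp
    have "1\<^sup>2 < (\<theta> j * sqrt (F (Inl j) z * F (Inr j) z))\<^sup>2"
      using super[OF that] Fp[OF j] by (simp add: power_mult_distrib mult.assoc)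
    then have "1 < \<theta> j * sqrt (F (Inl j) z * F (Inr j) z)"
      using Fp[OF j] by (intro power2_less_imp_less[of 1]) simp_all
    then show ?thesis unfolding d_def using Fp[OF j] by (simp add: mult_pos_neg)
  qed
  have Qlim: "(\<lambda>n. Q n j l) \<longlonglongrightarrow> (if j = l then of_real (d j) else 0)" if jl: "j \<in> {..k}" "l \<in> {..k}" for j l
  proof -
    have jr: "j < r" "l < r" using jl k by auto
    have "(\<lambda>n. Q n j l) \<longlonglongrightarrow> (\<Sum>s\<in>?S. of_real (\<eta> l s) * cnj (of_real (F s z * \<eta> j s))) -
      (\<Sum>i<r. of_real (\<theta> i) * (cnj (of_real (F (Inl i) z * \<eta> j (Inl i))) * of_real (F (Inr i) z * \<eta> l (Inr i)) +
         cnj (of_real (F (Inr i) z * \<eta> j (Inr i))) * of_real (F (Inl i) z * \<eta> l (Inl i))))"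
      unfolding Q_def by (intro tendsto_intros tendsto_sum Clim jr) auto
    also have "(\<Sum>i<r. of_real (\<theta> i) * (cnj (of_real (F (Inl i) z * \<eta> j (Inl i))) * of_real (F (Inr i) z * \<eta> l (Inr i)) +
         cnj (of_real (F (Inr i) z * \<eta> j (Inr i))) * of_real (F (Inl i) z * \<eta> l (Inl i)))) =
       (\<Sum>i<r. if j = i then (if j = l then complex_of_real (2 * \<theta> j * F (Inl j) z * F (Inr j) z * \<beta> j) else 0) else 0)"
      by (intro sum.cong refl) (auto simp: \<eta>_def algebra_simps)
    also have "\<dots> = (if j = l then complex_of_real (2 * \<theta> j * F (Inl j) z * F (Inr j) z * \<beta> j) else 0)"
      using jr by simp
    also have "(\<Sum>s\<in>?S. of_real (\<eta> l s) * cnj (of_real (F s z * \<eta> j s))) =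
       (if j = l then complex_of_real (F (Inl j) z + \<beta> j * (F (Inr j) z * \<beta> j)) else 0)"
      unfolding sumS[OF jr(2)] by (auto simp: \<eta>_def)
    finally have lim: "(\<lambda>n. Q n j l) \<longlonglongrightarrow> (if j = l then complex_of_real (F (Inl j) z + \<beta> j * (F (Inr j) z * \<beta> j)) else 0) -
        (if j = l then complex_of_real (2 * \<theta> j * F (Inl j) z * F (Inr j) z * \<beta> j) else 0)" .
    have bb: "\<beta> j * (F (Inr j) z * \<beta> j) = F (Inl j) z"
    proof -
      have "\<beta> j * \<beta> j = F (Inl j) z / F (Inr j) z" using Fp[OF jr(1)] by (simp add: \<beta>_def)
      then show ?thesis using Fp[OF jr(1)] by (simp add: field_simps)
    qed
    have b2: "F (Inr j) z * \<beta> j = sqrt (F (Inl j) z * F (Inr j) z)"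
      using Fp[OF jr(1)] by (simp add: \<beta>_def real_sqrt_mult real_sqrt_divide field_simps)
    have "F (Inl j) z + \<beta> j * (F (Inr j) z * \<beta> j) - 2 * \<theta> j * F (Inl j) z * F (Inr j) z * \<beta> j = d j"
      unfolding bb d_def b2[symmetric] by (simp add: algebra_simps)
    note dj = this
    show ?thesis
    proof (cases "j = l")
      case True
      show ?thesis using lim unfolding if_P[OF True] of_real_diff[symmetric] dj .
    next
      case False
      show ?thesis using lim unfolding if_not_P[OF False] by simp
    qed
  qed
  \<comment> \<open>Half of the smallest gap: with an error of size e every diagonal entry remains
    at most \<open>- e\<close>.\<close>
  define e where "e = Min ((\<lambda>j. - d j / 2) ` {..k})"
  have e: "e > 0" unfolding e_def using d by (subst Min_gr_iff) auto
  have ed: "d j \<le> - (2 * e)" if "j \<le> k" for j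
  proof -
    have "e \<le> - d j / 2" unfolding e_def using that by (intro Min_le) auto
    then show ?thesis by simp
  qed
  obtain B where B: "b < B" "B < z" using dense[OF z] by blast
  have B0: "0 \<le> B" using B b_nonneg by simp
  have adf: "\<forall>\<^sub>F n in sequentially. \<forall>c.
      norm ((\<Sum>j\<le>k. \<Sum>l\<le>k. cnj (c j) * c l * Q n j l) - of_real (\<Sum>j\<le>k. (norm (c j))\<^sup>2 * d j))
        \<le> e * (\<Sum>j\<le>k. (norm (c j))\<^sup>2)"
    by (rule almost_diagonal_form[OF finite_atMost e]) (rule Qlim)
  show ?thesis
    using adf eventually_bounded_by[OF B(1)]
  proof eventually_elim
    case (elim n)
    have sol: "solves n z (\<lambda>s. of_real (\<eta> j s)) (X n j)" for j
      unfolding X_def by (rule someI_ex[OF solves_exists[OF elim(2) B0 B(2)]])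
    have ipC: "ip (I n) (W n s) (X n j) = C n s j" for s j
      unfolding C_def by (rule ip_solves[OF elim(2) B0 B(2) sol])
    have ipC': "ip (I n) (X n j) (W n s) = cnj (C n s j)" for s j
      by (simp add: ipC[symmetric] cnj_ip)
    have BQ: "bform n z (X n j) (X n l) - pert n (X n j) (X n l) = Q n j l" for j l
      unfolding Q_def bform_solves[OF sol] pert_def ipC ipC' ..
    show ?case
    proof (intro exI[of _ "X n"] allI impI)
      fix c :: "nat \<Rightarrow> complex" assume c: "\<exists>j\<le>k. c j \<noteq> 0"
      let ?Y = "\<lambda>i. \<Sum>j\<le>k. c j * X n j i"
      define N where "N = (\<Sum>j\<le>k. (norm (c j))\<^sup>2)"
      obtain j0 where j0: "j0 \<le> k" "c j0 \<noteq> 0" using c by blast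
      have N: "N > 0" unfolding N_def by (rule sum_pos2[of _ j0]) (use j0 in auto)
      have "Re (bform n z ?Y ?Y - pert n ?Y ?Y) - (\<Sum>j\<le>k. (norm (c j))\<^sup>2 * d j) =
        Re ((\<Sum>j\<le>k. \<Sum>l\<le>k. cnj (c j) * c l * Q n j l) - of_real (\<Sum>j\<le>k. (norm (c j))\<^sup>2 * d j))"
        unfolding bform_pert_sum BQ by simp
      also have "\<dots> \<le> e * N" unfolding N_def by (rule order_trans[OF complex_Re_le_cmod spec[OF elim(1)]])
      finally have 1: "Re (bform n z ?Y ?Y - pert n ?Y ?Y) - (\<Sum>j\<le>k. (norm (c j))\<^sup>2 * d j) \<le> e * N" .
      have "(\<Sum>j\<le>k. (norm (c j))\<^sup>2 * d j) \<le> (\<Sum>j\<le>k. (norm (c j))\<^sup>2 * - (2 * e))"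
        using ed by (intro sum_mono mult_left_mono) auto
      also have "\<dots> = - (2 * e) * N" unfolding N_def sum_distrib_left by (simp add: mult.commute)
      finally have "Re (bform n z ?Y ?Y - pert n ?Y ?Y) \<le> - (e * N)" using 1 by simp
      also have "\<dots> < 0" using e N by simp
      finally show "z * nsq (I n) ?Y < Re (ip (I n) ?Y (T n ?Y)) + Re (pert n ?Y ?Y)"
        by (simp add: Re_bform)
    qed
  qed
qed

text \<open>The eigenvector equation of the perturbed dilation becomes an unperturbed resolvent
  equation when the perturbation is read as its right-hand side. The sides are exchanged: the weight
  of the left spike j is \<open>\<theta> j\<close> times the overlap with the right spike j, and
  conversely.\<close>

lemma vector_asymptotics:
  assumes z: "\<sigma> \<longlonglongrightarrow> z" "b < z"
    and x: "\<forall>\<^sub>F n in sequentially. \<forall>i\<in>I n. of_real (\<sigma> n) * x n i = T n (x n) i +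
      (\<Sum>j<r. of_real (\<theta> j) * (ip (I n) (W n (Inr j)) (x n) * W n (Inl j) i + ip (I n) (W n (Inl j)) (x n) * W n (Inr j) i))"
    and K: "\<And>n. nsq (I n) (x n) \<le> K"
  shows "i < r \<Longrightarrow> (\<lambda>n. ip (I n) (W n (Inl i)) (x n) - of_real (F (Inl i) z * \<theta> i) * ip (I n) (W n (Inr i)) (x n)) \<longlonglongrightarrow> 0"
    and "i < r \<Longrightarrow> (\<lambda>n. ip (I n) (W n (Inr i)) (x n) - of_real (F (Inr i) z * \<theta> i) * ip (I n) (W n (Inl i)) (x n)) \<longlonglongrightarrow> 0"
    and "(\<lambda>n. nsq (I n) (x n) - (\<Sum>i<r. (\<theta> i)\<^sup>2 * (G (Inl i) z * (norm (ip (I n) (W n (Inr i)) (x n)))\<^sup>2 +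
       G (Inr i) z * (norm (ip (I n) (W n (Inl i)) (x n)))\<^sup>2))) \<longlonglongrightarrow> 0"
    and "\<exists>C. \<forall>n. \<forall>s\<in>idx r r. norm (ip (I n) (W n s) (x n)) \<le> C"
proof -
  define \<eta> where "\<eta> n s = (case s of Inl i \<Rightarrow> of_real (\<theta> i) * ip (I n) (W n (Inr i)) (x n)
    | Inr i \<Rightarrow> of_real (\<theta> i) * ip (I n) (W n (Inl i)) (x n))" for n s
  have "\<exists>C. \<forall>n. norm (ip (I n) (W n s) (x n)) \<le> C" if s: "s \<in> idx r r" for s
  proof -
    obtain D where D: "\<And>n. norm (nsq (I n) (W n s)) \<le> D"
      using convergent_imp_Bseq[OF convergentI[OF nsq_W_tendsto[OF s]]] by (auto simp: Bseq_def)
    have D0: "0 \<le> D" using order_trans[OF norm_ge_zero D] .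
    have "norm (ip (I n) (W n s) (x n)) \<le> sqrt D * sqrt K" for n
      using D[of n] K[of n] by (intro order_trans[OF norm_ip_le] mult_mono real_sqrt_le_mono) (auto simp: D0)
    then show ?thesis by (intro exI allI)
  qed
  then obtain C0 where C0: "\<And>s n. s \<in> idx r r \<Longrightarrow> norm (ip (I n) (W n s) (x n)) \<le> C0 s" by metis
  define C where "C = (\<Sum>s\<in>idx r r. C0 s)"
  have C0nn: "C0 s \<ge> 0" if "s \<in> idx r r" for s using order_trans[OF norm_ge_zero C0[OF that]] .
  have C: "norm (ip (I n) (W n s) (x n)) \<le> C" if "s \<in> idx r r" for s n
    unfolding C_def using C0[OF that, of n] member_le_sum[OF that C0nn fin(2)] by force
  then show "\<exists>C. \<forall>n. \<forall>s\<in>idx r r. norm (ip (I n) (W n s) (x n)) \<le> C" by (intro exI allI ballI)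
  define \<Theta> where "\<Theta> = (\<Sum>i<r. \<theta> i)"
  have Th: "\<theta> i \<le> \<Theta>" if "i < r" for i
    unfolding \<Theta>_def using that \<theta>_pos by (intro member_le_sum) (auto simp: less_imp_le)
  have eta: "norm (\<eta> n s) \<le> \<Theta> * C" if s: "s \<in> idx r r" for n s
  proof -
    obtain i t where it: "i < r" "t \<in> idx r r" "\<eta> n s = of_real (\<theta> i) * ip (I n) (W n t) (x n)"
    proof (cases s)
      case (Inl i)
      then show ?thesis using s that[of i "Inr i"] by (auto simp: \<eta>_def)
    next
      case (Inr i)
      then show ?thesis using s that[of i "Inl i"] by (auto simp: \<eta>_def)
    qed
    have "norm (\<eta> n s) = \<theta> i * norm (ip (I n) (W n t) (x n))" using \<theta>_pos[OF it(1)] by (simp add: it(3) norm_mult)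
    also have "\<dots> \<le> \<Theta> * C" using Th[OF it(1)] \<theta>_pos[OF it(1)] C[OF it(2)] by (intro mult_mono) auto
    finally show ?thesis .
  qed
  have sol: "\<forall>\<^sub>F n in sequentially. solves n (\<sigma> n) (\<eta> n) (x n)"
    using x
  proof eventually_elim
    case (elim n)
    show ?case
      unfolding solves_def
    proof
      fix i assume "i \<in> I n"
      then have "of_real (\<sigma> n) * x n i = T n (x n) i + (\<Sum>j<r. of_real (\<theta> j) *
          (ip (I n) (W n (Inr j)) (x n) * W n (Inl j) i + ip (I n) (W n (Inl j)) (x n) * W n (Inr j) i))"
        using elim by blast
      also have "(\<Sum>j<r. of_real (\<theta> j) *
          (ip (I n) (W n (Inr j)) (x n) * W n (Inl j) i + ip (I n) (W n (Inl j)) (x n) * W n (Inr j) i)) = comb n (\<eta> n) i"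
        unfolding comb_def sum_idx \<eta>_def sum.case sum.distrib[symmetric]
        by (intro sum.cong refl) (simp add: algebra_simps)
      finally show "of_real (\<sigma> n) * x n i = comb n (\<eta> n) i + T n (x n) i" by (simp only: add.commute)
    qed
  qed
  have A1: "(\<lambda>n. ip (I n) (W n s) (x n) - of_real (F s z) * \<eta> n s) \<longlonglongrightarrow> 0" if "s \<in> idx r r" for s
    by (rule solves_asymptotics(1)[OF z _ sol that]) (rule eta)
  have A2: "(\<lambda>n. nsq (I n) (x n) - (\<Sum>s\<in>idx r r. G s z * (norm (\<eta> n s))\<^sup>2)) \<longlonglongrightarrow> 0"
    by (rule solves_asymptotics(2)[OF z _ sol]) (rule eta)
  show "(\<lambda>n. ip (I n) (W n (Inl i)) (x n) - of_real (F (Inl i) z * \<theta> i) * ip (I n) (W n (Inr i)) (x n)) \<longlonglongrightarrow> 0" if "i < r"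
    using A1[OF InlI[of i]] that by (simp add: \<eta>_def mult.assoc)
  show "(\<lambda>n. ip (I n) (W n (Inr i)) (x n) - of_real (F (Inr i) z * \<theta> i) * ip (I n) (W n (Inl i)) (x n)) \<longlonglongrightarrow> 0" if "i < r"
    using A1[OF InrI[of i]] that by (simp add: \<eta>_def mult.assoc)
  have e: "(\<Sum>s\<in>idx r r. G s z * (norm (\<eta> n s))\<^sup>2) = (\<Sum>i<r. (\<theta> i)\<^sup>2 * (G (Inl i) z * (norm (ip (I n) (W n (Inr i)) (x n)))\<^sup>2 +
       G (Inr i) z * (norm (ip (I n) (W n (Inl i)) (x n)))\<^sup>2))" for n
    unfolding sum_idx \<eta>_def sum.case sum.distrib[symmetric]
    by (intro sum.cong refl) (simp add: norm_mult power_mult_distrib algebra_simps)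
  show "(\<lambda>n. nsq (I n) (x n) - (\<Sum>i<r. (\<theta> i)\<^sup>2 * (G (Inl i) z * (norm (ip (I n) (W n (Inr i)) (x n)))\<^sup>2 +
       G (Inr i) z * (norm (ip (I n) (W n (Inl i)) (x n)))\<^sup>2))) \<longlonglongrightarrow> 0"
    using A2 by (simp only: e)
qed

text \<open>For each i the two overlap relations form a system of determinant
  \<open>1 - (\<theta> i)^2 * Fa * Fb\<close>, which vanishes exactly when
  \<open>\<theta> i = \<theta> i0\<close>; the other overlaps tend to 0. In the critical group the
  system expresses d through c, and the norm relation fixes the total. The squared norm 2 is that of
  two stacked unit vectors.\<close>

lemma outlier_vector_asymptotics:
  assumes z: "\<sigma> \<longlonglongrightarrow> z" "b < z"
    and x: "\<forall>\<^sub>F n in sequentially. \<forall>i\<in>I n. of_real (\<sigma> n) * x n i = T n (x n) i +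
      (\<Sum>j<r. of_real (\<theta> j) * (ip (I n) (W n (Inr j)) (x n) * W n (Inl j) i + ip (I n) (W n (Inl j)) (x n) * W n (Inr j) i))"
    and x2: "\<And>n. nsq (I n) (x n) \<le> 2" "\<forall>\<^sub>F n in sequentially. nsq (I n) (x n) = 2"
    and Fa: "\<And>i. i < r \<Longrightarrow> F (Inl i) z = Fa" "\<And>i. i < r \<Longrightarrow> G (Inl i) z = Ga"
    and Fb: "\<And>i. i < r \<Longrightarrow> F (Inr i) z = Fb" "\<And>i. i < r \<Longrightarrow> G (Inr i) z = Gb"
    and pos: "0 < Fa" "0 < Fb" "0 < Ga" "0 < Gb"
    and i0: "i0 < r" "(\<theta> i0)\<^sup>2 * Fa * Fb = 1"
  shows "i < r \<Longrightarrow> \<theta> i \<noteq> \<theta> i0 \<Longrightarrow> (\<lambda>n. ip (I n) (W n (Inl i)) (x n)) \<longlonglongrightarrow> 0"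
    and "i < r \<Longrightarrow> \<theta> i \<noteq> \<theta> i0 \<Longrightarrow> (\<lambda>n. ip (I n) (W n (Inr i)) (x n)) \<longlonglongrightarrow> 0"
    and "(\<lambda>n. \<Sum>i | i < r \<and> \<theta> i = \<theta> i0. (norm (ip (I n) (W n (Inl i)) (x n)))\<^sup>2) \<longlonglongrightarrow> 2 * Fa / ((\<theta> i0)\<^sup>2 * (Ga * Fb + Gb * Fa))"
    and "(\<lambda>n. \<Sum>i | i < r \<and> \<theta> i = \<theta> i0. (norm (ip (I n) (W n (Inr i)) (x n)))\<^sup>2) \<longlonglongrightarrow> 2 * Fb / ((\<theta> i0)\<^sup>2 * (Ga * Fb + Gb * Fa))"
    and "i < r \<Longrightarrow> \<theta> i = \<theta> i0 \<Longrightarrow>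
      (\<lambda>n. of_real (Fa * \<theta> i) * ip (I n) (W n (Inr i)) (x n) - ip (I n) (W n (Inl i)) (x n)) \<longlonglongrightarrow> 0"
proof -
  define c where "c n i = ip (I n) (W n (Inl i)) (x n)" for n i
  define d where "d n i = ip (I n) (W n (Inr i)) (x n)" for n i
  note A = vector_asymptotics[OF z x x2(1)]
  have cd: "(\<lambda>n. c n i - of_real (Fa * \<theta> i) * d n i) \<longlonglongrightarrow> 0" "(\<lambda>n. d n i - of_real (Fb * \<theta> i) * c n i) \<longlonglongrightarrow> 0"
    if "i < r" for i
    using A(1,2)[OF that] by (simp_all only: Fa[OF that] Fb[OF that] c_def d_def)
  obtain C where C0: "\<forall>n. \<forall>s\<in>idx r r. norm (ip (I n) (W n s) (x n)) \<le> C" using A(4) by (elim exE)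
  have C: "norm (c n i) \<le> C" "norm (d n i) \<le> C" if "i < r" for n i
    unfolding c_def d_def using C0 that by (simp_all add: InlI InrI)
  have ne: "(\<lambda>n. c n i) \<longlonglongrightarrow> 0 \<and> (\<lambda>n. d n i) \<longlonglongrightarrow> 0" if i: "i < r" "\<theta> i \<noteq> \<theta> i0" for i
  proof -
    define q where "q = 1 - (\<theta> i)\<^sup>2 * Fa * Fb"
    have q: "q \<noteq> 0"
    proof
      assume "q = 0"
      then have "(\<theta> i)\<^sup>2 * (Fa * Fb) = (\<theta> i0)\<^sup>2 * (Fa * Fb)" using i0(2) by (simp add: q_def mult.assoc)
      then have "(\<theta> i)\<^sup>2 = (\<theta> i0)\<^sup>2" using pos by simp
      then show False using i \<theta>_pos[OF i(1)] \<theta>_pos[OF i0(1)] by (simp add: power2_eq_iff_nonneg)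
    qed
    have "(\<lambda>n. ((c n i - of_real (Fa * \<theta> i) * d n i) + of_real (Fa * \<theta> i) * (d n i - of_real (Fb * \<theta> i) * c n i)) / of_real q)
      \<longlonglongrightarrow> (0 + of_real (Fa * \<theta> i) * 0) / of_real q"
      by (intro tendsto_intros cd i) (simp add: q)
    moreover have "((c n i - of_real (Fa * \<theta> i) * d n i) + of_real (Fa * \<theta> i) * (d n i - of_real (Fb * \<theta> i) * c n i)) / of_real q = c n i" for n
    proof -
      have "(c n i - of_real (Fa * \<theta> i) * d n i) + of_real (Fa * \<theta> i) * (d n i - of_real (Fb * \<theta> i) * c n i) = of_real q * c n i"
        by (simp add: q_def algebra_simps power2_eq_square)
      then show ?thesis using q by simp
    qed
    ultimately have c0: "(\<lambda>n. c n i) \<longlonglongrightarrow> 0" by simp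
    have "(\<lambda>n. (d n i - of_real (Fb * \<theta> i) * c n i) + of_real (Fb * \<theta> i) * c n i) \<longlonglongrightarrow> 0 + of_real (Fb * \<theta> i) * 0"
      by (intro tendsto_intros cd i c0)
    with c0 show ?thesis by simp
  qed
  show "(\<lambda>n. ip (I n) (W n (Inl i)) (x n)) \<longlonglongrightarrow> 0" "(\<lambda>n. ip (I n) (W n (Inr i)) (x n)) \<longlonglongrightarrow> 0"
    if "i < r" "\<theta> i \<noteq> \<theta> i0" for i
    using ne[OF that] by (simp_all only: c_def d_def)
  show "(\<lambda>n. of_real (Fa * \<theta> i) * ip (I n) (W n (Inr i)) (x n) - ip (I n) (W n (Inl i)) (x n)) \<longlonglongrightarrow> 0"
    if "i < r" "\<theta> i = \<theta> i0" for i
    using tendsto_minus[OF cd(1)[OF that(1)]] by (simp add: c_def d_def)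
  \<comment> \<open>From the overlaps to their squared moduli: a difference of squares is a small
    difference times a bounded sum.\<close>
  have sq: "(\<lambda>n. (norm (d n i))\<^sup>2 - (Fb * \<theta> i)\<^sup>2 * (norm (c n i))\<^sup>2) \<longlonglongrightarrow> 0" if i: "i < r" for i
  proof (rule Lim_null_comparison[OF always_eventually])
    let ?t = "Fb * \<theta> i"
    have t: "?t > 0" using pos \<theta>_pos[OF i] by simp
    show "\<forall>n. norm ((norm (d n i))\<^sup>2 - ?t\<^sup>2 * (norm (c n i))\<^sup>2) \<le> norm (d n i - of_real ?t * c n i) * (C + ?t * C)"
    proof
      fix n
      have nt: "norm (of_real ?t * c n i) = ?t * norm (c n i)" unfolding norm_mult norm_of_real using t by simp
      have "(norm (d n i))\<^sup>2 - ?t\<^sup>2 * (norm (c n i))\<^sup>2 =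
          (norm (d n i) - norm (of_real ?t * c n i)) * (norm (d n i) + norm (of_real ?t * c n i))"
        unfolding nt by (simp add: power2_eq_square algebra_simps)
      also have "norm \<dots> \<le> norm (d n i - of_real ?t * c n i) * (norm (d n i) + norm (of_real ?t * c n i))"
        unfolding real_norm_def abs_mult by (intro mult_mono norm_triangle_ineq3) auto
      also have "\<dots> \<le> norm (d n i - of_real ?t * c n i) * (C + ?t * C)"
        unfolding nt using C[OF i] t by (intro mult_left_mono add_mono mult_left_mono) auto
      finally show "norm ((norm (d n i))\<^sup>2 - ?t\<^sup>2 * (norm (c n i))\<^sup>2) \<le> norm (d n i - of_real ?t * c n i) * (C + ?t * C)" .
    qed
    show "(\<lambda>n. norm (d n i - of_real ?t * c n i) * (C + ?t * C)) \<longlonglongrightarrow> 0"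
      by (rule tendsto_mult_left_zero[OF tendsto_norm_zero[OF cd(2)[OF i]]])
  qed
  let ?I0 = "{i. i < r \<and> \<theta> i = \<theta> i0}" and ?I1 = "{i. i < r \<and> \<theta> i \<noteq> \<theta> i0}"
  define t0 where "t0 = \<theta> i0"
  have t0: "t0 > 0" "t0\<^sup>2 * Fa * Fb = 1" using \<theta>_pos[OF i0(1)] i0(2) by (simp_all add: t0_def)
  \<comment> \<open>The coefficient of \<open>Sc\<close> in the norm relation once \<open>Sd\<close>
    is replaced by \<open>(Fb * t0)^2 * Sc\<close>.\<close>
  define \<kappa> where "\<kappa> = t0\<^sup>2 * (Ga * (Fb * t0)\<^sup>2 + Gb)"
  have k: "\<kappa> > 0" using pos t0 by (simp add: \<kappa>_def add_nonneg_pos)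
  define Sc where "Sc n = (\<Sum>i\<in>?I0. (norm (c n i))\<^sup>2)" for n
  define Sd where "Sd n = (\<Sum>i\<in>?I0. (norm (d n i))\<^sup>2)" for n
  have Sdc: "(\<lambda>n. Sd n - (Fb * t0)\<^sup>2 * Sc n) \<longlonglongrightarrow> 0"
  proof -
    have "(\<lambda>n. \<Sum>i\<in>?I0. ((norm (d n i))\<^sup>2 - (Fb * \<theta> i)\<^sup>2 * (norm (c n i))\<^sup>2)) \<longlonglongrightarrow> 0"
      by (intro tendsto_null_sum sq) simp
    moreover have "(\<Sum>i\<in>?I0. ((norm (d n i))\<^sup>2 - (Fb * \<theta> i)\<^sup>2 * (norm (c n i))\<^sup>2)) = Sd n - (Fb * t0)\<^sup>2 * Sc n" for n
      unfolding Sd_def Sc_def sum_distrib_left sum_subtractf[symmetric] by (intro sum.cong refl) (simp add: t0_def)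
    ultimately show ?thesis by simp
  qed
  have other: "(\<lambda>n. \<Sum>i\<in>?I1. (\<theta> i)\<^sup>2 * (Ga * (norm (d n i))\<^sup>2 + Gb * (norm (c n i))\<^sup>2)) \<longlonglongrightarrow> 0"
  proof (rule tendsto_null_sum)
    fix i assume "i \<in> ?I1"
    then have "(\<lambda>n. c n i) \<longlonglongrightarrow> 0" "(\<lambda>n. d n i) \<longlonglongrightarrow> 0" using ne by auto
    then have "(\<lambda>n. (\<theta> i)\<^sup>2 * (Ga * (norm (d n i))\<^sup>2 + Gb * (norm (c n i))\<^sup>2)) \<longlonglongrightarrow> (\<theta> i)\<^sup>2 * (Ga * (norm (0::complex))\<^sup>2 + Gb * (norm (0::complex))\<^sup>2)"
      by (intro tendsto_intros)
    then show "(\<lambda>n. (\<theta> i)\<^sup>2 * (Ga * (norm (d n i))\<^sup>2 + Gb * (norm (c n i))\<^sup>2)) \<longlonglongrightarrow> 0" by simp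
  qed
  have tot: "(\<lambda>n. nsq (I n) (x n) - (t0\<^sup>2 * (Ga * Sd n + Gb * Sc n) +
      (\<Sum>i\<in>?I1. (\<theta> i)\<^sup>2 * (Ga * (norm (d n i))\<^sup>2 + Gb * (norm (c n i))\<^sup>2)))) \<longlonglongrightarrow> 0"
  proof -
    have "(\<Sum>i<r. (\<theta> i)\<^sup>2 * (G (Inl i) z * (norm (ip (I n) (W n (Inr i)) (x n)))\<^sup>2 +
       G (Inr i) z * (norm (ip (I n) (W n (Inl i)) (x n)))\<^sup>2)) = t0\<^sup>2 * (Ga * Sd n + Gb * Sc n) +
      (\<Sum>i\<in>?I1. (\<theta> i)\<^sup>2 * (Ga * (norm (d n i))\<^sup>2 + Gb * (norm (c n i))\<^sup>2))" for n
    proof -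
      have "(\<Sum>i<r. (\<theta> i)\<^sup>2 * (G (Inl i) z * (norm (ip (I n) (W n (Inr i)) (x n)))\<^sup>2 +
         G (Inr i) z * (norm (ip (I n) (W n (Inl i)) (x n)))\<^sup>2)) =
        (\<Sum>i\<in>?I0 \<union> ?I1. (\<theta> i)\<^sup>2 * (Ga * (norm (d n i))\<^sup>2 + Gb * (norm (c n i))\<^sup>2))"
        by (intro sum.cong) (auto simp: Fa Fb c_def d_def)
      also have "\<dots> = (\<Sum>i\<in>?I0. (\<theta> i)\<^sup>2 * (Ga * (norm (d n i))\<^sup>2 + Gb * (norm (c n i))\<^sup>2)) +
        (\<Sum>i\<in>?I1. (\<theta> i)\<^sup>2 * (Ga * (norm (d n i))\<^sup>2 + Gb * (norm (c n i))\<^sup>2))"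
        by (rule sum.union_disjoint) auto
      also have "(\<Sum>i\<in>?I0. (\<theta> i)\<^sup>2 * (Ga * (norm (d n i))\<^sup>2 + Gb * (norm (c n i))\<^sup>2)) = t0\<^sup>2 * (Ga * Sd n + Gb * Sc n)"
        unfolding Sd_def Sc_def sum_distrib_left sum.distrib[symmetric] by (intro sum.cong refl) (simp add: t0_def)
      finally show ?thesis .
    qed
    with A(3) show ?thesis by (simp only:)
  qed
  have "(\<lambda>n. (nsq (I n) (x n) - ((nsq (I n) (x n) - (t0\<^sup>2 * (Ga * Sd n + Gb * Sc n) +
      (\<Sum>i\<in>?I1. (\<theta> i)\<^sup>2 * (Ga * (norm (d n i))\<^sup>2 + Gb * (norm (c n i))\<^sup>2)))) +
      (\<Sum>i\<in>?I1. (\<theta> i)\<^sup>2 * (Ga * (norm (d n i))\<^sup>2 + Gb * (norm (c n i))\<^sup>2)) +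
      t0\<^sup>2 * Ga * (Sd n - (Fb * t0)\<^sup>2 * Sc n))) / \<kappa>) \<longlonglongrightarrow> (2 - (0 + 0 + t0\<^sup>2 * Ga * 0)) / \<kappa>"
    using k by (intro tendsto_intros tot other Sdc tendsto_eventually x2(2)) auto
  moreover have "(a - ((a - (t0\<^sup>2 * (Ga * u + Gb * v) + w)) + w + t0\<^sup>2 * Ga * (u - (Fb * t0)\<^sup>2 * v))) / \<kappa> = v" for a u v w
  proof -
    have "a - ((a - (t0\<^sup>2 * (Ga * u + Gb * v) + w)) + w + t0\<^sup>2 * Ga * (u - (Fb * t0)\<^sup>2 * v)) = \<kappa> * v"
      by (simp add: \<kappa>_def power2_eq_square algebra_simps)
    then show ?thesis using k by simp
  qed
  ultimately have Sc: "Sc \<longlonglongrightarrow> 2 / \<kappa>" by simp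
  \<comment> \<open>The outlier condition turns \<kappa> into an expression symmetric in the two
    blocks, up to the factor \<open>1 / Fa\<close>.\<close>
  have FF: "Fb * t0\<^sup>2 = 1 / Fa" using t0 pos by (simp add: field_simps)
  have "\<kappa> = t0\<^sup>2 * (Ga * (Fb * (Fb * t0\<^sup>2)) + Gb)" by (simp add: \<kappa>_def power2_eq_square mult_ac)
  also have "\<dots> = t0\<^sup>2 * (Ga * Fb + Gb * Fa) / Fa" unfolding FF using pos by (simp add: field_simps)
  finally have kk: "\<kappa> = t0\<^sup>2 * (Ga * Fb + Gb * Fa) / Fa" .
  have v: "2 / \<kappa> = 2 * Fa / (t0\<^sup>2 * (Ga * Fb + Gb * Fa))" unfolding kk by simp
  show "(\<lambda>n. \<Sum>i | i < r \<and> \<theta> i = \<theta> i0. (norm (ip (I n) (W n (Inl i)) (x n)))\<^sup>2) \<longlonglongrightarrow> 2 * Fa / ((\<theta> i0)\<^sup>2 * (Ga * Fb + Gb * Fa))"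
    using Sc unfolding v t0_def Sc_def c_def .
  have "(\<lambda>n. (Sd n - (Fb * t0)\<^sup>2 * Sc n) + (Fb * t0)\<^sup>2 * Sc n) \<longlonglongrightarrow> 0 + (Fb * t0)\<^sup>2 * (2 / \<kappa>)"
    by (intro tendsto_intros Sdc Sc)
  moreover have "0 + (Fb * t0)\<^sup>2 * (2 / \<kappa>) = 2 * Fb / (t0\<^sup>2 * (Ga * Fb + Gb * Fa))"
  proof -
    have "(Fb * t0)\<^sup>2 = Fb * (Fb * t0\<^sup>2)" by (simp add: power2_eq_square mult_ac)
    also have "\<dots> = Fb / Fa" by (simp only: FF) simp
    finally have "(Fb * t0)\<^sup>2 = Fb / Fa" .
    then show ?thesis unfolding v using pos by simp
  qed
  ultimately have "Sd \<longlonglongrightarrow> 2 * Fb / (t0\<^sup>2 * (Ga * Fb + Gb * Fa))" by simp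
  then show "(\<lambda>n. \<Sum>i | i < r \<and> \<theta> i = \<theta> i0. (norm (ip (I n) (W n (Inr i)) (x n)))\<^sup>2) \<longlonglongrightarrow> 2 * Fb / ((\<theta> i0)\<^sup>2 * (Ga * Fb + Gb * Fa))"
    unfolding t0_def Sd_def d_def .
qed

end

section \<open>Transforms of the limit law\<close>

text \<open>For the moments of a law this is the integral of 1 / (z - t), expanded at infinity;
  \<open>stieltjes2\<close> is minus its derivative.\<close>

definition stieltjes :: "(nat \<Rightarrow> real) \<Rightarrow> real \<Rightarrow> real" where
  "stieltjes L z = (\<Sum>k. L k / z ^ (k + 1))"

definition stieltjes2 :: "(nat \<Rightarrow> real) \<Rightarrow> real \<Rightarrow> real" where
  "stieltjes2 L z = (\<Sum>k. real (k + 1) * L k / z ^ (k + 2))"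

locale moment_seq =
  fixes L :: "nat \<Rightarrow> real" and b :: real
  assumes b: "0 \<le> b" and L0: "L 0 = 1" and L_nonneg: "0 \<le> L k" and L_le: "L k \<le> b ^ k"
begin

lemma summable: assumes "b < z" shows "summable (\<lambda>k. L k / z ^ (k + 1))"
proof (rule summable_comparison_test')
  have "norm (b / z) < 1" using b assms by simp
  then show "summable (\<lambda>k. 1 / z * (b / z) ^ k)" by (intro summable_mult summable_geometric)
  fix k :: nat
  have "L k / z ^ (k + 1) \<le> b ^ k / z ^ (k + 1)" using b assms by (intro divide_right_mono L_le) simp
  then show "norm (L k / z ^ (k + 1)) \<le> 1 / z * (b / z) ^ k"
    using b assms L_nonneg[of k] by (simp add: power_divide)
qed

lemma stieltjes_le: assumes "b < z" shows "stieltjes L z \<le> 1 / (z - b)"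
proof -
  have z: "z > 0" "norm (b / z) < 1" using b assms by auto
  have "stieltjes L z \<le> (\<Sum>k. 1 / z * (b / z) ^ k)"
    unfolding stieltjes_def
  proof (rule suminf_le[OF _ summable[OF assms]])
    show "summable (\<lambda>k. 1 / z * (b / z) ^ k)" using z by (intro summable_mult summable_geometric)
    fix k :: nat
    have "L k / z ^ (k + 1) \<le> b ^ k / z ^ (k + 1)" using z by (intro divide_right_mono L_le) simp
    then show "L k / z ^ (k + 1) \<le> 1 / z * (b / z) ^ k" by (simp add: power_divide)
  qed
  also have "\<dots> = 1 / z * (1 / (1 - b / z))"
    using z by (subst suminf_mult) (simp_all only: summable_geometric suminf_geometric)
  also have "\<dots> = 1 / (z - b)" using z by (simp add: field_simps)
  finally show ?thesis .
qed

lemma stieltjes_pos: assumes "b < z" shows "stieltjes L z > 0"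
  unfolding stieltjes_def
  by (rule suminf_pos2[OF summable[OF assms], of 0]) (use b assms L_nonneg L0 in auto)

text \<open>A power series in 1 / z, differentiated termwise inside its disc and composed with the
  reciprocal.\<close>

lemma DERIV_stieltjes:
  assumes "b < z"
  shows "(stieltjes L has_field_derivative - stieltjes2 L z) (at z)" "summable (\<lambda>k. real (k + 1) * L k / z ^ (k + 2))"
proof -
  obtain y where y: "b < y" "y < z" using dense[OF assms] by blast
  have pos: "y > 0" "z > 0" using b y by auto
  \<comment> \<open>The coefficients are shifted by one so that \<open>h (1 / x)\<close> begins with
    \<open>L 0 / x\<close>.\<close>
  define c where "c j = (case j of 0 \<Rightarrow> 0 | Suc k \<Rightarrow> L k)" for j
  define h where "h w = (\<Sum>j. c j * w ^ j)" for w
  have sm: "Series.summable (\<lambda>j. c j * (1 / x) ^ j)" if "b < x" for x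
  proof -
    have "Series.summable (\<lambda>k. c (Suc k) * (1 / x) ^ Suc k)"
      using summable[OF that] by (simp add: c_def power_divide)
    then show ?thesis by (subst (asm) summable_Suc_iff[where f = "\<lambda>j. c j * (1 / x) ^ j"])
  qed
  have hs: "h (1 / x) = stieltjes L x" if "b < x" for x
    unfolding h_def stieltjes_def using suminf_split_head[OF sm[OF that]] by (simp add: c_def power_divide)
  have lt: "norm (1 / z) < norm (1 / y)" using pos y by (simp add: frac_less2)
  have dc: "diffs c k * (1 / z) ^ k = z\<^sup>2 * (real (k + 1) * L k / z ^ (k + 2))" for k
    using pos by (simp add: diffs_def c_def power_divide power2_eq_square)
  have s': "Series.summable (\<lambda>k. diffs c k * (1 / z) ^ k)"
  proof (rule termdiff_converges)
    show "norm (1 / z) < 1 / y" using lt pos by simp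
    fix x :: real assume "norm x < 1 / y"
    then show "Series.summable (\<lambda>k. c k * x ^ k)" by (intro powser_inside[OF sm[OF y(1)]]) (use pos in simp)
  qed
  have "Series.summable (\<lambda>k. (1 / z\<^sup>2) * (diffs c k * (1 / z) ^ k))" using s' by (rule summable_mult)
  then show sG: "Series.summable (\<lambda>k. real (k + 1) * L k / z ^ (k + 2))"
    unfolding dc using pos by simp
  have d: "(h has_field_derivative (\<Sum>k. diffs c k * (1 / z) ^ k)) (at (1 / z))"
    unfolding h_def by (rule termdiffs_strong[OF sm[OF y(1)] lt])
  have sum: "(\<Sum>k. diffs c k * (1 / z) ^ k) = z\<^sup>2 * stieltjes2 L z"
    unfolding stieltjes2_def dc by (rule suminf_mult[OF sG])
  have "((\<lambda>x. h (1 / x)) has_field_derivative (z\<^sup>2 * stieltjes2 L z) * (- (1 / z\<^sup>2))) (at z)"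
  proof (rule DERIV_chain2[of h])
    show "(h has_field_derivative z\<^sup>2 * stieltjes2 L z) (at (1 / z))" using d unfolding sum .
    show "((\<lambda>x. 1 / x) has_field_derivative - (1 / z\<^sup>2)) (at z)"
      using pos by (auto intro!: derivative_eq_intros simp: power2_eq_square)
  qed
  then have "((\<lambda>x. h (1 / x)) has_field_derivative - stieltjes2 L z) (at z)" using pos by simp
  then show "(stieltjes L has_field_derivative - stieltjes2 L z) (at z)"
    by (rule DERIV_cong_ev[THEN iffD1, rotated 3, OF _ refl _ refl])
      (use hs eventually_nhds_in_open[of "{b<..}" z] assms in \<open>auto elim!: eventually_mono\<close>)
qed

lemma stieltjes2_pos: assumes "b < z" shows "stieltjes2 L z > 0"
  unfolding stieltjes2_def
  by (rule suminf_pos2[OF DERIV_stieltjes(2)[OF assms], of 0]) (use b assms L_nonneg L0 in auto)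

end

text \<open>The moments of the symmetrization of \<mu>: the nonzero eigenvalues of the dilation come
  in pairs of opposite sign.\<close>

definition even_moments :: "real measure \<Rightarrow> nat \<Rightarrow> real" where
  "even_moments \<mu> k = (if even k then (\<integral>t. t ^ k \<partial>\<mu>) else 0)"

locale limit_law =
  fixes \<mu> :: "real measure" and b c :: real
  assumes \<mu>: "real_distribution \<mu>" and b0: "0 \<le> b" and c: "0 \<le> c" "c \<le> 1"
    and supp: "AE t in \<mu>. 0 \<le> t \<and> t \<le> b"
begin

interpretation real_distribution \<mu> by (rule \<mu>)

definition "L1 = even_moments \<mu>"
text \<open>Moments of the symmetrization of c \<mu> + (1 - c) \<delta>, with \<delta> the unit mass
  at 0; the atom contributes only at order 0, where the total mass is 1.\<close>

definition "L2 k = (if k = 0 then 1 else c * even_moments \<mu> k)"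

lemma total_mass: "measure \<mu> UNIV = 1"
  using prob_space by simp

lemma integrable_pow: "integrable \<mu> (\<lambda>t. t ^ k)"
proof (rule integrable_const_bound[of _ "b ^ k"])
  show "AE t in \<mu>. norm (t ^ k) \<le> b ^ k" using supp by eventually_elim (simp add: power_abs power_mono)
qed simp

lemma moment_bounds: "0 \<le> (\<integral>t. t ^ k \<partial>\<mu>)" "(\<integral>t. t ^ k \<partial>\<mu>) \<le> b ^ k"
proof -
  show "0 \<le> (\<integral>t. t ^ k \<partial>\<mu>)" by (rule integral_nonneg_AE) (use supp in \<open>eventually_elim, simp\<close>)
  have "(\<integral>t. t ^ k \<partial>\<mu>) \<le> (\<integral>t. b ^ k \<partial>\<mu>)"
  proof (rule integral_mono_AE[OF integrable_pow])
    show "AE t in \<mu>. t ^ k \<le> b ^ k" using supp by eventually_elim (simp add: power_mono)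
  qed simp
  then show "(\<integral>t. t ^ k \<partial>\<mu>) \<le> b ^ k" by (simp add: total_mass)
qed

lemma moment_seq1: "moment_seq L1 b"
  by unfold_locales (use b0 moment_bounds in \<open>auto simp: L1_def even_moments_def total_mass\<close>)

lemma moment_seq2: "moment_seq L2 b"
proof
  fix k
  show "0 \<le> L2 k" using c moment_bounds(1)[of k] by (simp add: L2_def even_moments_def)
  have "c * (\<integral>t. t ^ k \<partial>\<mu>) \<le> 1 * b ^ k" using c moment_bounds[of k] by (intro mult_mono) auto
  then show "L2 k \<le> b ^ k" using b0 by (simp add: L2_def even_moments_def)
qed (use b0 in \<open>simp_all add: L2_def\<close>)

text \<open>The integrand is half the sum of 1 / (z - t) and 1 / (z + t); in the sum of their
  geometric series the odd powers cancel. Powers of \<open>b / z\<close> dominate, so the series may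
  be integrated termwise.\<close>

lemma phi_eq: assumes z: "b < z" shows "\<phi> \<mu> z = stieltjes L1 z"
proof -
  have zp: "z > 0" using z b0 by simp
  define f where "f k t = (if even k then t ^ k else 0) / z ^ (k + 1)" for k and t :: real
  have fi: "integrable \<mu> (f k)" for k
    unfolding f_def using integrable_pow[of k] by (cases "even k") simp_all
  have fb: "AE t in \<mu>. \<forall>k. norm (f k t) \<le> 1 / z * (b / z) ^ k"
    using supp
  proof eventually_elim
    case (elim t)
    show ?case
    proof
      fix k
      have "t ^ k / z ^ (k + 1) \<le> b ^ k / z ^ (k + 1)" using elim zp by (intro divide_right_mono power_mono) auto
      then show "norm (f k t) \<le> 1 / z * (b / z) ^ k"
        using elim zp b0 by (auto simp: f_def power_divide)
    qed
  qed
  have sg: "summable (\<lambda>k. 1 / z * (b / z) ^ k)" using z b0 by (intro summable_mult summable_geometric) simp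
  have "(\<lambda>k. integral\<^sup>L \<mu> (f k)) sums (integral\<^sup>L \<mu> (\<lambda>t. \<Sum>k. f k t))"
  proof (rule sums_integral[OF fi])
    show "AE t in \<mu>. summable (\<lambda>k. norm (f k t))"
      using fb by eventually_elim (rule summable_comparison_test'[OF sg, of 0], simp)
    show "summable (\<lambda>k. \<integral>t. norm (f k t) \<partial>\<mu>)"
    proof (rule summable_comparison_test'[OF sg, of 0])
      fix k
      have "(\<integral>t. norm (f k t) \<partial>\<mu>) \<le> (\<integral>t. 1 / z * (b / z) ^ k \<partial>\<mu>)"
        by (rule integral_mono_AE[OF integrable_norm[OF fi]]) (use fb in \<open>auto elim!: eventually_mono\<close>)
      then show "norm (\<integral>t. norm (f k t) \<partial>\<mu>) \<le> 1 / z * (b / z) ^ k" by (simp add: total_mass)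
    qed
  qed
  moreover have "integral\<^sup>L \<mu> (\<lambda>t. \<Sum>k. f k t) = \<phi> \<mu> z"
    unfolding \<phi>_def
  proof (rule integral_cong_AE)
    show "AE t in \<mu>. (\<Sum>k. f k t) = z / (z\<^sup>2 - t\<^sup>2)"
      using supp
    proof eventually_elim
      case (elim t)
      have n: "norm (t / z) < 1" "norm (- t / z) < 1" using elim z b0 by auto
      have "(\<lambda>k. ((t / z) ^ k + (- t / z) ^ k) / (2 * z)) sums ((1 / (1 - t / z) + 1 / (1 - - t / z)) / (2 * z))"
        by (intro sums_divide sums_add geometric_sums n)
      moreover have "((t / z) ^ k + (- t / z) ^ k) / (2 * z) = f k t" for k
        using zp by (cases "even k") (simp_all add: f_def power_divide)
      ultimately have "(\<Sum>k. f k t) = (1 / (1 - t / z) + 1 / (1 - - t / z)) / (2 * z)"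
        by (simp add: sums_iff)
      also have "\<dots> = z / (z\<^sup>2 - t\<^sup>2)"
      proof -
        have nz: "z - t \<noteq> 0" "z + t \<noteq> 0" "z \<noteq> 0" using elim z b0 by auto
        have "1 / (1 - t / z) = z / (z - t)" "1 / (1 - - t / z) = z / (z + t)" using nz by (simp_all add: field_simps)
        then have "(1 / (1 - t / z) + 1 / (1 - - t / z)) / (2 * z) = (z / (z - t) + z / (z + t)) / (2 * z)" by simp
        also have "z / (z - t) + z / (z + t) = (2 * z) * (z / ((z - t) * (z + t)))"
          using nz by (simp add: add_frac_eq) (simp add: algebra_simps)
        also have "\<dots> / (2 * z) = z / ((z - t) * (z + t))" using nz by simp
        finally show ?thesis by (simp add: power2_eq_square algebra_simps)
      qed
      finally show ?case .
    qed
  qed (simp_all add: f_def)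
  moreover have "integral\<^sup>L \<mu> (f k) = L1 k / z ^ (k + 1)" for k
  proof -
    have "f k = (\<lambda>t. (if even k then t ^ k else 0) / z ^ (k + 1))" by (rule ext) (simp add: f_def)
    then show ?thesis by (simp add: L1_def even_moments_def)
  qed
  ultimately show ?thesis by (simp add: stieltjes_def sums_iff)
qed

text \<open>\<open>mix_dirac0\<close> is given by a set function, so countable additivity is checked
  first; integrals of nonnegative functions then follow by induction over measurable functions. The
  integrand is nonnegative only almost everywhere, and this is verified for both measures.\<close>

lemma phi_mix: assumes z: "b < z" shows "\<phi> (mix_dirac0 c \<mu>) z = c * \<phi> \<mu> z + (1 - c) / z"
proof -
  have zp: "z > 0" using z b0 by simp
  let ?f = "\<lambda>t. z / (z\<^sup>2 - t\<^sup>2)"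
  let ?w = "\<lambda>t. c * indicator UNIV t :: real"
  define N where "N = mix_dirac0 c \<mu>"
  have em: "emeasure N A = ennreal c * emeasure \<mu> A + ennreal (1 - c) * indicator A 0" if "A \<in> sets borel" for A
    unfolding N_def mix_dirac0_def
  proof (rule emeasure_measure_of_sigma)
    show "sigma_algebra UNIV (sets (borel :: real measure))" using sets.sigma_algebra_axioms[of "borel :: real measure"] by simp
    show "positive (sets borel) (\<lambda>A. ennreal c * emeasure \<mu> A + ennreal (1 - c) * indicator A 0)" by (simp add: positive_def)
    show "countably_additive (sets borel) (\<lambda>A. ennreal c * emeasure \<mu> A + ennreal (1 - c) * indicator A 0)"
    proof (rule countably_additiveI)
      fix A :: "nat \<Rightarrow> real set" assume A: "range A \<subseteq> sets borel" "disjoint_family A" "\<Union> (range A) \<in> sets borel"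
      have "(\<Sum>i. emeasure \<mu> (A i)) = emeasure \<mu> (\<Union> (range A))" using A by (intro suminf_emeasure) (auto simp: events_eq_borel)
      moreover have "(\<Sum>i. indicator (A i) (0::real)) = (indicator (\<Union> (range A)) 0 :: ennreal)" using suminf_indicator[OF A(2)] .
      ultimately show "(\<Sum>i. ennreal c * emeasure \<mu> (A i) + ennreal (1 - c) * indicator (A i) 0) =
         ennreal c * emeasure \<mu> (\<Union> (range A)) + ennreal (1 - c) * indicator (\<Union> (range A)) 0"
        by (simp add: suminf_add[symmetric] ennreal_suminf_cmult)
    qed
    show "A \<in> sets borel" by (rule that)
  qed
  have sN: "sets N = sets borel" "space N = UNIV"
    unfolding N_def mix_dirac0_def using sets.sigma_sets_eq[of "borel :: real measure"] by simp_all
  have nn: "(\<integral>\<^sup>+t. g t \<partial>N) = ennreal c * (\<integral>\<^sup>+t. g t \<partial>\<mu>) + ennreal (1 - c) * g 0" if "g \<in> borel_measurable borel" for g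
    using that
  proof (induction rule: borel_measurable_induct)
    case (cong f g)
    then show ?case by (simp add: space_borel cong: nn_integral_cong)
  next
    case (set A)
    then show ?case using em[of A] by (simp add: sN events_eq_borel)
  next
    case (mult u c')
    then show ?case by (simp add: nn_integral_cmult sN events_eq_borel measurable_cong_sets[OF sN(1) refl] measurable_cong_sets[OF events_eq_borel refl] distrib_left mult_ac)
  next
    case (add u v)
    then show ?case by (simp add: nn_integral_add measurable_cong_sets[OF sN(1) refl] measurable_cong_sets[OF events_eq_borel refl] distrib_left add_ac)
  next
    case (seq U)
    have "(\<integral>\<^sup>+t. (SUP i. U i t) \<partial>N) = (SUP i. \<integral>\<^sup>+t. U i t \<partial>N)"
      using seq by (intro nn_integral_monotone_convergence_SUP) (auto simp: measurable_cong_sets[OF sN(1) refl])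
    moreover have "(\<integral>\<^sup>+t. (SUP i. U i t) \<partial>\<mu>) = (SUP i. \<integral>\<^sup>+t. U i t \<partial>\<mu>)"
      using seq by (intro nn_integral_monotone_convergence_SUP) (auto simp: measurable_cong_sets[OF events_eq_borel refl])
    moreover have "(SUP i. ennreal c * (\<integral>\<^sup>+t. U i t \<partial>\<mu>) + ennreal (1 - c) * U i 0) =
        (SUP i. ennreal c * (\<integral>\<^sup>+t. U i t \<partial>\<mu>)) + (SUP i. ennreal (1 - c) * U i 0)"
      using seq(3) by (intro ennreal_SUP_add)
        (auto simp: incseq_def le_fun_def intro!: mult_left_mono nn_integral_mono)
    ultimately show ?case using seq by (simp add: SUP_mult_left_ennreal image_comp)
  qed
  have fm: "?f \<in> borel_measurable borel" by measurable
  have ae: "AE t in \<mu>. 0 \<le> ?f t"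
    using supp
  proof eventually_elim
    case (elim t)
    then have "t\<^sup>2 \<le> z\<^sup>2" using z by (intro power_mono) auto
    then show ?case using zp by simp
  qed
  \<comment> \<open>The atom at 0 avoids the exceptional set because the integrand is 1 / z > 0
    there.\<close>
  have aeN: "AE t in N. 0 \<le> ?f t"
  proof (rule AE_I'[where N = "{t. \<not> 0 \<le> ?f t}"])
    have "emeasure \<mu> {t. \<not> 0 \<le> ?f t} = 0" using ae AE_iff_measurable[of "{t. \<not> 0 \<le> ?f t}" \<mu> "\<lambda>t. 0 \<le> ?f t"] by (simp add: events_eq_borel)
    then show "{t. \<not> 0 \<le> ?f t} \<in> null_sets N" using zp by (simp add: null_sets_def sN em)
  qed auto
  have "\<phi> N z = enn2real (\<integral>\<^sup>+t. ennreal (?f t) \<partial>N)"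
    unfolding \<phi>_def by (rule integral_eq_nn_integral[OF _ aeN]) (use fm in \<open>simp add: measurable_cong_sets[OF sN(1) refl]\<close>)
  also have "(\<integral>\<^sup>+t. ennreal (?f t) \<partial>N) = ennreal c * (\<integral>\<^sup>+t. ennreal (?f t) \<partial>\<mu>) + ennreal (1 - c) * ennreal (?f 0)"
    by (rule nn) simp
  also have "(\<integral>\<^sup>+t. ennreal (?f t) \<partial>\<mu>) = ennreal (\<phi> \<mu> z)"
    unfolding \<phi>_def
  proof (rule nn_integral_eq_integral[OF integrable_const_bound[of _ "z / (z\<^sup>2 - b\<^sup>2)"] ae])
    show "AE t in \<mu>. norm (?f t) \<le> z / (z\<^sup>2 - b\<^sup>2)"
      using supp
    proof eventually_elim
      case (elim t)
      have "t\<^sup>2 \<le> b\<^sup>2" "b\<^sup>2 < z\<^sup>2" using elim z b0 by (auto intro: power_mono power_strict_mono)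
      then show ?case using zp by (simp add: frac_le)
    qed
  qed simp
  also have "ennreal c * ennreal (\<phi> \<mu> z) + ennreal (1 - c) * ennreal (?f 0) = ennreal (c * \<phi> \<mu> z + (1 - c) / z)"
  proof -
    have "\<phi> \<mu> z \<ge> 0" unfolding \<phi>_def by (rule integral_nonneg_AE[OF ae])
    then show ?thesis using c zp by (simp add: ennreal_mult[symmetric] ennreal_plus[symmetric] power2_eq_square del: ennreal_plus)
  qed
  also have "enn2real \<dots> = c * \<phi> \<mu> z + (1 - c) / z"
  proof -
    have "\<phi> \<mu> z \<ge> 0" unfolding \<phi>_def by (rule integral_nonneg_AE[OF ae])
    then have "0 \<le> c * \<phi> \<mu> z + (1 - c) / z" using c zp by simp
    then show ?thesis by (rule enn2real_ennreal)
  qed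
  finally show ?thesis unfolding N_def .
qed

lemma stieltjes_L2: assumes z: "b < z" shows "stieltjes L2 z = c * \<phi> \<mu> z + (1 - c) / z"
proof -
  note s = moment_seq.summable[OF moment_seq1 z]
  have "L2 k / z ^ (k + 1) = c * (L1 k / z ^ (k + 1)) + (if k = 0 then (1 - c) / z else 0)" for k
    using moment_seq.L0[OF moment_seq1] by (simp add: L2_def L1_def diff_divide_distrib)
  moreover have "(\<lambda>k. c * (L1 k / z ^ (k + 1)) + (if k = 0 then (1 - c) / z else 0)) sums (c * stieltjes L1 z + (1 - c) / z)"
    unfolding stieltjes_def using sums_single[of 0 "\<lambda>_. (1 - c) / z"]
    by (intro sums_add sums_mult summable_sums[OF s]) (simp add: eq_commute)
  ultimately show ?thesis by (simp add: stieltjes_def sums_iff phi_eq[OF z])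
qed

lemma D_eq: assumes "b < z" shows "D_transform c \<mu> z = stieltjes L1 z * stieltjes L2 z"
  by (simp add: D_transform_def stieltjes_L2[OF assms] phi_eq[OF assms])

section \<open>Monotonicity and inversion of the D-transform\<close>

definition "D' z = - (stieltjes2 L1 z * stieltjes L2 z + stieltjes2 L2 z * stieltjes L1 z)"

lemma DERIV_D: assumes "b < z" shows "(D_transform c \<mu> has_field_derivative D' z) (at z)" "D' z < 0"
proof -
  have "((\<lambda>z. stieltjes L1 z * stieltjes L2 z) has_field_derivative D' z) (at z)"
    using moment_seq.DERIV_stieltjes(1)[OF moment_seq1 assms] moment_seq.DERIV_stieltjes(1)[OF moment_seq2 assms]
    by (auto intro!: derivative_eq_intros simp: D'_def)
  then show "(D_transform c \<mu> has_field_derivative D' z) (at z)"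
    by (rule DERIV_cong_ev[THEN iffD1, rotated 3, OF _ refl _ refl])
      (use D_eq eventually_nhds_in_open[of "{b<..}" z] assms in \<open>auto elim!: eventually_mono\<close>)
  have "0 < stieltjes2 L1 z * stieltjes L2 z" "0 < stieltjes2 L2 z * stieltjes L1 z"
    using moment_seq.stieltjes_pos[OF moment_seq1 assms] moment_seq.stieltjes_pos[OF moment_seq2 assms]
      moment_seq.stieltjes2_pos[OF moment_seq1 assms] moment_seq.stieltjes2_pos[OF moment_seq2 assms]
    by simp_all
  then show "D' z < 0" unfolding D'_def by linarith
qed

lemma D_strict_decreasing: assumes "b < x" "x < y" shows "D_transform c \<mu> y < D_transform c \<mu> x"
proof (rule DERIV_neg_imp_decreasing[OF assms(2)])
  fix t assume "x \<le> t" "t \<le> y"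
  then show "\<exists>d. (D_transform c \<mu> has_field_derivative d) (at t) \<and> d < 0" using DERIV_D[of t] assms by auto
qed

lemma D_pos: "b < z \<Longrightarrow> 0 < D_transform c \<mu> z"
  by (simp add: D_eq moment_seq.stieltjes_pos[OF moment_seq1] moment_seq.stieltjes_pos[OF moment_seq2])

lemma D_small: assumes "e > 0" shows "\<exists>z>b. D_transform c \<mu> z < e"
proof -
  \<comment> \<open>Far enough to the right that both factors of D, each at most
    \<open>1 / (z - b)\<close>, are below \<open>sqrt e\<close>.\<close>
  define z where "z = b + 1 + 1 / sqrt e"
  have z: "b < z" "z - b > 1 / sqrt e" using assms by (simp_all add: z_def add_pos_pos)
  have "1 / (z - b) < 1 / (1 / sqrt e)" using z assms by (intro divide_strict_left_mono) auto
  then have le: "1 / (z - b) < sqrt e" by simp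
  have "D_transform c \<mu> z \<le> (1 / (z - b)) * (1 / (z - b))"
    unfolding D_eq[OF z(1)] using z
    by (intro mult_mono moment_seq.stieltjes_le moment_seq1 moment_seq2 less_imp_le[OF moment_seq.stieltjes_pos[OF moment_seq2]]) auto
  also have "\<dots> < sqrt e * sqrt e" using le z assms by (intro mult_strict_mono) auto
  also have "\<dots> = e" using assms by simp
  finally show ?thesis using z(1) by blast
qed

text \<open>D decreases on the half-line, so when bounded it tends to its supremum at the edge. This
  excludes an infinite edge value in the argument by contradiction that follows.\<close>

lemma D_edge_le:
  assumes b: "b = sup_support \<mu>" and le: "\<And>z. b < z \<Longrightarrow> D_transform c \<mu> z \<le> B"
  shows "\<exists>l. 0 < l \<and> l \<le> B \<and> D_edge c \<mu> = ereal l"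
proof -
  let ?D = "D_transform c \<mu>"
  define l where "l = (SUP z\<in>{b<..}. ?D z)"
  have bdd: "bdd_above (?D ` {b<..})" using le by (auto intro!: bdd_aboveI[of _ B])
  have ge: "?D z \<le> l" if "b < z" for z unfolding l_def using that bdd by (intro cSUP_upper) auto
  have "(?D \<longlongrightarrow> l) (at_right b)"
  proof (rule tendstoI)
    fix e :: real assume "e > 0"
    then have "l - e < (SUP z\<in>{b<..}. ?D z)" by (simp add: l_def)
    then obtain z0 where z0: "b < z0" "l - e < ?D z0" by (subst (asm) less_cSUP_iff[OF _ bdd]) auto
    have "eventually (\<lambda>z. z \<in> {b<..<z0}) (at_right b)" using z0(1) by (rule eventually_at_right_real)
    then show "eventually (\<lambda>z. dist (?D z) l < e) (at_right b)"
    proof eventually_elim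
      case (elim z)
      then have "?D z0 < ?D z" "?D z \<le> l" using D_strict_decreasing[of z z0] ge by auto
      then show ?case using z0(2) \<open>e > 0\<close> by (simp add: dist_real_def)
    qed
  qed
  then have "((\<lambda>z. ereal (?D z)) \<longlongrightarrow> ereal l) (at_right b)" by simp
  then have "D_edge c \<mu> = ereal l" unfolding D_edge_def b[symmetric] by (intro tendsto_Lim) auto
  moreover have "0 < l" using ge[of "b + 1"] D_pos[of "b + 1"] by simp
  moreover have "l \<le> B" unfolding l_def using le by (intro cSUP_least) auto
  ultimately show ?thesis by blast
qed

text \<open>If D stayed at or below \<open>1 / t^2\<close>, so would its edge value l, and
  \<open>theta_bar\<close>, which is then \<open>1 / sqrt l\<close>, would be at least t. Hence D
  exceeds \<open>1 / t^2\<close> somewhere; far out it is smaller, and the intermediate value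
  theorem with strict monotonicity gives the unique solution.\<close>

lemma D_inverse_spec:
  assumes b: "b = sup_support \<mu>" and t: "t > theta_bar c \<mu>" "t > 0"
  defines "\<rho> \<equiv> D_inverse c \<mu> (1 / t\<^sup>2)"
  shows "b < \<rho>" "D_transform c \<mu> \<rho> = 1 / t\<^sup>2"
proof -
  let ?D = "D_transform c \<mu>"
  have "\<exists>z>b. 1 / t\<^sup>2 < ?D z"
  proof (rule ccontr)
    assume "\<not> ?thesis"
    then have "\<And>z. b < z \<Longrightarrow> ?D z \<le> 1 / t\<^sup>2" by (meson not_less)
    from D_edge_le[OF b this] obtain l where l: "0 < l" "l \<le> 1 / t\<^sup>2" "D_edge c \<mu> = ereal l" by blast
    have "theta_bar c \<mu> = l powr (- 1 / 2)" by (simp add: theta_bar_def l)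
    also have "\<dots> = 1 / sqrt l" using l by (simp add: powr_minus_divide powr_half_sqrt)
    finally have "1 / sqrt l < t" using t by simp
    moreover have "sqrt l \<le> 1 / t" using l(2) t(2) real_sqrt_le_mono[OF l(2)] by (simp add: real_sqrt_divide)
    then have "t \<le> 1 / sqrt l" using l(1) t(2) by (simp add: field_simps)
    ultimately show False by simp
  qed
  then obtain z1 where z1: "b < z1" "1 / t\<^sup>2 < ?D z1" by blast
  obtain z2 where z2: "b < z2" "?D z2 < 1 / t\<^sup>2" using D_small[of "1 / t\<^sup>2"] t by auto
  have lt: "z1 < z2"
    using D_strict_decreasing[OF z2(1), of z1] z1 z2 by (cases z1 z2 rule: linorder_cases) auto
  have "\<exists>z\<ge>z1. z \<le> z2 \<and> ?D z = 1 / t\<^sup>2"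
    using lt z1 z2 by (intro IVT2) (auto intro!: DERIV_isCont[OF DERIV_D(1)])
  then obtain z where z': "z1 \<le> z" "?D z = 1 / t\<^sup>2" by blast
  then have z: "b < z" "?D z = 1 / t\<^sup>2" using z1 by simp_all
  have inj: "inj_on ?D {b<..}"
    using D_strict_decreasing by (intro linorder_inj_onI) fastforce+
  have "\<rho> = z"
    unfolding \<rho>_def D_inverse_def b[symmetric] using z by (intro the_inv_into_f_eq[OF inj]) auto
  then show "b < \<rho>" "?D \<rho> = 1 / t\<^sup>2" using z by simp_all
qed

end

section \<open>Weak convergence of the singular value distributions\<close>

text \<open>The complement of the support is a union of open null sets, of which countably many
  suffice by Lindelof; compactness makes the supremum an upper bound of the support.\<close>

lemma AE_le_sup_support:
  assumes \<mu>: "real_distribution \<mu>" and c: "compact (measure_support \<mu>)"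
  shows "AE t in \<mu>. t \<le> sup_support \<mu>"
proof -
  interpret real_distribution \<mu> by (rule \<mu>)
  define \<F> where "\<F> = {U. open U \<and> emeasure \<mu> U = 0}"
  obtain \<F>' where F': "\<F>' \<subseteq> \<F>" "countable \<F>'" "\<Union>\<F>' = \<Union>\<F>"
    using Lindelof[of \<F>] by (auto simp: \<F>_def)
  have "AE t in \<mu>. \<forall>U\<in>\<F>'. t \<notin> U"
  proof (subst AE_ball_countable[OF F'(2)], rule ballI)
    fix U assume "U \<in> \<F>'"
    then have "open U" "emeasure \<mu> U = 0" using F'(1) by (auto simp: \<F>_def)
    then have "U \<in> null_sets \<mu>" by (simp add: null_sets_def)
    then show "AE t in \<mu>. t \<notin> U" by (rule AE_not_in)
  qed
  then show ?thesis
  proof eventually_elim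
    case (elim t)
    have "t \<in> measure_support \<mu>"
    proof (rule ccontr)
      assume "t \<notin> measure_support \<mu>"
      then obtain U where "open U" "t \<in> U" "emeasure \<mu> U = 0"
        by (auto simp: measure_support_def zero_less_iff_neq_zero)
      then have "t \<in> \<Union>\<F>" by (auto simp: \<F>_def)
      then show False using elim F'(3) by blast
    qed
    then show ?case unfolding sup_support_def
      using compact_imp_bounded[OF c] by (intro cSup_upper bounded_imp_bdd_above)
  qed
qed

text \<open>Powers are unbounded test functions. As the largest point tends to b, capping at
  \<open>b + 1\<close> changes nothing for large n, and nothing \<mu>-almost everywhere.\<close>

lemma weak_limit_empirical:
  assumes \<mu>: "real_distribution \<mu>"
    and w: "weak_conv_m (\<lambda>n. distr (uniform_count_measure {..<n}) borel (s n)) \<mu>"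
    and s: "\<And>n i. i < n \<Longrightarrow> 0 \<le> s n i" "\<And>n i. i < n \<Longrightarrow> s n i \<le> s n 0"
    and b: "(\<lambda>n. s n 0) \<longlonglongrightarrow> b" and supp: "AE t in \<mu>. t \<le> b"
  shows "0 \<le> b" "AE t in \<mu>. 0 \<le> t \<and> t \<le> b"
    "(\<lambda>n. (\<Sum>i<n. s n i ^ k) / real n) \<longlonglongrightarrow> (\<integral>t. t ^ k \<partial>\<mu>)"
proof -
  interpret real_distribution \<mu> by (rule \<mu>)
  let ?N = "\<lambda>n. distr (uniform_count_measure {..<n}) borel (s n)"
  have m: "s n \<in> measurable (uniform_count_measure {..<n}) borel" for n
    by (simp add: measurable_def space_uniform_count_measure sets_uniform_count_measure)
  \<comment> \<open>Shifted by one, since the uniform measure on the empty set is not a probability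
    measure.\<close>
  have rd: "real_distribution (?N (Suc n))" for n
  proof -
    interpret U: prob_space "uniform_count_measure {..<Suc n}" by (rule prob_space_uniform_count_measure) auto
    show ?thesis by (intro U.real_distribution_distr m)
  qed
  have w': "weak_conv_m (\<lambda>n. ?N (Suc n)) \<mu>"
    using w unfolding weak_conv_m_def weak_conv_def by (auto intro: LIMSEQ_Suc)
  have int: "(\<integral>t. f t \<partial>?N (Suc n)) = (\<Sum>i<Suc n. f (s (Suc n) i)) / real (Suc n)"
    if "f \<in> borel_measurable borel" for f :: "real \<Rightarrow> real" and n
  proof -
    have "(\<integral>t. f t \<partial>?N (Suc n)) = (\<integral>i. f (s (Suc n) i) \<partial>uniform_count_measure {..<Suc n})"
      by (rule integral_distr[OF m that])
    also have "\<dots> = (\<Sum>i<Suc n. 1 / real (card {..<Suc n}) * f (s (Suc n) i))"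
      unfolding uniform_count_measure_def by (subst lebesgue_integral_point_measure_finite) simp_all
    also have "\<dots> = (\<Sum>i<Suc n. f (s (Suc n) i)) / real (Suc n)"
      by (simp only: card_lessThan sum_divide_distrib) simp
    finally show ?thesis .
  qed
  have conv: "(\<lambda>n. (\<Sum>i<n. f (s n i)) / real n) \<longlonglongrightarrow> (\<integral>t. f t \<partial>\<mu>)"
    if f: "\<And>x. isCont f x" "\<And>x. norm (f x) \<le> B" for f :: "real \<Rightarrow> real" and B
  proof -
    have fm: "f \<in> borel_measurable borel" using f(1) by (intro borel_measurable_continuous_onI continuous_at_imp_continuous_on) auto
    have "(\<lambda>n. \<integral>t. f t \<partial>?N (Suc n)) \<longlonglongrightarrow> (\<integral>t. f t \<partial>\<mu>)"
      by (rule weak_conv_imp_integral_bdd_continuous_conv[OF rd \<mu> w' f])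
    then have "(\<lambda>n. (\<Sum>i<Suc n. f (s (Suc n) i)) / real (Suc n)) \<longlonglongrightarrow> (\<integral>t. f t \<partial>\<mu>)"
      by (simp only: int[OF fm])
    then show ?thesis by (rule LIMSEQ_imp_Suc)
  qed
  show b0: "0 \<le> b"
    by (rule LIMSEQ_le_const[OF b]) (auto intro!: exI[of _ 1] s)
  \<comment> \<open>Bounded, continuous and positive exactly on the negative reals, to which the
    empirical measures give no mass.\<close>
  define g where "g t = min 1 (max 0 (- t))" for t :: real
  have [measurable]: "g \<in> borel_measurable borel" unfolding g_def[abs_def] by measurable
  have "(\<lambda>n. (\<Sum>i<n. g (s n i)) / real n) \<longlonglongrightarrow> (\<integral>t. g t \<partial>\<mu>)"
    by (rule conv[of _ 1]) (auto simp: g_def intro!: continuous_intros)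
  moreover have "(\<Sum>i<n. g (s n i)) = 0" for n
    using s(1) by (intro sum.neutral) (auto simp: g_def)
  ultimately have "(\<integral>t. g t \<partial>\<mu>) = 0" by (simp add: LIMSEQ_const_iff)
  moreover have "integrable \<mu> g" by (rule integrable_const_bound[of _ 1]) (auto simp: g_def)
  ultimately have "AE t in \<mu>. g t = 0"
    by (subst (asm) integral_nonneg_eq_0_iff_AE) (auto simp: g_def)
  then show sp: "AE t in \<mu>. 0 \<le> t \<and> t \<le> b"
    using supp by eventually_elim (auto simp: g_def min_def max_def split: if_splits)
  define f where "f t = (max 0 (min t (b + 1))) ^ k" for t :: real
  have "(\<lambda>n. (\<Sum>i<n. f (s n i)) / real n) \<longlonglongrightarrow> (\<integral>t. f t \<partial>\<mu>)"
  proof (rule conv[of _ "(b + 1) ^ k"])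
    show "isCont f x" for x unfolding f_def by (intro continuous_intros)
    show "norm (f x) \<le> (b + 1) ^ k" for x using b0 by (auto simp: f_def power_abs intro!: power_mono)
  qed
  moreover have "(\<integral>t. f t \<partial>\<mu>) = (\<integral>t. t ^ k \<partial>\<mu>)"
  proof (rule integral_cong_AE)
    show "AE t in \<mu>. f t = t ^ k" using sp by eventually_elim (simp add: f_def)
  qed (simp_all add: f_def)
  moreover have "\<forall>\<^sub>F n in sequentially. (\<Sum>i<n. f (s n i)) / real n = (\<Sum>i<n. s n i ^ k) / real n"
  proof -
    have "\<forall>\<^sub>F n in sequentially. s n 0 < b + 1" by (rule order_tendstoD(2)[OF b]) simp
    then show ?thesis
  proof eventually_elim
    case (elim n)
    have "f (s n i) = s n i ^ k" if "i < n" for i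
    proof -
      have "s n i \<le> b + 1" "0 \<le> s n i" using s(1,2)[OF that] elim by linarith+
      then show ?thesis by (simp add: f_def)
    qed
    then show ?case by simp
  qed
  qed
  ultimately show "(\<lambda>n. (\<Sum>i<n. s n i ^ k) / real n) \<longlonglongrightarrow> (\<integral>t. t ^ k \<partial>\<mu>)"
    by (simp only: Lim_transform_eventually)
qed

section \<open>Moments under a logarithmic Sobolev inequality\<close>

text \<open>
  The inequality is applied to \<open>f = q\<^sup>2\<close>, where \<open>q = w / (1 + \<epsilon> w)\<close> truncates \<open>w = 1 + |x|\<^sup>2\<close>. The squared
  gradient is at most \<open>16 q\<^sup>3\<close>, while the entropy of \<open>q\<^sup>4\<close> dominates \<open>ln R\<close> times its integral up
  to lower order terms; for large \<open>R\<close> this bounds the integral of \<open>q\<^sup>4\<close> uniformly in \<open>\<epsilon>\<close>.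
\<close>

lemma log_sobolev_eighth_moment:
  fixes \<nu> :: "'a :: euclidean_space measure"
  assumes \<nu>: "prob_space \<nu>" "sets \<nu> = sets borel" and var: "integrable \<nu> (\<lambda>x. (norm x)\<^sup>2)"
    and lsi: "log_sobolev \<nu>"
  shows "integrable \<nu> (\<lambda>x. norm x ^ 8)"
proof -
  interpret prob_space \<nu> by (rule \<nu>(1))
  have [measurable_cong]: "sets \<nu> = sets borel" by (rule \<nu>(2))
  define w where "w x = 1 + x \<bullet> x" for x :: 'a
  have w1: "w x \<ge> 1" and w0: "w x > 0" for x by (simp_all add: w_def add_pos_nonneg)
  have wn: "(norm x)\<^sup>2 \<le> w x" for x by (simp add: w_def power2_norm_eq_inner)
  have [measurable]: "w \<in> borel_measurable borel" unfolding w_def by measurable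
  have wi: "integrable \<nu> w"
    using var unfolding w_def power2_norm_eq_inner by simp
  define W where "W = (\<integral>x. w x \<partial>\<nu>)"
  have W1: "W \<ge> 1"
    using integral_mono[OF integrable_const[of 1] wi w1] by (simp add: W_def prob_space)
  from lsi obtain C where C: "C > 0" and ls0: "\<forall>(f :: 'a \<Rightarrow> real) (g :: 'a \<Rightarrow> 'a).
        (\<forall>x. GDERIV f x :> g x) \<and> continuous_on UNIV g \<and>
        integrable \<nu> (\<lambda>x. (f x)\<^sup>2) \<and> integrable \<nu> (\<lambda>x. (norm (g x))\<^sup>2) \<longrightarrow>
        integrable \<nu> (\<lambda>x. (f x)\<^sup>2 * ln ((f x)\<^sup>2 / (\<integral>y. (f y)\<^sup>2 \<partial>\<nu>))) \<and>
        (\<integral>x. (f x)\<^sup>2 * ln ((f x)\<^sup>2 / (\<integral>y. (f y)\<^sup>2 \<partial>\<nu>)) \<partial>\<nu>)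
          \<le> 2 * C * (\<integral>x. (norm (g x))\<^sup>2 \<partial>\<nu>)"
    unfolding log_sobolev_def by (elim exE conjE) (rule that)
  \<comment> \<open>Chosen so that \<open>ln R / 2\<close> exceeds \<open>W + 1 + 48 * C\<close>:
    the gradient bound 16 and the factor \<open>2 * C\<close> give 32 C, and 48 is 32 times the 3/2
    from the bound by \<open>m / 2 + m\<close>.\<close>
  define R where "R = exp (2 * (W + 2 + 48 * C))"
  have R1: "R \<ge> 1" using W1 C by (simp add: R_def)
  have lnR: "ln R = 2 * (W + 2 + 48 * C)" by (simp add: R_def)
  have bound: "(\<integral>x. (w x / (1 + \<epsilon> * w x)) ^ 4 \<partial>\<nu>) \<le> 2 * R ^ 3 * W"
    and int4: "integrable \<nu> (\<lambda>x. (w x / (1 + \<epsilon> * w x)) ^ 4)" if e: "\<epsilon> > 0" for \<epsilon>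
  proof -
    define q where "q x = w x / (1 + \<epsilon> * w x)" for x
    have den: "1 + \<epsilon> * w x \<ge> 1" for x using e w0[of x] by simp
    have q0: "q x > 0" for x using w0[of x] den[of x] by (simp add: q_def)
    have qw: "q x \<le> w x" for x
      using w0[of x] den[of x] by (simp add: q_def divide_le_eq mult_le_cancel_left1)
    have qe: "q x \<le> 1 / \<epsilon>" for x
    proof -
      have "w x \<le> 1 / \<epsilon> * (1 + \<epsilon> * w x)" using e by (simp add: distrib_left)
      then show ?thesis using den[of x] pos_divide_le_eq[of "1 + \<epsilon> * w x" "w x" "1 / \<epsilon>"] by (simp add: q_def)
    qed
    have [measurable]: "q \<in> borel_measurable borel" unfolding q_def by measurable
    have qi: "integrable \<nu> (\<lambda>x. q x ^ k)" for k
    proof (rule integrable_const_bound[of _ "(1 / \<epsilon>) ^ k"])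
      show "AE x in \<nu>. norm (q x ^ k) \<le> (1 / \<epsilon>) ^ k"
        using q0 qe by (intro AE_I2) (simp add: power_abs less_imp_le power_mono abs_of_pos)
    qed measurable
    show "integrable \<nu> (\<lambda>x. (w x / (1 + \<epsilon> * w x)) ^ 4)" using qi[of 4] by (simp only: q_def)
    have qW: "(\<integral>x. q x \<partial>\<nu>) \<le> W" unfolding W_def using qi[of 1] by (intro integral_mono[OF _ wi qw]) simp
    define f where "f x = (q x)\<^sup>2" for x
    define g where "g x = (4 * q x / (1 + \<epsilon> * w x)\<^sup>2) *\<^sub>R x" for x
    have gd: "GDERIV f x :> g x" for x
    proof -
      have "((\<lambda>x. 1 + x \<bullet> x) has_derivative (\<lambda>h. h \<bullet> (2 *\<^sub>R x))) (at x)"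
        by (auto intro!: derivative_eq_intros simp: inner_commute)
      then have gw: "GDERIV w x :> 2 *\<^sub>R x" unfolding gderiv_def w_def .
      have nz: "1 + \<epsilon> * w x \<noteq> 0" using den[of x] by simp
      have "((\<lambda>t. (t / (1 + \<epsilon> * t))\<^sup>2) has_real_derivative 2 * q x * (1 / (1 + \<epsilon> * w x)\<^sup>2)) (at (w x))"
      proof -
        have "((\<lambda>t. t / (1 + \<epsilon> * t)) has_real_derivative (1 * (1 + \<epsilon> * w x) - w x * \<epsilon>) / ((1 + \<epsilon> * w x) * (1 + \<epsilon> * w x))) (at (w x))"
          using nz by (intro DERIV_divide) (auto intro!: derivative_eq_intros)
        then have "((\<lambda>t. t / (1 + \<epsilon> * t)) has_real_derivative 1 / (1 + \<epsilon> * w x)\<^sup>2) (at (w x))"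
          by (simp add: power2_eq_square algebra_simps)
        from DERIV_power[OF this, of 2] show ?thesis by (simp add: q_def mult_ac)
      qed
      from GDERIV_DERIV_compose[OF gw this]
      show ?thesis by (simp add: f_def[abs_def] q_def[abs_def] g_def mult_ac)
    qed
    have gc: "continuous_on UNIV g"
    proof -
      have "1 + \<epsilon> * (1 + x \<bullet> x) \<noteq> 0" for x :: 'a using den[of x] unfolding w_def by linarith
      then show ?thesis unfolding g_def q_def w_def by (intro continuous_intros) auto
    qed
    have gn: "(norm (g x))\<^sup>2 \<le> 16 * q x ^ 3" for x
    proof -
      define d where "d = 1 + \<epsilon> * w x"
      have d: "d \<ge> 1" using den by (simp add: d_def)
      have "(norm (g x))\<^sup>2 = 16 * (q x)\<^sup>2 * ((norm x)\<^sup>2 / d ^ 4)"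
        by (simp add: g_def d_def power_mult_distrib power_divide)
      also have "\<dots> \<le> 16 * (q x)\<^sup>2 * q x"
      proof (rule mult_left_mono)
        \<comment> \<open>Three of the four factors d, each at least 1, are dropped; what remains is
          q.\<close>
        have "(norm x)\<^sup>2 / d ^ 4 \<le> w x / d"
          using wn[of x] d w0[of x] power_increasing[of 1 4 d] by (intro frac_le) auto
        then show "(norm x)\<^sup>2 / d ^ 4 \<le> q x" by (simp add: q_def d_def)
      qed simp
      finally show ?thesis by (simp add: power2_eq_square power3_eq_cube mult_ac)
    qed
    have f2: "(f x)\<^sup>2 = q x ^ 4" for x by (simp add: f_def power_mult[symmetric])
    define m where "m = (\<integral>x. q x ^ 4 \<partial>\<nu>)"
    have gi: "integrable \<nu> (\<lambda>x. (norm (g x))\<^sup>2)"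
    proof (rule Bochner_Integration.integrable_bound)
      show "integrable \<nu> (\<lambda>x. 16 * q x ^ 3)" using qi[of 3] by simp
      show "(\<lambda>x. (norm (g x))\<^sup>2) \<in> borel_measurable \<nu>" unfolding g_def by measurable
      show "AE x in \<nu>. norm ((norm (g x))\<^sup>2) \<le> norm (16 * q x ^ 3)"
        using gn q0 by (intro AE_I2) (simp add: abs_of_pos)
    qed
    have m0: "m > 0"
    proof -
      have "m \<ge> 0" unfolding m_def using q0 by (intro integral_nonneg_AE AE_I2) (simp add: less_imp_le)
      moreover have "m \<noteq> 0"
      proof
        assume "m = 0"
        then have "AE x in \<nu>. q x ^ 4 = 0"
          unfolding m_def using qi[of 4] q0 by (subst (asm) integral_nonneg_eq_0_iff_AE) (auto simp: less_imp_le)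
        then have "AE x in \<nu>. False"
        proof eventually_elim
          case (elim x)
          with q0[of x] show ?case by simp
        qed
        then show False by (simp add: AE_False)
      qed
      ultimately show ?thesis by simp
    qed
    have "(\<forall>x. GDERIV f x :> g x) \<and> continuous_on UNIV g \<and>
        integrable \<nu> (\<lambda>x. (f x)\<^sup>2) \<and> integrable \<nu> (\<lambda>x. (norm (g x))\<^sup>2)"
      using gd gc gi qi[of 4] unfolding f2 by (intro conjI allI)
    from mp[OF spec[OF spec[OF ls0]] this]
    have lsm0: "integrable \<nu> (\<lambda>x. q x ^ 4 * ln (q x ^ 4 / m)) \<and>
      (\<integral>x. q x ^ 4 * ln (q x ^ 4 / m) \<partial>\<nu>) \<le> 2 * C * (\<integral>x. (norm (g x))\<^sup>2 \<partial>\<nu>)"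
      unfolding f2 m_def .
    note lsm = conjunct1[OF lsm0] conjunct2[OF lsm0]
    have "(\<integral>x. (norm (g x))\<^sup>2 \<partial>\<nu>) \<le> (\<integral>x. 16 * (R\<^sup>2 * q x + q x ^ 4 / R) \<partial>\<nu>)"
    proof (rule integral_mono[OF gi])
      show "integrable \<nu> (\<lambda>x. 16 * (R\<^sup>2 * q x + q x ^ 4 / R))" using qi[of 1] qi[of 4] by simp
      fix x
      \<comment> \<open>Splitting at q = R makes the cubic gradient term small relative to the
        fourth power; the remainder is linear in q, hence controlled by \<open>W\<close>.\<close>
      have "q x ^ 3 \<le> R\<^sup>2 * q x + q x ^ 4 / R"
      proof (cases "q x \<le> R")
        case True
        then have "(q x)\<^sup>2 * q x \<le> R\<^sup>2 * q x" using q0[of x] by (intro mult_right_mono power_mono) auto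
        moreover have "0 \<le> q x ^ 4 / R" using q0[of x] R1 by simp
        ultimately show ?thesis by (simp add: power3_eq_cube power2_eq_square)
      next
        case False
        then have "q x ^ 3 * R \<le> q x ^ 3 * q x" using q0[of x] by (intro mult_left_mono) auto
        then have "q x ^ 3 \<le> q x ^ 4 / R" using R1 by (simp add: field_simps eval_nat_numeral)
        moreover have "0 \<le> R\<^sup>2 * q x" using q0[of x] by simp
        ultimately show ?thesis by simp
      qed
      then show "(norm (g x))\<^sup>2 \<le> 16 * (R\<^sup>2 * q x + q x ^ 4 / R)" using gn[of x] by simp
    qed
    also have "\<dots> = 16 * (R\<^sup>2 * (\<integral>x. q x \<partial>\<nu>) + m / R)" using qi[of 1] qi[of 4] by (simp add: m_def)
    also have "\<dots> \<le> 16 * (R\<^sup>2 * W + m / R)" using qW by (simp add: mult_left_mono)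
    finally have up: "(\<integral>x. q x ^ 4 * ln (q x ^ 4 / m) \<partial>\<nu>) \<le> 32 * C * (R\<^sup>2 * W + m / R)"
      using lsm(2) C by (simp add: mult_left_mono order_trans)
    \<comment> \<open>Where q exceeds R the entropy density gains the factor \<open>ln R\<close>;
      elsewhere the subtracted terms linear in q and the constant outweigh this gain.\<close>
    have pt: "q x ^ 4 * ln (q x ^ 4 / m) \<ge> ln R * q x ^ 4 - ln R * (R ^ 3 * q x) - m * q x - m" for x
    proof -
      define t where "t = q x ^ 4 / m"
      have t0: "t > 0" using q0[of x] m0 by (simp add: t_def)
      \<comment> \<open>The tangent bound for the convex function \<open>t * ln t\<close>, used with
        \<open>s = 0\<close> and with \<open>s = ln R\<close>.\<close>
      have gibbs: "t * ln t \<ge> t * s - exp (s - 1)" for s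
      proof -
        have "1 + (s - 1 - ln t) \<le> exp (s - 1 - ln t)" by (rule exp_ge_add_one_self)
        then have "t * (s - ln t) \<le> t * exp (s - 1 - ln t)" using t0 by (intro mult_left_mono) auto
        also have "\<dots> = exp (s - 1)" using t0 by (simp add: exp_diff)
        finally show ?thesis by (simp add: algebra_simps)
      qed
      have "t * ln t \<ge> ln R * t - ln R * (R ^ 3 * q x) / m - q x - 1"
      proof (cases "q x \<le> R")
        case True
        then have "q x ^ 3 * q x \<le> R ^ 3 * q x" using q0[of x] by (intro mult_right_mono power_mono) auto
        then have "t \<le> R ^ 3 * q x / m" using m0 by (simp add: t_def divide_right_mono eval_nat_numeral)
        then have "ln R * t \<le> ln R * (R ^ 3 * q x) / m"
          using R1 mult_left_mono[of t "R ^ 3 * q x / m" "ln R"] by simp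
        moreover have "t * ln t \<ge> - exp (0 - 1)" using gibbs[of 0] by simp
        moreover have "exp (0 - 1 :: real) \<le> 1" by simp
        ultimately show ?thesis using q0[of x] by linarith
      next
        case False
        have "exp (ln R - 1) \<le> exp (ln R)" by simp
        also have "\<dots> = R" using R1 by simp
        finally have "exp (ln R - 1) \<le> q x" using False by simp
        moreover have "0 \<le> ln R * (R ^ 3 * q x) / m" using R1 q0[of x] m0 by simp
        ultimately show ?thesis using gibbs[of "ln R"] by (simp add: mult.commute)
      qed
      then have "m * (ln R * t - ln R * (R ^ 3 * q x) / m - q x - 1) \<le> m * (t * ln t)"
        using m0 by (intro mult_left_mono) auto
      moreover have "m * (ln R * t - ln R * (R ^ 3 * q x) / m - q x - 1) = ln R * q x ^ 4 - ln R * (R ^ 3 * q x) - m * q x - m"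
        using m0 by (simp add: t_def field_simps)
      moreover have "m * (t * ln t) = q x ^ 4 * ln (q x ^ 4 / m)" using m0 by (simp add: t_def)
      ultimately show ?thesis by simp
    qed
    have "(\<integral>x. ln R * q x ^ 4 - ln R * (R ^ 3 * q x) - m * q x - m \<partial>\<nu>) \<le> (\<integral>x. q x ^ 4 * ln (q x ^ 4 / m) \<partial>\<nu>)"
      using qi[of 1] qi[of 4] by (intro integral_mono lsm(1) pt) auto
    moreover have "(\<integral>x. ln R * q x ^ 4 - ln R * (R ^ 3 * q x) - m * q x - m \<partial>\<nu>) =
        ln R * m - (ln R * R ^ 3 + m) * (\<integral>x. q x \<partial>\<nu>) - m"
      using qi[of 1] qi[of 4] by (simp add: m_def prob_space algebra_simps)
    moreover have "(ln R * R ^ 3 + m) * (\<integral>x. q x \<partial>\<nu>) \<le> (ln R * R ^ 3 + m) * W"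
      using qW R1 m0 by (intro mult_left_mono) auto
    ultimately have main: "ln R * m - (ln R * R ^ 3 + m) * W - m \<le> 32 * C * (R\<^sup>2 * W + m / R)"
      using up by linarith
    \<comment> \<open>Otherwise the entropy inequality would give
      \<open>ln R / 2 \<le> W + 1 + 48 * C\<close>, against the choice of R.\<close>
    have "m \<le> 2 * R ^ 3 * W"
    proof (rule ccontr)
      assume "\<not> ?thesis"
      then have big: "2 * R ^ 3 * W < m" by simp
      have l0: "0 < ln R" using lnR W1 C by simp
      have a1: "ln R * (R ^ 3 * W) \<le> ln R * (m / 2)" using big l0 by (intro mult_left_mono) auto
      have "R\<^sup>2 * W \<le> R ^ 3 * W" using R1 W1 by (intro mult_right_mono power_increasing) auto
      then have "R\<^sup>2 * W + m / R \<le> m / 2 + m" using big R1 m0 by (intro add_mono) (auto simp: divide_le_eq mult_le_cancel_left1)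
      then have a2: "32 * C * (R\<^sup>2 * W + m / R) \<le> 32 * C * (m / 2 + m)" using C by (intro mult_left_mono) auto
      have "ln R * m - ln R * (m / 2) - m * W - m \<le> 48 * C * m"
        using main a1 a2 by (simp add: algebra_simps)
      then have "m * (ln R / 2) \<le> m * (W + 1 + 48 * C)" by (simp add: algebra_simps)
      then have "ln R / 2 \<le> W + 1 + 48 * C" using m0 by simp
      then show False using lnR by simp
    qed
    then show "(\<integral>x. (w x / (1 + \<epsilon> * w x)) ^ 4 \<partial>\<nu>) \<le> 2 * R ^ 3 * W" by (simp only: m_def q_def)
  qed
  \<comment> \<open>The bound does not depend on \<epsilon>, so Fatou's lemma along \<epsilon> = 1 /
    (n + 1) removes the truncation.\<close>
  define u where "u n x = (w x / (1 + 1 / real (Suc n) * w x)) ^ 4" for n x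
  have [measurable]: "u n \<in> borel_measurable \<nu>" for n unfolding u_def by measurable
  have u0: "u n x \<ge> 0" for n x using w0[of x] by (simp add: u_def)
  have ulim: "(\<lambda>n. u n x) \<longlonglongrightarrow> w x ^ 4" for x
  proof -
    have "(\<lambda>n. (w x / (1 + 1 / real (Suc n) * w x)) ^ 4) \<longlonglongrightarrow> (w x / (1 + 0 * w x)) ^ 4"
      by (intro tendsto_intros lim_1_over_n[THEN LIMSEQ_Suc]) auto
    then show ?thesis by (simp add: u_def)
  qed
  have "(\<integral>\<^sup>+x. ennreal (w x ^ 4) \<partial>\<nu>) = (\<integral>\<^sup>+x. liminf (\<lambda>n. ennreal (u n x)) \<partial>\<nu>)"
  proof (intro nn_integral_cong)
    fix x
    have "(\<lambda>n. ennreal (u n x)) \<longlonglongrightarrow> ennreal (w x ^ 4)" by (intro tendsto_ennrealI ulim)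
    then show "ennreal (w x ^ 4) = liminf (\<lambda>n. ennreal (u n x))" by (rule lim_imp_Liminf[OF sequentially_bot, symmetric])
  qed
  also have "\<dots> \<le> liminf (\<lambda>n. \<integral>\<^sup>+x. ennreal (u n x) \<partial>\<nu>)" by (rule nn_integral_liminf) measurable
  also have "\<dots> \<le> ennreal (2 * R ^ 3 * W)"
  proof (rule Liminf_le)
    have "(\<integral>\<^sup>+x. ennreal (u n x) \<partial>\<nu>) \<le> ennreal (2 * R ^ 3 * W)" for n
    proof -
      have i: "integrable \<nu> (u n)" unfolding u_def by (rule int4) simp
      have "(\<integral>\<^sup>+x. ennreal (u n x) \<partial>\<nu>) = ennreal (\<integral>x. u n x \<partial>\<nu>)"
        by (rule nn_integral_eq_integral[OF i]) (simp add: u0)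
      also have "\<dots> \<le> ennreal (2 * R ^ 3 * W)" unfolding u_def by (intro ennreal_leI bound) simp
      finally show ?thesis .
    qed
    then show "\<forall>\<^sub>F n in sequentially. (\<integral>\<^sup>+x. ennreal (u n x) \<partial>\<nu>) \<le> ennreal (2 * R ^ 3 * W)" by simp
  qed simp
  finally have "(\<integral>\<^sup>+x. ennreal (w x ^ 4) \<partial>\<nu>) < \<infinity>" by (rule le_less_trans) simp
  then have wi4: "integrable \<nu> (\<lambda>x. w x ^ 4)"
    by (intro integrableI_nonneg) (auto simp: less_imp_le[OF w0])
  show ?thesis
  proof (rule Bochner_Integration.integrable_bound[OF wi4])
    show "AE x in \<nu>. norm (norm x ^ 8) \<le> norm (w x ^ 4)"
    proof (rule AE_I2)
      fix x
      have "((norm x)\<^sup>2) ^ 4 \<le> w x ^ 4" by (intro power_mono wn) simp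
      then show "norm (norm x ^ 8) \<le> norm (w x ^ 4)" by (simp add: power_mult[symmetric])
    qed
  qed measurable
qed

section \<open>Fourth moments of quadratic forms\<close>

text \<open>
  The term linear in \<open>D\<close> is kept exact: in the induction over the index set below \<open>D\<close> is the increment
  caused by a new variable, and this term integrates to zero.
\<close>

lemma norm_add_fourth_le:
  fixes S D :: complex
  assumes "\<tau> > 0"
  shows "norm (S + D) ^ 4 \<le> (1 + \<tau>) * norm S ^ 4 + 4 * Re (of_real ((norm S)\<^sup>2) * cnj S * D) + (3 + 16 / \<tau>) * norm D ^ 4"
proof -
  define p where "p = (norm S)\<^sup>2"
  define d where "d = (norm D)\<^sup>2"
  define r where "r = Re (cnj S * D)"
  have pd: "p \<ge> 0" "d \<ge> 0" by (simp_all add: p_def d_def)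
  have e: "(norm (S + D))\<^sup>2 = p + 2 * r + d"
    unfolding p_def d_def r_def cmod_power2 by (simp add: power2_eq_square algebra_simps)
  have "\<bar>r\<bar> \<le> norm (cnj S * D)" unfolding r_def by (rule abs_Re_le_cmod)
  then have "r\<^sup>2 \<le> (norm (cnj S * D))\<^sup>2" by (metis abs_le_square_iff abs_norm_cancel)
  then have rr: "r\<^sup>2 \<le> p * d" by (simp add: p_def d_def norm_mult power_mult_distrib)
  have rd: "2 * r * d \<le> r\<^sup>2 + d\<^sup>2" using sum_squares_bound[of r d] by simp
  have "0 \<le> (\<tau> * p - 4 * d)\<^sup>2" by simp
  then have "8 * \<tau> * (p * d) \<le> \<tau>\<^sup>2 * p\<^sup>2 + 16 * d\<^sup>2" by (simp add: power2_eq_square algebra_simps)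
  then have "8 * \<tau> * (p * d) / \<tau> \<le> (\<tau>\<^sup>2 * p\<^sup>2 + 16 * d\<^sup>2) / \<tau>" using assms by (intro divide_right_mono) auto
  then have pdt: "8 * (p * d) \<le> \<tau> * p\<^sup>2 + 16 / \<tau> * d\<^sup>2" using assms by (simp add: add_divide_distrib power2_eq_square)
  have "norm (S + D) ^ 4 = ((norm (S + D))\<^sup>2)\<^sup>2" by (simp add: power_mult[symmetric])
  also have "\<dots> = p\<^sup>2 + 4 * r\<^sup>2 + d\<^sup>2 + 4 * p * r + 2 * (p * d) + 2 * (2 * r * d)"
    unfolding e by (simp add: power2_eq_square algebra_simps)
  also have "\<dots> \<le> p\<^sup>2 + 4 * p * r + 8 * (p * d) + 3 * d\<^sup>2" using rr rd by linarith
  also have "\<dots> \<le> (1 + \<tau>) * p\<^sup>2 + 4 * (p * r) + (3 + 16 / \<tau>) * d\<^sup>2" using pdt by (simp add: algebra_simps)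
  also have "p * r = Re (of_real ((norm S)\<^sup>2) * cnj S * D)" by (simp add: p_def r_def mult.assoc del: of_real_power)
  finally show ?thesis by (simp add: p_def d_def power_mult[symmetric])
qed

lemma norm_sum3_fourth_le:
  fixes x y z :: complex
  shows "norm (x + y + z) ^ 4 \<le> 27 * (norm x ^ 4 + norm y ^ 4 + norm z ^ 4)"
proof -
  define a b c where "a = norm x" and "b = norm y" and "c = norm z"
  have sq: "(u + v + w)\<^sup>2 \<le> 3 * (u\<^sup>2 + v\<^sup>2 + w\<^sup>2)" for u v w :: real
  proof -
    have "0 \<le> (u - v)\<^sup>2 + (v - w)\<^sup>2 + (u - w)\<^sup>2" by simp
    then show ?thesis by (simp add: power2_eq_square algebra_simps)
  qed
  have "norm (x + y + z) \<le> a + b + c" unfolding a_def b_def c_def by (intro norm_triangle_le add_mono norm_triangle_ineq) simp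
  then have "norm (x + y + z) ^ 4 \<le> (a + b + c) ^ 4" by (intro power_mono) auto
  also have "\<dots> = ((a + b + c)\<^sup>2)\<^sup>2" by (simp add: power_mult[symmetric])
  also have "\<dots> \<le> (3 * (a\<^sup>2 + b\<^sup>2 + c\<^sup>2))\<^sup>2" by (intro power_mono sq) simp
  also have "\<dots> = 9 * (a\<^sup>2 + b\<^sup>2 + c\<^sup>2)\<^sup>2" unfolding power_mult_distrib by simp
  also have "\<dots> \<le> 9 * (3 * ((a\<^sup>2)\<^sup>2 + (b\<^sup>2)\<^sup>2 + (c\<^sup>2)\<^sup>2))" by (intro mult_left_mono sq) simp
  finally show ?thesis by (simp add: a_def b_def c_def power_mult[symmetric])
qed

lemma measurable_cnj [measurable]: "cnj \<in> borel_measurable borel"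
  by (intro borel_measurable_continuous_onI continuous_on_cnj continuous_on_id)

locale normalized_law = prob_space \<nu> for \<nu> :: "complex measure" +
  assumes sets_eq: "sets \<nu> = sets borel"
    and int1: "integrable \<nu> (\<lambda>z. z)" and mean: "(\<integral>z. z \<partial>\<nu>) = 0"
    and int2: "integrable \<nu> (\<lambda>z. (norm z)\<^sup>2)" and var: "(\<integral>z. (norm z)\<^sup>2 \<partial>\<nu>) = 1"
    and int8: "integrable \<nu> (\<lambda>z. norm z ^ 8)"
begin

declare sets_eq [measurable_cong]

text \<open>216 = 27 * 8: 27 from the fourth power of a sum of three terms, 8 from bounding
  \<open>norm y ^ 4\<close> and the fourth power of \<open>(norm y)^2 - 1\<close> by
  \<open>8 * (1 + norm y ^ 8)\<close>.\<close>

definition "C8 = 216 * (1 + (\<integral>z. norm z ^ 8 \<partial>\<nu>))"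

lemma C8_ge: "C8 \<ge> 1"
proof -
  have "(\<integral>z. norm z ^ 8 \<partial>\<nu>) \<ge> 0" by (intro integral_nonneg_AE AE_I2) simp
  then show ?thesis by (simp add: C8_def)
qed

text \<open>The increment caused by one new entry y: its centred squared modulus and linear terms in
  y and its conjugate. It has mean zero by the normalization of \<nu>, which removes the linear term
  of the fourth-power expansion.\<close>

lemma inner_fourth_moment:
  assumes t: "\<tau> > 0"
  shows "(\<integral>\<^sup>+y. ennreal (norm (S + (\<alpha> * of_real ((norm y)\<^sup>2 - 1) + cnj y * \<rho> + y * \<gamma>)) ^ 4) \<partial>\<nu>)
    \<le> ennreal ((1 + \<tau>) * norm S ^ 4 + (3 + 16 / \<tau>) * C8 * (norm \<alpha> ^ 4 + norm \<rho> ^ 4 + norm \<gamma> ^ 4))"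
proof -
  define N where "N = norm \<alpha> ^ 4 + norm \<rho> ^ 4 + norm \<gamma> ^ 4"
  define D where "D y = \<alpha> * of_real ((norm y)\<^sup>2 - 1) + cnj y * \<rho> + y * \<gamma>" for y
  define g where "g y = (1 + \<tau>) * norm S ^ 4 + 4 * Re (of_real ((norm S)\<^sup>2) * cnj S * D y) +
    (3 + 16 / \<tau>) * (216 * N) * (1 + norm y ^ 8)" for y
  have Nn: "N \<ge> 0" by (simp add: N_def)
  have D4: "norm (D y) ^ 4 \<le> 216 * N * (1 + norm y ^ 8)" for y
  proof -
    have a: "\<bar>(norm y)\<^sup>2 - 1\<bar> ^ 4 \<le> 8 * (1 + norm y ^ 8)"
    proof -
      define u where "u = (norm y)\<^sup>2"
      have u: "u \<ge> 0" by (simp add: u_def)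
      have "\<bar>u - 1\<bar> \<le> max 1 u" using u by (auto simp: max_def)
      then have "\<bar>u - 1\<bar> ^ 4 \<le> max 1 u ^ 4" by (intro power_mono) auto
      also have "\<dots> \<le> 1 + u ^ 4" by (auto simp: max_def u)
      also have "\<dots> \<le> 8 * (1 + u ^ 4)" using u by simp
      finally show ?thesis by (simp add: u_def power_mult[symmetric])
    qed
    have b: "norm y ^ 4 \<le> 8 * (1 + norm y ^ 8)"
    proof -
      define v where "v = norm y ^ 4"
      have v8: "norm y ^ 8 = v\<^sup>2" by (simp add: v_def power_mult[symmetric])
      have "2 * v \<le> 1 + v\<^sup>2" using sum_squares_bound[of 1 v] by simp
      moreover have "0 \<le> v\<^sup>2" by simp
      ultimately have "v \<le> 8 * (1 + v\<^sup>2)" by (smt (verit))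
      then show ?thesis unfolding v8 v_def .
    qed
    have "norm (D y) ^ 4 \<le> 27 * (norm (\<alpha> * of_real ((norm y)\<^sup>2 - 1)) ^ 4 + norm (cnj y * \<rho>) ^ 4 + norm (y * \<gamma>) ^ 4)"
      unfolding D_def by (rule norm_sum3_fourth_le)
    also have "\<dots> = 27 * (norm \<alpha> ^ 4 * \<bar>(norm y)\<^sup>2 - 1\<bar> ^ 4 + norm \<rho> ^ 4 * norm y ^ 4 + norm \<gamma> ^ 4 * norm y ^ 4)"
      by (simp only: norm_mult norm_of_real power_mult_distrib complex_mod_cnj mult.commute)
    also have "\<dots> \<le> 27 * (norm \<alpha> ^ 4 * (8 * (1 + norm y ^ 8)) + norm \<rho> ^ 4 * (8 * (1 + norm y ^ 8)) + norm \<gamma> ^ 4 * (8 * (1 + norm y ^ 8)))"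
      by (intro mult_left_mono add_mono a b) auto
    also have "\<dots> = 216 * N * (1 + norm y ^ 8)" by (simp add: N_def algebra_simps)
    finally show ?thesis .
  qed
  have le: "norm (S + D y) ^ 4 \<le> g y" for y
  proof -
    have "(3 + 16 / \<tau>) * norm (D y) ^ 4 \<le> (3 + 16 / \<tau>) * (216 * N * (1 + norm y ^ 8))"
      using t by (intro mult_left_mono D4) auto
    then show ?thesis using norm_add_fourth_le[OF t, of S "D y"] by (simp add: g_def mult.assoc)
  qed
  have ic: "integrable \<nu> cnj" using integrable_cnj[OF int1] by simp
  have iD: "integrable \<nu> D"
    unfolding D_def using int2 ic int1
    by (intro Bochner_Integration.integrable_add integrable_mult_right integrable_mult_left integrable_of_real integrable_diff) auto
  have "(\<integral>y. D y \<partial>\<nu>) = \<alpha> * (\<integral>y. of_real ((norm y)\<^sup>2 - 1) \<partial>\<nu>) + (\<integral>y. cnj y \<partial>\<nu>) * \<rho> + (\<integral>y. y \<partial>\<nu>) * \<gamma>"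
    unfolding D_def using int2 ic int1 by (simp del: of_real_diff of_real_power)
  also have "(\<integral>y. of_real ((norm y)\<^sup>2 - 1) \<partial>\<nu>) = complex_of_real ((\<integral>y. (norm y)\<^sup>2 \<partial>\<nu>) - 1)"
    using int2 by (simp add: prob_space del: of_real_diff of_real_power)
  also have "(\<integral>y. cnj y \<partial>\<nu>) = 0" using integral_bounded_linear[OF bounded_linear_cnj int1] by (simp add: mean)
  finally have D0: "(\<integral>y. D y \<partial>\<nu>) = 0" by (simp add: var mean)
  have gi: "integrable \<nu> g"
    unfolding g_def using iD int8 by (intro Bochner_Integration.integrable_add integrable_mult_right integrable_Re) auto
  have "(\<integral>y. Re (of_real ((norm S)\<^sup>2) * cnj S * D y) \<partial>\<nu>) = Re (of_real ((norm S)\<^sup>2) * cnj S * (\<integral>y. D y \<partial>\<nu>))"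
    using iD by (simp only: integral_Re[OF integrable_mult_right] Bochner_Integration.integral_mult_right)
  then have c0: "(\<integral>y. Re (of_real ((norm S)\<^sup>2) * cnj S * D y) \<partial>\<nu>) = 0" by (simp only: D0 mult_zero_right zero_complex.sel)
  have iR: "integrable \<nu> (\<lambda>y. Re (of_real ((norm S)\<^sup>2) * cnj S * D y))" using iD by (intro integrable_Re integrable_mult_right)
  have gI: "(\<integral>y. g y \<partial>\<nu>) = (1 + \<tau>) * norm S ^ 4 + (3 + 16 / \<tau>) * C8 * N"
  proof -
    define h where "h y = Re (of_real ((norm S)\<^sup>2) * cnj S * D y)" for y
    define A where "A = (1 + \<tau>) * norm S ^ 4"
    define c where "c = (3 + 16 / \<tau>) * (216 * N)"
    have ih: "integrable \<nu> h" using iR by (simp only: h_def[abs_def])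
    have i8: "integrable \<nu> (\<lambda>y. 1 + norm y ^ 8)" using int8 by simp
    have "(\<integral>y. g y \<partial>\<nu>) = (\<integral>y. (A + 4 * h y) + c * (1 + norm y ^ 8) \<partial>\<nu>)"
      by (simp only: g_def h_def A_def c_def)
    also have "\<dots> = (\<integral>y. A + 4 * h y \<partial>\<nu>) + (\<integral>y. c * (1 + norm y ^ 8) \<partial>\<nu>)"
      by (rule Bochner_Integration.integral_add) (use ih i8 in auto)
    also have "(\<integral>y. A + 4 * h y \<partial>\<nu>) = A + 4 * (\<integral>y. h y \<partial>\<nu>)" using ih by (simp add: prob_space)
    also have "(\<integral>y. c * (1 + norm y ^ 8) \<partial>\<nu>) = c * (\<integral>y. 1 + norm y ^ 8 \<partial>\<nu>)"
      by (rule Bochner_Integration.integral_mult_right) (rule i8)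
    finally have "(\<integral>y. g y \<partial>\<nu>) = (1 + \<tau>) * norm S ^ 4 + 4 * (\<integral>y. Re (of_real ((norm S)\<^sup>2) * cnj S * D y) \<partial>\<nu>) +
       (3 + 16 / \<tau>) * (216 * N) * (\<integral>y. 1 + norm y ^ 8 \<partial>\<nu>)"
      by (simp only: A_def h_def c_def)
    also have "(\<integral>y. 1 + norm y ^ 8 \<partial>\<nu>) = 1 + (\<integral>y. norm y ^ 8 \<partial>\<nu>)" using int8 by (simp add: prob_space)
    finally show ?thesis unfolding c0 by (simp add: C8_def algebra_simps add_divide_distrib)
  qed
  have "(\<integral>\<^sup>+y. ennreal (norm (S + D y) ^ 4) \<partial>\<nu>) \<le> (\<integral>\<^sup>+y. ennreal (g y) \<partial>\<nu>)"
    by (intro nn_integral_mono ennreal_leI le)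
  also have "\<dots> = ennreal (\<integral>y. g y \<partial>\<nu>)"
    using order_trans[OF _ le] by (intro nn_integral_eq_integral[OF gi] AE_I2) simp
  finally show ?thesis unfolding gI D_def N_def by (simp add: mult.assoc)
qed

text \<open>The choice \<open>\<tau> = d / (\<Sigma> + d)\<close> completes the square in \<Sigma> +
  d; 19 = 3 + 16 is the factor left at \<open>d^2\<close>. For \<open>d = 0\<close> this choice
  degenerates, and \<tau> is sent to 0 instead.\<close>

lemma fourth_moment_recursion:
  assumes T: "T \<le> ennreal (A * \<Sigma>\<^sup>2)"
    and rec: "\<And>\<tau>. \<tau> > 0 \<Longrightarrow> T' \<le> ennreal (1 + \<tau>) * T + ennreal ((3 + 16 / \<tau>) * (B * d\<^sup>2))"
    and pos: "\<Sigma> \<ge> 0" "d \<ge> 0" "B \<ge> 0" "A \<ge> 19 * B"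
  shows "T' \<le> ennreal (A * (\<Sigma> + d)\<^sup>2)"
proof -
  have A: "A \<ge> 0" using pos by simp
  have le: "T' \<le> ennreal ((1 + \<tau>) * (A * \<Sigma>\<^sup>2) + (3 + 16 / \<tau>) * (B * d\<^sup>2))" if t: "\<tau> > 0" for \<tau>
  proof -
    have "T' \<le> ennreal (1 + \<tau>) * ennreal (A * \<Sigma>\<^sup>2) + ennreal ((3 + 16 / \<tau>) * (B * d\<^sup>2))"
      by (rule order_trans[OF rec[OF t]]) (intro add_right_mono mult_left_mono T, simp)
    also have "\<dots> = ennreal ((1 + \<tau>) * (A * \<Sigma>\<^sup>2) + (3 + 16 / \<tau>) * (B * d\<^sup>2))"
    proof -
      have 1: "ennreal (1 + \<tau>) * ennreal (A * \<Sigma>\<^sup>2) = ennreal ((1 + \<tau>) * (A * \<Sigma>\<^sup>2))"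
        using t A by (intro ennreal_mult[symmetric]) auto
      show ?thesis unfolding 1 using t A pos by (intro ennreal_plus[symmetric]) auto
    qed
    finally show ?thesis .
  qed
  show ?thesis
  proof (cases "d = 0")
    case False
    then have d: "d > 0" using pos by simp
    define \<tau> where "\<tau> = d / (\<Sigma> + d)"
    have t: "\<tau> > 0" using d pos by (simp add: \<tau>_def)
    have "\<tau> * \<Sigma>\<^sup>2 \<le> d * \<Sigma>"
    proof -
      have "\<tau> * \<Sigma> \<le> d" using d pos by (simp add: \<tau>_def divide_le_eq distrib_left)
      then have "\<tau> * \<Sigma> * \<Sigma> \<le> d * \<Sigma>" using pos by (intro mult_right_mono) auto
      then show ?thesis by (simp add: power2_eq_square mult.assoc)
    qed
    then have 1: "A * (\<tau> * \<Sigma>\<^sup>2) \<le> A * (d * \<Sigma>)" using A by (intro mult_left_mono)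
    have it: "16 / \<tau> * d\<^sup>2 = 16 * (d * (\<Sigma> + d))" using d pos by (simp add: \<tau>_def power2_eq_square field_simps)
    have "(1 + \<tau>) * (A * \<Sigma>\<^sup>2) + (3 + 16 / \<tau>) * (B * d\<^sup>2) = A * \<Sigma>\<^sup>2 + A * (\<tau> * \<Sigma>\<^sup>2) + 3 * B * d\<^sup>2 + B * (16 / \<tau> * d\<^sup>2)"
      by (simp add: algebra_simps)
    also have "\<dots> \<le> A * \<Sigma>\<^sup>2 + A * (d * \<Sigma>) + 3 * B * d\<^sup>2 + B * (16 * (d * (\<Sigma> + d)))"
      using 1 unfolding it by simp
    also have "\<dots> = A * \<Sigma>\<^sup>2 + A * (d * \<Sigma>) + (19 * B) * d\<^sup>2 + (16 * B) * (d * \<Sigma>)"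
      by (simp add: power2_eq_square algebra_simps)
    also have "\<dots> \<le> A * \<Sigma>\<^sup>2 + A * (d * \<Sigma>) + A * d\<^sup>2 + A * (d * \<Sigma>)"
      using pos by (intro add_mono mult_right_mono) auto
    also have "\<dots> = A * (\<Sigma> + d)\<^sup>2" by (simp add: power2_eq_square algebra_simps)
    finally show ?thesis by (intro order_trans[OF le[OF t]] ennreal_leI)
  next
    case True
    have l: "T' \<le> ennreal (A * \<Sigma>\<^sup>2 + e)" if e: "e > 0" for e
    proof -
      define \<tau> where "\<tau> = e / (A * \<Sigma>\<^sup>2 + 1)"
      have den: "A * \<Sigma>\<^sup>2 + 1 > 0" using A by (simp add: add_nonneg_pos)
      have t: "\<tau> > 0" using e den by (simp add: \<tau>_def)
      have "\<tau> * (A * \<Sigma>\<^sup>2) \<le> e" using e den A by (simp add: \<tau>_def divide_le_eq distrib_left)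
      then have "(1 + \<tau>) * (A * \<Sigma>\<^sup>2) + (3 + 16 / \<tau>) * (B * d\<^sup>2) \<le> A * \<Sigma>\<^sup>2 + e" using True by (simp add: distrib_right)
      then show ?thesis by (intro order_trans[OF le[OF t]] ennreal_leI)
    qed
    have "T' < \<infinity>" using le_less_trans[OF l[of 1] ennreal_less_top] by simp
    then obtain t where t: "T' = ennreal t" "t \<ge> 0" by (cases T') auto
    have "t \<le> A * \<Sigma>\<^sup>2"
    proof (rule field_le_epsilon)
      fix e :: real assume "e > 0"
      with l[OF this] A t(1) show "t \<le> A * \<Sigma>\<^sup>2 + e" by (subst (asm) t(1), subst (asm) ennreal_le_iff) auto
    qed
    then show ?thesis using True t by (simp add: ennreal_leI)
  qed
qed

section \<open>Fourth moments of linear and quadratic forms in independent entries\<close>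

interpretation P: product_prob_space "\<lambda>_. \<nu>" for I :: "'k set"
  by unfold_locales

lemma linear_form_fourth_moment:
  assumes "finite K"
  shows "(\<integral>\<^sup>+x. ennreal (norm (\<Sum>k\<in>K. b k * x k) ^ 4) \<partial>PiM K (\<lambda>_. \<nu>)) \<le> ennreal (19 * C8 * (\<Sum>k\<in>K. (norm (b k))\<^sup>2)\<^sup>2)"
  using assms
proof (induction K rule: finite_induct)
  case empty
  then show ?case by simp
next
  case (insert s K)
  let ?f = "\<lambda>K x. ennreal (norm (\<Sum>k\<in>K. b k * x k) ^ 4)"
  let ?T = "\<integral>\<^sup>+x. ?f K x \<partial>PiM K (\<lambda>_. \<nu>)"
  have fm: "?f K \<in> borel_measurable (PiM K (\<lambda>_. \<nu>))" by measurable
  have "(\<integral>\<^sup>+x. ?f (insert s K) x \<partial>PiM (insert s K) (\<lambda>_. \<nu>)) =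
      (\<integral>\<^sup>+x. (\<integral>\<^sup>+y. ?f (insert s K) (x(s := y)) \<partial>\<nu>) \<partial>PiM K (\<lambda>_. \<nu>))"
    using insert by (intro P.product_nn_integral_insert) (auto, measurable)
  also have "\<dots> = (\<integral>\<^sup>+x. (\<integral>\<^sup>+y. ennreal (norm ((\<Sum>k\<in>K. b k * x k) + (0 * of_real ((norm y)\<^sup>2 - 1) + cnj y * 0 + y * b s)) ^ 4) \<partial>\<nu>) \<partial>PiM K (\<lambda>_. \<nu>))"
  proof (intro nn_integral_cong)
    fix x y
    have "(\<Sum>k\<in>insert s K. b k * (x(s := y)) k) = b s * y + (\<Sum>k\<in>K. b k * x k)"
    proof -
      have "(\<Sum>k\<in>K. b k * (x(s := y)) k) = (\<Sum>k\<in>K. b k * x k)" using insert(2) by (intro sum.cong refl) auto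
      then show ?thesis using insert(1,2) by (simp add: sum.insert)
    qed
    then show "?f (insert s K) (x(s := y)) = ennreal (norm ((\<Sum>k\<in>K. b k * x k) + (0 * of_real ((norm y)\<^sup>2 - 1) + cnj y * 0 + y * b s)) ^ 4)"
      by (simp add: add.commute mult.commute)
  qed
  finally have eq: "(\<integral>\<^sup>+x. ?f (insert s K) x \<partial>PiM (insert s K) (\<lambda>_. \<nu>)) = \<dots>" .
  have "(\<integral>\<^sup>+x. ?f (insert s K) x \<partial>PiM (insert s K) (\<lambda>_. \<nu>)) \<le>
      ennreal (19 * C8 * ((\<Sum>k\<in>K. (norm (b k))\<^sup>2) + (norm (b s))\<^sup>2)\<^sup>2)"
  proof (rule fourth_moment_recursion[OF insert.IH])
    fix \<tau> :: real assume t: "\<tau> > 0"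
    have "(\<integral>\<^sup>+x. ?f (insert s K) x \<partial>PiM (insert s K) (\<lambda>_. \<nu>)) \<le>
       (\<integral>\<^sup>+x. ennreal ((1 + \<tau>) * norm (\<Sum>k\<in>K. b k * x k) ^ 4 + (3 + 16 / \<tau>) * C8 * (norm (0::complex) ^ 4 + norm (0::complex) ^ 4 + norm (b s) ^ 4)) \<partial>PiM K (\<lambda>_. \<nu>))"
      unfolding eq by (intro nn_integral_mono inner_fourth_moment t)
    also have "\<dots> = (\<integral>\<^sup>+x. ennreal (1 + \<tau>) * ?f K x + ennreal ((3 + 16 / \<tau>) * (C8 * ((norm (b s))\<^sup>2)\<^sup>2)) \<partial>PiM K (\<lambda>_. \<nu>))"
      using t C8_ge by (intro nn_integral_cong) (simp add: ennreal_mult[symmetric] ennreal_plus[symmetric] power_mult[symmetric] mult.assoc del: ennreal_plus)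
    also have "\<dots> = ennreal (1 + \<tau>) * ?T + ennreal ((3 + 16 / \<tau>) * (C8 * ((norm (b s))\<^sup>2)\<^sup>2))"
      using P.emeasure_space_1[of K] by (simp add: nn_integral_add nn_integral_cmult fm)
    finally show "(\<integral>\<^sup>+x. ?f (insert s K) x \<partial>PiM (insert s K) (\<lambda>_. \<nu>)) \<le> ennreal (1 + \<tau>) * ?T + ennreal ((3 + 16 / \<tau>) * (C8 * ((norm (b s))\<^sup>2)\<^sup>2))" .
  qed (use C8_ge in \<open>auto intro: sum_nonneg\<close>)
  then show ?case using insert by (simp add: add.commute)
qed

text \<open>The subtracted sum is the expectation of the form, the entries being independent with
  mean 0 and variance 1.\<close>

definition "qform K a x = (\<Sum>k\<in>K. \<Sum>l\<in>K. a k l * cnj (x k) * x l) - (\<Sum>k\<in>K. a k k)"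

text \<open>A new index s adds a centred diagonal term and linear forms with the new row and the new
  column as coefficients. These have fourth moments bounded by \<open>19 * C8\<close> times squares,
  and a second use of the recursion gives 361 = 19 * 19 and the square of \<open>C8\<close>.\<close>

lemma quadratic_form_fourth_moment:
  fixes K :: "'a set"
  assumes "finite K"
  shows "(\<integral>\<^sup>+x. ennreal (norm (qform K a x) ^ 4) \<partial>PiM K (\<lambda>_. \<nu>)) \<le> ennreal (361 * C8\<^sup>2 * (\<Sum>k\<in>K. \<Sum>l\<in>K. (norm (a k l))\<^sup>2)\<^sup>2)"
  using assms
proof (induction K rule: finite_induct)
  case empty
  then show ?case by (simp add: qform_def)
next
  case (insert s K)
  let ?f = "\<lambda>K x. ennreal (norm (qform K a x) ^ 4)"
  let ?T = "\<integral>\<^sup>+x. ?f K x \<partial>PiM K (\<lambda>_. \<nu>)"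
  define \<rho> where "\<rho> x = (\<Sum>l\<in>K. a s l * x l)" for x
  define \<gamma> where "\<gamma> x = (\<Sum>k\<in>K. a k s * cnj (x k))" for x
  define d1 where "d1 = (\<Sum>l\<in>K. (norm (a s l))\<^sup>2)"
  define d2 where "d2 = (\<Sum>k\<in>K. (norm (a k s))\<^sup>2)"
  define d where "d = (norm (a s s))\<^sup>2 + d1 + d2"
  have dn: "d1 \<ge> 0" "d2 \<ge> 0" by (simp_all add: d1_def d2_def sum_nonneg)
  have fm: "?f L \<in> borel_measurable (PiM L (\<lambda>_. \<nu>))" for L unfolding qform_def by measurable
  have rm: "(\<lambda>x. ennreal (norm (\<rho> x) ^ 4)) \<in> borel_measurable (PiM K (\<lambda>_. \<nu>))"
    "(\<lambda>x. ennreal (norm (\<gamma> x) ^ 4)) \<in> borel_measurable (PiM K (\<lambda>_. \<nu>))" unfolding \<rho>_def \<gamma>_def by measurable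
  have eq: "(\<integral>\<^sup>+x. ?f (insert s K) x \<partial>PiM (insert s K) (\<lambda>_. \<nu>)) =
      (\<integral>\<^sup>+x. (\<integral>\<^sup>+y. ennreal (norm (qform K a x + (a s s * of_real ((norm y)\<^sup>2 - 1) + cnj y * \<rho> x + y * \<gamma> x)) ^ 4) \<partial>\<nu>) \<partial>PiM K (\<lambda>_. \<nu>))"
  proof -
    have "(\<integral>\<^sup>+x. ?f (insert s K) x \<partial>PiM (insert s K) (\<lambda>_. \<nu>)) =
      (\<integral>\<^sup>+x. (\<integral>\<^sup>+y. ?f (insert s K) (x(s := y)) \<partial>\<nu>) \<partial>PiM K (\<lambda>_. \<nu>))"
      by (rule P.product_nn_integral_insert[OF insert(1,2) fm])
    also have "\<dots> = (\<integral>\<^sup>+x. (\<integral>\<^sup>+y. ennreal (norm (qform K a x + (a s s * of_real ((norm y)\<^sup>2 - 1) + cnj y * \<rho> x + y * \<gamma> x)) ^ 4) \<partial>\<nu>) \<partial>PiM K (\<lambda>_. \<nu>))"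
    proof (intro nn_integral_cong)
      fix x :: "'a \<Rightarrow> complex" and y :: complex
      define x' where "x' = x(s := y)"
      have u: "x' k = x k" if "k \<in> K" for k unfolding x'_def using insert(2) that by (intro fun_upd_other) blast
      have us: "x' s = y" by (simp add: x'_def)
      have "(\<Sum>k\<in>insert s K. \<Sum>l\<in>insert s K. a k l * cnj (x' k) * x' l) =
        (a s s * cnj y * y + (\<Sum>l\<in>K. a s l * cnj y * x l)) + (\<Sum>k\<in>K. a k s * cnj (x k) * y + (\<Sum>l\<in>K. a k l * cnj (x k) * x l))"
        using insert(1,2) by (simp add: us u cong: sum.cong)
      also have "\<dots> = a s s * of_real ((norm y)\<^sup>2) + cnj y * \<rho> x + y * \<gamma> x + (\<Sum>k\<in>K. \<Sum>l\<in>K. a k l * cnj (x k) * x l)"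
        unfolding complex_norm_square by (simp add: \<rho>_def \<gamma>_def sum.distrib sum_distrib_left mult_ac)
      finally have "qform (insert s K) a x' = qform K a x + (a s s * of_real ((norm y)\<^sup>2 - 1) + cnj y * \<rho> x + y * \<gamma> x)"
        using insert(1,2) by (simp add: qform_def right_diff_distrib)
      then show "?f (insert s K) (x(s := y)) = ennreal (norm (qform K a x + (a s s * of_real ((norm y)\<^sup>2 - 1) + cnj y * \<rho> x + y * \<gamma> x)) ^ 4)"
        by (simp only: x'_def)
    qed
    finally show ?thesis .
  qed
  have r4: "(\<integral>\<^sup>+x. ennreal (norm (\<rho> x) ^ 4) \<partial>PiM K (\<lambda>_. \<nu>)) \<le> ennreal (19 * C8 * d1\<^sup>2)"
    unfolding \<rho>_def d1_def by (rule linear_form_fourth_moment[OF insert(1)])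
  have g4: "(\<integral>\<^sup>+x. ennreal (norm (\<gamma> x) ^ 4) \<partial>PiM K (\<lambda>_. \<nu>)) \<le> ennreal (19 * C8 * d2\<^sup>2)"
  proof -
    have "norm (\<gamma> x) = norm (\<Sum>k\<in>K. cnj (a k s) * x k)" for x
    proof -
      have "cnj (\<gamma> x) = (\<Sum>k\<in>K. cnj (a k s) * x k)" by (simp add: \<gamma>_def)
      then show ?thesis by (metis complex_mod_cnj)
    qed
    then show ?thesis using linear_form_fourth_moment[OF insert(1), of "\<lambda>k. cnj (a k s)"] by (simp add: d2_def)
  qed
  have "(\<integral>\<^sup>+x. ?f (insert s K) x \<partial>PiM (insert s K) (\<lambda>_. \<nu>)) \<le>
      ennreal (361 * C8\<^sup>2 * ((\<Sum>k\<in>K. \<Sum>l\<in>K. (norm (a k l))\<^sup>2) + d)\<^sup>2)"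
  proof (rule fourth_moment_recursion[OF insert.IH])
    fix \<tau> :: real assume t: "\<tau> > 0"
    define c where "c = (3 + 16 / \<tau>) * C8"
    have c: "c \<ge> 0" using t C8_ge by (simp add: c_def)
    have "(\<integral>\<^sup>+x. ?f (insert s K) x \<partial>PiM (insert s K) (\<lambda>_. \<nu>)) \<le>
       (\<integral>\<^sup>+x. ennreal ((1 + \<tau>) * norm (qform K a x) ^ 4 + c * (norm (a s s) ^ 4 + norm (\<rho> x) ^ 4 + norm (\<gamma> x) ^ 4)) \<partial>PiM K (\<lambda>_. \<nu>))"
      unfolding eq c_def by (intro nn_integral_mono inner_fourth_moment t)
    also have "\<dots> = (\<integral>\<^sup>+x. ennreal (1 + \<tau>) * ?f K x + (ennreal c * ennreal (norm (a s s) ^ 4) + (ennreal c * ennreal (norm (\<rho> x) ^ 4) + ennreal c * ennreal (norm (\<gamma> x) ^ 4))) \<partial>PiM K (\<lambda>_. \<nu>))"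
      using t c by (intro nn_integral_cong) (simp add: ennreal_mult[symmetric] ennreal_plus[symmetric] distrib_left add.assoc del: ennreal_plus)
    also have "\<dots> = ennreal (1 + \<tau>) * ?T + (ennreal c * ennreal (norm (a s s) ^ 4) + (ennreal c * (\<integral>\<^sup>+x. ennreal (norm (\<rho> x) ^ 4) \<partial>PiM K (\<lambda>_. \<nu>)) + ennreal c * (\<integral>\<^sup>+x. ennreal (norm (\<gamma> x) ^ 4) \<partial>PiM K (\<lambda>_. \<nu>))))"
      using P.emeasure_space_1[of K] fm rm by (simp add: nn_integral_add nn_integral_cmult)
    also have "\<dots> \<le> ennreal (1 + \<tau>) * ?T + (ennreal c * ennreal (norm (a s s) ^ 4) + (ennreal c * ennreal (19 * C8 * d1\<^sup>2) + ennreal c * ennreal (19 * C8 * d2\<^sup>2)))"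
      by (intro add_left_mono add_mono mult_left_mono r4 g4) auto
    also have "\<dots> = ennreal (1 + \<tau>) * ?T + ennreal (c * (norm (a s s) ^ 4 + 19 * C8 * d1\<^sup>2 + 19 * C8 * d2\<^sup>2))"
      using c C8_ge by (simp add: ennreal_mult[symmetric] ennreal_plus[symmetric] distrib_left add.assoc del: ennreal_plus)
    also have "\<dots> \<le> ennreal (1 + \<tau>) * ?T + ennreal (c * (19 * C8 * d\<^sup>2))"
    proof (intro add_left_mono ennreal_leI mult_left_mono c)
      have "norm (a s s) ^ 4 \<le> 19 * C8 * ((norm (a s s))\<^sup>2)\<^sup>2"
        using mult_right_mono[of 1 "19 * C8" "norm (a s s) ^ 4"] C8_ge by (simp add: power_mult[symmetric])
      then have "norm (a s s) ^ 4 + 19 * C8 * d1\<^sup>2 + 19 * C8 * d2\<^sup>2 \<le> 19 * C8 * (((norm (a s s))\<^sup>2)\<^sup>2 + d1\<^sup>2 + d2\<^sup>2)"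
        by (simp add: distrib_left)
      also have "\<dots> \<le> 19 * C8 * d\<^sup>2"
      proof (intro mult_left_mono)
        have "0 \<le> (norm (a s s))\<^sup>2 * d1" "0 \<le> (norm (a s s))\<^sup>2 * d2" "0 \<le> d1 * d2" using dn by simp_all
        then show "((norm (a s s))\<^sup>2)\<^sup>2 + d1\<^sup>2 + d2\<^sup>2 \<le> d\<^sup>2"
          unfolding d_def power2_sum by (simp add: algebra_simps)
      qed (use C8_ge in simp)
      finally show "norm (a s s) ^ 4 + 19 * C8 * d1\<^sup>2 + 19 * C8 * d2\<^sup>2 \<le> 19 * C8 * d\<^sup>2" .
    qed
    also have "c * (19 * C8 * d\<^sup>2) = (3 + 16 / \<tau>) * (19 * C8\<^sup>2 * d\<^sup>2)" by (simp add: c_def power2_eq_square mult_ac)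
    finally show "(\<integral>\<^sup>+x. ?f (insert s K) x \<partial>PiM (insert s K) (\<lambda>_. \<nu>)) \<le> ennreal (1 + \<tau>) * ?T + ennreal ((3 + 16 / \<tau>) * (19 * C8\<^sup>2 * d\<^sup>2))" .
  qed (use dn in \<open>auto intro!: sum_nonneg simp: d_def\<close>)
  moreover have "(\<Sum>k\<in>insert s K. \<Sum>l\<in>insert s K. (norm (a k l))\<^sup>2) = (\<Sum>k\<in>K. \<Sum>l\<in>K. (norm (a k l))\<^sup>2) + d"
    using insert(1,2) by (simp add: sum.insert d_def d1_def d2_def sum.distrib)
  ultimately show ?case by simp
qed

end

section \<open>Traces of powers of the dilation\<close>

abbreviation unit_fun :: "'i \<Rightarrow> 'i \<Rightarrow> complex" where
  "unit_fun p \<equiv> (\<lambda>q. if q = p then 1 else 0)"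

lemma ip_unit_right: "finite I \<Longrightarrow> p \<in> I \<Longrightarrow> ip I x (unit_fun p) = cnj (x p)"
  by (simp add: ip_def if_distrib[of "\<lambda>z. _ * z"] cong: if_cong)

lemma ip_unit_left: "finite I \<Longrightarrow> p \<in> I \<Longrightarrow> ip I (unit_fun p) x = x p"
  using cnj_ip[of I x "unit_fun p"] ip_unit_right[of I p x] by simp

definition inlv :: "(nat \<Rightarrow> complex) \<Rightarrow> nat + nat \<Rightarrow> complex" where "inlv x = case_sum x (\<lambda>_. 0)"
definition inrv :: "(nat \<Rightarrow> complex) \<Rightarrow> nat + nat \<Rightarrow> complex" where "inrv x = case_sum (\<lambda>_. 0) x"

lemma inlv_simps [simp]: "inlv x (Inl p) = x p" "inlv x (Inr q) = 0" "inrv x (Inl p) = 0" "inrv x (Inr q) = x q"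
  by (simp_all add: inlv_def inrv_def)

lemma app_zero: "app J A (\<lambda>_. 0) = (\<lambda>_. 0)"
  by (simp add: app_def)

lemma app_dil_inlv: "app (idx n m) (dil A) (inlv x) = inrv (app {..<n} (adj A) x)"
  unfolding app_dil inlv_def inrv_def case_sum_comp app_zero ..

lemma app_dil_inrv: "app (idx n m) (dil A) (inrv x) = inlv (app {..<m} A x)"
  unfolding app_dil inlv_def inrv_def case_sum_comp app_zero ..

lemma unit_fun_Inl: "unit_fun (Inl p) = inlv (unit_fun p)" and unit_fun_Inr: "unit_fun (Inr p) = inrv (unit_fun p)"
  by (auto simp: fun_eq_iff inlv_def inrv_def split: sum.splits)

lemma dil_even_inlv:
  "(app (idx n m) (dil A) ^^ (2 * j)) (inlv x) = inlv ((app {..<n} (gram_op {..<n} {..<m} A) ^^ j) x)"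
  by (induction j) (simp_all add: app_dil_inlv app_dil_inrv app_gram_op)

lemma dil_odd_inlv:
  "(app (idx n m) (dil A) ^^ Suc (2 * j)) (inlv x) = inrv (app {..<n} (adj A) ((app {..<n} (gram_op {..<n} {..<m} A) ^^ j) x))"
proof -
  have "(app (idx n m) (dil A) ^^ Suc (2 * j)) (inlv x) = app (idx n m) (dil A) ((app (idx n m) (dil A) ^^ (2 * j)) (inlv x))"
    by simp
  then show ?thesis unfolding dil_even_inlv app_dil_inlv .
qed

lemma dil_odd_inrv:
  "(app (idx n m) (dil A) ^^ Suc (2 * j)) (inrv x) = inlv ((app {..<n} (gram_op {..<n} {..<m} A) ^^ j) (app {..<m} A x))"
proof -
  have "(app (idx n m) (dil A) ^^ Suc (2 * j)) (inrv x) = (app (idx n m) (dil A) ^^ (2 * j)) (app (idx n m) (dil A) (inrv x))"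
    by (simp add: funpow_swap1)
  then show ?thesis unfolding app_dil_inrv dil_even_inlv .
qed

lemma dil_even_inrv:
  "(app (idx n m) (dil A) ^^ Suc (Suc (2 * j))) (inrv x) =
    inrv (app {..<n} (adj A) ((app {..<n} (gram_op {..<n} {..<m} A) ^^ j) (app {..<m} A x)))"
proof -
  have "(app (idx n m) (dil A) ^^ Suc (Suc (2 * j))) (inrv x) = app (idx n m) (dil A) ((app (idx n m) (dil A) ^^ Suc (2 * j)) (inrv x))"
    by simp
  then show ?thesis unfolding dil_odd_inrv app_dil_inlv .
qed

lemma ip_funpow_gram:
  assumes b: "sv_basis n m A \<sigma> e"
  shows "ip {..<n} w ((app {..<n} (gram_op {..<n} {..<m} A) ^^ j) w) =
    of_real (\<Sum>l<n. \<sigma> l ^ (2 * j) * (norm (ip {..<n} (e l) w))\<^sup>2)"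
proof -
  let ?B = "app {..<n} (gram_op {..<n} {..<m} A)"
  have pe: "(?B ^^ j) (e l) i = of_real (\<sigma> l ^ (2 * j)) * e l i" if "l < n" "i < n" for l i
    using that(2)
  proof (induction j arbitrary: i)
    case (Suc j)
    have "?B ((?B ^^ j) (e l)) = ?B (\<lambda>i. of_real (\<sigma> l ^ (2 * j)) * e l i)"
      by (rule app_cong) (simp add: Suc.IH)
    then have "(?B ^^ Suc j) (e l) i = ?B (\<lambda>i. of_real (\<sigma> l ^ (2 * j)) * e l i) i" by simp
    also have "\<dots> = of_real (\<sigma> l ^ (2 * j)) * (of_real ((\<sigma> l)\<^sup>2) * e l i)"
      unfolding app_scale using sv_basisD(3)[OF b that(1) Suc.prems] by simp
    finally show ?case by (simp add: power2_eq_square)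
  qed simp
  have "(?B ^^ j) w i = (\<Sum>l<n. ip {..<n} (e l) w * (of_real (\<sigma> l ^ (2 * j)) * e l i))" if i: "i < n" for i
  proof -
    have "(?B ^^ j) w i = (?B ^^ j) (\<lambda>i. \<Sum>l<n. ip {..<n} (e l) w * e l i) i"
      using i sv_basis_expand[OF b] by (intro funpow_app_cong[of "{..<n}" w]) simp_all
    then show ?thesis using i by (simp add: funpow_app_sum funpow_app_scale pe)
  qed
  then have "ip {..<n} w ((?B ^^ j) w) = ip {..<n} w (\<lambda>i. \<Sum>l<n. ip {..<n} (e l) w * (of_real (\<sigma> l ^ (2 * j)) * e l i))"
    by (intro ip_cong refl) auto
  also have "\<dots> = (\<Sum>l<n. of_real (\<sigma> l ^ (2 * j)) * (cnj (ip {..<n} (e l) w) * ip {..<n} (e l) w))"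
    unfolding ip_sum_right ip_scale_right by (intro sum.cong refl) (simp add: cnj_ip)
  finally show ?thesis unfolding cnj_mult_self by simp
qed

text \<open>Even powers act on the left block as powers of the Gram operator, whose trace is
  computed in its eigenbasis; odd powers exchange the blocks and have no diagonal.\<close>

lemma trace_dil_left:
  assumes b: "sv_basis n m A \<sigma> e"
  shows "(\<Sum>p<n. (app (idx n m) (dil A) ^^ k) (unit_fun (Inl p)) (Inl p)) =
    of_real (if even k then \<Sum>l<n. \<sigma> l ^ k else 0)"
proof (cases "even k")
  case True
  then obtain j where k: "k = 2 * j" by (elim evenE)
  have "(\<Sum>p<n. (app (idx n m) (dil A) ^^ k) (unit_fun (Inl p)) (Inl p)) =
     (\<Sum>p<n. ip {..<n} (unit_fun p) ((app {..<n} (gram_op {..<n} {..<m} A) ^^ j) (unit_fun p)))"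
    unfolding k unit_fun_Inl dil_even_inlv by (intro sum.cong refl) (simp add: ip_unit_left)
  also have "\<dots> = of_real (\<Sum>p<n. \<Sum>l<n. \<sigma> l ^ (2 * j) * (norm (e l p))\<^sup>2)"
    unfolding ip_funpow_gram[OF b] by (simp add: ip_unit_right)
  also have "(\<Sum>p<n. \<Sum>l<n. \<sigma> l ^ (2 * j) * (norm (e l p))\<^sup>2) = (\<Sum>l<n. \<sigma> l ^ (2 * j) * nsq {..<n} (e l))"
    unfolding nsq_def sum_distrib_left by (rule sum.swap)
  also have "\<dots> = (\<Sum>l<n. \<sigma> l ^ (2 * j))"
    by (intro sum.cong refl) (simp add: nsq_eq_Re sv_basisD(1)[OF b])
  finally show ?thesis using True by (simp add: k)
next
  case False
  then obtain j where k: "k = Suc (2 * j)" by (auto elim: oddE)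
  show ?thesis unfolding k unit_fun_Inl dil_odd_inlv by simp
qed

text \<open>The two Gram operators share their nonzero eigenvalues, so the traces of both blocks
  agree for even k > 0. At k = 0 the block has dimension m instead of n.\<close>

lemma trace_dil_right:
  assumes b: "sv_basis n m A \<sigma> e"
  shows "(\<Sum>q<m. (app (idx n m) (dil A) ^^ k) (unit_fun (Inr q)) (Inr q)) =
    of_real (if k = 0 then real m else if even k then \<Sum>l<n. \<sigma> l ^ k else 0)"
proof (cases "even k")
  case True
  show ?thesis
  proof (cases "k = 0")
    case False
    \<comment> \<open>At least two factors are present, so one can be moved to each side of the
      inner product.\<close>
    with True obtain j where k: "k = Suc (Suc (2 * j))" by (auto elim!: evenE) (metis Suc_pred' mult_Suc_right add_2_eq_Suc not_gr_zero)
    have "(\<Sum>q<m. (app (idx n m) (dil A) ^^ k) (unit_fun (Inr q)) (Inr q)) =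
       (\<Sum>q<m. ip {..<n} (app {..<m} A (unit_fun q)) ((app {..<n} (gram_op {..<n} {..<m} A) ^^ j) (app {..<m} A (unit_fun q))))"
      unfolding k unit_fun_Inr dil_even_inrv
    proof (intro sum.cong refl)
      fix q assume "q \<in> {..<m}"
      then have "app {..<n} (adj A) w q = ip {..<n} (app {..<m} A (unit_fun q)) w" for w
        using ip_app[of "{..<m}" "unit_fun q" "{..<n}" "adj A" w] by (simp add: ip_unit_left)
      then show "inrv (app {..<n} (adj A) ((app {..<n} (gram_op {..<n} {..<m} A) ^^ j) (app {..<m} A (unit_fun q)))) (Inr q) =
        ip {..<n} (app {..<m} A (unit_fun q)) ((app {..<n} (gram_op {..<n} {..<m} A) ^^ j) (app {..<m} A (unit_fun q)))" by simp
    qed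
    also have "\<dots> = of_real (\<Sum>q<m. \<Sum>l<n. \<sigma> l ^ (2 * j) * (norm (app {..<n} (adj A) (e l) q))\<^sup>2)"
      unfolding ip_funpow_gram[OF b] by (simp add: ip_app ip_unit_right)
    also have "(\<Sum>q<m. \<Sum>l<n. \<sigma> l ^ (2 * j) * (norm (app {..<n} (adj A) (e l) q))\<^sup>2) = (\<Sum>l<n. \<sigma> l ^ (2 * j) * nsq {..<m} (app {..<n} (adj A) (e l)))"
      unfolding nsq_def sum_distrib_left by (rule sum.swap)
    also have "\<dots> = (\<Sum>l<n. \<sigma> l ^ k)"
      by (intro sum.cong refl) (simp add: nsq_eq_Re sv_basis_adj[OF b] k power2_eq_square mult_ac)
    finally show ?thesis using True False by simp
  qed (simp add: unit_fun_Inr)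
next
  case False
  then obtain j where k: "k = Suc (2 * j)" by (auto elim: oddE)
  show ?thesis unfolding k unit_fun_Inr dil_odd_inrv by simp
qed

text \<open>The squared Hilbert-Schmidt norm of a self-adjoint operator is the trace of its square,
  and each block contributes one copy. At k = 0 it would be n + m.\<close>

lemma hilbert_schmidt_dil:
  assumes b: "sv_basis n m A \<sigma> e" and k: "k > 0"
  shows "(\<Sum>q\<in>idx n m. nsq (idx n m) ((app (idx n m) (dil A) ^^ k) (unit_fun q))) = 2 * (\<Sum>l<n. \<sigma> l ^ (2 * k))"
proof -
  let ?T = "app (idx n m) (dil A)"
  have "of_real (\<Sum>q\<in>idx n m. nsq (idx n m) ((?T ^^ k) (unit_fun q))) = (\<Sum>q\<in>idx n m. (?T ^^ (2 * k)) (unit_fun q) q)"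
    unfolding of_real_sum
  proof (intro sum.cong refl)
    fix q assume q: "q \<in> idx n m"
    have "of_real (nsq (idx n m) ((?T ^^ k) (unit_fun q))) = ip (idx n m) (unit_fun q) ((?T ^^ k) ((?T ^^ k) (unit_fun q)))"
      by (simp add: ip_self[symmetric] ip_funpow)
    also have "\<dots> = (?T ^^ (2 * k)) (unit_fun q) q"
      using q by (subst ip_unit_left) (auto simp: mult_2 funpow_add)
    finally show "of_real (nsq (idx n m) ((?T ^^ k) (unit_fun q))) = (?T ^^ (2 * k)) (unit_fun q) q" .
  qed
  also have "\<dots> = of_real (2 * (\<Sum>l<n. \<sigma> l ^ (2 * k)))"
    unfolding sum_idx trace_dil_left[OF b] trace_dil_right[OF b] using k by simp
  finally show ?thesis by (simp only: of_real_eq_iff)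
qed

section \<open>Almost sure limits of the moments\<close>

lemma (in prob_space) distr_pair_of_indep:
  assumes Y: "random_variable N Y" and X: "random_variable P X"
    and ind: "\<And>A B. A \<in> sets N \<Longrightarrow> B \<in> sets P \<Longrightarrow>
      prob ((Y -` A \<inter> space M) \<inter> (X -` B \<inter> space M)) = prob (Y -` A \<inter> space M) * prob (X -` B \<inter> space M)"
  shows "distr M N Y \<Otimes>\<^sub>M distr M P X = distr M (N \<Otimes>\<^sub>M P) (\<lambda>\<omega>. (Y \<omega>, X \<omega>))"
proof (rule pair_measure_eqI)
  interpret Y: prob_space "distr M N Y" by (rule prob_space_distr) (rule Y)
  interpret X: prob_space "distr M P X" by (rule prob_space_distr) (rule X)
  show "sigma_finite_measure (distr M N Y)" "sigma_finite_measure (distr M P X)" by unfold_locales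
  show "sets (distr M N Y \<Otimes>\<^sub>M distr M P X) = sets (distr M (N \<Otimes>\<^sub>M P) (\<lambda>\<omega>. (Y \<omega>, X \<omega>)))"
    by (simp cong: sets_pair_measure_cong)
  fix A B assume "A \<in> sets (distr M N Y)" "B \<in> sets (distr M P X)"
  then have AB: "A \<in> sets N" "B \<in> sets P" by simp_all
  have pm: "(\<lambda>\<omega>. (Y \<omega>, X \<omega>)) \<in> measurable M (N \<Otimes>\<^sub>M P)" using Y X by measurable
  have "(\<lambda>\<omega>. (Y \<omega>, X \<omega>)) -` (A \<times> B) \<inter> space M = (Y -` A \<inter> space M) \<inter> (X -` B \<inter> space M)" by auto
  then have "emeasure (distr M (N \<Otimes>\<^sub>M P) (\<lambda>\<omega>. (Y \<omega>, X \<omega>))) (A \<times> B) = ennreal (prob ((Y -` A \<inter> space M) \<inter> (X -` B \<inter> space M)))"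
    using AB by (subst emeasure_distr[OF pm]) (auto simp: emeasure_eq_measure)
  then show "emeasure (distr M N Y) A * emeasure (distr M P X) B = emeasure (distr M (N \<Otimes>\<^sub>M P) (\<lambda>\<omega>. (Y \<omega>, X \<omega>))) (A \<times> B)"
    using AB by (simp add: ind emeasure_distr[OF Y] emeasure_distr[OF X] emeasure_eq_measure ennreal_mult)
qed

text \<open>Conditioning on Y freezes the coefficients, so Fubini reduces the claim to the
  deterministic form. The bound h on the squared Hilbert-Schmidt norm must hold at every y, so that
  the outer integral is over a constant.\<close>

lemma (in prob_space) indep_quadratic_form:
  fixes Y :: "'a \<Rightarrow> 'y" and \<xi> :: "'a \<Rightarrow> 'k \<Rightarrow> complex" and a :: "'y \<Rightarrow> 'k \<Rightarrow> 'k \<Rightarrow> complex"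
  assumes \<nu>: "normalized_law \<nu>" and K: "finite K"
    and Y[measurable]: "random_variable N Y" and x[measurable]: "random_variable (PiM K (\<lambda>_. borel)) \<xi>"
    and eq: "distr M N Y \<Otimes>\<^sub>M distr M (PiM K (\<lambda>_. borel)) \<xi> = distr M (N \<Otimes>\<^sub>M PiM K (\<lambda>_. borel)) (\<lambda>\<omega>. (Y \<omega>, \<xi> \<omega>))"
    and law: "distr M (PiM K (\<lambda>_. borel)) \<xi> = PiM K (\<lambda>_. \<nu>)"
    and am: "\<And>k l. k \<in> K \<Longrightarrow> l \<in> K \<Longrightarrow> (\<lambda>y. a y k l) \<in> borel_measurable N"
    and hs: "\<And>y. y \<in> space N \<Longrightarrow> (\<Sum>k\<in>K. \<Sum>l\<in>K. (norm (a y k l))\<^sup>2) \<le> h"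
  shows "(\<integral>\<^sup>+\<omega>. ennreal (norm (normalized_law.qform K (a (Y \<omega>)) (\<xi> \<omega>)) ^ 4) \<partial>M) \<le> ennreal (361 * (normalized_law.C8 \<nu>)\<^sup>2 * h\<^sup>2)"
    and "random_variable borel (\<lambda>\<omega>. norm (normalized_law.qform K (a (Y \<omega>)) (\<xi> \<omega>)))"
proof -
  interpret \<nu>: normalized_law \<nu> by (rule \<nu>)
  let ?P = "PiM K (\<lambda>_. borel :: complex measure)"
  interpret X: prob_space "distr M ?P \<xi>" by (rule prob_space_distr) (rule x)
  interpret Y: prob_space "distr M N Y" by (rule prob_space_distr) (rule Y)
  define f where "f z = norm (\<nu>.qform K (a (fst z)) (snd z))" for z :: "'y \<times> ('k \<Rightarrow> complex)"
  have fm: "f \<in> borel_measurable (N \<Otimes>\<^sub>M ?P)"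
  proof -
    have 1: "(\<lambda>z. a (fst z) k l) \<in> borel_measurable (N \<Otimes>\<^sub>M ?P)" if "k \<in> K" "l \<in> K" for k l
      using measurable_compose[OF measurable_fst am[OF that]] .
    have 2: "(\<lambda>z. snd z k) \<in> borel_measurable (N \<Otimes>\<^sub>M ?P)" if "k \<in> K" for k
      using measurable_compose[OF measurable_snd measurable_component_singleton[OF that]] .
    have 3: "(\<lambda>z. cnj (snd z k)) \<in> borel_measurable (N \<Otimes>\<^sub>M ?P)" if "k \<in> K" for k
      using measurable_compose[OF 2[OF that] measurable_cnj] .
    have [measurable]: "(\<lambda>z. \<nu>.qform K (a (fst z)) (snd z)) \<in> borel_measurable (N \<Otimes>\<^sub>M ?P)" unfolding \<nu>.qform_def
      by (intro borel_measurable_diff borel_measurable_sum borel_measurable_times 1 2 3) auto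
    show ?thesis unfolding f_def by measurable
  qed
  have pm: "(\<lambda>\<omega>. (Y \<omega>, \<xi> \<omega>)) \<in> measurable M (N \<Otimes>\<^sub>M ?P)" by measurable
  show "random_variable borel (\<lambda>\<omega>. norm (normalized_law.qform K (a (Y \<omega>)) (\<xi> \<omega>)))"
    using measurable_compose[OF pm fm] by (simp add: f_def)
  have f4: "(\<lambda>z. ennreal (f z ^ 4)) \<in> borel_measurable (N \<Otimes>\<^sub>M ?P)" using fm by measurable
  have "(\<integral>\<^sup>+\<omega>. ennreal (norm (\<nu>.qform K (a (Y \<omega>)) (\<xi> \<omega>)) ^ 4) \<partial>M) = (\<integral>\<^sup>+z. ennreal (f z ^ 4) \<partial>distr M (N \<Otimes>\<^sub>M ?P) (\<lambda>\<omega>. (Y \<omega>, \<xi> \<omega>)))"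
    by (subst nn_integral_distr[OF pm]) (use f4 in \<open>simp_all add: f_def\<close>)
  also have "\<dots> = (\<integral>\<^sup>+z. ennreal (f z ^ 4) \<partial>(distr M N Y \<Otimes>\<^sub>M distr M ?P \<xi>))" by (simp only: eq)
  also have "\<dots> = (\<integral>\<^sup>+y. (\<integral>\<^sup>+x. ennreal (f (y, x) ^ 4) \<partial>distr M ?P \<xi>) \<partial>distr M N Y)"
    by (rule X.nn_integral_fst[symmetric]) (use f4 in \<open>simp cong: measurable_cong_sets\<close>)
  also have "\<dots> \<le> (\<integral>\<^sup>+y. ennreal (361 * \<nu>.C8\<^sup>2 * h\<^sup>2) \<partial>distr M N Y)"
  proof (rule nn_integral_mono)
    fix y assume "y \<in> space (distr M N Y)"
    then have y: "y \<in> space N" by simp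
    have "(\<integral>\<^sup>+x. ennreal (f (y, x) ^ 4) \<partial>distr M ?P \<xi>) \<le> ennreal (361 * \<nu>.C8\<^sup>2 * (\<Sum>k\<in>K. \<Sum>l\<in>K. (norm (a y k l))\<^sup>2)\<^sup>2)"
      unfolding law f_def fst_conv snd_conv by (rule \<nu>.quadratic_form_fourth_moment[OF K])
    also have "\<dots> \<le> ennreal (361 * \<nu>.C8\<^sup>2 * h\<^sup>2)"
      using hs[OF y] by (intro ennreal_leI mult_left_mono power_mono) (auto intro!: sum_nonneg)
    finally show "(\<integral>\<^sup>+x. ennreal (f (y, x) ^ 4) \<partial>distr M ?P \<xi>) \<le> ennreal (361 * \<nu>.C8\<^sup>2 * h\<^sup>2)" .
  qed
  also have "\<dots> = ennreal (361 * \<nu>.C8\<^sup>2 * h\<^sup>2)" using Y.emeasure_space_1 by simp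
  finally show "(\<integral>\<^sup>+\<omega>. ennreal (norm (\<nu>.qform K (a (Y \<omega>)) (\<xi> \<omega>)) ^ 4) \<partial>M) \<le> ennreal (361 * \<nu>.C8\<^sup>2 * h\<^sup>2)" .
qed

text \<open>The expected sum of the fourth powers is finite; almost surely the sum itself is then
  finite and its terms tend to 0.\<close>

lemma AE_tendsto_0_of_fourth_moments:
  fixes Z :: "nat \<Rightarrow> 'a \<Rightarrow> real"
  assumes m: "\<And>n. Z n \<in> borel_measurable M" and nn: "\<And>n \<omega>. 0 \<le> Z n \<omega>"
    and le: "\<And>n. n \<ge> 1 \<Longrightarrow> (\<integral>\<^sup>+\<omega>. ennreal (Z n \<omega> ^ 4) \<partial>M) \<le> ennreal (C / real n ^ 2)"
  shows "AE \<omega> in M. (\<lambda>n. Z n \<omega>) \<longlonglongrightarrow> 0"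
proof -
  define D where "D = max C 0"
  have le': "(\<integral>\<^sup>+\<omega>. ennreal (Z (Suc n) \<omega> ^ 4) \<partial>M) \<le> ennreal (D / real (Suc n) ^ 2)" for n
    by (rule order_trans[OF le]) (auto simp: D_def intro!: ennreal_leI divide_right_mono)
  have s: "summable (\<lambda>n. D / real (Suc n) ^ 2)"
  proof -
    have "summable (\<lambda>n. inverse (real n ^ 2))" by (rule inverse_power_summable) simp
    then have "summable (\<lambda>n. inverse (real (Suc n) ^ 2))" by (subst summable_Suc_iff)
    then have "summable (\<lambda>n. D * inverse (real (Suc n) ^ 2))" by (rule summable_mult)
    then show ?thesis by (simp add: divide_inverse)
  qed
  have "(\<integral>\<^sup>+\<omega>. (\<Sum>n. ennreal (Z (Suc n) \<omega> ^ 4)) \<partial>M) = (\<Sum>n. \<integral>\<^sup>+\<omega>. ennreal (Z (Suc n) \<omega> ^ 4) \<partial>M)"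
    by (intro nn_integral_suminf) (use m in measurable)
  also have "\<dots> \<le> (\<Sum>n. ennreal (D / real (Suc n) ^ 2))" by (intro suminf_le le' summableI)
  also have "\<dots> = ennreal (\<Sum>n. D / real (Suc n) ^ 2)" by (rule suminf_ennreal2[OF _ s]) (simp add: D_def)
  also have "\<dots> < \<infinity>" by simp
  finally have "(\<integral>\<^sup>+\<omega>. (\<Sum>n. ennreal (Z (Suc n) \<omega> ^ 4)) \<partial>M) \<noteq> \<infinity>" by simp
  then have "AE \<omega> in M. (\<Sum>n. ennreal (Z (Suc n) \<omega> ^ 4)) \<noteq> \<infinity>"
    by (intro nn_integral_PInf_AE) (use m in measurable)
  then show ?thesis
  proof eventually_elim
    case (elim \<omega>)
    have "summable (\<lambda>n. Z (Suc n) \<omega> ^ 4)"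
      by (rule summable_suminf_not_top) (use elim nn in auto)
    then have "(\<lambda>n. Z (Suc n) \<omega> ^ 4) \<longlonglongrightarrow> 0" by (rule summable_LIMSEQ_zero)
    from tendsto_real_root[OF this, of 4] have "(\<lambda>n. Z (Suc n) \<omega>) \<longlonglongrightarrow> 0"
      using nn by (simp add: real_root_power_cancel)
    then show ?case by (rule LIMSEQ_imp_Suc)
  qed
qed

section \<open>The moments as quadratic forms in the entries\<close>

fun pos_of :: "(nat \<times> nat) + (nat \<times> nat) \<Rightarrow> nat + nat" where
  "pos_of (Inl (p, i)) = Inl p" | "pos_of (Inr (q, i)) = Inr q"

fun label_of :: "(nat \<times> nat) + (nat \<times> nat) \<Rightarrow> nat + nat" where
  "label_of (Inl (p, i)) = Inl i" | "label_of (Inr (q, i)) = Inr i"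

text \<open>The entries of both matrices as a single family of variables: \<open>label_of\<close>
  names the column, hence the spike, and \<open>pos_of\<close> the coordinate of the dilation that
  the entry occupies.\<close>

abbreviation entry_idx :: "nat \<Rightarrow> nat \<Rightarrow> nat \<Rightarrow> ((nat \<times> nat) + (nat \<times> nat)) set" where
  "entry_idx n m r \<equiv> ({..<n} \<times> {..<r}) <+> ({..<m} \<times> {..<r})"

lemma sum_entry_idx: "(\<Sum>\<kappa>\<in>entry_idx n m r. f \<kappa>) = (\<Sum>p<n. \<Sum>i<r. f (Inl (p, i))) + (\<Sum>q<m. \<Sum>i<r. f (Inr (q, i)))"
  by (simp add: sum.Plus sum.cartesian_product)

lemma sum_label:
  assumes "s \<in> idx r r"
  shows "(\<Sum>\<kappa>\<in>entry_idx n m r. if label_of \<kappa> = s then f \<kappa> else 0) =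
    (case s of Inl i \<Rightarrow> \<Sum>p<n. f (Inl (p, i)) | Inr i \<Rightarrow> \<Sum>q<m. f (Inr (q, i)))"
  using assms by (auto simp: sum_entry_idx)

definition weight :: "nat \<Rightarrow> nat \<Rightarrow> nat + nat \<Rightarrow> real" where
  "weight n m s = (case s of Inl _ \<Rightarrow> 1 / sqrt (real n) | Inr _ \<Rightarrow> 1 / sqrt (real m))"

definition spike_vec :: "nat \<Rightarrow> nat \<Rightarrow> ((nat \<times> nat) + (nat \<times> nat) \<Rightarrow> complex) \<Rightarrow> nat + nat \<Rightarrow> nat + nat \<Rightarrow> complex" where
  "spike_vec n m g s = (case s of
      Inl i \<Rightarrow> inlv (\<lambda>p. of_real (1 / sqrt (real n)) * g (Inl (p, i)))
    | Inr i \<Rightarrow> inrv (\<lambda>q. of_real (1 / sqrt (real m)) * g (Inr (q, i))))"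

text \<open>The coefficients of a moment of order k of two spikes, as a sesquilinear form in all
  entries; they live on the two columns in question.\<close>

definition spike_coef :: "nat \<Rightarrow> nat \<Rightarrow> (nat \<Rightarrow> nat \<Rightarrow> complex) \<Rightarrow> nat \<Rightarrow> nat + nat \<Rightarrow> nat + nat \<Rightarrow>
    (nat \<times> nat) + (nat \<times> nat) \<Rightarrow> (nat \<times> nat) + (nat \<times> nat) \<Rightarrow> complex" where
  "spike_coef n m A k s t \<kappa> l = (if label_of \<kappa> = s then if label_of l = t then
     of_real (weight n m s * weight n m t) * (app (idx n m) (dil A) ^^ k) (unit_fun (pos_of l)) (pos_of \<kappa>) else 0 else 0)"

lemma ip_spike_vec:
  assumes "s \<in> idx r r"
  shows "ip (idx n m) (spike_vec n m g s) x =
    (\<Sum>\<kappa>\<in>entry_idx n m r. if label_of \<kappa> = s then of_real (weight n m s) * cnj (g \<kappa>) * x (pos_of \<kappa>) else 0)"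
  unfolding sum_label[OF assms] ip_def sum_idx spike_vec_def weight_def
  by (cases s) (simp_all add: algebra_simps)

lemma spike_vec_expand:
  assumes "s \<in> idx r r" "x \<in> idx n m"
  shows "spike_vec n m g s x =
    (\<Sum>\<kappa>\<in>entry_idx n m r. if label_of \<kappa> = s then of_real (weight n m s) * g \<kappa> * unit_fun (pos_of \<kappa>) x else 0)"
  unfolding sum_label[OF assms(1)] spike_vec_def weight_def
  using assms(2) by (cases s; cases x) (auto simp: if_distrib[of "\<lambda>z. _ * z"] cong: if_cong)

lemma ip_spike_moment:
  assumes s: "s \<in> idx r r" and t: "t \<in> idx r r"
  shows "ip (idx n m) (spike_vec n m g s) ((app (idx n m) (dil A) ^^ k) (spike_vec n m g t)) =
    (\<Sum>\<kappa>\<in>entry_idx n m r. \<Sum>l\<in>entry_idx n m r. spike_coef n m A k s t \<kappa> l * cnj (g \<kappa>) * g l)"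
proof -
  let ?T = "app (idx n m) (dil A)" and ?K = "entry_idx n m r"
  have e: "(?T ^^ k) (spike_vec n m g t) x = (\<Sum>l\<in>?K. (if label_of l = t then of_real (weight n m t) * g l else 0) * (?T ^^ k) (unit_fun (pos_of l)) x)"
    if x: "x \<in> idx n m" for x
  proof -
    have "(?T ^^ k) (spike_vec n m g t) x = (?T ^^ k) (\<lambda>x. \<Sum>l\<in>?K. (if label_of l = t then of_real (weight n m t) * g l else 0) * unit_fun (pos_of l) x) x"
    proof (rule funpow_app_cong[OF _ x])
      fix x assume "x \<in> idx n m"
      show "spike_vec n m g t x = (\<Sum>l\<in>?K. (if label_of l = t then of_real (weight n m t) * g l else 0) * unit_fun (pos_of l) x)"
        unfolding spike_vec_expand[OF t \<open>x \<in> idx n m\<close>] by (intro sum.cong refl) simp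
    qed
    then show ?thesis by (simp only: funpow_app_sum funpow_app_scale)
  qed
  have pk: "pos_of \<kappa> \<in> idx n m" if "\<kappa> \<in> ?K" for \<kappa> using that by auto
  have "ip (idx n m) (spike_vec n m g s) ((?T ^^ k) (spike_vec n m g t)) =
    (\<Sum>\<kappa>\<in>?K. if label_of \<kappa> = s then of_real (weight n m s) * cnj (g \<kappa>) *
      (\<Sum>l\<in>?K. (if label_of l = t then of_real (weight n m t) * g l else 0) * (?T ^^ k) (unit_fun (pos_of l)) (pos_of \<kappa>)) else 0)"
    unfolding ip_spike_vec[OF s] by (intro sum.cong refl if_cong) (simp only: e[OF pk])
  also have "\<dots> = (\<Sum>\<kappa>\<in>?K. \<Sum>l\<in>?K. spike_coef n m A k s t \<kappa> l * cnj (g \<kappa>) * g l)"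
  proof (intro sum.cong refl)
    fix \<kappa>
    show "(if label_of \<kappa> = s then of_real (weight n m s) * cnj (g \<kappa>) *
      (\<Sum>l\<in>?K. (if label_of l = t then of_real (weight n m t) * g l else 0) * (?T ^^ k) (unit_fun (pos_of l)) (pos_of \<kappa>)) else 0) =
      (\<Sum>l\<in>?K. spike_coef n m A k s t \<kappa> l * cnj (g \<kappa>) * g l)"
    proof (cases "label_of \<kappa> = s")
      case True
      then show ?thesis unfolding sum_distrib_left spike_coef_def if_P[OF True]
        by (intro sum.cong refl) (simp add: mult_ac)
    qed (simp add: spike_coef_def)
  qed
  finally show ?thesis .
qed

text \<open>The diagonal sum is the centring term of the quadratic form: a normalized trace over one
  block for equal spikes, and 0 otherwise since distinct columns share no entry.\<close>

lemma spike_coef_trace: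
  assumes b: "sv_basis n m A \<sigma> e" and s: "s \<in> idx r r" and t: "t \<in> idx r r" and nm: "0 < n" "n \<le> m"
  shows "(\<Sum>\<kappa>\<in>entry_idx n m r. spike_coef n m A k s t \<kappa> \<kappa>) = (if s = t then of_real (case s of
      Inl _ \<Rightarrow> (if even k then (\<Sum>l<n. \<sigma> l ^ k) / real n else 0)
    | Inr _ \<Rightarrow> (if k = 0 then 1 else if even k then real n / real m * ((\<Sum>l<n. \<sigma> l ^ k) / real n) else 0)) else 0)"
proof (cases "s = t")
  case True
  let ?T = "app (idx n m) (dil A)"
  have "(\<Sum>\<kappa>\<in>entry_idx n m r. spike_coef n m A k s t \<kappa> \<kappa>) =
    (\<Sum>\<kappa>\<in>entry_idx n m r. if label_of \<kappa> = s then of_real (weight n m s * weight n m s) * (?T ^^ k) (unit_fun (pos_of \<kappa>)) (pos_of \<kappa>) else 0)"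
    by (intro sum.cong refl) (simp add: spike_coef_def True)
  also have "\<dots> = of_real (case s of
      Inl _ \<Rightarrow> (if even k then (\<Sum>l<n. \<sigma> l ^ k) / real n else 0)
    | Inr _ \<Rightarrow> (if k = 0 then 1 else if even k then real n / real m * ((\<Sum>l<n. \<sigma> l ^ k) / real n) else 0))"
  proof (cases s)
    case (Inl i)
    show ?thesis unfolding sum_label[OF s] unfolding Inl using nm
      by (simp add: weight_def sum_distrib_left[symmetric] sum_divide_distrib[symmetric] trace_dil_left[OF b] del: of_real_mult flip: of_real_mult)
  next
    case (Inr i)
    show ?thesis unfolding sum_label[OF s] unfolding Inr using nm
      by (simp add: weight_def sum_distrib_left[symmetric] sum_divide_distrib[symmetric] trace_dil_right[OF b] del: of_real_mult flip: of_real_mult)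
  qed
  finally show ?thesis using True by simp
next
  case False
  have "spike_coef n m A k s t \<kappa> \<kappa> = 0" for \<kappa> using False by (simp add: spike_coef_def)
  with False show ?thesis by simp
qed

text \<open>Both squared weights are at most 1 / n, and for k > 0 the squared Hilbert-Schmidt norm
  of the power is a sum of n terms. For k = 0 it can be as large as m, which one of the weights
  cancels exactly.\<close>

lemma spike_coef_hs:
  assumes b: "sv_basis n m A \<sigma> e" and s: "s \<in> idx r r" and t: "t \<in> idx r r" and nm: "0 < n" "n \<le> m"
  shows "(\<Sum>\<kappa>\<in>entry_idx n m r. \<Sum>l\<in>entry_idx n m r. (norm (spike_coef n m A k s t \<kappa> l))\<^sup>2)
    \<le> (1 + 2 * ((\<Sum>l<n. \<sigma> l ^ (2 * k)) / real n)) / real n"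
proof -
  let ?T = "app (idx n m) (dil A)"
  define side where "side u = (case u of Inl _ \<Rightarrow> Inl ` {..<n} | Inr _ \<Rightarrow> Inr ` {..<m})" for u :: "nat + nat"
  have sl: "(\<Sum>\<kappa>\<in>entry_idx n m r. if label_of \<kappa> = u then f (pos_of \<kappa>) else 0) = (\<Sum>p\<in>side u. f p)"
    if "u \<in> idx r r" for u and f :: "nat + nat \<Rightarrow> real"
    unfolding sum_label[OF that] by (cases u) (simp_all add: side_def sum.reindex)
  have sub: "side u \<subseteq> idx n m" for u by (cases u) (auto simp: side_def)
  have w: "(weight n m u)\<^sup>2 \<le> 1 / real n" "0 \<le> weight n m u" for u
    using nm by (cases u; simp add: weight_def power_divide frac_le)+
  have nc: "(norm (spike_coef n m A k s t \<kappa> l))\<^sup>2 = (if label_of \<kappa> = s then (if label_of l = t then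
      (weight n m s)\<^sup>2 * (weight n m t)\<^sup>2 * (norm ((?T ^^ k) (unit_fun (pos_of l)) (pos_of \<kappa>)))\<^sup>2 else 0) else 0)" for \<kappa> l
    by (simp add: spike_coef_def norm_mult power_mult_distrib)
  have "(\<Sum>\<kappa>\<in>entry_idx n m r. \<Sum>l\<in>entry_idx n m r. (norm (spike_coef n m A k s t \<kappa> l))\<^sup>2) =
    (\<Sum>p\<in>side s. \<Sum>q\<in>side t. (weight n m s)\<^sup>2 * (weight n m t)\<^sup>2 * (norm ((?T ^^ k) (unit_fun q) p))\<^sup>2)"
  proof -
    have "(\<Sum>l\<in>entry_idx n m r. (norm (spike_coef n m A k s t \<kappa> l))\<^sup>2) =
      (if label_of \<kappa> = s then (\<Sum>q\<in>side t. (weight n m s)\<^sup>2 * (weight n m t)\<^sup>2 * (norm ((?T ^^ k) (unit_fun q) (pos_of \<kappa>)))\<^sup>2) else 0)" for \<kappa>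
      unfolding nc using sl[OF t, of "\<lambda>q. (weight n m s)\<^sup>2 * (weight n m t)\<^sup>2 * (norm ((?T ^^ k) (unit_fun q) (pos_of \<kappa>)))\<^sup>2"]
      by (cases "label_of \<kappa> = s") simp_all
    then show ?thesis using sl[OF s, of "\<lambda>p. \<Sum>q\<in>side t. (weight n m s)\<^sup>2 * (weight n m t)\<^sup>2 * (norm ((?T ^^ k) (unit_fun q) p))\<^sup>2"] by simp
  qed
  also have "\<dots> = (weight n m s)\<^sup>2 * (weight n m t)\<^sup>2 * (\<Sum>p\<in>side s. \<Sum>q\<in>side t. (norm ((?T ^^ k) (unit_fun q) p))\<^sup>2)"
    by (simp add: sum_distrib_left)
  also have "\<dots> \<le> (1 + 2 * ((\<Sum>l<n. \<sigma> l ^ (2 * k)) / real n)) / real n"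
  proof (cases "k = 0")
    case True
    have "(\<Sum>p\<in>side s. \<Sum>q\<in>side t. (norm ((?T ^^ k) (unit_fun q) p))\<^sup>2) = (\<Sum>p\<in>side s. \<Sum>q\<in>side t. if q = p then 1 else 0)"
      by (intro sum.cong refl) (auto simp: True)
    also have "\<dots> = (\<Sum>p\<in>side s. if p \<in> side t then 1 else 0)"
      by (intro sum.cong refl) (use finite_subset[OF sub[of t]] in \<open>simp add: sum.delta\<close>)
    also have "(weight n m s)\<^sup>2 * (weight n m t)\<^sup>2 * \<dots> \<le> 1 / real n"
    proof -
      have fs: "(\<Sum>p\<in>side s. if p \<in> side t then 1 else 0) \<le> real (card (side s))"
        by (rule order_trans[OF sum_bounded_above[of _ _ 1]]) auto
      have ws: "(weight n m s)\<^sup>2 * real (card (side s)) = 1"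
        using nm by (cases s) (simp_all add: weight_def side_def card_image power_divide)
      have "(weight n m s)\<^sup>2 * (weight n m t)\<^sup>2 * (\<Sum>p\<in>side s. if p \<in> side t then 1 else 0) \<le>
        (weight n m s)\<^sup>2 * (weight n m t)\<^sup>2 * real (card (side s))" by (intro mult_left_mono fs) simp
      also have "\<dots> = (weight n m t)\<^sup>2" using ws by (simp add: mult_ac)
      also have "\<dots> \<le> 1 / real n" by (rule w)
      finally show ?thesis .
    qed
    also have "\<dots> \<le> (1 + 2 * ((\<Sum>l<n. \<sigma> l ^ (2 * k)) / real n)) / real n"
      using nm True by (intro divide_right_mono) auto
    finally show ?thesis .
  next
    case False
    have "(\<Sum>p\<in>side s. \<Sum>q\<in>side t. (norm ((?T ^^ k) (unit_fun q) p))\<^sup>2) \<le> (\<Sum>p\<in>idx n m. \<Sum>q\<in>idx n m. (norm ((?T ^^ k) (unit_fun q) p))\<^sup>2)"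
      by (intro order_trans[OF sum_mono sum_mono2] sum_mono2 sub sum_nonneg) auto
    also have "\<dots> = (\<Sum>q\<in>idx n m. nsq (idx n m) ((?T ^^ k) (unit_fun q)))"
      unfolding nsq_def by (rule sum.swap)
    also have "\<dots> = 2 * (\<Sum>l<n. \<sigma> l ^ (2 * k))" using False by (intro hilbert_schmidt_dil[OF b]) simp
    finally have "(weight n m s)\<^sup>2 * (weight n m t)\<^sup>2 * (\<Sum>p\<in>side s. \<Sum>q\<in>side t. (norm ((?T ^^ k) (unit_fun q) p))\<^sup>2) \<le>
      (1 / real n) * (1 / real n) * (2 * (\<Sum>l<n. \<sigma> l ^ (2 * k)))"
      using w by (intro mult_mono sum_nonneg) auto
    also have "\<dots> \<le> (1 + 2 * ((\<Sum>l<n. \<sigma> l ^ (2 * k)) / real n)) / real n"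
      using nm by (simp add: add_divide_distrib)
    finally show ?thesis .
  qed
  finally show ?thesis .
qed

lemma measurable_dil_power:
  assumes x: "x \<in> idx n m"
  shows "(\<lambda>y. (app (idx n m) (dil (\<lambda>i j. y (i, j))) ^^ k) u x) \<in> borel_measurable (PiM ({..<n} \<times> {..<m}) (\<lambda>_. borel))"
  using x
proof (induction k arbitrary: x)
  case (Suc k)
  have d: "(\<lambda>y. dil (\<lambda>i j. y (i, j)) x t) \<in> borel_measurable (PiM ({..<n} \<times> {..<m}) (\<lambda>_. borel))" if "t \<in> idx n m" for t
  proof -
    have c: "(\<lambda>y. y (i, j)) \<in> borel_measurable (PiM ({..<n} \<times> {..<m}) (\<lambda>_. borel :: complex measure))" if "i < n" "j < m" for i j
      using that by (intro measurable_component_singleton) auto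
    have c': "(\<lambda>y. cnj (y (i, j))) \<in> borel_measurable (PiM ({..<n} \<times> {..<m}) (\<lambda>_. borel :: complex measure))" if "i < n" "j < m" for i j
      using measurable_compose[OF c[OF that] measurable_cnj] .
    show ?thesis using that Suc.prems by (cases x; cases t) (auto simp: dil_def intro: c c')
  qed
  show ?case unfolding funpow.simps comp_def app_def[of "idx n m" _ "(_ ^^ k) u"]
    by (intro borel_measurable_sum borel_measurable_times d Suc.IH)
qed simp

definition spike_moment :: "real \<Rightarrow> (nat \<Rightarrow> real) \<Rightarrow> nat + nat \<Rightarrow> nat \<Rightarrow> real" where
  "spike_moment c L s k = (case s of Inl _ \<Rightarrow> (if even k then L k else 0)
    | Inr _ \<Rightarrow> (if k = 0 then 1 else if even k then c * L k else 0))"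

text \<open>The squared Hilbert-Schmidt norms are O(1/n) along almost every realization, but with no
  common constant. The coefficients are therefore set to 0 where the squared norm exceeds
  \<open>B / n\<close>; the forms tend to 0 almost surely for all naturals B at once, and almost
  every realization has some B at which the truncation never acts.\<close>

lemma (in prob_space) spike_moments_AE:
  fixes m :: "nat \<Rightarrow> nat" and r :: nat and c :: real and L :: "nat \<Rightarrow> real" and A :: "nat \<Rightarrow> 'a \<Rightarrow> nat \<Rightarrow> nat \<Rightarrow> complex"
    and g :: "nat \<Rightarrow> 'a \<Rightarrow> (nat \<times> nat) + (nat \<times> nat) \<Rightarrow> complex" and \<sigma> :: "nat \<Rightarrow> 'a \<Rightarrow> nat \<Rightarrow> real"
  defines "Y n \<omega> \<equiv> restrict (\<lambda>(i, j). A n \<omega> i j) ({..<n} \<times> {..<m n})"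
    and "\<xi> n \<omega> \<equiv> restrict (g n \<omega>) (entry_idx n (m n) r)"
    and "N n \<equiv> PiM ({..<n} \<times> {..<m n}) (\<lambda>_. borel :: complex measure)"
    and "Q n \<equiv> PiM (entry_idx n (m n) r) (\<lambda>_. borel :: complex measure)"
  assumes \<nu>: "normalized_law \<nu>"
    and m: "\<And>n. n \<ge> 1 \<Longrightarrow> n \<le> m n" and c: "(\<lambda>n. real n / real (m n)) \<longlonglongrightarrow> c"
    and Ym: "\<And>n. n \<ge> 1 \<Longrightarrow> random_variable (N n) (Y n)" and xm: "\<And>n. n \<ge> 1 \<Longrightarrow> random_variable (Q n) (\<xi> n)"
    and eq: "\<And>n. n \<ge> 1 \<Longrightarrow> distr M (N n) (Y n) \<Otimes>\<^sub>M distr M (Q n) (\<xi> n) = distr M (N n \<Otimes>\<^sub>M Q n) (\<lambda>\<omega>. (Y n \<omega>, \<xi> n \<omega>))"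
    and law: "\<And>n. n \<ge> 1 \<Longrightarrow> distr M (Q n) (\<xi> n) = PiM (entry_idx n (m n) r) (\<lambda>_. \<nu>)"
    and basis: "\<And>n \<omega>. n \<ge> 1 \<Longrightarrow> \<omega> \<in> space M \<Longrightarrow> \<exists>e. sv_basis n (m n) (A n \<omega>) (\<sigma> n \<omega>) e"
    and lim: "AE \<omega> in M. \<forall>k. (\<lambda>n. (\<Sum>l<n. \<sigma> n \<omega> l ^ k) / real n) \<longlonglongrightarrow> L k"
  shows "AE \<omega> in M. \<forall>k. \<forall>s\<in>idx r r. \<forall>t\<in>idx r r.
    (\<lambda>n. ip (idx n (m n)) (spike_vec n (m n) (g n \<omega>) s) ((app (idx n (m n)) (dil (A n \<omega>)) ^^ k) (spike_vec n (m n) (g n \<omega>) t)))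
      \<longlonglongrightarrow> (if s = t then of_real (spike_moment c L s k) else 0)"
proof -
  let ?K = "\<lambda>n. entry_idx n (m n) r"
  define hs where "hs n k s t y = (\<Sum>\<kappa>\<in>?K n. \<Sum>l\<in>?K n. (norm (spike_coef n (m n) (\<lambda>i j. y (i, j)) k s t \<kappa> l))\<^sup>2)" for n k s t y
  define a where "a n k s t B y \<kappa> l = (if hs n k s t y \<le> real B / real n then spike_coef n (m n) (\<lambda>i j. y (i, j)) k s t \<kappa> l else 0)" for n k s t B y \<kappa> l
  \<comment> \<open>Set to 0 at n = 0, where the hypotheses say nothing.\<close>
  define Z where "Z k s t B n \<omega> = (if n = 0 then 0 else norm (normalized_law.qform (?K n) (a n k s t B (Y n \<omega>)) (\<xi> n \<omega>)))" for k s t B n \<omega>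
  have cm: "(\<lambda>y. spike_coef n (m n) (\<lambda>i j. y (i, j)) k s t \<kappa> l) \<in> borel_measurable (N n)" if "\<kappa> \<in> ?K n" for n k s t \<kappa> l
  proof -
    have "pos_of \<kappa> \<in> idx n (m n)" using that by auto
    then show ?thesis unfolding spike_coef_def N_def
      by (cases "label_of \<kappa> = s"; cases "label_of l = t") (auto intro!: borel_measurable_times measurable_dil_power)
  qed
  have hm: "hs n k s t \<in> borel_measurable (N n)" for n k s t
    unfolding hs_def[abs_def] by (intro borel_measurable_sum borel_measurable_power measurable_compose[OF cm borel_measurable_norm])
  have am: "(\<lambda>y. a n k s t B y \<kappa> l) \<in> borel_measurable (N n)" if "\<kappa> \<in> ?K n" for n k s t B \<kappa> l
    unfolding a_def using hm cm[OF that] by measurable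
  have ahs: "(\<Sum>\<kappa>\<in>?K n. \<Sum>l\<in>?K n. (norm (a n k s t B y \<kappa> l))\<^sup>2) \<le> real B / real n" for n k s t B y
    by (cases "hs n k s t y \<le> real B / real n") (simp_all add: a_def hs_def)
  have Z0: "AE \<omega> in M. (\<lambda>n. Z k s t B n \<omega>) \<longlonglongrightarrow> 0" for k s t B
  proof (rule AE_tendsto_0_of_fourth_moments)
    show "0 \<le> Z k s t B n \<omega>" for n \<omega> by (simp add: Z_def)
    have iq: "(\<integral>\<^sup>+\<omega>. ennreal (norm (normalized_law.qform (?K n) (a n k s t B (Y n \<omega>)) (\<xi> n \<omega>)) ^ 4) \<partial>M) \<le>
        ennreal (361 * (normalized_law.C8 \<nu>)\<^sup>2 * (real B / real n)\<^sup>2)"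
      "random_variable borel (\<lambda>\<omega>. norm (normalized_law.qform (?K n) (a n k s t B (Y n \<omega>)) (\<xi> n \<omega>)))" if n: "n \<ge> 1" for n
    proof -
      note q = indep_quadratic_form[OF \<nu> _ Ym[OF n] xm[OF n, unfolded Q_def] eq[OF n, unfolded Q_def] law[OF n, unfolded Q_def] am ahs]
      show "(\<integral>\<^sup>+\<omega>. ennreal (norm (normalized_law.qform (?K n) (a n k s t B (Y n \<omega>)) (\<xi> n \<omega>)) ^ 4) \<partial>M) \<le>
        ennreal (361 * (normalized_law.C8 \<nu>)\<^sup>2 * (real B / real n)\<^sup>2)" by (rule q(1)) auto
      show "random_variable borel (\<lambda>\<omega>. norm (normalized_law.qform (?K n) (a n k s t B (Y n \<omega>)) (\<xi> n \<omega>)))" by (rule q(2)) auto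
    qed
    show "Z k s t B n \<in> borel_measurable M" for n
      using iq(2)[of n] by (cases "n = 0") (simp_all add: Z_def[abs_def])
    show "(\<integral>\<^sup>+\<omega>. ennreal (Z k s t B n \<omega> ^ 4) \<partial>M) \<le> ennreal ((361 * (normalized_law.C8 \<nu>)\<^sup>2 * (real B)\<^sup>2) / real n ^ 2)" if "n \<ge> 1" for n
      using iq(1)[OF that] that by (simp add: Z_def power_divide)
  qed
  have "AE \<omega> in M. \<forall>k s t B. (\<lambda>n. Z k s t B n \<omega>) \<longlonglongrightarrow> 0"
    unfolding AE_all_countable using Z0 by blast
  with lim AE_space show ?thesis
  proof eventually_elim
    case (elim \<omega>)
    show ?case
    proof (intro allI ballI)
      fix k s t assume s: "s \<in> idx r r" and t: "t \<in> idx r r"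
      let ?h = "\<lambda>n. (\<Sum>l<n. \<sigma> n \<omega> l ^ (2 * k)) / real n"
      let ?M = "\<lambda>n. ip (idx n (m n)) (spike_vec n (m n) (g n \<omega>) s) ((app (idx n (m n)) (dil (A n \<omega>)) ^^ k) (spike_vec n (m n) (g n \<omega>) t))"
      let ?tr = "\<lambda>n. (if s = t then complex_of_real (case s of
          Inl _ \<Rightarrow> (if even k then (\<Sum>l<n. \<sigma> n \<omega> l ^ k) / real n else 0)
        | Inr _ \<Rightarrow> (if k = 0 then 1 else if even k then real n / real (m n) * ((\<Sum>l<n. \<sigma> n \<omega> l ^ k) / real n) else 0)) else 0)"
      have lk: "\<And>k. (\<lambda>n. (\<Sum>l<n. \<sigma> n \<omega> l ^ k) / real n) \<longlonglongrightarrow> L k" using elim(1) by blast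
      \<comment> \<open>Convergent averages are bounded, which supplies the truncation level of this
        realization.\<close>
      obtain C where C: "\<And>n. norm (?h n) \<le> C"
        using convergent_imp_Bseq[OF convergentI[OF lk[of "2 * k"]]] unfolding Bseq_def by blast
      obtain B where B: "1 + 2 * C \<le> real B" using real_arch_simple by blast
      have eqn: "norm (?M n - ?tr n) = Z k s t B n \<omega>" if n: "n \<ge> 1" for n
      proof -
        obtain e where e: "sv_basis n (m n) (A n \<omega>) (\<sigma> n \<omega>) e" using basis[OF n elim(2)] by blast
        have n0: "0 < n" "n \<le> m n" using n m by auto
        have pe: "spike_coef n (m n) (\<lambda>i j. Y n \<omega> (i, j)) k s t \<kappa> l = spike_coef n (m n) (A n \<omega>) k s t \<kappa> l"
          if "\<kappa> \<in> ?K n" "l \<in> ?K n" for \<kappa> l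
        proof -
          have ac: "app (idx n (m n)) (dil (\<lambda>i j. Y n \<omega> (i, j))) u x = app (idx n (m n)) (dil (A n \<omega>)) u x" if "x \<in> idx n (m n)" for u x
            unfolding app_def using that by (intro sum.cong refl) (auto simp: dil_def Y_def)
          have "(app (idx n (m n)) (dil (\<lambda>i j. Y n \<omega> (i, j))) ^^ k) u x = (app (idx n (m n)) (dil (A n \<omega>)) ^^ k) u x" if "x \<in> idx n (m n)" for u x
            using that
          proof (induction k arbitrary: x)
            case (Suc k)
            have "app (idx n (m n)) (dil (A n \<omega>)) ((app (idx n (m n)) (dil (\<lambda>i j. Y n \<omega> (i, j))) ^^ k) u) =
              app (idx n (m n)) (dil (A n \<omega>)) ((app (idx n (m n)) (dil (A n \<omega>)) ^^ k) u)" by (intro app_cong Suc.IH)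
            then show ?case using ac[OF Suc.prems] by simp
          qed simp
          moreover have "pos_of \<kappa> \<in> idx n (m n)" using that by auto
          ultimately show ?thesis by (simp add: spike_coef_def)
        qed
        have "hs n k s t (Y n \<omega>) \<le> (1 + 2 * ?h n) / real n"
          unfolding hs_def using spike_coef_hs[OF e s t n0, of k] by (simp add: pe)
        also have "\<dots> \<le> real B / real n"
        proof (rule divide_right_mono)
          have "?h n \<le> C" using C[of n] unfolding real_norm_def by linarith
          then show "1 + 2 * ?h n \<le> real B" using B by linarith
        qed simp
        finally have "a n k s t B (Y n \<omega>) \<kappa> l = spike_coef n (m n) (A n \<omega>) k s t \<kappa> l" if "\<kappa> \<in> ?K n" "l \<in> ?K n" for \<kappa> l
          using pe[OF that] by (simp add: a_def)
        then have "normalized_law.qform (?K n) (a n k s t B (Y n \<omega>)) (\<xi> n \<omega>) = ?M n - ?tr n"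
          unfolding ip_spike_moment[OF s t] spike_coef_trace[OF e s t n0, symmetric] normalized_law.qform_def[OF \<nu>]
          by (simp add: \<xi>_def)
        then show ?thesis using n by (simp add: Z_def)
      qed
      have "(\<lambda>n. Z k s t B n \<omega>) \<longlonglongrightarrow> 0" using elim(3) by blast
      moreover have "\<forall>\<^sub>F n in sequentially. Z k s t B n \<omega> = norm (?M n - ?tr n)"
        using eventually_ge_at_top[of 1] by eventually_elim (rule eqn[symmetric])
      ultimately have "(\<lambda>n. norm (?M n - ?tr n)) \<longlonglongrightarrow> 0" by (rule Lim_transform_eventually)
      then have d: "(\<lambda>n. ?M n - ?tr n) \<longlonglongrightarrow> 0" by (rule tendsto_norm_zero_cancel)
      have tr: "?tr \<longlonglongrightarrow> (if s = t then of_real (spike_moment c L s k) else 0)"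
      proof (cases "s = t")
        case True
        have "(\<lambda>n. real n / real (m n) * ((\<Sum>l<n. \<sigma> n \<omega> l ^ k) / real n)) \<longlonglongrightarrow> c * L k" by (intro tendsto_mult c lk)
        then have "(\<lambda>n. case s of
          Inl _ \<Rightarrow> (if even k then (\<Sum>l<n. \<sigma> n \<omega> l ^ k) / real n else 0)
        | Inr _ \<Rightarrow> (if k = 0 then 1 else if even k then real n / real (m n) * ((\<Sum>l<n. \<sigma> n \<omega> l ^ k) / real n) else 0)) \<longlonglongrightarrow> spike_moment c L s k"
          using lk[of k] by (cases s; cases "even k"; cases "k = 0") (simp_all add: spike_moment_def)
        then show ?thesis unfolding if_P[OF True] by (rule tendsto_of_real)
      qed simp
      from tendsto_add[OF d tr] show "?M \<longlonglongrightarrow> (if s = t then of_real (spike_moment c L s k) else 0)" by simp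
    qed
  qed
qed

section \<open>Projections onto almost orthonormal families\<close>

text \<open>Gram-Schmidt by induction: the residuals of \<open>s j0\<close> and of x modulo J, then
  one further coefficient, taken as 0 if the residual of \<open>s j0\<close> vanishes. K is a
  conjugation-stable subfield; coefficients inside it make the projection a combination over the
  original scalar field.\<close>

lemma normal_equations:
  assumes "finite J" and I: "finite I"
    and K: "0 \<in> K" "\<And>x y. x \<in> K \<Longrightarrow> y \<in> K \<Longrightarrow> x + y \<in> K" "\<And>x y. x \<in> K \<Longrightarrow> y \<in> K \<Longrightarrow> x - y \<in> K"
      "\<And>x y. x \<in> K \<Longrightarrow> y \<in> K \<Longrightarrow> x * y \<in> K" "\<And>x y. x \<in> K \<Longrightarrow> y \<in> K \<Longrightarrow> x / y \<in> K" "\<And>x. x \<in> K \<Longrightarrow> cnj x \<in> K"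
    and s: "\<And>j i. j \<in> J \<Longrightarrow> i \<in> I \<Longrightarrow> s j i \<in> K" and x: "\<And>i. i \<in> I \<Longrightarrow> x i \<in> K"
  shows "\<exists>\<alpha>. (\<forall>j\<in>J. \<alpha> j \<in> K) \<and> (\<forall>j\<in>J. ip I (s j) (\<lambda>i. x i - (\<Sum>k\<in>J. \<alpha> k * s k i)) = 0)"
  using assms(1) s x
proof (induction J arbitrary: x rule: finite_induct)
  case (insert j0 J)
  have sumK: "(\<Sum>k\<in>A. f k) \<in> K" if "finite A" "\<And>k. k \<in> A \<Longrightarrow> f k \<in> K" for A :: "'c set" and f
    using that by (induction A rule: finite_induct) (auto intro: K)
  have sumJ: "(\<Sum>k\<in>J. f k) \<in> K" if "\<And>k. k \<in> J \<Longrightarrow> f k \<in> K" for f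
    using insert(1) that by (induction J rule: finite_induct) (auto intro: K)
  obtain \<beta> where \<beta>: "\<forall>j\<in>J. \<beta> j \<in> K" "\<forall>j\<in>J. ip I (s j) (\<lambda>i. s j0 i - (\<Sum>k\<in>J. \<beta> k * s k i)) = 0"
    using insert.IH[of "s j0"] insert.prems by (auto elim!: exE conjE)
  obtain \<alpha> where \<alpha>: "\<forall>j\<in>J. \<alpha> j \<in> K" "\<forall>j\<in>J. ip I (s j) (\<lambda>i. x i - (\<Sum>k\<in>J. \<alpha> k * s k i)) = 0"
    using insert.IH[of x] insert.prems by (auto elim!: exE conjE)
  define s' where "s' = (\<lambda>i. s j0 i - (\<Sum>k\<in>J. \<beta> k * s k i))"
  define x' where "x' = (\<lambda>i. x i - (\<Sum>k\<in>J. \<alpha> k * s k i))"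
  define c where "c = (if nsq I s' = 0 then 0 else ip I s' x' / ip I s' s')"
  define \<gamma> where "\<gamma> k = (if k = j0 then c else \<alpha> k - c * \<beta> k)" for k
  have s'K: "s' i \<in> K" and x'K: "x' i \<in> K" if "i \<in> I" for i
    unfolding s'_def x'_def using that \<alpha>(1) \<beta>(1) insert.prems by (auto intro!: K(2-4) sumJ)
  have "ip I s' x' \<in> K" "ip I s' s' \<in> K"
    unfolding ip_def using s'K x'K I by (auto intro!: sumK K(4,6))
  then have cK: "c \<in> K" by (auto simp: c_def intro: K)
  have s's: "ip I (s j) s' = 0" if "j \<in> J" for j using \<beta> that by (simp add: s'_def)
  have x's: "ip I (s j) x' = 0" if "j \<in> J" for j using \<alpha> that by (simp add: x'_def)
  have eq: "x i - (\<Sum>k\<in>insert j0 J. \<gamma> k * s k i) = x' i - c * s' i" for i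
  proof -
    have "(\<Sum>k\<in>J. \<gamma> k * s k i) = (\<Sum>k\<in>J. \<alpha> k * s k i - c * (\<beta> k * s k i))"
      using insert(2) by (intro sum.cong refl) (auto simp: \<gamma>_def algebra_simps)
    also have "\<dots> = (\<Sum>k\<in>J. \<alpha> k * s k i) - c * (\<Sum>k\<in>J. \<beta> k * s k i)"
      by (simp add: sum_subtractf sum_distrib_left)
    finally show ?thesis using insert(1,2) by (simp add: \<gamma>_def x'_def s'_def algebra_simps)
  qed
  have s'x: "ip I s' (\<lambda>i. x' i - c * s' i) = 0"
  proof (cases "nsq I s' = 0")
    case True
    then have "\<forall>i\<in>I. s' i = 0" using nsq_eq_0_iff[OF I] by blast
    then show ?thesis by (simp add: ip_def)
  next
    case False
    then have "c * ip I s' s' = ip I s' x'" by (simp add: c_def ip_self)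
    then show ?thesis unfolding ip_diff_right ip_scale_right by simp
  qed
  have J0: "ip I (s j) (\<lambda>i. x' i - c * s' i) = 0" if "j \<in> J" for j
    using that by (simp add: ip_diff_right ip_scale_right s's x's)
  have "s j0 = (\<lambda>i. s' i + (\<Sum>k\<in>J. \<beta> k * s k i))" by (simp add: s'_def)
  then have "ip I (s j0) (\<lambda>i. x' i - c * s' i) = ip I s' (\<lambda>i. x' i - c * s' i) + (\<Sum>k\<in>J. cnj (\<beta> k) * ip I (s k) (\<lambda>i. x' i - c * s' i))"
    by (simp only: ip_add_left ip_sum_left ip_scale_left)
  also have "\<dots> = 0" by (simp add: s'x J0)
  finally have "\<forall>j\<in>insert j0 J. ip I (s j) (\<lambda>i. x' i - c * s' i) = 0" using J0 by simp
  moreover have "\<forall>j\<in>insert j0 J. \<gamma> j \<in> K" using cK \<alpha>(1) \<beta>(1) by (auto simp: \<gamma>_def intro!: K)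
  ultimately show ?case by (intro exI[of _ \<gamma>] conjI) (simp_all only: eq)
qed simp

text \<open>The coefficients solve \<open>c = \<Gamma> \<alpha>\<close> with Gram matrices tending
  to the identity. Coercivity keeps \<alpha> bounded, so \<alpha> - c tends to 0, and the squared
  length of the projection is the pairing of \<alpha> with c.\<close>

lemma projection_asymptotics:
  fixes s :: "nat \<Rightarrow> 'j \<Rightarrow> 'i \<Rightarrow> complex"
  assumes J: "finite J"
    and gram: "\<And>j k. j \<in> J \<Longrightarrow> k \<in> J \<Longrightarrow> (\<lambda>n. ip (I n) (s n j) (s n k)) \<longlonglongrightarrow> (if j = k then 1 else 0)"
    and K: "\<forall>\<^sub>F n in sequentially. nsq (I n) (x n) \<le> K"
    and \<alpha>: "\<forall>\<^sub>F n in sequentially. \<forall>j\<in>J. ip (I n) (s n j) (\<lambda>i. x n i - (\<Sum>k\<in>J. \<alpha> n k * s n k i)) = 0"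
  shows "(\<lambda>n. nsq (I n) (\<lambda>i. \<Sum>k\<in>J. \<alpha> n k * s n k i) - (\<Sum>j\<in>J. (norm (ip (I n) (s n j) (x n)))\<^sup>2)) \<longlonglongrightarrow> 0"
proof -
  define p where "p n = (\<lambda>i. \<Sum>k\<in>J. \<alpha> n k * s n k i)" for n
  define c where "c n j = ip (I n) (s n j) (x n)" for n j
  define \<Gamma> where "\<Gamma> n j k = ip (I n) (s n j) (s n k)" for n j k
  \<comment> \<open>With tolerance 1/2 the Gram form is at least half of the squared norm of the
    coefficients, which bounds \<alpha>.\<close>
  have adf: "\<forall>\<^sub>F n in sequentially. \<forall>c.
      norm ((\<Sum>j\<in>J. \<Sum>k\<in>J. cnj (c j) * c k * \<Gamma> n j k) - of_real (\<Sum>j\<in>J. (norm (c j))\<^sup>2 * 1)) \<le> 1 / 2 * (\<Sum>j\<in>J. (norm (c j))\<^sup>2)"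
    proof (rule almost_diagonal_form[OF J])
    fix j k assume "j \<in> J" "k \<in> J"
    from gram[OF this] show "(\<lambda>n. \<Gamma> n j k) \<longlonglongrightarrow> (if j = k then of_real 1 else 0)" unfolding \<Gamma>_def by (simp only: of_real_1)
  qed simp_all
  have main: "\<forall>\<^sub>F n in sequentially. (\<forall>j\<in>J. c n j = (\<Sum>k\<in>J. \<Gamma> n j k * \<alpha> n k)) \<and>
      complex_of_real (nsq (I n) (p n)) = (\<Sum>j\<in>J. cnj (\<alpha> n j) * c n j) \<and> (\<forall>j\<in>J. norm (\<alpha> n j) \<le> sqrt (2 * K))"
    using adf K \<alpha>
  proof eventually_elim
    case (elim n)
    have cc: "c n j = (\<Sum>k\<in>J. \<Gamma> n j k * \<alpha> n k)" if "j \<in> J" for j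
    proof -
      have "c n j - ip (I n) (s n j) (p n) = 0" using elim(3) that by (simp add: c_def p_def ip_diff_right)
      then show ?thesis by (simp add: p_def ip_sum_right ip_scale_right \<Gamma>_def mult.commute)
    qed
    have "ip (I n) (p n) (p n) = (\<Sum>j\<in>J. cnj (\<alpha> n j) * (\<Sum>k\<in>J. \<Gamma> n j k * \<alpha> n k))"
      unfolding p_def ip_sum_left ip_sum_right ip_scale_left ip_scale_right \<Gamma>_def by (simp add: sum_distrib_left mult.commute mult.left_commute)
    then have pp: "complex_of_real (nsq (I n) (p n)) = (\<Sum>j\<in>J. cnj (\<alpha> n j) * c n j)"
      using cc by (simp add: ip_self)
    have px: "ip (I n) (p n) (\<lambda>i. x n i - p n i) = 0"
    proof -
      have "ip (I n) (p n) (\<lambda>i. x n i - p n i) = (\<Sum>k\<in>J. cnj (\<alpha> n k) * ip (I n) (s n k) (\<lambda>i. x n i - p n i))"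
        unfolding p_def ip_sum_left ip_scale_left ..
      also have "\<dots> = 0" using elim(3) by (intro sum.neutral) (simp add: p_def)
      finally show ?thesis .
    qed
    have "nsq (I n) (x n) = nsq (I n) (p n) + nsq (I n) (\<lambda>i. x n i - p n i)"
    proof -
      have "ip (I n) (x n) (x n) = ip (I n) (\<lambda>i. p n i + (x n i - p n i)) (\<lambda>i. p n i + (x n i - p n i))" by simp
      also have "\<dots> = ip (I n) (p n) (p n) + cnj (ip (I n) (p n) (\<lambda>i. x n i - p n i)) + ip (I n) (p n) (\<lambda>i. x n i - p n i)
          + ip (I n) (\<lambda>i. x n i - p n i) (\<lambda>i. x n i - p n i)"
        unfolding ip_add_left ip_add_right cnj_ip by simp
      finally show ?thesis unfolding px ip_self by (simp flip: of_real_add)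
    qed
    then have pK: "nsq (I n) (p n) \<le> K" using elim(2) nsq_nonneg[of "I n" "\<lambda>i. x n i - p n i"] by linarith
    define S where "S = (\<Sum>j\<in>J. (norm (\<alpha> n j))\<^sup>2)"
    have "(\<Sum>j\<in>J. \<Sum>k\<in>J. cnj (\<alpha> n j) * \<alpha> n k * \<Gamma> n j k) = complex_of_real (nsq (I n) (p n))"
      unfolding pp using cc by (simp add: sum_distrib_left mult_ac)
    moreover have "norm ((\<Sum>j\<in>J. \<Sum>k\<in>J. cnj (\<alpha> n j) * \<alpha> n k * \<Gamma> n j k) - complex_of_real S) \<le> 1 / 2 * S"
      using spec[OF elim(1), of "\<alpha> n"] by (simp only: S_def mult_1_right)
    ultimately have "\<bar>nsq (I n) (p n) - S\<bar> \<le> 1 / 2 * S" by (simp only: of_real_diff[symmetric] norm_of_real)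
    then have S: "S \<le> 2 * K" using pK by linarith
    have "norm (\<alpha> n j) \<le> sqrt (2 * K)" if "j \<in> J" for j
    proof (rule real_le_rsqrt)
      have "(norm (\<alpha> n j))\<^sup>2 \<le> S" unfolding S_def by (rule member_le_sum[OF that]) (use J in auto)
      then show "(norm (\<alpha> n j))\<^sup>2 \<le> 2 * K" using S by simp
    qed
    with cc pp show ?case by blast
  qed
  define C where "C = sqrt (2 * K)"
  have bz: "(\<lambda>n. e n * f n) \<longlonglongrightarrow> 0" if "\<forall>\<^sub>F n in sequentially. norm (e n :: complex) \<le> D" "f \<longlonglongrightarrow> (0::complex)" for e f D
  proof (rule Lim_null_comparison)
    show "\<forall>\<^sub>F n in sequentially. norm (e n * f n) \<le> D * norm (f n)"
      using that(1) by eventually_elim (simp add: norm_mult mult_right_mono)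
    show "(\<lambda>n. D * norm (f n)) \<longlonglongrightarrow> 0" by (rule tendsto_mult_right_zero[OF tendsto_norm_zero[OF that(2)]])
  qed
  have ac: "(\<lambda>n. c n j - \<alpha> n j) \<longlonglongrightarrow> 0" if j: "j \<in> J" for j
  proof -
    have "(\<lambda>n. \<Sum>k\<in>J. \<alpha> n k * (\<Gamma> n j k - (if j = k then 1 else 0))) \<longlonglongrightarrow> 0"
    proof (rule tendsto_null_sum)
      fix k assume k: "k \<in> J"
      have "\<forall>\<^sub>F n in sequentially. norm (\<alpha> n k) \<le> C" using main by eventually_elim (use k in \<open>simp add: C_def\<close>)
      then show "(\<lambda>n. \<alpha> n k * (\<Gamma> n j k - (if j = k then 1 else 0))) \<longlonglongrightarrow> 0"
        by (rule bz) (rule LIM_zero, unfold \<Gamma>_def, rule gram[OF j k])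
    qed
    moreover have "\<forall>\<^sub>F n in sequentially. (\<Sum>k\<in>J. \<alpha> n k * (\<Gamma> n j k - (if j = k then 1 else 0))) = c n j - \<alpha> n j"
      using main
    proof eventually_elim
      case (elim n)
      have "(\<Sum>k\<in>J. \<alpha> n k * (if j = k then 1 else 0)) = (\<Sum>k\<in>J. if j = k then \<alpha> n j else 0)"
        by (intro sum.cong refl) auto
      then have "(\<Sum>k\<in>J. \<alpha> n k * (if j = k then 1 else 0)) = \<alpha> n j" using j J by simp
      then show ?case using elim j by (simp add: right_diff_distrib sum_subtractf mult.commute)
    qed
    ultimately show ?thesis by (rule Lim_transform_eventually)
  qed
  have "(\<lambda>n. \<Sum>j\<in>J. c n j * cnj (\<alpha> n j - c n j)) \<longlonglongrightarrow> 0"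
  proof (rule tendsto_null_sum)
    fix j assume j: "j \<in> J"
    have a0: "(\<lambda>n. \<alpha> n j - c n j) \<longlonglongrightarrow> 0" using tendsto_minus[OF ac[OF j]] by simp
    have "\<forall>\<^sub>F n in sequentially. norm (c n j - \<alpha> n j) < 1" using tendstoD[OF ac[OF j], of 1] by simp
    with main have "\<forall>\<^sub>F n in sequentially. norm (c n j) \<le> C + 1"
    proof eventually_elim
      case (elim n)
      have "norm (c n j) \<le> norm (\<alpha> n j) + norm (c n j - \<alpha> n j)" using norm_triangle_ineq[of "\<alpha> n j" "c n j - \<alpha> n j"] by simp
      moreover have "norm (\<alpha> n j) \<le> C" using elim(1) j by (simp add: C_def)
      ultimately show ?case using elim(2) by linarith
    qed
    then show "(\<lambda>n. c n j * cnj (\<alpha> n j - c n j)) \<longlonglongrightarrow> 0"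
      by (rule bz) (use tendsto_cnj[OF a0] in simp)
  qed
  moreover have "\<forall>\<^sub>F n in sequentially. (\<Sum>j\<in>J. c n j * cnj (\<alpha> n j - c n j)) =
      complex_of_real (nsq (I n) (p n) - (\<Sum>j\<in>J. (norm (c n j))\<^sup>2))"
    using main
  proof eventually_elim
    case (elim n)
    have "(\<Sum>j\<in>J. c n j * cnj (\<alpha> n j - c n j)) = (\<Sum>j\<in>J. cnj (\<alpha> n j) * c n j) - (\<Sum>j\<in>J. cnj (c n j) * c n j)"
      unfolding sum_subtractf[symmetric] by (intro sum.cong refl) (simp add: algebra_simps)
    moreover have "(\<Sum>j\<in>J. cnj (c n j) * c n j) = complex_of_real (\<Sum>j\<in>J. (norm (c n j))\<^sup>2)"
      unfolding cnj_mult_self by simp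
    moreover have "complex_of_real (nsq (I n) (p n)) = (\<Sum>j\<in>J. cnj (\<alpha> n j) * c n j)" using elim by blast
    ultimately show ?case by (simp only: of_real_diff)
  qed
  ultimately have "(\<lambda>n. complex_of_real (nsq (I n) (p n) - (\<Sum>j\<in>J. (norm (c n j))\<^sup>2))) \<longlonglongrightarrow> 0"
    by (rule Lim_transform_eventually)
  from tendsto_Re[OF this] show ?thesis by (simp only: Re_complex_of_real zero_complex.sel p_def c_def)
qed

section \<open>Gram--Schmidt orthonormalization of almost orthonormal families\<close>

lemma sqrt_nsq_tendsto_0_iff: "(\<lambda>n. sqrt (nsq (I n) (x n))) \<longlonglongrightarrow> 0 \<longleftrightarrow> (\<lambda>n. nsq (I n) (x n)) \<longlonglongrightarrow> 0"
proof
  assume "(\<lambda>n. sqrt (nsq (I n) (x n))) \<longlonglongrightarrow> 0"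
  from tendsto_power[OF this, of 2] show "(\<lambda>n. nsq (I n) (x n)) \<longlonglongrightarrow> 0" by simp
next
  assume "(\<lambda>n. nsq (I n) (x n)) \<longlonglongrightarrow> 0"
  from tendsto_real_sqrt[OF this] show "(\<lambda>n. sqrt (nsq (I n) (x n))) \<longlonglongrightarrow> 0" by simp
qed

lemma sqrt_nsq_scale: "sqrt (nsq I (\<lambda>i. c * x i)) = norm c * sqrt (nsq I x)"
  by (simp add: nsq_scale real_sqrt_mult)

lemma sqrt_nsq_sum_le: "finite J \<Longrightarrow> sqrt (nsq I (\<lambda>i. \<Sum>j\<in>J. x j i)) \<le> (\<Sum>j\<in>J. sqrt (nsq I (x j)))"
proof (induction J rule: finite_induct)
  case (insert j J)
  then show ?case using sqrt_nsq_triangle[of I "x j" "\<lambda>i. \<Sum>j\<in>J. x j i"] by simp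
qed (simp add: nsq_def)

text \<open>Strong induction on the column: the earlier vectors are close to the given ones, so the
  numerators of the coefficients tend to vanishing inner products and the denominators tend to
  1.\<close>

lemma gram_schmidt_close:
  fixes g w :: "nat \<Rightarrow> nat \<Rightarrow> 'i \<Rightarrow> complex"
  assumes gram: "\<And>j k. j < r \<Longrightarrow> k < r \<Longrightarrow> (\<lambda>n. ip (I n) (g n j) (g n k)) \<longlonglongrightarrow> (if j = k then 1 else 0)"
    and w: "\<And>n j i. n \<ge> 1 \<Longrightarrow> j < r \<Longrightarrow> i \<in> I n \<Longrightarrow>
      w n j i = g n j i - (\<Sum>l<j. ip (I n) (w n l) (g n j) / ip (I n) (w n l) (w n l) * w n l i)"
    and j: "j < r"
  shows "(\<lambda>n. nsq (I n) (\<lambda>i. w n j i - g n j i)) \<longlonglongrightarrow> 0" "(\<lambda>n. nsq (I n) (w n j)) \<longlonglongrightarrow> 1"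
proof -
  have gs: "(\<lambda>n. sqrt (nsq (I n) (g n j))) \<longlonglongrightarrow> 1" if "j < r" for j
  proof -
    have "(\<lambda>n. nsq (I n) (g n j)) \<longlonglongrightarrow> 1" using tendsto_Re[OF gram[OF that that]] by (simp add: ip_self)
    from tendsto_real_sqrt[OF this] show ?thesis by simp
  qed
  have "(\<lambda>n. sqrt (nsq (I n) (\<lambda>i. w n j i - g n j i))) \<longlonglongrightarrow> 0 \<and> (\<lambda>n. sqrt (nsq (I n) (w n j))) \<longlonglongrightarrow> 1"
    using j
  proof (induction j rule: less_induct)
    case (less j)
    have coef: "(\<lambda>n. norm (ip (I n) (w n l) (g n j) / ip (I n) (w n l) (w n l)) * sqrt (nsq (I n) (w n l))) \<longlonglongrightarrow> 0" if l: "l < j" for l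
    proof -
      have lr: "l < r" using l less.prems by simp
      have d: "(\<lambda>n. sqrt (nsq (I n) (\<lambda>i. w n l i - g n l i))) \<longlonglongrightarrow> 0" and n1: "(\<lambda>n. sqrt (nsq (I n) (w n l))) \<longlonglongrightarrow> 1"
        using less.IH[OF l lr] by auto
      have "(\<lambda>n. ip (I n) (\<lambda>i. w n l i - g n l i) (g n j)) \<longlonglongrightarrow> 0"
      proof (rule Lim_null_comparison[OF always_eventually[OF allI]])
        show "norm (ip (I n) (\<lambda>i. w n l i - g n l i) (g n j)) \<le> sqrt (nsq (I n) (\<lambda>i. w n l i - g n l i)) * sqrt (nsq (I n) (g n j))" for n
          by (rule norm_ip_le)
        show "(\<lambda>n. sqrt (nsq (I n) (\<lambda>i. w n l i - g n l i)) * sqrt (nsq (I n) (g n j))) \<longlonglongrightarrow> 0"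
          using tendsto_mult[OF d gs[OF less.prems]] by simp
      qed
      from tendsto_add[OF this gram[OF lr less.prems]] l
      have "(\<lambda>n. ip (I n) (w n l) (g n j)) \<longlonglongrightarrow> 0" by (simp add: ip_diff_left)
      moreover have "(\<lambda>n. ip (I n) (w n l) (w n l)) \<longlonglongrightarrow> of_real (1\<^sup>2)"
        using tendsto_of_real[OF tendsto_power[OF n1, of 2]] by (simp add: ip_self)
      ultimately have "(\<lambda>n. norm (ip (I n) (w n l) (g n j) / ip (I n) (w n l) (w n l)) * sqrt (nsq (I n) (w n l))) \<longlonglongrightarrow> norm (0 / complex_of_real (1\<^sup>2)) * 1"
        by (intro tendsto_intros n1) auto
      then show ?thesis by simp
    qed
    have d: "(\<lambda>n. sqrt (nsq (I n) (\<lambda>i. w n j i - g n j i))) \<longlonglongrightarrow> 0"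
    proof (rule Lim_null_comparison)
      show "(\<lambda>n. \<Sum>l<j. norm (ip (I n) (w n l) (g n j) / ip (I n) (w n l) (w n l)) * sqrt (nsq (I n) (w n l))) \<longlonglongrightarrow> 0"
        by (rule tendsto_null_sum) (use coef in auto)
      show "\<forall>\<^sub>F n in sequentially. norm (sqrt (nsq (I n) (\<lambda>i. w n j i - g n j i))) \<le>
          (\<Sum>l<j. norm (ip (I n) (w n l) (g n j) / ip (I n) (w n l) (w n l)) * sqrt (nsq (I n) (w n l)))"
        using eventually_ge_at_top[of 1]
      proof eventually_elim
        case (elim n)
        have "nsq (I n) (\<lambda>i. w n j i - g n j i) = nsq (I n) (\<lambda>i. \<Sum>l<j. (- (ip (I n) (w n l) (g n j) / ip (I n) (w n l) (w n l))) * w n l i)"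
          by (intro nsq_cong) (simp add: w[OF elim less.prems] sum_negf)
        then show ?case
          using sqrt_nsq_sum_le[of "{..<j}" "I n" "\<lambda>l i. (- (ip (I n) (w n l) (g n j) / ip (I n) (w n l) (w n l))) * w n l i"]
          by (simp only: sqrt_nsq_scale norm_minus_cancel real_norm_def) simp
      qed
    qed
    have "(\<lambda>n. sqrt (nsq (I n) (w n j)) - sqrt (nsq (I n) (g n j))) \<longlonglongrightarrow> 0"
    proof (rule Lim_null_comparison[OF always_eventually[OF allI] d])
      fix n
      have "sqrt (nsq (I n) (w n j)) \<le> sqrt (nsq (I n) (\<lambda>i. w n j i - g n j i)) + sqrt (nsq (I n) (g n j))"
        using sqrt_nsq_triangle[of "I n" "\<lambda>i. w n j i - g n j i" "g n j"] by simp
      moreover have "sqrt (nsq (I n) (g n j)) \<le> sqrt (nsq (I n) (\<lambda>i. w n j i - g n j i)) + sqrt (nsq (I n) (w n j))"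
      proof -
        have "nsq (I n) (\<lambda>i. - 1 * (w n j i - g n j i)) = nsq (I n) (\<lambda>i. w n j i - g n j i)" by (subst nsq_scale) simp
        then show ?thesis using sqrt_nsq_triangle[of "I n" "\<lambda>i. - 1 * (w n j i - g n j i)" "w n j"] by simp
      qed
      ultimately show "norm (sqrt (nsq (I n) (w n j)) - sqrt (nsq (I n) (g n j))) \<le> sqrt (nsq (I n) (\<lambda>i. w n j i - g n j i))"
        by (simp add: abs_le_iff)
    qed
    from tendsto_add[OF this gs[OF less.prems]] d show ?case by simp
  qed
  then show "(\<lambda>n. nsq (I n) (\<lambda>i. w n j i - g n j i)) \<longlonglongrightarrow> 0" "(\<lambda>n. nsq (I n) (w n j)) \<longlonglongrightarrow> 1"
    using sqrt_nsq_tendsto_0_iff[of I "\<lambda>n i. w n j i - g n j i"] tendsto_power[of "\<lambda>n. sqrt (nsq (I n) (w n j))" 1 sequentially 2] by auto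
qed

lemma normalized_close:
  assumes d: "(\<lambda>n. nsq (I n) (\<lambda>i. w n i - g n i)) \<longlonglongrightarrow> 0" and w: "(\<lambda>n. nsq (I n) (w n)) \<longlonglongrightarrow> 1"
  shows "(\<lambda>n. nsq (I n) (\<lambda>i. of_real (1 / sqrt (nsq (I n) (w n))) * w n i - g n i)) \<longlonglongrightarrow> 0"
proof -
  define l where "l n = sqrt (nsq (I n) (w n))" for n
  have l1: "l \<longlonglongrightarrow> 1" using tendsto_real_sqrt[OF w] by (simp add: l_def[abs_def])
  have "(\<lambda>n. sqrt (nsq (I n) (\<lambda>i. of_real (1 / l n) * w n i - g n i))) \<longlonglongrightarrow> 0"
  proof (rule Lim_null_comparison[OF always_eventually[OF allI]])
    fix n
    have "sqrt (nsq (I n) (\<lambda>i. of_real (1 / l n) * w n i - g n i)) =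
      sqrt (nsq (I n) (\<lambda>i. of_real (1 / l n - 1) * w n i + (w n i - g n i)))" by (simp add: algebra_simps)
    also have "\<dots> \<le> sqrt (nsq (I n) (\<lambda>i. of_real (1 / l n - 1) * w n i)) + sqrt (nsq (I n) (\<lambda>i. w n i - g n i))"
      by (rule sqrt_nsq_triangle)
    also have "sqrt (nsq (I n) (\<lambda>i. of_real (1 / l n - 1) * w n i)) = \<bar>1 / l n - 1\<bar> * l n"
      unfolding sqrt_nsq_scale norm_of_real by (simp add: l_def)
    finally show "norm (sqrt (nsq (I n) (\<lambda>i. of_real (1 / l n) * w n i - g n i))) \<le> \<bar>1 / l n - 1\<bar> * l n + sqrt (nsq (I n) (\<lambda>i. w n i - g n i))"
      by simp
  next
    have "(\<lambda>n. \<bar>1 / l n - 1\<bar> * l n + sqrt (nsq (I n) (\<lambda>i. w n i - g n i))) \<longlonglongrightarrow> \<bar>1 / 1 - 1\<bar> * 1 + sqrt 0"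
      by (intro tendsto_intros l1 d) simp
    then show "(\<lambda>n. \<bar>1 / l n - 1\<bar> * l n + sqrt (nsq (I n) (\<lambda>i. w n i - g n i))) \<longlonglongrightarrow> 0" by simp
  qed
  then show ?thesis unfolding sqrt_nsq_tendsto_0_iff by (simp only: l_def)
qed

text \<open>The powers of H are bounded uniformly in large n, so moments depend continuously on the
  two vectors, uniformly in n.\<close>

lemma moment_limit_perturb:
  assumes bound: "\<forall>\<^sub>F n in sequentially. \<forall>x. nsq (I n) (app (I n) (H n) x) \<le> B\<^sup>2 * nsq (I n) x" "0 \<le> B"
    and a: "(\<lambda>n. nsq (I n) (\<lambda>i. a' n i - a n i)) \<longlonglongrightarrow> 0" "(\<lambda>n. nsq (I n) (a n)) \<longlonglongrightarrow> A"
    and b: "(\<lambda>n. nsq (I n) (\<lambda>i. b' n i - b n i)) \<longlonglongrightarrow> 0" "(\<lambda>n. nsq (I n) (b n)) \<longlonglongrightarrow> A'"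
    and lim: "(\<lambda>n. ip (I n) (a n) ((app (I n) (H n) ^^ k) (b n))) \<longlonglongrightarrow> l"
  shows "(\<lambda>n. ip (I n) (a' n) ((app (I n) (H n) ^^ k) (b' n))) \<longlonglongrightarrow> l"
proof -
  let ?T = "\<lambda>n. app (I n) (H n)"
  define da db where "da n = sqrt (nsq (I n) (\<lambda>i. a' n i - a n i))" and "db n = sqrt (nsq (I n) (\<lambda>i. b' n i - b n i))" for n
  have d0: "da \<longlonglongrightarrow> 0" "db \<longlonglongrightarrow> 0"
    using a(1) b(1) unfolding da_def[abs_def] db_def[abs_def] sqrt_nsq_tendsto_0_iff by auto
  have s: "(\<lambda>n. sqrt (nsq (I n) (a n))) \<longlonglongrightarrow> sqrt A" "(\<lambda>n. sqrt (nsq (I n) (b n))) \<longlonglongrightarrow> sqrt A'"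
    by (intro tendsto_real_sqrt a b)+
  have "(\<lambda>n. ip (I n) (a' n) ((?T n ^^ k) (b' n)) - ip (I n) (a n) ((?T n ^^ k) (b n))) \<longlonglongrightarrow> 0"
  proof (rule Lim_null_comparison)
    show "\<forall>\<^sub>F n in sequentially. norm (ip (I n) (a' n) ((?T n ^^ k) (b' n)) - ip (I n) (a n) ((?T n ^^ k) (b n))) \<le>
      (da n * (db n + sqrt (nsq (I n) (b n))) + sqrt (nsq (I n) (a n)) * db n) * B ^ k"
      using bound(1)
    proof eventually_elim
      case (elim n)
      have e: "(?T n ^^ k) (b' n) = (\<lambda>i. (?T n ^^ k) (\<lambda>i. b' n i - b n i) i + (?T n ^^ k) (b n) i)"
        by (simp add: funpow_app_diff)
      have bb: "sqrt (nsq (I n) (b' n)) \<le> db n + sqrt (nsq (I n) (b n))"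
        using sqrt_nsq_triangle[of "I n" "\<lambda>i. b' n i - b n i" "b n"] by (simp add: db_def)
      define U V where "U = ip (I n) (\<lambda>i. a' n i - a n i) ((?T n ^^ k) (b' n))"
        and "V = ip (I n) (a n) ((?T n ^^ k) (\<lambda>i. b' n i - b n i))"
      have "ip (I n) (a n) ((?T n ^^ k) (b' n)) = V + ip (I n) (a n) ((?T n ^^ k) (b n))"
        unfolding V_def by (subst e) (simp only: ip_add_right)
      moreover have "U = ip (I n) (a' n) ((?T n ^^ k) (b' n)) - ip (I n) (a n) ((?T n ^^ k) (b' n))"
        unfolding U_def by (simp only: ip_diff_left)
      ultimately have UV: "ip (I n) (a' n) ((?T n ^^ k) (b' n)) - ip (I n) (a n) ((?T n ^^ k) (b n)) = U + V" by (simp only:) simp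
      have "norm U \<le> sqrt (nsq (I n) (\<lambda>i. a' n i - a n i)) * sqrt (nsq (I n) (b' n)) * B ^ k"
        unfolding U_def by (rule norm_ip_funpow_le) (use elim bound(2) in auto)
      moreover have "norm V \<le> sqrt (nsq (I n) (a n)) * sqrt (nsq (I n) (\<lambda>i. b' n i - b n i)) * B ^ k"
        unfolding V_def by (rule norm_ip_funpow_le) (use elim bound(2) in auto)
      ultimately have "norm (U + V) \<le> sqrt (nsq (I n) (\<lambda>i. a' n i - a n i)) * sqrt (nsq (I n) (b' n)) * B ^ k +
         sqrt (nsq (I n) (a n)) * sqrt (nsq (I n) (\<lambda>i. b' n i - b n i)) * B ^ k"
        using norm_triangle_ineq[of U V] by linarith
      also have "\<dots> = (da n * sqrt (nsq (I n) (b' n)) + sqrt (nsq (I n) (a n)) * db n) * B ^ k"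
        by (simp add: da_def db_def distrib_right)
      also have "\<dots> \<le> (da n * (db n + sqrt (nsq (I n) (b n))) + sqrt (nsq (I n) (a n)) * db n) * B ^ k"
        using bb bound(2) by (intro mult_right_mono add_right_mono mult_left_mono) (auto simp: da_def)
      finally show ?case by (simp only: UV)
    qed
    have "(\<lambda>n. (da n * (db n + sqrt (nsq (I n) (b n))) + sqrt (nsq (I n) (a n)) * db n) * B ^ k) \<longlonglongrightarrow>
      (0 * (0 + sqrt A') + sqrt A * 0) * B ^ k" by (intro tendsto_intros d0 s)
    then show "(\<lambda>n. (da n * (db n + sqrt (nsq (I n) (b n))) + sqrt (nsq (I n) (a n)) * db n) * B ^ k) \<longlonglongrightarrow> 0" by simp
  qed
  from tendsto_add[OF this lim] show ?thesis by simp
qed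

section \<open>Vectors over the scalar field as complex functions\<close>

definition vfun :: "'a :: rc_field vec \<Rightarrow> nat \<Rightarrow> complex" where
  "vfun v i = to_complex (v $ i)"

lemma vfun_simps:
  "dim_vec v = n \<Longrightarrow> dim_vec w = n \<Longrightarrow> i < n \<Longrightarrow> vfun (v + w) i = vfun v i + vfun w i"
  "dim_vec v = n \<Longrightarrow> dim_vec w = n \<Longrightarrow> i < n \<Longrightarrow> vfun (v - w) i = vfun v i - vfun w i"
  "dim_vec v = n \<Longrightarrow> i < n \<Longrightarrow> vfun (a \<cdot>\<^sub>v v) i = to_complex a * vfun v i"
  "i < n \<Longrightarrow> vfun (0\<^sub>v n) i = 0"
  by (simp_all add: vfun_def)

lemma l2_norm_eq: "dim_vec v = n \<Longrightarrow> l2_norm v = sqrt (nsq {..<n} (vfun v))"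
  by (simp add: l2_norm_def sqrt_nsq vfun_def)

lemma cscalar_prod_eq:
  "dim_vec x = n \<Longrightarrow> dim_vec y = n \<Longrightarrow> to_complex (x \<bullet>c y) = ip {..<n} (vfun y) (vfun x)"
  by (simp add: scalar_prod_def ip_def vfun_def atLeast0LessThan mult.commute)

lemma vfun_mult_mat_vec:
  assumes "A \<in> carrier_mat n k" "v \<in> carrier_vec k" "i < n"
  shows "vfun (A *\<^sub>v v) i = app {..<k} (entries A) (vfun v) i"
  using assms by (simp add: vfun_def app_def entries_def scalar_prod_def atLeast0LessThan)

lemma vec_eq_iff_vfun:
  "dim_vec x = n \<Longrightarrow> dim_vec y = n \<Longrightarrow> x = y \<longleftrightarrow> (\<forall>i<n. vfun x i = vfun y i)"
  by (auto simp: vfun_def)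

locale rc_vec_space = vec_space f_ty n for f_ty :: "'a :: rc_field itself" and n
begin

lemma vec_span_eq: "vec_span n (S :: 'a vec set) = span S"
  by (simp add: vec_span_def)

lemma vec_span_combination:
  fixes u :: "nat \<Rightarrow> 'a vec" and a :: "nat \<Rightarrow> 'a"
  assumes J: "finite J" and u: "\<And>j. j \<in> J \<Longrightarrow> u j \<in> carrier_vec n"
  shows "\<exists>p\<in>vec_span n (u ` J). p \<in> carrier_vec n \<and> (\<forall>i<n. vfun p i = (\<Sum>k\<in>J. to_complex (a k) * vfun (u k) i))"
proof -
  have uJ: "u ` J \<subseteq> carrier_vec n" using u by auto
  have "\<exists>p\<in>span (u ` J). p \<in> carrier_vec n \<and> (\<forall>i<n. vfun p i = (\<Sum>k\<in>K. to_complex (a k) * vfun (u k) i))" if "K \<subseteq> J" for K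
    using finite_subset[OF that J] that
  proof (induction K rule: finite_induct)
    case empty
    have "0\<^sub>v n \<in> span (u ` J)" using span_zero by simp
    then show ?case by (intro bexI[of _ "0\<^sub>v n"]) (auto simp: vfun_simps)
  next
    case (insert k K)
    have "K \<subseteq> J" using insert.prems by blast
    from insert.IH[OF this]
    obtain p where p: "p \<in> span (u ` J)" "p \<in> carrier_vec n" "\<forall>i<n. vfun p i = (\<Sum>k\<in>K. to_complex (a k) * vfun (u k) i)"
      by (elim bexE conjE)
    have k: "u k \<in> carrier_vec n" using insert.prems u by blast
    have "u k \<in> span (u ` J)" by (rule span_mem) (use uJ insert.prems in auto)
    then have "a k \<cdot>\<^sub>v u k \<in> span (u ` J)" by (rule smult_in_span[OF uJ])
    then have q: "a k \<cdot>\<^sub>v u k + p \<in> span (u ` J)"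
      using span_add1[of "u ` J" "a k \<cdot>\<^sub>v u k" p] uJ p(1) by simp
    have "\<forall>i<n. vfun (a k \<cdot>\<^sub>v u k + p) i = (\<Sum>k\<in>insert k K. to_complex (a k) * vfun (u k) i)"
      using insert(1,2) k p(2,3) by (simp add: vfun_simps[where n = n])
    then show ?case using q k p(2) by (intro bexI[OF _ q] conjI) simp_all
  qed
  then show ?thesis by (simp add: vec_span_eq)
qed

lemma vec_span_orthogonal:
  fixes z y :: "'a vec"
  assumes S: "S \<subseteq> carrier_vec n" and y: "y \<in> vec_span n S" and z: "z \<in> carrier_vec n"
    and o: "\<And>s. s \<in> S \<Longrightarrow> z \<bullet>c s = 0"
  shows "z \<bullet>c y = 0" "y \<in> carrier_vec n"
proof -
  show "y \<in> carrier_vec n" using y span_closed[OF S] by (simp add: vec_span_eq)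
  obtain a A where A: "finite A" "A \<subseteq> S" "y = lincomb a A" using y unfolding vec_span_eq span_def by auto
  have AC: "A \<subseteq> carrier_vec n" using A S by auto
  have "z \<bullet>c lincomb a A = 0 \<and> lincomb a A \<in> carrier_vec n" using A(1,2) AC
  proof (induction A rule: finite_induct)
    case empty
    then show ?case using z by (simp add: lincomb_def scalar_prod_def)
  next
    case (insert s A)
    have s: "s \<in> carrier_vec n" using insert.prems by auto
    have e: "lincomb a (insert s A) = a s \<cdot>\<^sub>v s + lincomb a A"
      using insert by (intro lincomb_insert2) auto
    have L: "lincomb a A \<in> carrier_vec n" "z \<bullet>c lincomb a A = 0" using insert by auto
    have "to_complex (z \<bullet>c (a s \<cdot>\<^sub>v s + lincomb a A)) = cnj (to_complex (a s)) * to_complex (z \<bullet>c s) + to_complex (z \<bullet>c lincomb a A)"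
    proof -
      have d: "dim_vec z = n" "dim_vec s = n" "dim_vec (lincomb a A) = n" using z s L by auto
      have "to_complex (z \<bullet>c (a s \<cdot>\<^sub>v s + lincomb a A)) = ip {..<n} (\<lambda>i. to_complex (a s) * vfun s i + vfun (lincomb a A) i) (vfun z)"
        using d by (subst cscalar_prod_eq[of _ n]) (auto intro!: ip_cong simp: vfun_simps)
      then show ?thesis using d by (simp only: ip_add_left ip_scale_left cscalar_prod_eq)
    qed
    also have "\<dots> = 0" using L o insert.prems by simp
    finally show ?case using s L by (simp add: e flip: to_complex_0)
  qed
  then show "z \<bullet>c y = 0" using A by simp
qed

text \<open>The projection is a definite description, so a point of the span with orthogonal
  residual has to be exhibited and shown to be the only one. The vectors may be dependent, in which
  case \<alpha> is one of several solutions.\<close>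

lemma proj_norm_combination:
  fixes u :: "nat \<Rightarrow> 'a vec"
  assumes J: "finite J" and u: "\<And>j. j \<in> J \<Longrightarrow> u j \<in> carrier_vec n" and x: "x \<in> carrier_vec n"
  shows "\<exists>\<alpha>. (\<forall>j\<in>J. ip {..<n} (vfun (u j)) (\<lambda>i. vfun x i - (\<Sum>k\<in>J. \<alpha> k * vfun (u k) i)) = 0) \<and>
    (proj_norm x (vec_span n (u ` J)))\<^sup>2 = nsq {..<n} (\<lambda>i. \<Sum>k\<in>J. \<alpha> k * vfun (u k) i)"
proof -
  have uJ: "u ` J \<subseteq> carrier_vec n" using u by auto
  have "\<exists>\<alpha>. (\<forall>j\<in>J. \<alpha> j \<in> range (to_complex :: 'a \<Rightarrow> complex)) \<and>
      (\<forall>j\<in>J. ip {..<n} (vfun (u j)) (\<lambda>i. vfun x i - (\<Sum>k\<in>J. \<alpha> k * vfun (u k) i)) = 0)"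
  proof (rule normal_equations[OF J finite_lessThan])
    show "0 \<in> range (to_complex :: 'a \<Rightarrow> complex)" by (metis rangeI to_complex_0)
    show "x + y \<in> range (to_complex :: 'a \<Rightarrow> complex)" if "x \<in> range (to_complex :: 'a \<Rightarrow> complex)" "y \<in> range (to_complex :: 'a \<Rightarrow> complex)" for x y
      using that by (metis (mono_tags) rangeE rangeI to_complex_simps(1))
    show "x - y \<in> range (to_complex :: 'a \<Rightarrow> complex)" if "x \<in> range (to_complex :: 'a \<Rightarrow> complex)" "y \<in> range (to_complex :: 'a \<Rightarrow> complex)" for x y
      using that by (metis (mono_tags) rangeE rangeI to_complex_diff)
    show "x * y \<in> range (to_complex :: 'a \<Rightarrow> complex)" if "x \<in> range (to_complex :: 'a \<Rightarrow> complex)" "y \<in> range (to_complex :: 'a \<Rightarrow> complex)" for x y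
      using that by (metis (mono_tags) rangeE rangeI to_complex_simps(2))
    show "x / y \<in> range (to_complex :: 'a \<Rightarrow> complex)" if "x \<in> range (to_complex :: 'a \<Rightarrow> complex)" "y \<in> range (to_complex :: 'a \<Rightarrow> complex)" for x y
      using that by (metis (mono_tags) rangeE rangeI to_complex_divide)
    show "cnj x \<in> range (to_complex :: 'a \<Rightarrow> complex)" if "x \<in> range (to_complex :: 'a \<Rightarrow> complex)" for x
      using that by (metis (mono_tags) rangeE rangeI to_complex_simps(4))
  qed (auto simp: vfun_def)
  then obtain \<alpha> where \<alpha>: "\<forall>j\<in>J. \<alpha> j \<in> range (to_complex :: 'a \<Rightarrow> complex)"
      "\<forall>j\<in>J. ip {..<n} (vfun (u j)) (\<lambda>i. vfun x i - (\<Sum>k\<in>J. \<alpha> k * vfun (u k) i)) = 0" by (elim exE conjE)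
  \<comment> \<open>Preimages in the scalar field, so that the combination lies in the span over
    that field.\<close>
  define a where "a j = (SOME t :: 'a. to_complex t = \<alpha> j)" for j
  have a: "to_complex (a j) = \<alpha> j" if "j \<in> J" for j
    unfolding a_def by (rule someI_ex) (use \<alpha>(1) that in fastforce)
  obtain p where p: "p \<in> vec_span n (u ` J)" "p \<in> carrier_vec n" "\<forall>i<n. vfun p i = (\<Sum>k\<in>J. to_complex (a k) * vfun (u k) i)"
    using vec_span_combination[of J u a] J u by (auto elim!: bexE)
  have pf: "vfun p i = (\<Sum>k\<in>J. \<alpha> k * vfun (u k) i)" if "i < n" for i
    using p(3) that a by simp
  have "(x - p) \<bullet>c s = 0" if s: "s \<in> u ` J" for s
  proof -
    obtain j where j: "j \<in> J" "s = u j" using s by auto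
    have "to_complex ((x - p) \<bullet>c u j) = ip {..<n} (vfun (u j)) (\<lambda>i. vfun x i - (\<Sum>k\<in>J. \<alpha> k * vfun (u k) i))"
      using x p(2) u[OF j(1)] pf by (subst cscalar_prod_eq[of _ n]) (auto intro!: ip_cong simp: vfun_simps)
    then show ?thesis using \<alpha>(2) j by (simp flip: to_complex_0)
  qed
  then have orth: "(x - p) \<bullet>c y = 0" if "y \<in> vec_span n (u ` J)" for y
    using vec_span_orthogonal(1)[OF uJ that, of "x - p"] x p(2) by auto
  have "orth_proj x (vec_span n (u ` J)) = p"
    unfolding orth_proj_def
  proof (rule the_equality)
    show "p \<in> vec_span n (u ` J) \<and> (\<forall>y\<in>vec_span n (u ` J). (x - p) \<bullet>c y = 0)" using p orth by blast
  next
    fix q assume q: "q \<in> vec_span n (u ` J) \<and> (\<forall>y\<in>vec_span n (u ` J). (x - q) \<bullet>c y = 0)"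
    have qC: "q \<in> carrier_vec n" using span_closed[OF uJ] q by (simp add: vec_span_eq)
    have 1: "ip {..<n} (vfun y) (vfun (x - p)) = 0" "ip {..<n} (vfun y) (vfun (x - q)) = 0" if "y \<in> vec_span n (u ` J)" for y
      using orth[OF that] q that cscalar_prod_eq[of "x - p" n y] cscalar_prod_eq[of "x - q" n y] x p(2) qC
        span_closed[OF uJ, of y] by (auto simp: vec_span_eq)
    have "ip {..<n} (vfun y) (\<lambda>i. vfun q i - vfun p i) = ip {..<n} (vfun y) (vfun (x - p)) - ip {..<n} (vfun y) (vfun (x - q))" for y :: "'a vec"
      unfolding ip_diff_right[symmetric] using x p(2) qC by (intro ip_cong) (auto simp: vfun_simps)
    then have 2: "ip {..<n} (vfun y) (\<lambda>i. vfun q i - vfun p i) = 0" if "y \<in> vec_span n (u ` J)" for y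
      using 1[OF that] by simp
    have "ip {..<n} (\<lambda>i. vfun q i - vfun p i) (\<lambda>i. vfun q i - vfun p i) = 0"
      unfolding ip_diff_left[of _ "vfun q" "vfun p"] using 2[of q] 2[OF p(1)] q by simp
    then have "\<forall>i\<in>{..<n}. vfun q i - vfun p i = 0"
      using nsq_eq_0_iff[of "{..<n}" "\<lambda>i. vfun q i - vfun p i"] by (simp add: ip_self)
    then show "q = p" using vec_eq_iff_vfun[of q n p] qC p(2) by auto
  qed
  then have "(proj_norm x (vec_span n (u ` J)))\<^sup>2 = nsq {..<n} (\<lambda>i. \<Sum>k\<in>J. \<alpha> k * vfun (u k) i)"
  proof -
    have "nsq {..<n} (vfun p) = nsq {..<n} (\<lambda>i. \<Sum>k\<in>J. \<alpha> k * vfun (u k) i)" by (rule nsq_cong) (use pf in simp)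
    moreover assume "orth_proj x (vec_span n (u ` J)) = p"
    ultimately show ?thesis using p(2) by (simp add: proj_norm_def l2_norm_eq[of _ n])
  qed
  then show ?thesis using \<alpha>(2) by blast
qed

end

text \<open>The spikes are orthonormal only in the limit, so the sum of squared overlaps gives the
  length of the projection only asymptotically. The threshold \<open>lo\<close> serves vectors that
  are available from some n on.\<close>

theorem proj_norm_asymptotics:
  fixes u :: "nat \<Rightarrow> nat \<Rightarrow> 'a :: rc_field vec"
  assumes J: "finite J"
    and u: "\<And>n j. n \<ge> lo \<Longrightarrow> j \<in> J \<Longrightarrow> u n j \<in> carrier_vec (d n)"
    and x: "\<And>n. n \<ge> lo \<Longrightarrow> x n \<in> carrier_vec (d n)"
    and gram: "\<And>j k. j \<in> J \<Longrightarrow> k \<in> J \<Longrightarrow>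
      (\<lambda>n. ip {..<d n} (vfun (u n j)) (vfun (u n k))) \<longlonglongrightarrow> (if j = k then 1 else 0)"
    and K: "\<forall>\<^sub>F n in sequentially. nsq {..<d n} (vfun (x n)) \<le> K"
    and l: "(\<lambda>n. \<Sum>j\<in>J. (norm (ip {..<d n} (vfun (u n j)) (vfun (x n))))\<^sup>2) \<longlonglongrightarrow> l"
  shows "(\<lambda>n. (proj_norm (x n) (vec_span (d n) (u n ` J)))\<^sup>2) \<longlonglongrightarrow> l"
proof -
  have "\<forall>n. \<exists>\<alpha>. n \<ge> lo \<longrightarrow> (\<forall>j\<in>J. ip {..<d n} (vfun (u n j)) (\<lambda>i. vfun (x n) i - (\<Sum>k\<in>J. \<alpha> k * vfun (u n k) i)) = 0) \<and>
    (proj_norm (x n) (vec_span (d n) (u n ` J)))\<^sup>2 = nsq {..<d n} (\<lambda>i. \<Sum>k\<in>J. \<alpha> k * vfun (u n k) i)"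
  proof (intro allI)
    fix n
    show "\<exists>\<alpha>. n \<ge> lo \<longrightarrow> (\<forall>j\<in>J. ip {..<d n} (vfun (u n j)) (\<lambda>i. vfun (x n) i - (\<Sum>k\<in>J. \<alpha> k * vfun (u n k) i)) = 0) \<and>
      (proj_norm (x n) (vec_span (d n) (u n ` J)))\<^sup>2 = nsq {..<d n} (\<lambda>i. \<Sum>k\<in>J. \<alpha> k * vfun (u n k) i)"
    proof (cases "n \<ge> lo")
      case True
      have "\<exists>\<alpha>. (\<forall>j\<in>J. ip {..<d n} (vfun (u n j)) (\<lambda>i. vfun (x n) i - (\<Sum>k\<in>J. \<alpha> k * vfun (u n k) i)) = 0) \<and>
        (proj_norm (x n) (vec_span (d n) (u n ` J)))\<^sup>2 = nsq {..<d n} (\<lambda>i. \<Sum>k\<in>J. \<alpha> k * vfun (u n k) i)"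
        by (rule rc_vec_space.proj_norm_combination[OF J]) (use u x True in auto)
      then obtain \<alpha> where "\<forall>j\<in>J. ip {..<d n} (vfun (u n j)) (\<lambda>i. vfun (x n) i - (\<Sum>k\<in>J. \<alpha> k * vfun (u n k) i)) = 0"
        "(proj_norm (x n) (vec_span (d n) (u n ` J)))\<^sup>2 = nsq {..<d n} (\<lambda>i. \<Sum>k\<in>J. \<alpha> k * vfun (u n k) i)"
        by (elim exE conjE)
      then show ?thesis by (intro exI[of _ \<alpha>] impI conjI)
    qed simp
  qed
  from choice[OF this] obtain \<alpha> where \<alpha>: "\<forall>n. n \<ge> lo \<longrightarrow> (\<forall>j\<in>J. ip {..<d n} (vfun (u n j)) (\<lambda>i. vfun (x n) i - (\<Sum>k\<in>J. \<alpha> n k * vfun (u n k) i)) = 0) \<and>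
    (proj_norm (x n) (vec_span (d n) (u n ` J)))\<^sup>2 = nsq {..<d n} (\<lambda>i. \<Sum>k\<in>J. \<alpha> n k * vfun (u n k) i)"
    by (elim exE)
  have "(\<lambda>n. nsq {..<d n} (\<lambda>i. \<Sum>k\<in>J. \<alpha> n k * vfun (u n k) i) - (\<Sum>j\<in>J. (norm (ip {..<d n} (vfun (u n j)) (vfun (x n))))\<^sup>2)) \<longlonglongrightarrow> 0"
    by (rule projection_asymptotics[OF J gram K eventually_sequentiallyI[of lo]]) (use \<alpha> in auto)
  from tendsto_add[OF this l]
  have "(\<lambda>n. nsq {..<d n} (\<lambda>i. \<Sum>k\<in>J. \<alpha> n k * vfun (u n k) i)) \<longlonglongrightarrow> l" by simp
  moreover have "\<forall>\<^sub>F n in sequentially. nsq {..<d n} (\<lambda>i. \<Sum>k\<in>J. \<alpha> n k * vfun (u n k) i) = (proj_norm (x n) (vec_span (d n) (u n ` J)))\<^sup>2"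
    using eventually_ge_at_top[of lo] by eventually_elim (use \<alpha> in simp)
  ultimately show ?thesis by (rule Lim_transform_eventually)
qed

section \<open>The columns of the spikes\<close>

lemma scaled_columns_nth:
  assumes G: "G \<in> carrier_mat d r" and i: "i < r"
  shows "scaled_columns G ! i \<in> carrier_vec d"
    "k < d \<Longrightarrow> vfun (scaled_columns G ! i) k = of_real (1 / sqrt (real d)) * to_complex (G $$ (k, i))"
proof -
  have e: "scaled_columns G ! i = of_real (1 / sqrt (real d)) \<cdot>\<^sub>v col G i"
    using G i by (simp add: scaled_columns_def)
  show "scaled_columns G ! i \<in> carrier_vec d" unfolding e using G i by simp
  show "k < d \<Longrightarrow> vfun (scaled_columns G ! i) k = of_real (1 / sqrt (real d)) * to_complex (G $$ (k, i))"
    unfolding e using G i by (simp add: vfun_simps[where n = d]) (simp add: vfun_def)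
qed

lemma vfun_adjuster:
  assumes "w \<in> carrier_vec d" "set us \<subseteq> carrier_vec d"
  shows "adjuster d w us \<in> carrier_vec d \<and> (\<forall>i<d. vfun (adjuster d w us) i =
    - (\<Sum>l<length us. ip {..<d} (vfun (us ! l)) (vfun w) / ip {..<d} (vfun (us ! l)) (vfun (us ! l)) * vfun (us ! l) i))"
  using assms(2)
proof (induction us)
  case (Cons u us)
  then have u: "u \<in> carrier_vec d" and IH: "adjuster d w us \<in> carrier_vec d" "\<forall>i<d. vfun (adjuster d w us) i =
    - (\<Sum>l<length us. ip {..<d} (vfun (us ! l)) (vfun w) / ip {..<d} (vfun (us ! l)) (vfun (us ! l)) * vfun (us ! l) i)" by auto
  have "vfun (- (w \<bullet>c u) / (u \<bullet>c u) \<cdot>\<^sub>v u) i = - (ip {..<d} (vfun u) (vfun w) / ip {..<d} (vfun u) (vfun u) * vfun u i)" if "i < d" for i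
    using u assms(1) that by (simp add: vfun_simps[where n = d] cscalar_prod_eq[of _ d])
  then show ?case using u IH by (auto simp: vfun_simps[where n = d] sum.lessThan_Suc_shift simp del: sum.lessThan_Suc)
qed (simp add: vfun_simps)

text \<open>The accumulator holds the vectors already produced, the latest first; hence the reversed
  prefix.\<close>

lemma gram_schmidt_sub2_nth:
  fixes us ws :: "'a :: rc_field vec list"
  assumes "set us \<subseteq> carrier_vec d" "set ws \<subseteq> carrier_vec d"
  shows "length (gram_schmidt_sub2 d us ws) = length ws \<and> (\<forall>j<length ws.
    gram_schmidt_sub2 d us ws ! j = adjuster d (ws ! j) (rev (take j (gram_schmidt_sub2 d us ws)) @ us) + ws ! j \<and>
    gram_schmidt_sub2 d us ws ! j \<in> carrier_vec d)"
  using assms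
proof (induction ws arbitrary: us)
  case (Cons w ws)
  define u where "u = adjuster d w us + w"
  have u: "u \<in> carrier_vec d" using vfun_adjuster[of w d us] Cons.prems by (simp add: u_def)
  have e: "gram_schmidt_sub2 d us (w # ws) = u # gram_schmidt_sub2 d (u # us) ws" by (simp add: u_def Let_def)
  have IH: "length (gram_schmidt_sub2 d (u # us) ws) = length ws"
    "\<And>j. j < length ws \<Longrightarrow> gram_schmidt_sub2 d (u # us) ws ! j = adjuster d (ws ! j) (rev (take j (gram_schmidt_sub2 d (u # us) ws)) @ u # us) + ws ! j \<and>
    gram_schmidt_sub2 d (u # us) ws ! j \<in> carrier_vec d"
    using Cons.IH[of "u # us"] Cons.prems u by auto
  have "gram_schmidt_sub2 d us (w # ws) ! j = adjuster d ((w # ws) ! j) (rev (take j (gram_schmidt_sub2 d us (w # ws))) @ us) + (w # ws) ! j \<and>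
      gram_schmidt_sub2 d us (w # ws) ! j \<in> carrier_vec d" if "j < length (w # ws)" for j
  proof (cases j)
    case 0
    then show ?thesis using u by (simp add: e del: gram_schmidt_sub2.simps) (simp add: u_def)
  next
    case (Suc j')
    have j': "j' < length ws" using Suc that by simp
    have 1: "gram_schmidt_sub2 d us (w # ws) ! j = gram_schmidt_sub2 d (u # us) ws ! j'" by (simp only: e Suc nth_Cons_Suc)
    have 2: "adjuster d ((w # ws) ! j) (rev (take j (gram_schmidt_sub2 d us (w # ws))) @ us) + (w # ws) ! j =
      adjuster d (ws ! j') (rev (take j' (gram_schmidt_sub2 d (u # us) ws)) @ u # us) + ws ! j'"
      by (simp add: e Suc del: gram_schmidt_sub2.simps)
    show ?thesis unfolding 1 2 by (rule IH(2)[OF j'])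
  qed
  moreover have "length (gram_schmidt_sub2 d us (w # ws)) = length (w # ws)"
    by (simp only: e IH(1) list.size)
  ultimately show ?case by blast
qed simp

lemma gram_schmidt_recursion:
  fixes ws :: "'a :: rc_field vec list"
  assumes ws: "set ws \<subseteq> carrier_vec d" and j: "j < length ws"
  shows "gram_schmidt d ws ! j \<in> carrier_vec d" "length (gram_schmidt d ws) = length ws"
    "i < d \<Longrightarrow> vfun (gram_schmidt d ws ! j) i = vfun (ws ! j) i -
      (\<Sum>l<j. ip {..<d} (vfun (gram_schmidt d ws ! l)) (vfun (ws ! j)) /
         ip {..<d} (vfun (gram_schmidt d ws ! l)) (vfun (gram_schmidt d ws ! l)) * vfun (gram_schmidt d ws ! l) i)"
proof -
  define W where "W = gram_schmidt d ws"
  have W: "length W = length ws" "\<And>j. j < length ws \<Longrightarrow> W ! j = adjuster d (ws ! j) (rev (take j W)) + ws ! j"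
    "\<And>j. j < length ws \<Longrightarrow> W ! j \<in> carrier_vec d"
  proof -
    have "set [] \<subseteq> carrier_vec d" by simp
    from gram_schmidt_sub2_nth[OF this ws, unfolded append_Nil2]
    have 1: "length W = length ws \<and> (\<forall>j<length ws. W ! j = adjuster d (ws ! j) (rev (take j W)) + ws ! j \<and> W ! j \<in> carrier_vec d)"
      unfolding W_def gram_schmidt_code .
    show "length W = length ws" using 1 by (rule conjunct1)
    show "W ! j = adjuster d (ws ! j) (rev (take j W)) + ws ! j" "W ! j \<in> carrier_vec d" if "j < length ws" for j
      using conjunct1[OF spec[OF conjunct2[OF 1], of j, THEN mp, OF that]] conjunct2[OF spec[OF conjunct2[OF 1], of j, THEN mp, OF that]] .
  qed
  show "gram_schmidt d ws ! j \<in> carrier_vec d" "length (gram_schmidt d ws) = length ws"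
    using W j by (auto simp flip: W_def)
  assume i: "i < d"
  let ?f = "\<lambda>v. ip {..<d} (vfun v) (vfun (ws ! j)) / ip {..<d} (vfun v) (vfun v) * vfun v i"
  have wj: "ws ! j \<in> carrier_vec d" using ws j by auto
  have sT: "set (rev (take j W)) \<subseteq> carrier_vec d" using W(1,3) j by (auto simp: in_set_conv_nth)
  have len: "length (rev (take j W)) = j" using W(1) j by simp
  have "vfun (W ! j) i = vfun (adjuster d (ws ! j) (rev (take j W))) i + vfun (ws ! j) i"
    using vfun_adjuster[OF wj sT] wj i W(2)[OF j] by (simp add: vfun_simps[where n = d])
  also have "vfun (adjuster d (ws ! j) (rev (take j W))) i = - (\<Sum>l<j. ?f (rev (take j W) ! l))"
    using vfun_adjuster[OF wj sT] i len by simp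
  \<comment> \<open>Reindexing undoes the reversal of the accumulator.\<close>
  also have "(\<Sum>l<j. ?f (rev (take j W) ! l)) = (\<Sum>l<j. ?f (W ! l))"
    by (rule sum.reindex_bij_witness[of _ "\<lambda>l. j - Suc l" "\<lambda>l. j - Suc l"]) (use len W(1) j in \<open>auto simp: rev_nth\<close>)
  finally show "vfun (gram_schmidt d ws ! j) i = vfun (ws ! j) i -
      (\<Sum>l<j. ip {..<d} (vfun (gram_schmidt d ws ! l)) (vfun (ws ! j)) /
         ip {..<d} (vfun (gram_schmidt d ws ! l)) (vfun (gram_schmidt d ws ! l)) * vfun (gram_schmidt d ws ! l) i)"
    by (simp add: W_def)
qed

section \<open>The spiked matrix along a fixed realization\<close>

lemma singular_value_limits:
  fixes X :: "nat \<Rightarrow> 'a :: rc_field mat"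
  assumes \<mu>: "real_distribution \<mu>" "compact (measure_support \<mu>)"
    and X: "\<And>n. n \<ge> 1 \<Longrightarrow> X n \<in> carrier_mat n (m n)"
    and weak: "weak_conv_m (\<lambda>n. sv_measure (X n)) \<mu>"
    and top: "(\<lambda>n. singular_values (X n) ! 0) \<longlonglongrightarrow> sup_support \<mu>"
  shows "0 \<le> sup_support \<mu>" "AE t in \<mu>. 0 \<le> t \<and> t \<le> sup_support \<mu>"
    "(\<lambda>n. (\<Sum>i<n. (singular_values (X n) ! i) ^ k) / real n) \<longlonglongrightarrow> (\<integral>t. t ^ k \<partial>\<mu>)"
proof -
  define s where "s n i = singular_values (X n) ! i" for n i
  have sb: "0 \<le> s n i \<and> s n i \<le> s n 0" if i: "i < n" for n i
  proof -
    have n: "n \<ge> 1" using i by simp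
    obtain e where e: "sv_basis n (m n) (entries (X n)) (s n) e"
      using sv_basis_exists[OF X[OF n]] unfolding s_def[abs_def] by (elim exE)
    show ?thesis using sv_basisD(2)[OF e i] sv_basisD(4)[OF e _ i, of 0] by simp
  qed
  \<comment> \<open>At n = 0 the dimension of \<open>X n\<close> is unspecified, so the two
    sequences of measures are compared from n = 1 on.\<close>
  have "weak_conv_m (\<lambda>n. distr (uniform_count_measure {..<n}) borel (s n)) \<mu>"
    unfolding weak_conv_m_def weak_conv_def
  proof (intro allI impI)
    fix x assume "isCont (cdf \<mu>) x"
    with weak have l: "(\<lambda>n. cdf (sv_measure (X n)) x) \<longlonglongrightarrow> cdf \<mu> x"
      unfolding weak_conv_m_def weak_conv_def by blast
    have "\<forall>\<^sub>F n in sequentially. cdf (sv_measure (X n)) x = cdf (distr (uniform_count_measure {..<n}) borel (s n)) x"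
      using eventually_ge_at_top[of 1]
    proof eventually_elim
      case (elim n)
      have "dim_row (X n) = n" using X[OF elim] by simp
      then show ?case by (simp add: sv_measure_def s_def[abs_def])
    qed
    then show "(\<lambda>n. cdf (distr (uniform_count_measure {..<n}) borel (s n)) x) \<longlonglongrightarrow> cdf \<mu> x"
      by (rule Lim_transform_eventually[OF l])
  qed
  note * = weak_limit_empirical[OF \<mu>(1) this _ _ _ AE_le_sup_support[OF \<mu>]]
  have s0: "(\<lambda>n. s n 0) \<longlonglongrightarrow> sup_support \<mu>" using top by (simp add: s_def)
  show "0 \<le> sup_support \<mu>" by (rule *(1)) (use sb s0 in auto)
  show "AE t in \<mu>. 0 \<le> t \<and> t \<le> sup_support \<mu>" by (rule *(2)) (use sb s0 in auto)
  have "(\<lambda>n. (\<Sum>i<n. s n i ^ k) / real n) \<longlonglongrightarrow> (\<integral>t. t ^ k \<partial>\<mu>)" by (rule *(3)) (use sb s0 in auto)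
  then show "(\<lambda>n. (\<Sum>i<n. (singular_values (X n) ! i) ^ k) / real n) \<longlonglongrightarrow> (\<integral>t. t ^ k \<partial>\<mu>)" by (simp add: s_def)
qed

definition spike_fun :: "'a :: rc_field vec list \<Rightarrow> 'a vec list \<Rightarrow> nat + nat \<Rightarrow> nat + nat \<Rightarrow> complex" where
  "spike_fun us vs s = (case s of Inl i \<Rightarrow> inlv (vfun (us ! i)) | Inr i \<Rightarrow> inrv (vfun (vs ! i)))"

lemma spike_fun_simps [simp]:
  "spike_fun us vs (Inl i) = inlv (vfun (us ! i))" "spike_fun us vs (Inr i) = inrv (vfun (vs ! i))"
  by (simp_all add: spike_fun_def)

lemma ip_inlv: "ip (idx n m) (inlv u) x = ip {..<n} u (x \<circ> Inl)" "ip (idx n m) (inrv v) x = ip {..<m} v (x \<circ> Inr)"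
  by (simp_all add: ip_def sum_idx)

lemma inlv_comp [simp]: "inlv u \<circ> Inl = u" "inrv v \<circ> Inr = v"
  by (simp_all add: fun_eq_iff)

lemma nsq_inlv: "nsq (idx n m) (inlv u) = nsq {..<n} u" "nsq (idx n m) (inrv v) = nsq {..<m} v"
  by (simp_all add: nsq_def sum_idx)

lemma app_dil_perturbation:
  fixes X :: "'a :: rc_field mat"
  assumes X: "X \<in> carrier_mat n m" and i: "i \<in> idx n m"
  shows "app (idx n m) (dil (entries (X + perturbation n m r \<theta> us vs))) x i = app (idx n m) (dil (entries X)) x i +
    (\<Sum>j<r. of_real (\<theta> j) * (ip (idx n m) (spike_fun us vs (Inr j)) x * spike_fun us vs (Inl j) i
      + ip (idx n m) (spike_fun us vs (Inl j)) x * spike_fun us vs (Inr j) i))"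
proof -
  have e: "entries (X + perturbation n m r \<theta> us vs) k l = entries X k l +
      (\<Sum>j<r. of_real (\<theta> j) * vfun (us ! j) k * cnj (vfun (vs ! j) l))" if "k < n" "l < m" for k l
    using X that by (simp add: entries_def perturbation_def vfun_def)
  show ?thesis
  proof (cases i)
    case (Inl k)
    then have k: "k < n" using i by auto
    have "app {..<m} (entries (X + perturbation n m r \<theta> us vs)) (x \<circ> Inr) k =
      (\<Sum>l<m. entries X k l * x (Inr l) + (\<Sum>j<r. of_real (\<theta> j) * vfun (us ! j) k * cnj (vfun (vs ! j) l) * x (Inr l)))"
      unfolding app_def by (intro sum.cong refl) (simp add: e k distrib_right sum_distrib_right)
    also have "\<dots> = app {..<m} (entries X) (x \<circ> Inr) k + (\<Sum>j<r. \<Sum>l<m. of_real (\<theta> j) * vfun (us ! j) k * cnj (vfun (vs ! j) l) * x (Inr l))"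
      unfolding sum.distrib app_def by (subst sum.swap) simp
    also have "(\<Sum>j<r. \<Sum>l<m. of_real (\<theta> j) * vfun (us ! j) k * cnj (vfun (vs ! j) l) * x (Inr l)) =
      (\<Sum>j<r. of_real (\<theta> j) * (ip {..<m} (vfun (vs ! j)) (x \<circ> Inr) * vfun (us ! j) k))"
      unfolding ip_def by (intro sum.cong refl) (simp add: sum_distrib_left sum_distrib_right mult_ac)
    finally show ?thesis by (simp add: Inl app_dil ip_inlv comp_def)
  next
    case (Inr l)
    then have l: "l < m" using i by auto
    have "app {..<n} (adj (entries (X + perturbation n m r \<theta> us vs))) (x \<circ> Inl) l =
      (\<Sum>k<n. cnj (entries X k l) * x (Inl k) + (\<Sum>j<r. of_real (\<theta> j) * cnj (vfun (us ! j) k) * vfun (vs ! j) l * x (Inl k)))"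
      unfolding app_def adj_def by (intro sum.cong refl) (simp add: e l distrib_right sum_distrib_right)
    also have "\<dots> = app {..<n} (adj (entries X)) (x \<circ> Inl) l + (\<Sum>j<r. \<Sum>k<n. of_real (\<theta> j) * cnj (vfun (us ! j) k) * vfun (vs ! j) l * x (Inl k))"
      unfolding sum.distrib app_def adj_def by (subst sum.swap) simp
    also have "(\<Sum>j<r. \<Sum>k<n. of_real (\<theta> j) * cnj (vfun (us ! j) k) * vfun (vs ! j) l * x (Inl k)) =
      (\<Sum>j<r. of_real (\<theta> j) * (ip {..<n} (vfun (us ! j)) (x \<circ> Inl) * vfun (vs ! j) l))"
      unfolding ip_def by (intro sum.cong refl) (simp add: sum_distrib_left sum_distrib_right mult_ac)
    finally show ?thesis by (simp add: Inr app_dil ip_inlv comp_def)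
  qed
qed

lemma singular_vector_pair_dil:
  fixes A :: "'a :: rc_field mat"
  assumes A: "A \<in> carrier_mat n m" and p: "singular_vector_pair A s u v"
  defines "x \<equiv> case_sum (vfun u) (vfun v)"
  shows "i \<in> idx n m \<Longrightarrow> of_real s * x i = app (idx n m) (dil (entries A)) x i"
    "nsq {..<n} (vfun u) = 1" "nsq {..<m} (vfun v) = 1" "u \<in> carrier_vec n" "v \<in> carrier_vec m"
proof -
  have u: "u \<in> carrier_vec n" and v: "v \<in> carrier_vec m" and n1: "l2_norm u = 1" "l2_norm v = 1"
    and e: "A *\<^sub>v v = of_real s \<cdot>\<^sub>v u" "mat_adjoint A *\<^sub>v u = of_real s \<cdot>\<^sub>v v"
    using p A by (auto simp: singular_vector_pair_def)
  show "u \<in> carrier_vec n" "v \<in> carrier_vec m" by fact+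
  show "nsq {..<n} (vfun u) = 1" "nsq {..<m} (vfun v) = 1"
    using n1 u v by (auto simp: l2_norm_eq[of _ n] l2_norm_eq[of _ m])
  assume i: "i \<in> idx n m"
  show "of_real s * x i = app (idx n m) (dil (entries A)) x i"
  proof (cases i)
    case (Inl k)
    then have k: "k < n" using i by auto
    have "of_real s * vfun u k = vfun (A *\<^sub>v v) k" unfolding e using u k by (simp add: vfun_simps[where n = n])
    also have "\<dots> = app {..<m} (entries A) (vfun v) k" using A v k by (rule vfun_mult_mat_vec)
    finally show ?thesis by (simp add: Inl app_dil x_def)
  next
    case (Inr l)
    then have l: "l < m" using i by auto
    have Aa: "mat_adjoint A \<in> carrier_mat m n" using A mat_of_rows_carrier(1)[of n "map conjugate (cols A)"] by (simp add: mat_adjoint_def)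
    have "of_real s * vfun v l = vfun (mat_adjoint A *\<^sub>v u) l" unfolding e using v l by (simp add: vfun_simps[where n = m])
    also have "\<dots> = app {..<n} (entries (mat_adjoint A)) (vfun u) l" using Aa u l by (rule vfun_mult_mat_vec)
    also have "\<dots> = app {..<n} (adj (entries A)) (vfun u) l"
      unfolding app_def by (intro sum.cong refl) (simp add: entries_mat_adjoint[OF A l])
    finally show ?thesis by (simp add: Inr app_dil x_def)
  qed
qed

text \<open>Everything required of one realization. Both models are instances: the moment limits
  hold directly for the scaled columns and by perturbation for the orthonormalized ones.\<close>

locale spiked_path =
  fixes m :: "nat \<Rightarrow> nat" and X :: "nat \<Rightarrow> 'a :: rc_field mat" and us vs :: "nat \<Rightarrow> 'a vec list"
    and r :: nat and \<theta> :: "nat \<Rightarrow> real" and \<mu> :: "real measure" and c :: real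
  assumes X_dim: "n \<ge> 1 \<Longrightarrow> X n \<in> carrier_mat n (m n)"
    and \<mu>: "real_distribution \<mu>" "compact (measure_support \<mu>)"
    and c01: "0 \<le> c" "c \<le> 1"
    and weak: "weak_conv_m (\<lambda>n. sv_measure (X n)) \<mu>"
    and top: "(\<lambda>n. singular_values (X n) ! 0) \<longlonglongrightarrow> sup_support \<mu>"
    and us_dim: "n \<ge> 1 \<Longrightarrow> i < r \<Longrightarrow> us n ! i \<in> carrier_vec n"
    and vs_dim: "n \<ge> 1 \<Longrightarrow> i < r \<Longrightarrow> vs n ! i \<in> carrier_vec (m n)"
    and \<theta>_pos: "i < r \<Longrightarrow> \<theta> i > 0" and \<theta>_decr: "i \<le> j \<Longrightarrow> j < r \<Longrightarrow> \<theta> j \<le> \<theta> i"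
    and spike_moments: "s \<in> idx r r \<Longrightarrow> t \<in> idx r r \<Longrightarrow>
      (\<lambda>n. ip (idx n (m n)) (spike_fun (us n) (vs n) s) ((app (idx n (m n)) (dil (entries (X n))) ^^ k) (spike_fun (us n) (vs n) t)))
        \<longlonglongrightarrow> (if s = t then of_real (spike_moment c (\<lambda>k. \<integral>t. t ^ k \<partial>\<mu>) s k) else 0)"
begin

abbreviation "b \<equiv> sup_support \<mu>"

sublocale law: limit_law \<mu> b c
proof (rule limit_law.intro)
  show "0 \<le> b" by (rule singular_value_limits(1)[OF \<mu> _ weak top]) (rule X_dim)
  show "AE t in \<mu>. 0 \<le> t \<and> t \<le> b" by (rule singular_value_limits(2)[OF \<mu> _ weak top]) (rule X_dim)
qed (fact \<mu> c01)+

abbreviation "spike_law \<equiv> spike_moment c (\<lambda>k. \<integral>t. t ^ k \<partial>\<mu>)"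

lemma spike_law_eq: "spike_law (Inl i) = law.L1" "spike_law (Inr i) = law.L2"
  by (auto simp: fun_eq_iff spike_moment_def law.L1_def law.L2_def even_moments_def)

sublocale res: resolvent_limits "\<lambda>n. idx n (m n)" "\<lambda>n. dil (entries (X n))" "\<lambda>n. spike_fun (us n) (vs n)" "idx r r" b spike_law
proof
  fix B assume B: "B > b"
  have "\<forall>\<^sub>F n in sequentially. singular_values (X n) ! 0 < B" using order_tendstoD(2)[OF top B] .
  then show "\<forall>\<^sub>F n in sequentially. \<forall>x. nsq (idx n (m n)) (app (idx n (m n)) (dil (entries (X n))) x) \<le> B\<^sup>2 * nsq (idx n (m n)) x"
    using eventually_ge_at_top[of 1]
  proof eventually_elim
    case (elim n)
    obtain e where e: "sv_basis n (m n) (entries (X n)) (\<lambda>k. singular_values (X n) ! k) e"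
      using sv_basis_exists[OF X_dim[OF elim(2)]] by (elim exE)
    have n: "0 < n" using elim by simp
    show ?case
    proof
      fix x
      have "nsq (idx n (m n)) (app (idx n (m n)) (dil (entries (X n))) x) \<le> (singular_values (X n) ! 0)\<^sup>2 * nsq (idx n (m n)) x"
        by (rule nsq_app_dil_le[OF e n])
      also have "\<dots> \<le> B\<^sup>2 * nsq (idx n (m n)) x"
        by (intro mult_right_mono power_mono) (use elim(1) sv_basisD(2)[OF e n] in auto)
      finally show "nsq (idx n (m n)) (app (idx n (m n)) (dil (entries (X n))) x) \<le> B\<^sup>2 * nsq (idx n (m n)) x" .
    qed
  qed
next
  show "0 \<le> b" by (rule law.b0)
qed (simp_all add: spike_moments)

lemma F_eq: "res.F (Inl i) z = stieltjes law.L1 z" "res.F (Inr i) z = stieltjes law.L2 z"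
  "res.G (Inl i) z = stieltjes2 law.L1 z" "res.G (Inr i) z = stieltjes2 law.L2 z"
  by (simp_all only: res.F_def res.G_def stieltjes_def stieltjes2_def spike_law_eq)

lemma stieltjes_L_pos:
  assumes "b < z"
  shows "stieltjes law.L1 z > 0" "stieltjes law.L2 z > 0" "stieltjes2 law.L1 z > 0" "stieltjes2 law.L2 z > 0"
  using moment_seq.stieltjes_pos[OF law.moment_seq1 assms] moment_seq.stieltjes_pos[OF law.moment_seq2 assms]
    moment_seq.stieltjes2_pos[OF law.moment_seq1 assms] moment_seq.stieltjes2_pos[OF law.moment_seq2 assms] by auto

sublocale sp: spiked "\<lambda>n. idx n (m n)" "\<lambda>n. dil (entries (X n))" "\<lambda>n. spike_fun (us n) (vs n)" r b spike_law \<theta>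
proof
  show "res.F s z > 0" if "s \<in> idx r r" "b < z" for s z
    using that(1) stieltjes_L_pos[OF that(2)] by (auto simp: F_eq)
qed (rule \<theta>_pos)

abbreviation "Xt n \<equiv> X n + perturbation n (m n) r \<theta> (us n) (vs n)"

lemma Xt_dim: "n \<ge> 1 \<Longrightarrow> Xt n \<in> carrier_mat n (m n)"
  using X_dim[of n] by (simp add: perturbation_def)

lemma Xt_form:
  assumes n: "n \<ge> 1"
  shows "ip (idx n (m n)) x (app (idx n (m n)) (dil (entries (Xt n))) x) =
    ip (idx n (m n)) x (app (idx n (m n)) (dil (entries (X n))) x) + sp.pert n x x"
proof -
  let ?I = "idx n (m n)" and ?W = "spike_fun (us n) (vs n)"
  have "ip ?I x (app ?I (dil (entries (Xt n))) x) = ip ?I x (\<lambda>i. app ?I (dil (entries (X n))) x i +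
    (\<Sum>j<r. of_real (\<theta> j) * (ip ?I (?W (Inr j)) x * ?W (Inl j) i + ip ?I (?W (Inl j)) x * ?W (Inr j) i)))"
    by (intro ip_cong refl) (rule app_dil_perturbation[OF X_dim[OF n]])
  also have "\<dots> = ip ?I x (app ?I (dil (entries (X n))) x) + (\<Sum>j<r. of_real (\<theta> j) *
    (ip ?I (?W (Inr j)) x * ip ?I x (?W (Inl j)) + ip ?I (?W (Inl j)) x * ip ?I x (?W (Inr j))))"
    by (simp only: ip_add_right ip_sum_right ip_scale_right)
  also have "(\<Sum>j<r. of_real (\<theta> j) *
    (ip ?I (?W (Inr j)) x * ip ?I x (?W (Inl j)) + ip ?I (?W (Inl j)) x * ip ?I x (?W (Inr j)))) = sp.pert n x x"
    unfolding sp.pert_def by (intro sum.cong refl) (simp only: mult.commute)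
  finally show ?thesis .
qed

lemma Re_pert_le:
  "Re (sp.pert n x x) \<le> 2 * (\<Sum>i<r. \<theta> i * norm (ip (idx n (m n)) (spike_fun (us n) (vs n) (Inl i)) x) *
     norm (ip (idx n (m n)) (spike_fun (us n) (vs n) (Inr i)) x))"
proof -
  let ?I = "idx n (m n)" and ?W = "spike_fun (us n) (vs n)"
  have "Re (of_real (\<theta> i) * (ip ?I x (?W (Inl i)) * ip ?I (?W (Inr i)) x + ip ?I x (?W (Inr i)) * ip ?I (?W (Inl i)) x))
    \<le> 2 * (\<theta> i * norm (ip ?I (?W (Inl i)) x) * norm (ip ?I (?W (Inr i)) x))" if "i < r" for i
  proof -
    have n: "norm (ip ?I x y) = norm (ip ?I y x)" for y
      by (subst cnj_ip[symmetric]) (rule complex_mod_cnj)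
    have "Re (of_real (\<theta> i) * (ip ?I x (?W (Inl i)) * ip ?I (?W (Inr i)) x + ip ?I x (?W (Inr i)) * ip ?I (?W (Inl i)) x))
      \<le> norm (of_real (\<theta> i) * (ip ?I x (?W (Inl i)) * ip ?I (?W (Inr i)) x + ip ?I x (?W (Inr i)) * ip ?I (?W (Inl i)) x))"
      by (rule complex_Re_le_cmod)
    also have "\<dots> = \<theta> i * norm (ip ?I x (?W (Inl i)) * ip ?I (?W (Inr i)) x + ip ?I x (?W (Inr i)) * ip ?I (?W (Inl i)) x)"
      unfolding norm_mult norm_of_real using \<theta>_pos[OF that] by simp
    also have "\<dots> \<le> \<theta> i * (norm (ip ?I x (?W (Inl i)) * ip ?I (?W (Inr i)) x) + norm (ip ?I x (?W (Inr i)) * ip ?I (?W (Inl i)) x))"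
      using \<theta>_pos[OF that] by (intro mult_left_mono norm_triangle_ineq) simp
    also have "\<dots> = 2 * (\<theta> i * norm (ip ?I (?W (Inl i)) x) * norm (ip ?I (?W (Inr i)) x))"
      unfolding norm_mult n[of "?W (Inl i)"] n[of "?W (Inr i)"] by (simp add: algebra_simps)
    finally show ?thesis .
  qed
  then show ?thesis unfolding sp.pert_def Re_sum sum_distrib_left by (intro sum_mono) (simp only: lessThan_iff)
qed

lemma D_values: "b < z \<Longrightarrow> (\<theta> i)\<^sup>2 * res.F (Inl i) z * res.F (Inr i) z = (\<theta> i)\<^sup>2 * D_transform c \<mu> z"
  by (simp add: F_eq law.D_eq)

section \<open>Location of the outlier singular value\<close>

context
  fixes i0 :: nat and \<rho> :: real
  assumes i0: "i0 < r" and \<rho>: "b < \<rho>" "D_transform c \<mu> \<rho> = 1 / (\<theta> i0)\<^sup>2"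
begin

text \<open>A larger singular value would give a test vector orthogonal to the left spikes of index
  below \<open>i0\<close>. Those terms of the perturbation vanish on it, and the others satisfy
  \<open>(\<theta> i)^2 * D_transform c \<mu> z < 1\<close> as z exceeds \<rho>, so the bound on the
  form contradicts the witness.\<close>

lemma outlier_le:
  assumes z: "\<rho> < z"
  shows "\<forall>\<^sub>F n in sequentially. singular_values (Xt n) ! i0 \<le> z"
proof -
  have bz: "b < z" using z \<rho> by simp
  have "\<forall>\<^sub>F n in sequentially. \<forall>x. Re (ip (idx n (m n)) x (app (idx n (m n)) (dil (entries (X n))) x)) +
    2 * (\<Sum>i\<in>{i0..<r}. \<theta> i * norm (ip (idx n (m n)) (spike_fun (us n) (vs n) (Inl i)) x) *
      norm (ip (idx n (m n)) (spike_fun (us n) (vs n) (Inr i)) x)) \<le> z * nsq (idx n (m n)) x"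
  proof (rule sp.upper_edge[OF bz])
    fix i assume "i \<in> {i0..<r}"
    then have i: "i < r" "\<theta> i \<le> \<theta> i0" using \<theta>_decr by auto
    have "(\<theta> i)\<^sup>2 * D_transform c \<mu> z \<le> (\<theta> i0)\<^sup>2 * D_transform c \<mu> z"
      using i \<theta>_pos[OF i(1)] law.D_pos[OF bz] by (intro mult_right_mono power_mono) auto
    also have "\<dots> < (\<theta> i0)\<^sup>2 * D_transform c \<mu> \<rho>"
      using law.D_strict_decreasing[OF \<rho>(1) z] \<theta>_pos[OF i0] by (intro mult_strict_left_mono) auto
    also have "\<dots> = 1" using \<rho>(2) \<theta>_pos[OF i0] by simp
    finally show "(\<theta> i)\<^sup>2 * res.F (Inl i) z * res.F (Inr i) z < 1" by (simp only: D_values[OF bz])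
  qed auto
  \<comment> \<open>The singular value of index \<open>i0\<close> makes sense only for n >
    i0.\<close>
  then show ?thesis using eventually_gt_at_top[of i0]
  proof eventually_elim
    case (elim n)
    have n1: "n \<ge> 1" using elim(2) by simp
    obtain e where e: "sv_basis n (m n) (entries (Xt n)) (\<lambda>k. singular_values (Xt n) ! k) e"
      using sv_basis_exists[OF Xt_dim[OF n1]] by (elim exE)
    show ?case
    proof (rule ccontr)
      assume "\<not> singular_values (Xt n) ! i0 \<le> z"
      then have zs: "z < singular_values (Xt n) ! i0" by simp
      have z0: "0 \<le> z" using bz law.b0 by simp
      obtain w v where wv: "nsq {..<n} w > 0" "nsq {..<m n} v = nsq {..<n} w" "\<forall>i<i0. ip {..<n} (vfun (us n ! i)) w = 0"
        "Re (ip {..<n} w (app {..<m n} (entries (Xt n)) v)) > z * nsq {..<n} w"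
        using large_singular_value_witness[OF e elim(2) z0 zs, of "\<lambda>i. vfun (us n ! i)"] by (elim exE conjE)
      define x where "x = case_sum w v"
      let ?I = "idx n (m n)" and ?W = "spike_fun (us n) (vs n)"
      have x2: "nsq ?I x = 2 * nsq {..<n} w" using wv(2) by (simp add: nsq_idx x_def)
      have "Re (ip ?I x (app ?I (dil (entries (Xt n))) x)) = 2 * Re (ip {..<n} w (app {..<m n} (entries (Xt n)) v))"
        unfolding Re_ip_dil by (simp add: x_def)
      with wv(4) x2 have 1: "z * nsq ?I x < Re (ip ?I x (app ?I (dil (entries (Xt n))) x))" by simp
      have "(\<Sum>i<r. \<theta> i * norm (ip ?I (?W (Inl i)) x) * norm (ip ?I (?W (Inr i)) x)) =
        (\<Sum>i\<in>{i0..<r}. \<theta> i * norm (ip ?I (?W (Inl i)) x) * norm (ip ?I (?W (Inr i)) x))"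
        by (rule sum.mono_neutral_right) (use wv(3) in \<open>auto simp: ip_inlv x_def\<close>)
      then have "Re (sp.pert n x x) \<le> 2 * (\<Sum>i\<in>{i0..<r}. \<theta> i * norm (ip ?I (?W (Inl i)) x) * norm (ip ?I (?W (Inr i)) x))"
        using Re_pert_le[of n x] by (simp only:)
      moreover have "Re (ip ?I x (app ?I (dil (entries (X n))) x)) +
        2 * (\<Sum>i\<in>{i0..<r}. \<theta> i * norm (ip ?I (?W (Inl i)) x) * norm (ip ?I (?W (Inr i)) x)) \<le> z * nsq ?I x"
        using elim(1) by (rule spec)
      moreover have "Re (ip ?I x (app ?I (dil (entries (Xt n))) x)) = Re (ip ?I x (app ?I (dil (entries (X n))) x)) + Re (sp.pert n x x)"
        unfolding Xt_form[OF n1] by (rule plus_complex.sel(1))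
      ultimately have "Re (ip ?I x (app ?I (dil (entries (Xt n))) x)) \<le> z * nsq ?I x" by linarith
      with 1 show False by simp
    qed
  qed
qed

text \<open>To the left of \<rho> the spikes of index up to \<open>i0\<close> satisfy the reverse
  inequality and give \<open>i0 + 1\<close> trial vectors on whose nontrivial combinations the form
  exceeds z; a singular value below z rules that out.\<close>

lemma outlier_ge:
  assumes z: "b < z" "z < \<rho>"
  shows "\<forall>\<^sub>F n in sequentially. z \<le> singular_values (Xt n) ! i0"
proof -
  have "\<forall>\<^sub>F n in sequentially. \<exists>x. \<forall>c. (\<exists>j\<le>i0. c j \<noteq> 0) \<longrightarrow>
    z * nsq (idx n (m n)) (\<lambda>i. \<Sum>j\<le>i0. c j * x j i) <
      Re (ip (idx n (m n)) (\<lambda>i. \<Sum>j\<le>i0. c j * x j i) (app (idx n (m n)) (dil (entries (X n))) (\<lambda>i. \<Sum>j\<le>i0. c j * x j i))) +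
      Re (sp.pert n (\<lambda>i. \<Sum>j\<le>i0. c j * x j i) (\<lambda>i. \<Sum>j\<le>i0. c j * x j i))"
  proof (rule sp.lower_edge[OF z(1) i0])
    fix i assume i: "i \<le> i0"
    then have "\<theta> i0 \<le> \<theta> i" using \<theta>_decr i0 by auto
    have "1 = (\<theta> i0)\<^sup>2 * D_transform c \<mu> \<rho>" using \<rho>(2) \<theta>_pos[OF i0] by simp
    also have "\<dots> < (\<theta> i0)\<^sup>2 * D_transform c \<mu> z"
      using law.D_strict_decreasing[OF z] \<theta>_pos[OF i0] by (intro mult_strict_left_mono) auto
    also have "\<dots> \<le> (\<theta> i)\<^sup>2 * D_transform c \<mu> z"
      using \<open>\<theta> i0 \<le> \<theta> i\<close> \<theta>_pos[OF i0] law.D_pos[OF z(1)] by (intro mult_right_mono power_mono) auto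
    finally show "(\<theta> i)\<^sup>2 * res.F (Inl i) z * res.F (Inr i) z > 1" by (simp only: D_values[OF z(1)])
  qed
  then show ?thesis using eventually_gt_at_top[of i0]
  proof eventually_elim
    case (elim n)
    have n1: "n \<ge> 1" using elim(2) by simp
    let ?I = "idx n (m n)"
    obtain e where e: "sv_basis n (m n) (entries (Xt n)) (\<lambda>k. singular_values (Xt n) ! k) e"
      using sv_basis_exists[OF Xt_dim[OF n1]] by (elim exE)
    obtain x where x: "\<And>c. (\<exists>j\<le>i0. c j \<noteq> 0) \<Longrightarrow>
      z * nsq ?I (\<lambda>i. \<Sum>j\<le>i0. c j * x j i) <
      Re (ip ?I (\<lambda>i. \<Sum>j\<le>i0. c j * x j i) (app ?I (dil (entries (X n))) (\<lambda>i. \<Sum>j\<le>i0. c j * x j i))) +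
      Re (sp.pert n (\<lambda>i. \<Sum>j\<le>i0. c j * x j i) (\<lambda>i. \<Sum>j\<le>i0. c j * x j i))"
      using elim(1) by (elim exE) blast
    show ?case
    proof (rule ccontr)
      assume "\<not> z \<le> singular_values (Xt n) ! i0"
      then have zs: "singular_values (Xt n) ! i0 < z" by simp
      obtain a where a: "\<exists>j\<le>i0. a j \<noteq> 0"
        "2 * Re (ip {..<n} (\<lambda>i. \<Sum>j\<le>i0. a j * (x j \<circ> Inl) i) (app {..<m n} (entries (Xt n)) (\<lambda>i. \<Sum>j\<le>i0. a j * (x j \<circ> Inr) i)))
        \<le> z * (nsq {..<n} (\<lambda>i. \<Sum>j\<le>i0. a j * (x j \<circ> Inl) i) + nsq {..<m n} (\<lambda>i. \<Sum>j\<le>i0. a j * (x j \<circ> Inr) i))"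
        using small_singular_value_combination[OF e elim(2) zs, of "\<lambda>j. x j \<circ> Inl" "\<lambda>j. x j \<circ> Inr"] by (rule exE) (erule conjE, rule that)
      define y where "y = (\<lambda>i. \<Sum>j\<le>i0. a j * x j i)"
      have y: "(\<lambda>i. \<Sum>j\<le>i0. a j * (x j \<circ> Inl) i) = y \<circ> Inl" "(\<lambda>i. \<Sum>j\<le>i0. a j * (x j \<circ> Inr) i) = y \<circ> Inr"
        by (auto simp: y_def fun_eq_iff)
      have "Re (ip ?I y (app ?I (dil (entries (Xt n))) y)) \<le> z * nsq ?I y"
        using a(2) unfolding y Re_ip_dil nsq_idx .
      moreover have "z * nsq ?I y < Re (ip ?I y (app ?I (dil (entries (Xt n))) y))"
        using x[OF a(1)] unfolding y_def[symmetric] Xt_form[OF n1] plus_complex.sel .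
      ultimately show False by simp
    qed
  qed
qed

lemma outlier_tendsto: "(\<lambda>n. singular_values (Xt n) ! i0) \<longlonglongrightarrow> \<rho>"
proof (rule order_tendstoI)
  fix a assume a: "a < \<rho>"
  define z where "z = (max a b + \<rho>) / 2"
  have "\<forall>\<^sub>F n in sequentially. z \<le> singular_values (Xt n) ! i0"
    by (rule outlier_ge) (use a \<rho>(1) in \<open>auto simp: z_def\<close>)
  moreover have "a < z" using a \<rho>(1) by (auto simp: z_def)
  ultimately show "\<forall>\<^sub>F n in sequentially. a < singular_values (Xt n) ! i0" by (auto elim: eventually_mono)
next
  fix a assume a: "\<rho> < a"
  have "\<forall>\<^sub>F n in sequentially. singular_values (Xt n) ! i0 \<le> (\<rho> + a) / 2" by (rule outlier_le) (use a in simp)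
  moreover have "(\<rho> + a) / 2 < a" using a by simp
  ultimately show "\<forall>\<^sub>F n in sequentially. singular_values (Xt n) ! i0 < a" by (auto elim: eventually_mono)
qed

end

section \<open>Overlaps and projections along one realization\<close>

lemma gram_tendsto:
  assumes "i < r" "j < r"
  shows "(\<lambda>n. ip {..<n} (vfun (us n ! i)) (vfun (us n ! j))) \<longlonglongrightarrow> (if i = j then 1 else 0)"
    "(\<lambda>n. ip {..<m n} (vfun (vs n ! i)) (vfun (vs n ! j))) \<longlonglongrightarrow> (if i = j then 1 else 0)"
proof -
  have L0: "spike_law (Inl i) 0 = 1" "spike_law (Inr i) 0 = 1"
    using law.total_mass real_distribution.space_eq_univ[OF \<mu>(1)] by (simp_all add: spike_moment_def)
  show "(\<lambda>n. ip {..<n} (vfun (us n ! i)) (vfun (us n ! j))) \<longlonglongrightarrow> (if i = j then 1 else 0)"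
    using spike_moments[OF InlI[of i "{..<r}"] InlI[of j "{..<r}"], of 0] assms L0 by (cases "i = j") (simp_all add: ip_inlv)
  show "(\<lambda>n. ip {..<m n} (vfun (vs n ! i)) (vfun (vs n ! j))) \<longlonglongrightarrow> (if i = j then 1 else 0)"
    using spike_moments[OF InrI[of i "{..<r}"] InrI[of j "{..<r}"], of 0] assms L0 by (cases "i = j") (simp_all add: ip_inlv)
qed

lemma nsq_spike_tendsto:
  assumes "i < r"
  shows "(\<lambda>n. sqrt (nsq {..<n} (vfun (us n ! i)))) \<longlonglongrightarrow> 1" "(\<lambda>n. sqrt (nsq {..<m n} (vfun (vs n ! i)))) \<longlonglongrightarrow> 1"
proof -
  have "(\<lambda>n. Re (ip {..<n} (vfun (us n ! i)) (vfun (us n ! i)))) \<longlonglongrightarrow> 1" "(\<lambda>n. Re (ip {..<m n} (vfun (vs n ! i)) (vfun (vs n ! i)))) \<longlonglongrightarrow> 1"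
    using tendsto_Re[OF gram_tendsto(1)[OF assms assms]] tendsto_Re[OF gram_tendsto(2)[OF assms assms]] by simp_all
  then show "(\<lambda>n. sqrt (nsq {..<n} (vfun (us n ! i)))) \<longlonglongrightarrow> 1" "(\<lambda>n. sqrt (nsq {..<m n} (vfun (vs n ! i)))) \<longlonglongrightarrow> 1"
    using tendsto_real_sqrt[of "\<lambda>n. Re (ip {..<n} (vfun (us n ! i)) (vfun (us n ! i)))" 1]
      tendsto_real_sqrt[of "\<lambda>n. Re (ip {..<m n} (vfun (vs n ! i)) (vfun (vs n ! i)))" 1] by (simp_all add: ip_self)
qed

context
  fixes i0 :: nat and \<rho> :: real and ut vt :: "nat \<Rightarrow> 'a vec"
  assumes i0: "i0 < r" and \<rho>: "b < \<rho>" "D_transform c \<mu> \<rho> = 1 / (\<theta> i0)\<^sup>2"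
    and pair: "\<And>n. n > i0 \<Longrightarrow> singular_vector_pair (Xt n) (singular_values (Xt n) ! i0) (ut n) (vt n)"
begin

lemma uv_facts:
  assumes n: "n \<ge> Suc i0"
  shows "ut n \<in> carrier_vec n" "vt n \<in> carrier_vec (m n)" "nsq {..<n} (vfun (ut n)) = 1" "nsq {..<m n} (vfun (vt n)) = 1"
proof -
  have n1: "n \<ge> 1" and n2: "n > i0" using n by simp_all
  note * = singular_vector_pair_dil[OF Xt_dim[OF n1] pair[OF n2]]
  show "ut n \<in> carrier_vec n" "vt n \<in> carrier_vec (m n)" "nsq {..<n} (vfun (ut n)) = 1" "nsq {..<m n} (vfun (vt n)) = 1"
    by (rule *)+
qed

definition "cl n j = ip {..<n} (vfun (us n ! j)) (vfun (ut n))"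
definition "dl n j = ip {..<m n} (vfun (vs n ! j)) (vfun (vt n))"

text \<open>The stacked pair of singular vectors is an eigenvector of the perturbed dilation at a
  value tending to \<rho>. The denominator of the general limits is minus the derivative of D at
  \<rho>, by the product rule.\<close>

lemma overlaps:
  shows "j < r \<Longrightarrow> \<theta> j \<noteq> \<theta> i0 \<Longrightarrow> (\<lambda>n. cl n j) \<longlonglongrightarrow> 0"
    and "j < r \<Longrightarrow> \<theta> j \<noteq> \<theta> i0 \<Longrightarrow> (\<lambda>n. dl n j) \<longlonglongrightarrow> 0"
    and "(\<lambda>n. \<Sum>j | j < r \<and> \<theta> j = \<theta> i0. (norm (cl n j))\<^sup>2) \<longlonglongrightarrow> - 2 * \<phi> \<mu> \<rho> / ((\<theta> i0)\<^sup>2 * deriv (D_transform c \<mu>) \<rho>)"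
    and "(\<lambda>n. \<Sum>j | j < r \<and> \<theta> j = \<theta> i0. (norm (dl n j))\<^sup>2) \<longlonglongrightarrow> - 2 * \<phi> (mix_dirac0 c \<mu>) \<rho> / ((\<theta> i0)\<^sup>2 * deriv (D_transform c \<mu>) \<rho>)"
    and "j < r \<Longrightarrow> \<theta> j = \<theta> i0 \<Longrightarrow> (\<lambda>n. of_real (\<phi> \<mu> \<rho> * \<theta> j) * dl n j - cl n j) \<longlonglongrightarrow> 0"
proof -
  \<comment> \<open>Zero for small n, where \<open>ut\<close> and \<open>vt\<close> are
    unrestricted, so that the norm bound holds for every n.\<close>
  define x where "x n = (if n > i0 then case_sum (vfun (ut n)) (vfun (vt n)) else (\<lambda>_. 0))" for n
  let ?I = "\<lambda>n. idx n (m n)" and ?W = "\<lambda>n. spike_fun (us n) (vs n)"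
  have xs: "x n = case_sum (vfun (ut n)) (vfun (vt n))" if "n \<ge> Suc i0" for n using that by (simp add: x_def)
  have cd: "cl n j = ip (?I n) (?W n (Inl j)) (x n)" "dl n j = ip (?I n) (?W n (Inr j)) (x n)" if "n \<ge> Suc i0" for n j
    by (simp_all add: xs[OF that] ip_inlv cl_def dl_def)
  have x2: "nsq (?I n) (x n) = 2" if "n \<ge> Suc i0" for n
    using uv_facts[OF that] by (simp add: xs[OF that] nsq_idx)
  have x2': "nsq (?I n) (x n) \<le> 2" for n
    using x2[of n] by (cases "n \<ge> Suc i0") (auto simp: x_def nsq_def)
  define Ga Gb Fa Fb where "Ga = stieltjes2 law.L1 \<rho>" and "Gb = stieltjes2 law.L2 \<rho>" and "Fa = stieltjes law.L1 \<rho>" and "Fb = stieltjes law.L2 \<rho>"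
  have pos: "0 < Fa" "0 < Fb" "0 < Ga" "0 < Gb" using stieltjes_L_pos[OF \<rho>(1)] by (simp_all add: Ga_def Gb_def Fa_def Fb_def)
  have FF: "(\<theta> i0)\<^sup>2 * Fa * Fb = 1"
    using law.D_eq[OF \<rho>(1)] \<rho>(2) \<theta>_pos[OF i0] by (simp add: Fa_def Fb_def field_simps)
  have ev: "\<forall>\<^sub>F n in sequentially. n \<ge> Suc i0" by (rule eventually_ge_at_top)
  have eq: "\<forall>\<^sub>F n in sequentially. \<forall>i\<in>?I n. of_real (singular_values (Xt n) ! i0) * x n i = res.T n (x n) i +
      (\<Sum>j<r. of_real (\<theta> j) * (ip (?I n) (?W n (Inr j)) (x n) * ?W n (Inl j) i + ip (?I n) (?W n (Inl j)) (x n) * ?W n (Inr j) i))"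
    using ev
  proof eventually_elim
    case (elim n)
    have n1: "n \<ge> 1" and n2: "n > i0" using elim by simp_all
    show ?case
    proof
      fix i assume i: "i \<in> ?I n"
      have "of_real (singular_values (Xt n) ! i0) * x n i = app (?I n) (dil (entries (Xt n))) (x n) i"
        unfolding xs[OF elim] by (rule singular_vector_pair_dil(1)[OF Xt_dim[OF n1] pair[OF n2] i])
      then show "of_real (singular_values (Xt n) ! i0) * x n i = res.T n (x n) i +
        (\<Sum>j<r. of_real (\<theta> j) * (ip (?I n) (?W n (Inr j)) (x n) * ?W n (Inl j) i + ip (?I n) (?W n (Inl j)) (x n) * ?W n (Inr j) i))"
        unfolding app_dil_perturbation[OF X_dim[OF n1] i] .
    qed
  qed
  have ev2: "\<forall>\<^sub>F n in sequentially. nsq (?I n) (x n) = 2" using ev by eventually_elim (rule x2)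
  have FG: "res.F (Inl i) \<rho> = Fa" "res.G (Inl i) \<rho> = Ga" "res.F (Inr i) \<rho> = Fb" "res.G (Inr i) \<rho> = Gb" for i
    by (simp_all only: F_eq Ga_def Gb_def Fa_def Fb_def)
  note out = sp.outlier_vector_asymptotics[OF outlier_tendsto[OF i0 \<rho>] \<rho>(1) eq x2' ev2 FG(1) FG(2) FG(3) FG(4) pos i0 FF]
  \<comment> \<open>Transfers the limit of any expression h in the overlaps of x to
    \<open>cl\<close> and \<open>dl\<close>, which agree with them for large n.\<close>
  have tr: "(\<lambda>n. h n (\<lambda>j. cl n j) (\<lambda>j. dl n j)) \<longlonglongrightarrow> l"
    if "(\<lambda>n. h n (\<lambda>j. ip (?I n) (?W n (Inl j)) (x n)) (\<lambda>j. ip (?I n) (?W n (Inr j)) (x n))) \<longlonglongrightarrow> l"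
    for h :: "nat \<Rightarrow> (nat \<Rightarrow> complex) \<Rightarrow> (nat \<Rightarrow> complex) \<Rightarrow> 'z :: topological_space" and l
    by (rule Lim_transform_eventually[OF that]) (use ev in eventually_elim, simp add: cd)
  have D: "deriv (D_transform c \<mu>) \<rho> = - (Ga * Fb + Gb * Fa)"
    using DERIV_imp_deriv[OF law.DERIV_D(1)[OF \<rho>(1)]] by (simp add: law.D'_def Ga_def Gb_def Fa_def Fb_def)
  have ph: "\<phi> \<mu> \<rho> = Fa" "\<phi> (mix_dirac0 c \<mu>) \<rho> = Fb"
    using law.phi_eq[OF \<rho>(1)] law.phi_mix[OF \<rho>(1)] law.stieltjes_L2[OF \<rho>(1)] by (simp_all add: Fa_def Fb_def)
  have val: "- 2 * f / ((\<theta> i0)\<^sup>2 * deriv (D_transform c \<mu>) \<rho>) = 2 * f / ((\<theta> i0)\<^sup>2 * (Ga * Fb + Gb * Fa))" for f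
  proof -
    have "- 2 * f = - (2 * f)" by simp
    then show ?thesis unfolding D mult_minus_right by (simp only: minus_divide_divide)
  qed
  show "(\<lambda>n. cl n j) \<longlonglongrightarrow> 0" if "j < r" "\<theta> j \<noteq> \<theta> i0" for j
    using tr[of "\<lambda>n e f. e j"] out(1)[OF that] by simp
  show "(\<lambda>n. dl n j) \<longlonglongrightarrow> 0" if "j < r" "\<theta> j \<noteq> \<theta> i0" for j
    using tr[of "\<lambda>n e f. f j"] out(2)[OF that] by simp
  show "(\<lambda>n. \<Sum>j | j < r \<and> \<theta> j = \<theta> i0. (norm (cl n j))\<^sup>2) \<longlonglongrightarrow> - 2 * \<phi> \<mu> \<rho> / ((\<theta> i0)\<^sup>2 * deriv (D_transform c \<mu>) \<rho>)"
    unfolding val unfolding ph by (rule tr[of "\<lambda>n e f. \<Sum>j | j < r \<and> \<theta> j = \<theta> i0. (norm (e j))\<^sup>2"]) (rule out(3))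
  show "(\<lambda>n. \<Sum>j | j < r \<and> \<theta> j = \<theta> i0. (norm (dl n j))\<^sup>2) \<longlonglongrightarrow> - 2 * \<phi> (mix_dirac0 c \<mu>) \<rho> / ((\<theta> i0)\<^sup>2 * deriv (D_transform c \<mu>) \<rho>)"
    unfolding val unfolding ph by (rule tr[of "\<lambda>n e f. \<Sum>j | j < r \<and> \<theta> j = \<theta> i0. (norm (f j))\<^sup>2"]) (rule out(4))
  show "(\<lambda>n. of_real (\<phi> \<mu> \<rho> * \<theta> j) * dl n j - cl n j) \<longlonglongrightarrow> 0" if "j < r" "\<theta> j = \<theta> i0" for j
    unfolding ph by (rule tr[of "\<lambda>n e f. of_real (Fa * \<theta> j) * f j - e j"]) (rule out(5)[OF that])
qed

lemma left_projection:
  assumes J: "J \<subseteq> {..<r}" and l: "(\<lambda>n. \<Sum>j\<in>J. (norm (cl n j))\<^sup>2) \<longlonglongrightarrow> l"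
  shows "(\<lambda>n. (proj_norm (ut n) (vec_span n ((\<lambda>i. us n ! i) ` J)))\<^sup>2) \<longlonglongrightarrow> l"
proof (rule proj_norm_asymptotics[where lo = "Suc i0" and K = 1])
  show "finite J" using J by (rule finite_subset) simp
  show "us n ! j \<in> carrier_vec n" if "n \<ge> Suc i0" "j \<in> J" for n j using us_dim[of n j] that J by auto
  show "ut n \<in> carrier_vec n" if "n \<ge> Suc i0" for n using uv_facts(1)[OF that] .
  show "(\<lambda>n. ip {..<n} (vfun (us n ! j)) (vfun (us n ! k))) \<longlonglongrightarrow> (if j = k then 1 else 0)" if "j \<in> J" "k \<in> J" for j k
    by (rule gram_tendsto) (use that J in auto)
  show "\<forall>\<^sub>F n in sequentially. nsq {..<n} (vfun (ut n)) \<le> 1"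
    using eventually_ge_at_top[of "Suc i0"] by eventually_elim (simp add: uv_facts)
  show "(\<lambda>n. \<Sum>j\<in>J. (norm (ip {..<n} (vfun (us n ! j)) (vfun (ut n))))\<^sup>2) \<longlonglongrightarrow> l" using l by (simp only: cl_def)
qed

lemma right_projection:
  assumes J: "J \<subseteq> {..<r}" and l: "(\<lambda>n. \<Sum>j\<in>J. (norm (dl n j))\<^sup>2) \<longlonglongrightarrow> l"
  shows "(\<lambda>n. (proj_norm (vt n) (vec_span (m n) ((\<lambda>i. vs n ! i) ` J)))\<^sup>2) \<longlonglongrightarrow> l"
proof (rule proj_norm_asymptotics[where lo = "Suc i0" and K = 1])
  show "finite J" using J by (rule finite_subset) simp
  show "vs n ! j \<in> carrier_vec (m n)" if "n \<ge> Suc i0" "j \<in> J" for n j using vs_dim[of n j] that J by auto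
  show "vt n \<in> carrier_vec (m n)" if "n \<ge> Suc i0" for n using uv_facts(2)[OF that] .
  show "(\<lambda>n. ip {..<m n} (vfun (vs n ! j)) (vfun (vs n ! k))) \<longlonglongrightarrow> (if j = k then 1 else 0)" if "j \<in> J" "k \<in> J" for j k
    by (rule gram_tendsto) (use that J in auto)
  show "\<forall>\<^sub>F n in sequentially. nsq {..<m n} (vfun (vt n)) \<le> 1"
    using eventually_ge_at_top[of "Suc i0"] by eventually_elim (simp add: uv_facts)
  show "(\<lambda>n. \<Sum>j\<in>J. (norm (ip {..<m n} (vfun (vs n ! j)) (vfun (vt n))))\<^sup>2) \<longlonglongrightarrow> l" using l by (simp only: dl_def)
qed

lemma norm_dl_le: "n \<ge> Suc i0 \<Longrightarrow> norm (dl n j) \<le> sqrt (nsq {..<m n} (vfun (vs n ! j)))"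
  using norm_ip_le[of "{..<m n}" "vfun (vs n ! j)" "vfun (vt n)"] uv_facts(4)[of n] by (simp add: dl_def)

abbreviation "residual n \<equiv> of_real (\<phi> \<mu> \<rho>) \<cdot>\<^sub>v (perturbation n (m n) r \<theta> (us n) (vs n) *\<^sub>v vt n) - ut n"

lemma residual_entry:
  assumes n: "n \<ge> Suc i0" and k: "k < n"
  shows "residual n \<in> carrier_vec n" "vfun (residual n) k =
    (\<Sum>i<r. of_real (\<phi> \<mu> \<rho> * \<theta> i) * dl n i * vfun (us n ! i) k) - vfun (ut n) k"
proof -
  let ?P = "perturbation n (m n) r \<theta> (us n) (vs n)"
  have P: "?P \<in> carrier_mat n (m n)" by (simp add: perturbation_def)
  have u: "ut n \<in> carrier_vec n" and v: "vt n \<in> carrier_vec (m n)" using uv_facts[OF n] by auto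
  have Pv: "?P *\<^sub>v vt n \<in> carrier_vec n" using P v by auto
  show "residual n \<in> carrier_vec n" using Pv u by simp
  have "vfun (?P *\<^sub>v vt n) k = (\<Sum>l<m n. (\<Sum>i<r. of_real (\<theta> i) * vfun (us n ! i) k * cnj (vfun (vs n ! i) l)) * vfun (vt n) l)"
    unfolding vfun_mult_mat_vec[OF P v k] app_def by (intro sum.cong refl) (simp add: entries_def perturbation_def vfun_def k)
  also have "\<dots> = (\<Sum>l<m n. \<Sum>i<r. of_real (\<theta> i) * vfun (us n ! i) k * (cnj (vfun (vs n ! i) l) * vfun (vt n) l))"
    by (simp only: sum_distrib_right mult.assoc)
  also have "\<dots> = (\<Sum>i<r. of_real (\<theta> i) * vfun (us n ! i) k * dl n i)"
    unfolding dl_def ip_def sum_distrib_left by (rule sum.swap)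
  finally have e: "vfun (?P *\<^sub>v vt n) k = (\<Sum>i<r. of_real (\<theta> i) * vfun (us n ! i) k * dl n i)" .
  have d: "dim_vec (of_real (\<phi> \<mu> \<rho>) \<cdot>\<^sub>v (?P *\<^sub>v vt n)) = n" "dim_vec (?P *\<^sub>v vt n) = n" "dim_vec (ut n) = n"
    using Pv u by (simp_all only: index_smult_vec carrier_vecD)
  have "vfun (residual n) k = vfun (of_real (\<phi> \<mu> \<rho>) \<cdot>\<^sub>v (?P *\<^sub>v vt n)) k - vfun (ut n) k"
    by (rule vfun_simps(2)[OF d(1,3) k])
  also have "vfun (of_real (\<phi> \<mu> \<rho>) \<cdot>\<^sub>v (?P *\<^sub>v vt n)) k = of_real (\<phi> \<mu> \<rho>) * vfun (?P *\<^sub>v vt n) k"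
    by (subst vfun_simps(3)[OF d(2) k]) (simp only: to_complex_simps)
  also have "of_real (\<phi> \<mu> \<rho>) * vfun (?P *\<^sub>v vt n) k = (\<Sum>i<r. of_real (\<phi> \<mu> \<rho> * \<theta> i) * dl n i * vfun (us n ! i) k)"
    unfolding e sum_distrib_left of_real_mult by (intro sum.cong refl) (simp only: mult.assoc mult.commute mult.left_commute)
  finally show "vfun (residual n) k = (\<Sum>i<r. of_real (\<phi> \<mu> \<rho> * \<theta> i) * dl n i * vfun (us n ! i) k) - vfun (ut n) k" .
qed

text \<open>If the spikes were orthonormal the overlap would be
  \<open>\<phi> \<mu> \<rho> * \<theta> j * dl n j - cl n j\<close>, which tends to 0. The deviation
  consists of Gram matrix errors multiplied by bounded overlaps.\<close>

lemma residual_overlap: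
  assumes j: "j < r" "\<theta> j = \<theta> i0"
  shows "(\<lambda>n. ip {..<n} (vfun (us n ! j)) (vfun (residual n))) \<longlonglongrightarrow> 0"
proof -
  let ?d = "\<lambda>i. if j = i then 1 else (0 :: complex)"
  have t: "(\<lambda>n. of_real (\<phi> \<mu> \<rho> * \<theta> i) * (dl n i * (ip {..<n} (vfun (us n ! j)) (vfun (us n ! i)) - ?d i))) \<longlonglongrightarrow> 0" if i: "i < r" for i
  proof (rule tendsto_mult_right_zero, rule Lim_null_comparison[rotated])
    have g: "(\<lambda>n. ip {..<n} (vfun (us n ! j)) (vfun (us n ! i)) - ?d i) \<longlonglongrightarrow> 0"
      using tendsto_diff[OF gram_tendsto(1)[OF j(1) i] tendsto_const[of "?d i"]] by simp
    show "(\<lambda>n. sqrt (nsq {..<m n} (vfun (vs n ! i))) * norm (ip {..<n} (vfun (us n ! j)) (vfun (us n ! i)) - ?d i)) \<longlonglongrightarrow> 0"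
      using tendsto_mult[OF nsq_spike_tendsto(2)[OF i] tendsto_norm[OF g]] by simp
    show "\<forall>\<^sub>F n in sequentially. norm (dl n i * (ip {..<n} (vfun (us n ! j)) (vfun (us n ! i)) - ?d i))
      \<le> sqrt (nsq {..<m n} (vfun (vs n ! i))) * norm (ip {..<n} (vfun (us n ! j)) (vfun (us n ! i)) - ?d i)"
      using eventually_ge_at_top[of "Suc i0"]
      by eventually_elim (simp only: norm_mult, rule mult_right_mono, rule norm_dl_le, simp_all)
  qed
  have "(\<lambda>n. (\<Sum>i<r. of_real (\<phi> \<mu> \<rho> * \<theta> i) * (dl n i * (ip {..<n} (vfun (us n ! j)) (vfun (us n ! i)) - ?d i)))
      + (of_real (\<phi> \<mu> \<rho> * \<theta> j) * dl n j - cl n j)) \<longlonglongrightarrow> 0 + 0"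
    by (intro tendsto_add tendsto_null_sum overlaps(5)[OF j] t) simp
  moreover have "\<forall>\<^sub>F n in sequentially. (\<Sum>i<r. of_real (\<phi> \<mu> \<rho> * \<theta> i) * (dl n i * (ip {..<n} (vfun (us n ! j)) (vfun (us n ! i)) - ?d i)))
      + (of_real (\<phi> \<mu> \<rho> * \<theta> j) * dl n j - cl n j) = ip {..<n} (vfun (us n ! j)) (vfun (residual n))"
    using eventually_ge_at_top[of "Suc i0"]
  proof eventually_elim
    case (elim n)
    have "ip {..<n} (vfun (us n ! j)) (vfun (residual n)) =
      ip {..<n} (vfun (us n ! j)) (\<lambda>k. (\<Sum>i<r. of_real (\<phi> \<mu> \<rho> * \<theta> i) * dl n i * vfun (us n ! i) k) - vfun (ut n) k)"
      by (intro ip_cong refl residual_entry(2)[OF elim]) simp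
    also have "\<dots> = (\<Sum>i<r. of_real (\<phi> \<mu> \<rho> * \<theta> i) * dl n i * ip {..<n} (vfun (us n ! j)) (vfun (us n ! i))) - cl n j"
      by (simp only: ip_diff_right ip_sum_right ip_scale_right cl_def)
    also have "(\<Sum>i<r. of_real (\<phi> \<mu> \<rho> * \<theta> i) * dl n i * ip {..<n} (vfun (us n ! j)) (vfun (us n ! i))) =
      (\<Sum>i<r. of_real (\<phi> \<mu> \<rho> * \<theta> i) * (dl n i * (ip {..<n} (vfun (us n ! j)) (vfun (us n ! i)) - ?d i)) + of_real (\<phi> \<mu> \<rho> * \<theta> i) * dl n i * ?d i)"
      by (intro sum.cong refl) (simp add: algebra_simps)
    also have "\<dots> = (\<Sum>i<r. of_real (\<phi> \<mu> \<rho> * \<theta> i) * (dl n i * (ip {..<n} (vfun (us n ! j)) (vfun (us n ! i)) - ?d i))) + of_real (\<phi> \<mu> \<rho> * \<theta> j) * dl n j"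
      unfolding sum.distrib using j(1) by (simp add: if_distrib[of "\<lambda>t. _ * t"] sum.delta' cong: if_cong)
    finally show ?case by simp
  qed
  ultimately show ?thesis using Lim_transform_eventually by fastforce
qed

text \<open>Supplies the norm bound that the projection asymptotics ask for, the residual not being
  a unit vector.\<close>

lemma residual_bounded: "\<exists>K. \<forall>\<^sub>F n in sequentially. nsq {..<n} (vfun (residual n)) \<le> K"
proof -
  define B where "B n = (\<Sum>i<r. \<bar>\<phi> \<mu> \<rho> * \<theta> i\<bar> * sqrt (nsq {..<m n} (vfun (vs n ! i))) * sqrt (nsq {..<n} (vfun (us n ! i)))) + 1" for n
  have "B \<longlonglongrightarrow> (\<Sum>i<r. \<bar>\<phi> \<mu> \<rho> * \<theta> i\<bar> * 1 * 1) + 1"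
    unfolding B_def[abs_def] by (intro tendsto_add tendsto_sum tendsto_mult tendsto_const nsq_spike_tendsto) simp_all
  then have "\<forall>\<^sub>F n in sequentially. B n < (\<Sum>i<r. \<bar>\<phi> \<mu> \<rho> * \<theta> i\<bar> * 1 * 1) + 2" by (rule order_tendstoD) simp
  then have "\<forall>\<^sub>F n in sequentially. nsq {..<n} (vfun (residual n)) \<le> ((\<Sum>i<r. \<bar>\<phi> \<mu> \<rho> * \<theta> i\<bar> * 1 * 1) + 2)\<^sup>2"
    using eventually_ge_at_top[of "Suc i0"]
  proof eventually_elim
    case (elim n)
    have "nsq {..<n} (vfun (residual n)) = nsq {..<n} (\<lambda>k. (\<Sum>i<r. (of_real (\<phi> \<mu> \<rho> * \<theta> i) * dl n i) * vfun (us n ! i) k) + (- 1) * vfun (ut n) k)"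
      by (intro nsq_cong) (simp add: residual_entry(2)[OF elim(2)])
    then have "sqrt (nsq {..<n} (vfun (residual n))) \<le>
      sqrt (nsq {..<n} (\<lambda>k. \<Sum>i<r. (of_real (\<phi> \<mu> \<rho> * \<theta> i) * dl n i) * vfun (us n ! i) k)) + sqrt (nsq {..<n} (\<lambda>k. (- 1) * vfun (ut n) k))"
      by (simp only: sqrt_nsq_triangle)
    also have "sqrt (nsq {..<n} (\<lambda>k. (- 1) * vfun (ut n) k)) = 1"
      unfolding sqrt_nsq_scale using uv_facts(3)[OF elim(2)] by simp
    also have "sqrt (nsq {..<n} (\<lambda>k. \<Sum>i<r. (of_real (\<phi> \<mu> \<rho> * \<theta> i) * dl n i) * vfun (us n ! i) k)) \<le>
      (\<Sum>i<r. sqrt (nsq {..<n} (\<lambda>k. (of_real (\<phi> \<mu> \<rho> * \<theta> i) * dl n i) * vfun (us n ! i) k)))"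
      by (rule sqrt_nsq_sum_le) simp
    also have "\<dots> \<le> (\<Sum>i<r. \<bar>\<phi> \<mu> \<rho> * \<theta> i\<bar> * sqrt (nsq {..<m n} (vfun (vs n ! i))) * sqrt (nsq {..<n} (vfun (us n ! i))))"
      unfolding sqrt_nsq_scale norm_mult norm_of_real abs_mult
      by (intro sum_mono mult_right_mono mult_left_mono norm_dl_le[OF elim(2)]) auto
    finally have "sqrt (nsq {..<n} (vfun (residual n))) \<le> (\<Sum>i<r. \<bar>\<phi> \<mu> \<rho> * \<theta> i\<bar> * 1 * 1) + 2"
      using elim(1) by (simp add: B_def)
    from power_mono[OF this, of 2] show ?case by simp
  qed
  then show ?thesis by blast
qed

theorem spiked_path_limits:
  defines "J \<equiv> {i. i < r \<and> \<theta> i = \<theta> i0}" and "J' \<equiv> {i. i < r \<and> \<theta> i \<noteq> \<theta> i0}"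
  shows "(\<lambda>n. (proj_norm (ut n) (vec_span n ((\<lambda>i. us n ! i) ` J)))\<^sup>2)
        \<longlonglongrightarrow> - 2 * \<phi> \<mu> \<rho> / ((\<theta> i0)\<^sup>2 * deriv (D_transform c \<mu>) \<rho>)"
    "(\<lambda>n. (proj_norm (vt n) (vec_span (m n) ((\<lambda>i. vs n ! i) ` J)))\<^sup>2)
        \<longlonglongrightarrow> - 2 * \<phi> (mix_dirac0 c \<mu>) \<rho> / ((\<theta> i0)\<^sup>2 * deriv (D_transform c \<mu>) \<rho>)"
    "(\<lambda>n. (proj_norm (ut n) (vec_span n ((\<lambda>i. us n ! i) ` J')))\<^sup>2) \<longlonglongrightarrow> 0"
    "(\<lambda>n. (proj_norm (vt n) (vec_span (m n) ((\<lambda>i. vs n ! i) ` J')))\<^sup>2) \<longlonglongrightarrow> 0"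
    "(\<lambda>n. proj_norm (residual n) (vec_span n ((\<lambda>i. us n ! i) ` J))) \<longlonglongrightarrow> 0"
proof -
  have J: "J \<subseteq> {..<r}" "J' \<subseteq> {..<r}" by (auto simp: J_def J'_def)
  show "(\<lambda>n. (proj_norm (ut n) (vec_span n ((\<lambda>i. us n ! i) ` J)))\<^sup>2)
        \<longlonglongrightarrow> - 2 * \<phi> \<mu> \<rho> / ((\<theta> i0)\<^sup>2 * deriv (D_transform c \<mu>) \<rho>)"
    by (rule left_projection[OF J(1)]) (use overlaps(3) in \<open>simp only: J_def\<close>)
  show "(\<lambda>n. (proj_norm (vt n) (vec_span (m n) ((\<lambda>i. vs n ! i) ` J)))\<^sup>2)
        \<longlonglongrightarrow> - 2 * \<phi> (mix_dirac0 c \<mu>) \<rho> / ((\<theta> i0)\<^sup>2 * deriv (D_transform c \<mu>) \<rho>)"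
    by (rule right_projection[OF J(1)]) (use overlaps(4) in \<open>simp only: J_def\<close>)
  have sq: "(\<lambda>n. \<Sum>j\<in>K. (norm (f n j))\<^sup>2) \<longlonglongrightarrow> 0" if "\<And>j. j \<in> K \<Longrightarrow> (\<lambda>n. f n j) \<longlonglongrightarrow> 0" for K :: "nat set" and f :: "nat \<Rightarrow> nat \<Rightarrow> complex"
    by (intro tendsto_null_sum) (use tendsto_power[OF tendsto_norm_zero[OF that], of _ 2] in simp)
  show "(\<lambda>n. (proj_norm (ut n) (vec_span n ((\<lambda>i. us n ! i) ` J')))\<^sup>2) \<longlonglongrightarrow> 0"
    by (rule left_projection[OF J(2) sq]) (use overlaps(1) in \<open>auto simp: J'_def\<close>)
  show "(\<lambda>n. (proj_norm (vt n) (vec_span (m n) ((\<lambda>i. vs n ! i) ` J')))\<^sup>2) \<longlonglongrightarrow> 0"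
    by (rule right_projection[OF J(2) sq]) (use overlaps(2) in \<open>auto simp: J'_def\<close>)
  obtain K where K: "\<forall>\<^sub>F n in sequentially. nsq {..<n} (vfun (residual n)) \<le> K" using residual_bounded by (rule exE)
  have "(\<lambda>n. (proj_norm (residual n) (vec_span n ((\<lambda>i. us n ! i) ` J)))\<^sup>2) \<longlonglongrightarrow> 0"
  proof (rule proj_norm_asymptotics[where lo = "Suc i0", OF _ _ _ _ K])
    show "finite J" using J(1) by (rule finite_subset) simp
    show "us n ! j \<in> carrier_vec n" if "n \<ge> Suc i0" "j \<in> J" for n j using us_dim[of n j] that J by auto
    show "residual n \<in> carrier_vec n" if "n \<ge> Suc i0" for n using residual_entry(1)[OF that, of 0] that by simp
    show "(\<lambda>n. ip {..<n} (vfun (us n ! j)) (vfun (us n ! k))) \<longlonglongrightarrow> (if j = k then 1 else 0)" if "j \<in> J" "k \<in> J" for j k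
      by (rule gram_tendsto) (use that J in auto)
    show "(\<lambda>n. \<Sum>j\<in>J. (norm (ip {..<n} (vfun (us n ! j)) (vfun (residual n))))\<^sup>2) \<longlonglongrightarrow> 0"
      by (rule sq) (rule residual_overlap, auto simp: J_def)
  qed
  \<comment> \<open>The claim about the residual concerns the norm and not its square.\<close>
  from tendsto_real_sqrt[OF this] show "(\<lambda>n. proj_norm (residual n) (vec_span n ((\<lambda>i. us n ! i) ` J))) \<longlonglongrightarrow> 0"
    by (simp add: proj_norm_def l2_norm_def)
qed

end

end

section \<open>Orthonormalized columns\<close>

lemma orthonormalized_columns_nth:
  fixes G :: "'a :: rc_field mat"
  assumes G: "G \<in> carrier_mat d r" and i: "i < r"
  shows "orthonormalized_columns G ! i \<in> carrier_vec d"
    "k < d \<Longrightarrow> vfun (orthonormalized_columns G ! i) k =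
      of_real (1 / sqrt (nsq {..<d} (vfun (gram_schmidt d (cols G) ! i)))) * vfun (gram_schmidt d (cols G) ! i) k"
proof -
  have c: "set (cols G) \<subseteq> carrier_vec d" "i < length (cols G)" using G i cols_dim[of G] by auto
  note gs = gram_schmidt_recursion[OF c]
  have e: "orthonormalized_columns G ! i = of_real (1 / l2_norm (gram_schmidt d (cols G) ! i)) \<cdot>\<^sub>v gram_schmidt d (cols G) ! i"
    using G c gs(2) by (simp add: orthonormalized_columns_def)
  show "orthonormalized_columns G ! i \<in> carrier_vec d" unfolding e using gs(1) by simp
  have dim: "dim_vec (gram_schmidt d (cols G) ! i) = d" using gs(1) by simp
  show "vfun (orthonormalized_columns G ! i) k =
      of_real (1 / sqrt (nsq {..<d} (vfun (gram_schmidt d (cols G) ! i)))) * vfun (gram_schmidt d (cols G) ! i) k" if "k < d"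
    unfolding e vfun_simps(3)[OF dim that] l2_norm_eq[OF dim] to_complex_simps ..
qed

text \<open>Gram-Schmidt commutes with a common scaling of its input, and the final normalization
  removes a positive factor. So the orthonormalized columns of G are those of the scaled columns,
  which are almost orthonormal.\<close>

lemma orthonormalized_columns_close:
  fixes G :: "nat \<Rightarrow> 'a :: rc_field mat"
  assumes G: "\<And>n. n \<ge> 1 \<Longrightarrow> G n \<in> carrier_mat (d n) r" and d: "\<And>n. n \<ge> 1 \<Longrightarrow> d n \<ge> 1"
    and gram: "\<And>i j. i < r \<Longrightarrow> j < r \<Longrightarrow>
      (\<lambda>n. ip {..<d n} (vfun (scaled_columns (G n) ! i)) (vfun (scaled_columns (G n) ! j))) \<longlonglongrightarrow> (if i = j then 1 else 0)"
    and i: "i < r"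
  shows "(\<lambda>n. nsq {..<d n} (\<lambda>k. vfun (orthonormalized_columns (G n) ! i) k - vfun (scaled_columns (G n) ! i) k)) \<longlonglongrightarrow> 0"
proof -
  define s where "s n = complex_of_real (1 / sqrt (real (d n)))" for n
  define w where "w n j = (\<lambda>k. s n * vfun (gram_schmidt (d n) (cols (G n)) ! j) k)" for n j
  define g where "g n j = vfun (scaled_columns (G n) ! j)" for n j
  have s: "s n \<noteq> 0" "norm (s n) = 1 / sqrt (real (d n))" if "n \<ge> 1" for n
    using d[OF that] by (auto simp: s_def norm_divide)
  have g: "g n j k = s n * vfun (cols (G n) ! j) k" if "n \<ge> 1" "j < r" "k < d n" for n j k
    using G[OF that(1)] scaled_columns_nth(2)[OF G[OF that(1)] that(2,3)] that by (simp add: g_def s_def vfun_def)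
  have rec: "w n j k = g n j k - (\<Sum>l<j. ip {..<d n} (w n l) (g n j) / ip {..<d n} (w n l) (w n l) * w n l k)"
    if n: "n \<ge> 1" and j: "j < r" and k: "k \<in> {..<d n}" for n j k
  proof -
    let ?W = "\<lambda>l. vfun (gram_schmidt (d n) (cols (G n)) ! l)" and ?I = "{..<d n}" and ?h = "vfun (cols (G n) ! j)"
    have c: "set (cols (G n)) \<subseteq> carrier_vec (d n)" "j < length (cols (G n))" using G[OF n] j cols_dim[of "G n"] by auto
    have wg: "ip ?I (w n l) (g n j) = cnj (s n) * s n * ip ?I (?W l) ?h" for l
    proof -
      have "ip ?I (w n l) (g n j) = ip ?I (\<lambda>k. s n * ?W l k) (\<lambda>k. s n * ?h k)"
        by (rule ip_cong) (simp_all only: w_def lessThan_iff g[OF n j])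
      then show ?thesis by (simp only: ip_scale_left ip_scale_right mult.assoc)
    qed
    have ww: "ip ?I (w n l) (w n l) = cnj (s n) * s n * ip ?I (?W l) (?W l)" for l
      unfolding w_def by (simp only: ip_scale_left ip_scale_right mult.assoc)
    \<comment> \<open>The common factor is nonzero and cancels, also over a zero denominator by the
      convention for division.\<close>
    have q: "ip ?I (w n l) (g n j) / ip ?I (w n l) (w n l) = ip ?I (?W l) ?h / ip ?I (?W l) (?W l)" for l
      unfolding wg ww by (rule mult_divide_mult_cancel_left) (use s(1)[OF n] in simp)
    have "w n j k = s n * (?h k - (\<Sum>l<j. ip ?I (?W l) ?h / ip ?I (?W l) (?W l) * ?W l k))"
      using gram_schmidt_recursion(3)[OF c, of k] k by (simp only: w_def lessThan_iff)
    also have "\<dots> = g n j k - (\<Sum>l<j. ip ?I (?W l) ?h / ip ?I (?W l) (?W l) * w n l k)"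
      using k by (simp add: g[OF n j] right_diff_distrib sum_distrib_left w_def mult.left_commute)
    finally show ?thesis by (simp only: q)
  qed
  have gg: "(\<lambda>n. ip {..<d n} (g n j) (g n k)) \<longlonglongrightarrow> (if j = k then 1 else 0)" if "j < r" "k < r" for j k
    unfolding g_def by (rule gram[OF that])
  have cl: "(\<lambda>n. nsq {..<d n} (\<lambda>k. w n i k - g n i k)) \<longlonglongrightarrow> 0" "(\<lambda>n. nsq {..<d n} (w n i)) \<longlonglongrightarrow> 1"
    by (rule gram_schmidt_close[OF gg rec i]; assumption)+
  have "(\<lambda>n. nsq {..<d n} (\<lambda>k. of_real (1 / sqrt (nsq {..<d n} (w n i))) * w n i k - g n i k)) \<longlonglongrightarrow> 0"
    using normalized_close[where I = "\<lambda>n. {..<d n}" and w = "\<lambda>n. w n i" and g = "\<lambda>n. g n i", OF cl] .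
  moreover have "\<forall>\<^sub>F n in sequentially. nsq {..<d n} (\<lambda>k. of_real (1 / sqrt (nsq {..<d n} (w n i))) * w n i k - g n i k) =
    nsq {..<d n} (\<lambda>k. vfun (orthonormalized_columns (G n) ! i) k - vfun (scaled_columns (G n) ! i) k)"
    using eventually_ge_at_top[of 1]
  proof eventually_elim
    case (elim n)
    let ?W = "vfun (gram_schmidt (d n) (cols (G n)) ! i)"
    have "sqrt (nsq {..<d n} (w n i)) = 1 / sqrt (real (d n)) * sqrt (nsq {..<d n} ?W)"
      unfolding w_def sqrt_nsq_scale s(2)[OF elim] ..
    then have "of_real (1 / sqrt (nsq {..<d n} (w n i))) * w n i k = of_real (1 / sqrt (nsq {..<d n} ?W)) * ?W k" for k
      using d[OF elim] by (simp add: w_def s_def)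
    then show ?case by (intro nsq_cong) (simp add: g_def orthonormalized_columns_nth(2)[OF G[OF elim] i])
  qed
  ultimately show ?thesis by (rule Lim_transform_eventually)
qed

lemma spiked_path_orthonormalized:
  fixes X :: "nat \<Rightarrow> 'a :: rc_field mat"
  assumes sp: "spiked_path m X (\<lambda>n. scaled_columns (Gu n)) (\<lambda>n. scaled_columns (Gv n)) r \<theta> \<mu> c"
    and m: "\<And>n. n \<ge> 1 \<Longrightarrow> n \<le> m n"
    and Gu: "\<And>n. n \<ge> 1 \<Longrightarrow> Gu n \<in> carrier_mat n r" and Gv: "\<And>n. n \<ge> 1 \<Longrightarrow> Gv n \<in> carrier_mat (m n) r"
  shows "spiked_path m X (\<lambda>n. orthonormalized_columns (Gu n)) (\<lambda>n. orthonormalized_columns (Gv n)) r \<theta> \<mu> c"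
proof -
  interpret spiked_path m X "\<lambda>n. scaled_columns (Gu n)" "\<lambda>n. scaled_columns (Gv n)" r \<theta> \<mu> c by (rule sp)
  let ?a = "\<lambda>n. spike_fun (scaled_columns (Gu n)) (scaled_columns (Gv n))"
  let ?a' = "\<lambda>n. spike_fun (orthonormalized_columns (Gu n)) (orthonormalized_columns (Gv n))"
  have m1: "m n \<ge> 1" if "n \<ge> 1" for n using m[OF that] that by simp
  have cu: "(\<lambda>n. nsq {..<n} (\<lambda>k. vfun (orthonormalized_columns (Gu n) ! i) k - vfun (scaled_columns (Gu n) ! i) k)) \<longlonglongrightarrow> 0" if "i < r" for i
  proof (rule orthonormalized_columns_close[where d = "\<lambda>n. n" and r = r])
    show "Gu n \<in> carrier_mat n r" if "n \<ge> 1" for n by (rule Gu[OF that])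
  qed (rule gram_tendsto(1) that | assumption)+
  have cv: "(\<lambda>n. nsq {..<m n} (\<lambda>k. vfun (orthonormalized_columns (Gv n) ! i) k - vfun (scaled_columns (Gv n) ! i) k)) \<longlonglongrightarrow> 0" if "i < r" for i
  proof (rule orthonormalized_columns_close[where d = m and r = r])
    show "Gv n \<in> carrier_mat (m n) r" if "n \<ge> 1" for n by (rule Gv[OF that])
  qed (rule gram_tendsto(2) m1 that | assumption)+
  have close: "(\<lambda>n. nsq (idx n (m n)) (\<lambda>i. ?a' n s i - ?a n s i)) \<longlonglongrightarrow> 0" if s: "s \<in> idx r r" for s
  proof (cases s)
    case (Inl i)
    then have "i < r" using s by auto
    from cu[OF this] show ?thesis by (simp add: nsq_def sum_idx Inl)
  next
    case (Inr i)
    then have "i < r" using s by auto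
    from cv[OF this] show ?thesis by (simp add: nsq_def sum_idx Inr)
  qed
  have n1: "(\<lambda>n. nsq (idx n (m n)) (?a n s)) \<longlonglongrightarrow> 1" if s: "s \<in> idx r r" for s
  proof (cases s)
    case (Inl i)
    then have "i < r" using s by auto
    from tendsto_power[OF nsq_spike_tendsto(1)[OF this], of 2] show ?thesis by (simp add: nsq_inlv Inl)
  next
    case (Inr i)
    then have "i < r" using s by auto
    from tendsto_power[OF nsq_spike_tendsto(2)[OF this], of 2] show ?thesis by (simp add: nsq_inlv Inr)
  qed
  have B: "b + 1 > b" "0 \<le> b + 1" using law.b0 by auto
  show ?thesis
  proof (rule spiked_path.intro)
    show "orthonormalized_columns (Gu n) ! i \<in> carrier_vec n" if "n \<ge> 1" "i < r" for n i
      using orthonormalized_columns_nth(1)[OF Gu that(2)] that(1) by simp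
    show "orthonormalized_columns (Gv n) ! i \<in> carrier_vec (m n)" if "n \<ge> 1" "i < r" for n i
      using orthonormalized_columns_nth(1)[OF Gv that(2)] that(1) by simp
    show "(\<lambda>n. ip (idx n (m n)) (?a' n s) ((app (idx n (m n)) (dil (entries (X n))) ^^ k) (?a' n t)))
      \<longlonglongrightarrow> (if s = t then of_real (spike_moment c (\<lambda>k. \<integral>t. t ^ k \<partial>\<mu>) s k) else 0)" if "s \<in> idx r r" "t \<in> idx r r" for s t k
      by (rule moment_limit_perturb[where I = "\<lambda>n. idx n (m n)" and H = "\<lambda>n. dil (entries (X n))"
            and a = "\<lambda>n. ?a n s" and a' = "\<lambda>n. ?a' n s" and b = "\<lambda>n. ?a n t" and b' = "\<lambda>n. ?a' n t" and A = 1 and A' = 1,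
          OF res.bound[OF B(1)] B(2) close[OF that(1)] n1[OF that(1)] close[OF that(2)] n1[OF that(2)] spike_moments[OF that]])
  qed (fact X_dim \<mu> c01 weak top \<theta>_pos \<theta>_decr)+
qed

section \<open>The law of the entries\<close>

lemma bounded_linear_to_complex: "bounded_linear to_complex"
  by (rule bounded_linear_intro[where K = 1]) (simp_all add: scaleR_conv_of_real)

text \<open>The embedding is a linear isometry, so means and absolute moments transfer; the
  logarithmic Sobolev inequality is applied to the original law.\<close>

lemma normalized_law_to_complex:
  fixes \<nu> :: "'a :: rc_field measure"
  assumes \<nu>: "prob_space \<nu>" "sets \<nu> = sets borel"
    and mean: "integrable \<nu> (\<lambda>x. x)" "(\<integral>x. x \<partial>\<nu>) = 0"
    and var: "integrable \<nu> (\<lambda>x. (norm x)\<^sup>2)" "(\<integral>x. (norm x)\<^sup>2 \<partial>\<nu>) = 1"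
    and lsi: "log_sobolev \<nu>"
  shows "normalized_law (distr \<nu> borel to_complex)"
proof -
  have m: "to_complex \<in> measurable \<nu> borel" using measurable_to_complex \<nu>(2) by (simp cong: measurable_cong_sets)
  have "integrable \<nu> (\<lambda>x. to_complex x)" by (rule integrable_bounded_linear[OF bounded_linear_to_complex mean(1)])
  moreover have "(\<integral>x. to_complex x \<partial>\<nu>) = 0"
    using integral_bounded_linear[OF bounded_linear_to_complex mean(1)] mean(2) by simp
  ultimately show ?thesis
    using prob_space.prob_space_distr[OF \<nu>(1) m] var log_sobolev_eighth_moment[OF \<nu> var(1) lsi]
    by (intro normalized_law.intro normalized_law_axioms.intro) (simp_all add: integrable_distr_eq[OF m] integral_distr[OF m])
qed

section \<open>Almost sure convergence\<close>

text \<open>For each n the joint law of \<open>X n\<close> and all entries of the two G's is a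
  product, with a power of the image of \<nu> as one factor; this is the input for the almost sure
  moment limits.\<close>

lemma scaled_columns_spiked_path_AE:
  fixes M :: "'w measure" and X :: "nat \<Rightarrow> 'w \<Rightarrow> 'a :: rc_field mat" and Gu Gv :: "nat \<Rightarrow> 'w \<Rightarrow> 'a mat"
  assumes prob: "prob_space M"
    and m_ge: "\<And>n. n \<ge> 1 \<Longrightarrow> n \<le> m n"
    and c01: "0 \<le> c" "c \<le> 1"
    and c_lim: "(\<lambda>n. real n / real (m n)) \<longlonglongrightarrow> c"
    and X_dim: "\<And>n \<omega>. n \<ge> 1 \<Longrightarrow> \<omega> \<in> space M \<Longrightarrow> X n \<omega> \<in> carrier_mat n (m n)"
    and X_meas: "\<And>n i j. n \<ge> 1 \<Longrightarrow> i < n \<Longrightarrow> j < m n \<Longrightarrow> (\<lambda>\<omega>. X n \<omega> $$ (i, j)) \<in> borel_measurable M"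
    and \<mu>X: "real_distribution \<mu>X" "compact (measure_support \<mu>X)"
    and X_weak: "AE \<omega> in M. weak_conv_m (\<lambda>n. sv_measure (X n \<omega>)) \<mu>X"
    and X_top: "AE \<omega> in M. (\<lambda>n. singular_values (X n \<omega>) ! 0) \<longlonglongrightarrow> sup_support \<mu>X"
    and \<nu>: "prob_space \<nu>" "sets \<nu> = sets borel"
    and \<nu>_mean: "integrable \<nu> (\<lambda>x. x)" "(\<integral>x. x \<partial>\<nu>) = 0"
    and \<nu>_var: "integrable \<nu> (\<lambda>x. (norm x)\<^sup>2)" "(\<integral>x. (norm x)\<^sup>2 \<partial>\<nu>) = 1"
    and \<nu>_lsi: "log_sobolev \<nu>"
    and Gu_dim: "\<And>n \<omega>. n \<ge> 1 \<Longrightarrow> \<omega> \<in> space M \<Longrightarrow> Gu n \<omega> \<in> carrier_mat n r"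
    and Gv_dim: "\<And>n \<omega>. n \<ge> 1 \<Longrightarrow> \<omega> \<in> space M \<Longrightarrow> Gv n \<omega> \<in> carrier_mat (m n) r"
    and Gu_law: "\<And>n i j. n \<ge> 1 \<Longrightarrow> i < n \<Longrightarrow> j < r \<Longrightarrow> distr M borel (\<lambda>\<omega>. Gu n \<omega> $$ (i, j)) = \<nu>"
    and Gv_law: "\<And>n i j. n \<ge> 1 \<Longrightarrow> i < m n \<Longrightarrow> j < r \<Longrightarrow> distr M borel (\<lambda>\<omega>. Gv n \<omega> $$ (i, j)) = \<nu>"
    and G_indep: "\<And>n. n \<ge> 1 \<Longrightarrow>
           prob_space.indep_vars M (\<lambda>_. borel)
             (\<lambda>k \<omega>. case k of Inl ij \<Rightarrow> Gu n \<omega> $$ ij | Inr ij \<Rightarrow> Gv n \<omega> $$ ij)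
             (({..<n} \<times> {..<r}) <+> ({..<m n} \<times> {..<r}))"
    and GX_indep: "prob_space.indep_set M
           (sets (vimage_algebra (space M)
             (\<lambda>\<omega>. \<lambda>(n, k) \<in> (SIGMA n:{1..}. ({..<n} \<times> {..<r}) <+> ({..<m n} \<times> {..<r})).
                case k of Inl ij \<Rightarrow> Gu n \<omega> $$ ij | Inr ij \<Rightarrow> Gv n \<omega> $$ ij)
             (PiM (SIGMA n:{1..}. ({..<n} \<times> {..<r}) <+> ({..<m n} \<times> {..<r})) (\<lambda>_. borel))))
           (sets (vimage_algebra (space M)
             (\<lambda>\<omega>. \<lambda>(n, ij) \<in> (SIGMA n:{1..}. {..<n} \<times> {..<m n}). X n \<omega> $$ ij)
             (PiM (SIGMA n:{1..}. {..<n} \<times> {..<m n}) (\<lambda>_. borel))))"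
    and r: "r \<ge> 1"
    and \<theta>_pos: "\<And>i. i < r \<Longrightarrow> \<theta> i > 0"
    and \<theta>_decr: "\<And>i j. i \<le> j \<Longrightarrow> j < r \<Longrightarrow> \<theta> j \<le> \<theta> i"
  shows "AE \<omega> in M. spiked_path m (\<lambda>n. X n \<omega>) (\<lambda>n. scaled_columns (Gu n \<omega>)) (\<lambda>n. scaled_columns (Gv n \<omega>)) r \<theta> \<mu>X c"
proof -
  interpret prob_space M by (rule prob)
  define A where "A n \<omega> = entries (X n \<omega>)" for n \<omega>
  define G where "G n k \<omega> = (case k of Inl ij \<Rightarrow> Gu n \<omega> $$ ij | Inr ij \<Rightarrow> Gv n \<omega> $$ ij)" for n k \<omega>
  define g where "g n \<omega> = (\<lambda>k. to_complex (G n k \<omega>))" for n \<omega>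
  define \<nu>' where "\<nu>' = distr \<nu> borel to_complex"
  let ?Y = "\<lambda>n \<omega>. restrict (\<lambda>(i, j). A n \<omega> i j) ({..<n} \<times> {..<m n})"
  let ?K = "\<lambda>n. entry_idx n (m n) r"
  let ?\<xi> = "\<lambda>n \<omega>. restrict (g n \<omega>) (?K n)"
  let ?N = "\<lambda>n. PiM ({..<n} \<times> {..<m n}) (\<lambda>_. borel :: complex measure)"
  let ?Q = "\<lambda>n. PiM (?K n) (\<lambda>_. borel :: complex measure)"
  have law: "normalized_law \<nu>'" unfolding \<nu>'_def by (rule normalized_law_to_complex) fact+
  have iv: "indep_vars (\<lambda>_. borel) (G n) (?K n)" if "n \<ge> 1" for n
    using G_indep[OF that] unfolding G_def[abs_def] .
  have Gm: "random_variable borel (G n k)" if "n \<ge> 1" "k \<in> ?K n" for n k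
    using iv[OF that(1)] that(2) unfolding indep_vars_def2 by blast
  have Glaw: "distr M borel (G n k) = \<nu>" if "n \<ge> 1" "k \<in> ?K n" for n k
    using that Gu_law[OF that(1)] Gv_law[OF that(1)] by (auto simp: G_def[abs_def])
  have Ym: "random_variable (?N n) (?Y n)" if "n \<ge> 1" for n
  proof (rule measurable_restrict, clarsimp)
    fix i j assume "i < n" "j < m n"
    from measurable_compose[OF X_meas[OF that this] measurable_to_complex]
    show "(\<lambda>\<omega>. A n \<omega> i j) \<in> borel_measurable M" by (simp add: A_def entries_def)
  qed
  have xm: "random_variable (?Q n) (?\<xi> n)" if "n \<ge> 1" for n
    unfolding g_def by (rule measurable_restrict) (rule measurable_compose[OF Gm[OF that] measurable_to_complex])
  have "AE \<omega> in M. \<forall>k. \<forall>s\<in>idx r r. \<forall>t\<in>idx r r.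
    (\<lambda>n. ip (idx n (m n)) (spike_vec n (m n) (g n \<omega>) s) ((app (idx n (m n)) (dil (A n \<omega>)) ^^ k) (spike_vec n (m n) (g n \<omega>) t)))
      \<longlonglongrightarrow> (if s = t then of_real (spike_moment c (\<lambda>k. \<integral>t. t ^ k \<partial>\<mu>X) s k) else 0)"
  proof (rule spike_moments_AE[where \<sigma> = "\<lambda>n \<omega> k. singular_values (X n \<omega>) ! k", OF law])
    show "n \<le> m n" if "n \<ge> 1" for n by (rule m_ge[OF that])
    show "(\<lambda>n. real n / real (m n)) \<longlonglongrightarrow> c" by (rule c_lim)
    show "random_variable (?N n) (?Y n)" if "n \<ge> 1" for n by (rule Ym[OF that])
    show "random_variable (?Q n) (?\<xi> n)" if "n \<ge> 1" for n by (rule xm[OF that])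
    show "\<exists>e. sv_basis n (m n) (A n \<omega>) (\<lambda>k. singular_values (X n \<omega>) ! k) e" if "n \<ge> 1" "\<omega> \<in> space M" for n \<omega>
      unfolding A_def by (rule sv_basis_exists[OF X_dim[OF that]])
    show "distr M (?Q n) (?\<xi> n) = PiM (?K n) (\<lambda>_. \<nu>')" if n: "n \<ge> 1" for n
    proof -
      \<comment> \<open>From \<open>r \<ge> 1\<close> and \<open>n \<ge> 1\<close>; the
        characterization of independence by the product law asks for a nonempty index set.\<close>
      have ne: "?K n \<noteq> {}" using n r by force
      have rv: "random_variable borel (\<lambda>\<omega>. to_complex (G n k \<omega>))" if "k \<in> ?K n" for k
        by (rule measurable_compose[OF Gm[OF n that] measurable_to_complex])
      have ci: "indep_vars (\<lambda>_. borel) (\<lambda>k \<omega>. to_complex (G n k \<omega>)) (?K n)"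
        by (rule indep_vars_compose2[OF iv[OF n] measurable_to_complex])
      have iff: "indep_vars (\<lambda>_. borel) (\<lambda>k \<omega>. to_complex (G n k \<omega>)) (?K n) \<longleftrightarrow>
        distr M (?Q n) (\<lambda>\<omega>. \<lambda>k\<in>?K n. to_complex (G n k \<omega>)) = PiM (?K n) (\<lambda>k. distr M borel (\<lambda>\<omega>. to_complex (G n k \<omega>)))"
        by (rule indep_vars_iff_distr_eq_PiM'[OF ne]) (rule rv)
      have "distr M (?Q n) (\<lambda>\<omega>. \<lambda>k\<in>?K n. to_complex (G n k \<omega>)) = PiM (?K n) (\<lambda>k. distr M borel (\<lambda>\<omega>. to_complex (G n k \<omega>)))"
        by (rule iffD1[OF iff ci])
      also have "\<dots> = PiM (?K n) (\<lambda>_. \<nu>')"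
      proof (rule PiM_cong[OF refl])
        fix k assume k: "k \<in> ?K n"
        have "distr M borel (\<lambda>\<omega>. to_complex (G n k \<omega>)) = distr (distr M borel (G n k)) borel to_complex"
          using distr_distr[OF measurable_to_complex Gm[OF n k]] by (simp add: comp_def)
        then show "distr M borel (\<lambda>\<omega>. to_complex (G n k \<omega>)) = \<nu>'" by (simp add: Glaw[OF n k] \<nu>'_def)
      qed
      finally show ?thesis unfolding g_def restrict_def .
    qed
    \<comment> \<open>Independence is given for the whole families; the variables of one index n are
      measurable for the generated sigma-algebras, so it restricts to them.\<close>
    show "distr M (?N n) (?Y n) \<Otimes>\<^sub>M distr M (?Q n) (?\<xi> n) = distr M (?N n \<Otimes>\<^sub>M ?Q n) (\<lambda>\<omega>. (?Y n \<omega>, ?\<xi> n \<omega>))" if n: "n \<ge> 1" for n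
    proof (rule distr_pair_of_indep[OF Ym[OF n] xm[OF n]])
      fix B B' assume B: "B \<in> sets (?N n)" and B': "B' \<in> sets (?Q n)"
      let ?SG = "SIGMA n:{1..}. ?K n" and ?SX = "SIGMA n:{1..}. {..<n} \<times> {..<m n}"
      let ?FG = "\<lambda>\<omega>. \<lambda>(n, k) \<in> ?SG. case k of Inl ij \<Rightarrow> Gu n \<omega> $$ ij | Inr ij \<Rightarrow> Gv n \<omega> $$ ij"
      let ?FX = "\<lambda>\<omega>. \<lambda>(n, ij) \<in> ?SX. X n \<omega> $$ ij"
      let ?VG = "vimage_algebra (space M) ?FG (PiM ?SG (\<lambda>_. borel :: 'a measure))"
      let ?VX = "vimage_algebra (space M) ?FX (PiM ?SX (\<lambda>_. borel :: 'a measure))"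
      have FG: "?FG \<in> measurable ?VG (PiM ?SG (\<lambda>_. borel))"
        by (rule measurable_vimage_algebra1) (auto simp: space_PiM)
      have FX: "?FX \<in> measurable ?VX (PiM ?SX (\<lambda>_. borel))"
        by (rule measurable_vimage_algebra1) (auto simp: space_PiM)
      have xG: "?\<xi> n \<in> measurable ?VG (?Q n)"
      proof (rule measurable_restrict)
        fix k assume k: "k \<in> ?K n"
        then have "(n, k) \<in> ?SG" using n by simp
        from measurable_compose[OF measurable_compose[OF FG measurable_component_singleton[OF this]] measurable_to_complex]
        show "(\<lambda>\<omega>. g n \<omega> k) \<in> borel_measurable ?VG" using k n by (simp add: g_def G_def)
      qed
      have yX: "?Y n \<in> measurable ?VX (?N n)"
      proof (rule measurable_restrict)
        fix k assume k: "k \<in> {..<n} \<times> {..<m n}"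
        then have "(n, k) \<in> ?SX" using n by simp
        from measurable_compose[OF measurable_compose[OF FX measurable_component_singleton[OF this]] measurable_to_complex]
        show "(\<lambda>\<omega>. case k of (i, j) \<Rightarrow> A n \<omega> i j) \<in> borel_measurable ?VX"
          using k n by (cases k) (simp add: A_def entries_def)
      qed
      have 1: "?\<xi> n -` B' \<inter> space M \<in> sets ?VG" using measurable_sets[OF xG B'] by simp
      have 2: "?Y n -` B \<inter> space M \<in> sets ?VX" using measurable_sets[OF yX B] by simp
      show "prob ((?Y n -` B \<inter> space M) \<inter> (?\<xi> n -` B' \<inter> space M)) = prob (?Y n -` B \<inter> space M) * prob (?\<xi> n -` B' \<inter> space M)"
        using indep_setD[OF GX_indep 1 2] by (simp only: Int_commute mult.commute)
    qed
    show "AE \<omega> in M. \<forall>k. (\<lambda>n. (\<Sum>l<n. (singular_values (X n \<omega>) ! l) ^ k) / real n) \<longlonglongrightarrow> (\<integral>t. t ^ k \<partial>\<mu>X)"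
      using X_weak X_top AE_space
    proof eventually_elim
      case (elim \<omega>)
      show ?case
        by (intro allI singular_value_limits(3)[OF \<mu>X _ elim(1,2)]) (rule X_dim[OF _ elim(3)])
    qed
  qed
  then show ?thesis using X_weak X_top AE_space
  proof eventually_elim
    case (elim \<omega>)
    have dG: "n \<ge> 1 \<Longrightarrow> Gu n \<omega> \<in> carrier_mat n r" "n \<ge> 1 \<Longrightarrow> Gv n \<omega> \<in> carrier_mat (m n) r" for n
      using Gu_dim Gv_dim elim(4) by auto
    have sv: "spike_fun (scaled_columns (Gu n \<omega>)) (scaled_columns (Gv n \<omega>)) s i = spike_vec n (m n) (g n \<omega>) s i"
      if "n \<ge> 1" "s \<in> idx r r" "i \<in> idx n (m n)" for n s i
      using that scaled_columns_nth(2)[OF dG(1)[OF that(1)]] scaled_columns_nth(2)[OF dG(2)[OF that(1)]]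
      by (auto simp: spike_vec_def g_def G_def)
    show ?case
    proof (rule spiked_path.intro)
      show "X n \<omega> \<in> carrier_mat n (m n)" if "n \<ge> 1" for n by (rule X_dim[OF that elim(4)])
      show "scaled_columns (Gu n \<omega>) ! i \<in> carrier_vec n" if "n \<ge> 1" "i < r" for n i
        by (rule scaled_columns_nth(1)[OF dG(1)[OF that(1)] that(2)])
      show "scaled_columns (Gv n \<omega>) ! i \<in> carrier_vec (m n)" if "n \<ge> 1" "i < r" for n i
        by (rule scaled_columns_nth(1)[OF dG(2)[OF that(1)] that(2)])
      show "(\<lambda>n. ip (idx n (m n)) (spike_fun (scaled_columns (Gu n \<omega>)) (scaled_columns (Gv n \<omega>)) s)
          ((app (idx n (m n)) (dil (entries (X n \<omega>))) ^^ k) (spike_fun (scaled_columns (Gu n \<omega>)) (scaled_columns (Gv n \<omega>)) t)))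
        \<longlonglongrightarrow> (if s = t then of_real (spike_moment c (\<lambda>k. \<integral>t. t ^ k \<partial>\<mu>X) s k) else 0)"
        if st: "s \<in> idx r r" "t \<in> idx r r" for s t k
      proof (rule Lim_transform_eventually)
        show "(\<lambda>n. ip (idx n (m n)) (spike_vec n (m n) (g n \<omega>) s) ((app (idx n (m n)) (dil (A n \<omega>)) ^^ k) (spike_vec n (m n) (g n \<omega>) t)))
          \<longlonglongrightarrow> (if s = t then of_real (spike_moment c (\<lambda>k. \<integral>t. t ^ k \<partial>\<mu>X) s k) else 0)"
          using elim(1) st by blast
        show "\<forall>\<^sub>F n in sequentially. ip (idx n (m n)) (spike_vec n (m n) (g n \<omega>) s) ((app (idx n (m n)) (dil (A n \<omega>)) ^^ k) (spike_vec n (m n) (g n \<omega>) t)) =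
          ip (idx n (m n)) (spike_fun (scaled_columns (Gu n \<omega>)) (scaled_columns (Gv n \<omega>)) s)
          ((app (idx n (m n)) (dil (entries (X n \<omega>))) ^^ k) (spike_fun (scaled_columns (Gu n \<omega>)) (scaled_columns (Gv n \<omega>)) t))"
          using eventually_ge_at_top[of 1]
        proof eventually_elim
          case (elim n)
          show ?case unfolding A_def by (intro ip_cong funpow_app_cong sv[symmetric] elim st)
        qed
      qed
    qed (fact \<mu>X c01 elim \<theta>_pos \<theta>_decr)+
  qed
qed

theorem theorem2p9:
  fixes M :: "'w measure"
    and m :: "nat \<Rightarrow> nat" and c :: real
    and X :: "nat \<Rightarrow> 'w \<Rightarrow> 'a :: rc_field mat"
    and \<mu>X :: "real measure"
    and r :: nat and \<theta> :: "nat \<Rightarrow> real"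
    and \<nu> :: "'a measure"
    and Gu Gv :: "nat \<Rightarrow> 'w \<Rightarrow> 'a mat"
    and columns :: "'a mat \<Rightarrow> 'a vec list"
    and us vs :: "nat \<Rightarrow> 'w \<Rightarrow> 'a vec list"
    and P Xt :: "nat \<Rightarrow> 'w \<Rightarrow> 'a mat"
    and i0 :: nat
    and ut vt :: "nat \<Rightarrow> 'w \<Rightarrow> 'a vec"
    and \<rho> :: real
  assumes prob: "prob_space M"
    \<comment> \<open>the matrices X\<close>
    and m_ge: "\<And>n. n \<ge> 1 \<Longrightarrow> n \<le> m n"
    and c01: "0 \<le> c" "c \<le> 1"
    and c_lim: "(\<lambda>n. real n / real (m n)) \<longlonglongrightarrow> c"
    and X_dim: "\<And>n \<omega>. n \<ge> 1 \<Longrightarrow> \<omega> \<in> space M \<Longrightarrow> X n \<omega> \<in> carrier_mat n (m n)"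
    and X_meas: "\<And>n i j. n \<ge> 1 \<Longrightarrow> i < n \<Longrightarrow> j < m n \<Longrightarrow>
                   (\<lambda>\<omega>. X n \<omega> $$ (i, j)) \<in> borel_measurable M"
    and \<mu>X: "real_distribution \<mu>X" "compact (measure_support \<mu>X)"
    and X_weak: "AE \<omega> in M. weak_conv_m (\<lambda>n. sv_measure (X n \<omega>)) \<mu>X"
    and X_top: "AE \<omega> in M. (\<lambda>n. singular_values (X n \<omega>) ! 0) \<longlonglongrightarrow> sup_support \<mu>X"
    \<comment> \<open>the law of the entries of the G's\<close>
    and \<nu>: "prob_space \<nu>" "sets \<nu> = sets borel"
    and \<nu>_mean: "integrable \<nu> (\<lambda>x. x)" "(\<integral>x. x \<partial>\<nu>) = 0"
    and \<nu>_var: "integrable \<nu> (\<lambda>x. (norm x)\<^sup>2)" "(\<integral>x. (norm x)\<^sup>2 \<partial>\<nu>) = 1"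
    and \<nu>_lsi: "log_sobolev \<nu>"
    and Gu_dim: "\<And>n \<omega>. n \<ge> 1 \<Longrightarrow> \<omega> \<in> space M \<Longrightarrow> Gu n \<omega> \<in> carrier_mat n r"
    and Gv_dim: "\<And>n \<omega>. n \<ge> 1 \<Longrightarrow> \<omega> \<in> space M \<Longrightarrow> Gv n \<omega> \<in> carrier_mat (m n) r"
    and Gu_law: "\<And>n i j. n \<ge> 1 \<Longrightarrow> i < n \<Longrightarrow> j < r \<Longrightarrow>
                   distr M borel (\<lambda>\<omega>. Gu n \<omega> $$ (i, j)) = \<nu>"
    and Gv_law: "\<And>n i j. n \<ge> 1 \<Longrightarrow> i < m n \<Longrightarrow> j < r \<Longrightarrow>
                   distr M borel (\<lambda>\<omega>. Gv n \<omega> $$ (i, j)) = \<nu>"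
    and G_indep: "\<And>n. n \<ge> 1 \<Longrightarrow>
           prob_space.indep_vars M (\<lambda>_. borel)
             (\<lambda>k \<omega>. case k of Inl ij \<Rightarrow> Gu n \<omega> $$ ij | Inr ij \<Rightarrow> Gv n \<omega> $$ ij)
             (({..<n} \<times> {..<r}) <+> ({..<m n} \<times> {..<r}))"
    and GX_indep: "prob_space.indep_set M
           (sets (vimage_algebra (space M)
             (\<lambda>\<omega>. \<lambda>(n, k) \<in> (SIGMA n:{1..}. ({..<n} \<times> {..<r}) <+> ({..<m n} \<times> {..<r})).
                case k of Inl ij \<Rightarrow> Gu n \<omega> $$ ij | Inr ij \<Rightarrow> Gv n \<omega> $$ ij)
             (PiM (SIGMA n:{1..}. ({..<n} \<times> {..<r}) <+> ({..<m n} \<times> {..<r})) (\<lambda>_. borel))))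
           (sets (vimage_algebra (space M)
             (\<lambda>\<omega>. \<lambda>(n, ij) \<in> (SIGMA n:{1..}. {..<n} \<times> {..<m n}). X n \<omega> $$ ij)
             (PiM (SIGMA n:{1..}. {..<n} \<times> {..<m n}) (\<lambda>_. borel))))"
    \<comment> \<open>the perturbation; indices are shifted by one, so they range over 0, ..., r - 1\<close>
    and r: "r \<ge> 1"
    and \<theta>_pos: "\<And>i. i < r \<Longrightarrow> \<theta> i > 0"
    and \<theta>_decr: "\<And>i j. i \<le> j \<Longrightarrow> j < r \<Longrightarrow> \<theta> j \<le> \<theta> i"
    and model: "columns = scaled_columns \<or> columns = orthonormalized_columns"
    and us: "\<And>n \<omega>. us n \<omega> = columns (Gu n \<omega>)"
    and vs: "\<And>n \<omega>. vs n \<omega> = columns (Gv n \<omega>)"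
    and P: "\<And>n \<omega>. P n \<omega> = perturbation n (m n) r \<theta> (us n \<omega>) (vs n \<omega>)"
    and Xt: "\<And>n \<omega>. Xt n \<omega> = X n \<omega> + P n \<omega>"
    and i0: "i0 < r" "\<theta> i0 > theta_bar c \<mu>X"
    and sing_vecs: "\<And>n \<omega>. n > i0 \<Longrightarrow> \<omega> \<in> space M \<Longrightarrow>
           singular_vector_pair (Xt n \<omega>) (singular_values (Xt n \<omega>) ! i0) (ut n \<omega>) (vt n \<omega>)"
    and \<rho>: "\<rho> = D_inverse c \<mu>X (1 / (\<theta> i0)\<^sup>2)"
  shows "AE \<omega> in M.
     (\<lambda>n. (proj_norm (ut n \<omega>) (vec_span n {us n \<omega> ! i | i. i < r \<and> \<theta> i = \<theta> i0}))\<^sup>2)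
        \<longlonglongrightarrow> - 2 * \<phi> \<mu>X \<rho> / ((\<theta> i0)\<^sup>2 * deriv (D_transform c \<mu>X) \<rho>) \<and>
     (\<lambda>n. (proj_norm (vt n \<omega>) (vec_span (m n) {vs n \<omega> ! i | i. i < r \<and> \<theta> i = \<theta> i0}))\<^sup>2)
        \<longlonglongrightarrow> - 2 * \<phi> (mix_dirac0 c \<mu>X) \<rho> / ((\<theta> i0)\<^sup>2 * deriv (D_transform c \<mu>X) \<rho>) \<and>
     (\<lambda>n. (proj_norm (ut n \<omega>) (vec_span n {us n \<omega> ! i | i. i < r \<and> \<theta> i \<noteq> \<theta> i0}))\<^sup>2)
        \<longlonglongrightarrow> 0 \<and>
     (\<lambda>n. (proj_norm (vt n \<omega>) (vec_span (m n) {vs n \<omega> ! i | i. i < r \<and> \<theta> i \<noteq> \<theta> i0}))\<^sup>2)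
        \<longlonglongrightarrow> 0 \<and>
     (\<lambda>n. proj_norm (of_real (\<phi> \<mu>X \<rho>) \<cdot>\<^sub>v (P n \<omega> *\<^sub>v vt n \<omega>) - ut n \<omega>)
             (vec_span n {us n \<omega> ! i | i. i < r \<and> \<theta> i = \<theta> i0}))
        \<longlonglongrightarrow> 0"
proof -
  have im: "{f i | i. i < r \<and> Q i} = f ` {i. i < r \<and> Q i}" for f :: "nat \<Rightarrow> 'a vec" and Q by auto
  have "AE \<omega> in M. spiked_path m (\<lambda>n. X n \<omega>) (\<lambda>n. scaled_columns (Gu n \<omega>)) (\<lambda>n. scaled_columns (Gv n \<omega>)) r \<theta> \<mu>X c"
    by (rule scaled_columns_spiked_path_AE[where \<nu> = \<nu>]) fact+
  then show ?thesis using AE_space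
  proof eventually_elim
    case (elim \<omega>)
    \<comment> \<open>The realization is fixed from here on; the models differ only in how the
      moment limits are obtained.\<close>
    have "spiked_path m (\<lambda>n. X n \<omega>) (\<lambda>n. us n \<omega>) (\<lambda>n. vs n \<omega>) r \<theta> \<mu>X c"
      using model
    proof
      assume "columns = scaled_columns"
      then show ?thesis using elim(1) by (simp add: us vs)
    next
      assume "columns = orthonormalized_columns"
      moreover have "spiked_path m (\<lambda>n. X n \<omega>) (\<lambda>n. orthonormalized_columns (Gu n \<omega>)) (\<lambda>n. orthonormalized_columns (Gv n \<omega>)) r \<theta> \<mu>X c"
        by (rule spiked_path_orthonormalized[OF elim(1)]) (rule m_ge Gu_dim[OF _ elim(2)] Gv_dim[OF _ elim(2)], assumption)+
      ultimately show ?thesis by (simp add: us vs)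
    qed
    then interpret spiked_path m "\<lambda>n. X n \<omega>" "\<lambda>n. us n \<omega>" "\<lambda>n. vs n \<omega>" r \<theta> \<mu>X c .
    have \<rho>': "sup_support \<mu>X < \<rho>" "D_transform c \<mu>X \<rho> = 1 / (\<theta> i0)\<^sup>2"
      using law.D_inverse_spec[OF refl i0(2) \<theta>_pos[OF i0(1)]] by (simp_all add: \<rho>)
    have pair: "singular_vector_pair (X n \<omega> + perturbation n (m n) r \<theta> (us n \<omega>) (vs n \<omega>))
        (singular_values (X n \<omega> + perturbation n (m n) r \<theta> (us n \<omega>) (vs n \<omega>)) ! i0) (ut n \<omega>) (vt n \<omega>)" if "n > i0" for n
      using sing_vecs[OF that elim(2)] by (simp only: Xt P)
    note lim = spiked_path_limits[where ut = "\<lambda>n. ut n \<omega>" and vt = "\<lambda>n. vt n \<omega>", OF i0(1) \<rho>' pair]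
    show ?case unfolding im P by (intro conjI lim)
  qed
qed

end
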